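(* There is a universal constant $C>0$ such that the following holds. Let $(m_0,n_0)\in B^{1/2}_{2,1}(\mathbb{T})\times B^{1/2}_{2,1}(\mathbb{T})$, put $N_0=\|m_0\|_{B^{1/2}_{2,1}}+\|n_0\|_{B^{1/2}_{2,1}}$, and let $\lambda>0$ satisfy $$\lambda\ \ge\ \frac{6C^3}{\ln 2}\Big(N_0+\frac{4C^3}{\lambda}N_0^3\Big)^2e^{4C^3N_0^2/\lambda}.$$ Then the Cauchy problem for the weakly dissipative SQQ system $$\begin{cases} m_t+[(u-u_x)(v+v_x)m]_x+\lambda m=0, & t>0,\ x\in\mathbb{T},\\ n_t+[(u-u_x)(v+v_x)n]_x+\lambda n=0, & t>0,\ x\in\mathbb{T},\\ m(0,x)=m_0(x),\quad n(0,x)=n_0(x), & x\in\mathbb{T},\end{cases}\qquad m=u-u_{xx},\ n=v-v_{xx},$$ has a unique global strong solution $(m,n)\in E^{1/2}_{2,1}(\infty)$.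
   Context: $\mathbb{T}=\mathbb{R}/\mathbb{Z}$. $B^{s}_{p,r}(\mathbb{T})$ is the nonhomogeneous Besov space with norm $\|f\|_{B^s_{p,r}}=\big\|(2^{qs}\|\Delta_q f\|_{L^p})_{q\ge-1}\big\|_{\ell^r}$, where $(\Delta_q)_{q\ge -1}$ are the nonhomogeneous Littlewood–Paley dyadic blocks on $\mathbb{T}$. For $0<T<\infty$, $E^s_{2,1}(T)=C([0,T];B^s_{2,1}\times B^s_{2,1})\cap C^1([0,T];B^{s-1}_{2,1}\times B^{s-1}_{2,1})$, and $E^s_{2,1}(\infty)=\bigcap_{T>0}E^s_{2,1}(T)$. Here $u=(1-\partial_x^2)^{-1}m$, $v=(1-\partial_x^2)^{-1}n$ on $\mathbb{T}$, and $\lambda$ is the dissipative parameter. *)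

theory Defs
  imports "HOL-Analysis.Analysis"
begin

section \<open>Real periodic distributions on the circle R/Z\<close>

definition smooth :: "(real \<Rightarrow> real) \<Rightarrow> bool" where
  "smooth f \<longleftrightarrow> (\<forall>k x. ((deriv ^^ k) f) differentiable (at x))"

definition test_fun :: "(real \<Rightarrow> real) \<Rightarrow> bool" where
  "test_fun \<psi> \<longleftrightarrow> smooth \<psi> \<and> (\<forall>x. \<psi> (x + 1) = \<psi> x)"

lemma higher_deriv_lincomb:
  assumes "smooth f" "smooth g"
  shows "(deriv ^^ k) (\<lambda>x. a * f x + b * g x) = (\<lambda>x. a * (deriv ^^ k) f x + b * (deriv ^^ k) g x)"
proof (induction k)
  case (Suc k)
  have "deriv (\<lambda>x. a * (deriv ^^ k) f x + b * (deriv ^^ k) g x) x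
      = a * deriv ((deriv ^^ k) f) x + b * deriv ((deriv ^^ k) g) x" for x
  proof (rule DERIV_imp_deriv)
    have "((deriv ^^ k) f has_field_derivative deriv ((deriv ^^ k) f) x) (at x)"
      "((deriv ^^ k) g has_field_derivative deriv ((deriv ^^ k) g) x) (at x)"
      using assms unfolding smooth_def
      by (auto simp: DERIV_deriv_iff_real_differentiable)
    then show "((\<lambda>x. a * (deriv ^^ k) f x + b * (deriv ^^ k) g x) has_field_derivative
        a * deriv ((deriv ^^ k) f) x + b * deriv ((deriv ^^ k) g) x) (at x)"
      by (intro DERIV_add DERIV_cmult)
  qed
  then show ?case by (simp add: Suc fun_eq_iff)
qed simp

lemma smooth_lincomb: "smooth f \<Longrightarrow> smooth g \<Longrightarrow> smooth (\<lambda>x. a * f x + b * g x)"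
  by (subst smooth_def, auto simp: higher_deriv_lincomb smooth_def)

lemma test_fun_lincomb:
  "test_fun f \<Longrightarrow> test_fun g \<Longrightarrow> test_fun (\<lambda>x. a * f x + b * g x)"
  by (auto simp: test_fun_def smooth_lincomb)

lemma test_fun_deriv:
  assumes "test_fun \<psi>" shows "test_fun (deriv \<psi>)"
proof -
  have "smooth (deriv \<psi>)"
    unfolding smooth_def
  proof (intro allI)
    fix k x
    have "(deriv ^^ Suc k) \<psi> differentiable (at x)"
      using assms unfolding test_fun_def smooth_def by blast
    then show "(deriv ^^ k) (deriv \<psi>) differentiable (at x)"
      by (simp only: funpow_Suc_right o_apply)
  qed
  moreover have "deriv \<psi> (x + 1) = deriv \<psi> x" for x
  proof -
    have "(deriv ^^ 0) \<psi> differentiable (at (x + 1))"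
      using assms unfolding test_fun_def smooth_def by blast
    then have "(\<psi> has_field_derivative deriv \<psi> (x + 1)) (at (x + 1))"
      by (simp add: DERIV_deriv_iff_real_differentiable)
    then have "((\<lambda>y. \<psi> (y + 1)) has_field_derivative deriv \<psi> (x + 1)) (at x)"
      by (simp add: DERIV_shift)
    moreover have "(\<lambda>y. \<psi> (y + 1)) = \<psi>"
      using assms by (auto simp: test_fun_def)
    ultimately show ?thesis by (simp add: DERIV_imp_deriv)
  qed
  ultimately show ?thesis by (simp add: test_fun_def)
qed

text \<open>
  The dual of the Frechet space of smooth 1-periodic functions.  Functionals are normalised
  to be 0 off the test functions, so that equality of distributions is equality in the type.
  The last clause says that the functional is bounded by some C^N norm.
\<close>

definition is_pdist :: "((real \<Rightarrow> real) \<Rightarrow> real) \<Rightarrow> bool" where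
  "is_pdist F \<longleftrightarrow>
     (\<forall>\<psi>. \<not> test_fun \<psi> \<longrightarrow> F \<psi> = 0) \<and>
     (\<forall>\<psi> \<psi>' a b. test_fun \<psi> \<longrightarrow> test_fun \<psi>' \<longrightarrow>
        F (\<lambda>x. a * \<psi> x + b * \<psi>' x) = a * F \<psi> + b * F \<psi>') \<and>
     (\<exists>(N::nat) C. \<forall>\<psi> M. test_fun \<psi> \<longrightarrow> (\<forall>k\<le>N. \<forall>x. \<bar>(deriv ^^ k) \<psi> x\<bar> \<le> M) \<longrightarrow> \<bar>F \<psi>\<bar> \<le> C * M)"

typedef pdist = "{F. is_pdist F}"
  morphisms pairing Abs_pdist
  by (rule exI[of _ "\<lambda>_. 0"]) (auto simp: is_pdist_def intro!: exI[of _ 0])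

setup_lifting type_definition_pdist

lemma is_pdist_lincomb:
  assumes "is_pdist F" "is_pdist G"
  shows "is_pdist (\<lambda>\<psi>. c * F \<psi> + d * G \<psi>)"
proof -
  obtain N1 C1 where 1: "\<And>\<psi> M. test_fun \<psi> \<Longrightarrow> (\<forall>k\<le>(N1::nat). \<forall>x. \<bar>(deriv ^^ k) \<psi> x\<bar> \<le> M) \<Longrightarrow> \<bar>F \<psi>\<bar> \<le> C1 * M"
    using assms(1) unfolding is_pdist_def by blast
  obtain N2 C2 where 2: "\<And>\<psi> M. test_fun \<psi> \<Longrightarrow> (\<forall>k\<le>(N2::nat). \<forall>x. \<bar>(deriv ^^ k) \<psi> x\<bar> \<le> M) \<Longrightarrow> \<bar>G \<psi>\<bar> \<le> C2 * M"
    using assms(2) unfolding is_pdist_def by blast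
  have "\<bar>c * F \<psi> + d * G \<psi>\<bar> \<le> (\<bar>c\<bar> * C1 + \<bar>d\<bar> * C2) * M"
    if "test_fun \<psi>" "\<forall>k\<le>max N1 N2. \<forall>x. \<bar>(deriv ^^ k) \<psi> x\<bar> \<le> M" for \<psi> M
  proof -
    have "\<bar>c * F \<psi> + d * G \<psi>\<bar> \<le> \<bar>c\<bar> * \<bar>F \<psi>\<bar> + \<bar>d\<bar> * \<bar>G \<psi>\<bar>"
      by (metis abs_mult abs_triangle_ineq)
    also have "\<dots> \<le> \<bar>c\<bar> * (C1 * M) + \<bar>d\<bar> * (C2 * M)"
      using that by (intro add_mono mult_left_mono 1 2) auto
    finally show ?thesis by (simp add: algebra_simps)
  qed
  moreover have "c * F (\<lambda>x. a * \<psi> x + b * \<psi>' x) + d * G (\<lambda>x. a * \<psi> x + b * \<psi>' x)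
      = a * (c * F \<psi> + d * G \<psi>) + b * (c * F \<psi>' + d * G \<psi>')"
    if "test_fun \<psi>" "test_fun \<psi>'" for a b \<psi> \<psi>'
    using assms that by (simp add: is_pdist_def algebra_simps)
  moreover have "c * F \<psi> + d * G \<psi> = 0" if "\<not> test_fun \<psi>" for \<psi>
    using assms that by (simp add: is_pdist_def)
  ultimately show ?thesis unfolding is_pdist_def by blast
qed

instantiation pdist :: real_vector
begin

lift_definition zero_pdist :: pdist is "\<lambda>_. 0"
  by (auto simp: is_pdist_def intro!: exI[of _ 0])

lift_definition plus_pdist :: "pdist \<Rightarrow> pdist \<Rightarrow> pdist" is "\<lambda>F G \<psi>. F \<psi> + G \<psi>"
  using is_pdist_lincomb[of _ _ 1 1] by simp

lift_definition minus_pdist :: "pdist \<Rightarrow> pdist \<Rightarrow> pdist" is "\<lambda>F G \<psi>. F \<psi> - G \<psi>"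
  using is_pdist_lincomb[of _ _ 1 "-1"] by simp

lift_definition uminus_pdist :: "pdist \<Rightarrow> pdist" is "\<lambda>F \<psi>. - F \<psi>"
  using is_pdist_lincomb[of _ _ "-1" 0] by simp

lift_definition scaleR_pdist :: "real \<Rightarrow> pdist \<Rightarrow> pdist" is "\<lambda>c F \<psi>. c * F \<psi>"
  using is_pdist_lincomb[of _ _ _ 0] by simp

instance
  by standard (transfer; simp add: fun_eq_iff algebra_simps)+

end

lift_definition pd_deriv :: "pdist \<Rightarrow> pdist" is
  "\<lambda>F \<psi>. if test_fun \<psi> then - F (deriv \<psi>) else 0"
proof -
  fix F assume F: "is_pdist F"
  define G where "G = (\<lambda>\<psi>. if test_fun \<psi> then - F (deriv \<psi>) else 0)"
  obtain N C where NC: "\<And>\<psi> M. test_fun \<psi> \<Longrightarrow> (\<forall>k\<le>(N::nat). \<forall>x. \<bar>(deriv ^^ k) \<psi> x\<bar> \<le> M) \<Longrightarrow> \<bar>F \<psi>\<bar> \<le> C * M"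
    using F unfolding is_pdist_def by blast
  have bd: "\<bar>G \<psi>\<bar> \<le> C * M"
    if "test_fun \<psi>" "\<forall>k\<le>Suc N. \<forall>x. \<bar>(deriv ^^ k) \<psi> x\<bar> \<le> M" for \<psi> M
  proof -
    have "\<forall>k\<le>N. \<forall>x. \<bar>(deriv ^^ k) (deriv \<psi>) x\<bar> \<le> M"
    proof (intro allI impI)
      fix k x assume "k \<le> N"
      then have "\<bar>(deriv ^^ Suc k) \<psi> x\<bar> \<le> M" using that(2) Suc_le_mono by blast
      then show "\<bar>(deriv ^^ k) (deriv \<psi>) x\<bar> \<le> M"
        by (simp only: funpow_Suc_right o_apply)
    qed
    from NC[OF test_fun_deriv[OF that(1)] this] that(1) show ?thesis by (simp add: G_def)
  qed
  have lin: "G (\<lambda>x. a * \<psi> x + b * \<psi>' x) = a * G \<psi> + b * G \<psi>'"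
    if t: "test_fun \<psi>" "test_fun \<psi>'" for a b \<psi> \<psi>'
  proof -
    have "deriv (\<lambda>x. a * \<psi> x + b * \<psi>' x) = (\<lambda>x. a * deriv \<psi> x + b * deriv \<psi>' x)"
      using higher_deriv_lincomb[of \<psi> \<psi>' 1 a b] t by (simp add: test_fun_def)
    then show ?thesis
      using F t test_fun_lincomb[OF t] test_fun_deriv[OF t(1)] test_fun_deriv[OF t(2)]
      by (simp add: G_def is_pdist_def)
  qed
  have off: "\<forall>\<psi>. \<not> test_fun \<psi> \<longrightarrow> G \<psi> = 0" by (simp add: G_def)
  have "is_pdist G" unfolding is_pdist_def
  proof (intro conjI off allI impI)
    show "\<exists>(N::nat) C. \<forall>\<psi> M. test_fun \<psi> \<longrightarrow>
        (\<forall>k\<le>N. \<forall>x. \<bar>(deriv ^^ k) \<psi> x\<bar> \<le> M) \<longrightarrow> \<bar>G \<psi>\<bar> \<le> C * M"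
      using bd by blast
  qed (rule lin)
  then show "is_pdist (\<lambda>\<psi>. if test_fun \<psi> then - F (deriv \<psi>) else 0)" by (simp add: G_def)
qed

text \<open>Only the values of the function on the fundamental domain [0,1] matter.\<close>

lift_definition pd_of_fun :: "(real \<Rightarrow> real) \<Rightarrow> pdist" is
  "\<lambda>f \<psi>. if set_integrable lborel {0..1} f \<and> test_fun \<psi>
         then LBINT x:{0..1}. f x * \<psi> x else 0"
proof -
  fix f :: "real \<Rightarrow> real"
  define G where "G = (\<lambda>\<psi>. if set_integrable lborel {0..1} f \<and> test_fun \<psi>
         then LBINT x:{0..1}. f x * \<psi> x else 0)"
  have "is_pdist G"
  proof (cases "set_integrable lborel {0..1} f")
    case False
    then show ?thesis by (auto simp: G_def is_pdist_def intro!: exI[of _ 0])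
  next
    case True
    have meas: "\<psi> \<in> borel_measurable borel" if "test_fun \<psi>" for \<psi>
    proof -
      have "(deriv ^^ 0) \<psi> differentiable (at x)" for x
        using that unfolding test_fun_def smooth_def by blast
      then have "continuous_on UNIV \<psi>"
        by (simp add: continuous_at_imp_continuous_on differentiable_imp_continuous_within)
      then show ?thesis by (rule borel_measurable_continuous_onI)
    qed
    have fm: "(\<lambda>x. indicator {0..1} x * f x) \<in> borel_measurable borel"
      using True by (auto simp: set_integrable_def dest: borel_measurable_integrable)
    have bnd: "set_integrable lborel {0..1} (\<lambda>x. f x * \<psi> x) \<and>
        \<bar>LBINT x:{0..1}. f x * \<psi> x\<bar> \<le> (LBINT x:{0..1}. \<bar>f x\<bar>) * M"
      if t: "test_fun \<psi>" and M: "\<forall>x\<in>{0..1}. \<bar>\<psi> x\<bar> \<le> M" for \<psi> M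
    proof -
      have int0: "integrable lborel (\<lambda>x. indicator {0..1} x * \<bar>f x\<bar> * M)"
        using set_integrable_abs[OF True] by (intro integrable_mult_left) (simp add: set_integrable_def)
      have le: "\<bar>indicator {0..1} x * (f x * \<psi> x)\<bar> \<le> indicator {0..1} x * \<bar>f x\<bar> * M" for x
        using M by (auto simp: indicator_def abs_mult intro!: mult_left_mono)
      have m: "(\<lambda>x. indicator {0..1} x * (f x * \<psi> x)) \<in> borel_measurable lborel"
        using borel_measurable_times[OF fm meas[OF t]] by (simp add: mult.assoc)
      have int: "integrable lborel (\<lambda>x. indicator {0..1} x * (f x * \<psi> x))"
      proof (rule Bochner_Integration.integrable_bound[OF int0 m], rule AE_I2)
        fix x :: real
        show "norm (indicator {0..1} x * (f x * \<psi> x)) \<le> norm (indicator {0..1} x * \<bar>f x\<bar> * M)"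
          using order_trans[OF le abs_ge_self] unfolding real_norm_def .
      qed
      have "\<bar>LINT x|lborel. indicator {0..1} x * (f x * \<psi> x)\<bar>
          \<le> (LINT x|lborel. indicator {0..1} x * \<bar>f x\<bar> * M)"
        using Bochner_Integration.integral_norm_bound_integral[OF int int0] le by simp
      then show ?thesis
        using int by (simp add: set_integrable_def set_lebesgue_integral_def)
    qed
    have ex: "\<exists>M. \<forall>x\<in>{0..1}. \<bar>\<psi> x\<bar> \<le> M" if "test_fun \<psi>" for \<psi>
    proof -
      have "(deriv ^^ 0) \<psi> differentiable (at x)" for x
        using that unfolding test_fun_def smooth_def by blast
      then have "continuous_on {0..1} \<psi>"
        by (simp add: continuous_at_imp_continuous_on differentiable_imp_continuous_within)
      then have "compact (\<psi> ` {0..1})" by (rule compact_continuous_image) simp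
      then show ?thesis
        by (meson bounded_real compact_imp_bounded imageI)
    qed
    have lin: "G (\<lambda>x. a * \<psi> x + b * \<psi>' x) = a * G \<psi> + b * G \<psi>'"
      if t: "test_fun \<psi>" "test_fun \<psi>'" for a b \<psi> \<psi>'
    proof -
      have i: "set_integrable lborel {0..1} (\<lambda>x. f x * \<psi> x)"
        "set_integrable lborel {0..1} (\<lambda>x. f x * \<psi>' x)"
        using ex bnd t by blast+
      have "(LBINT x:{0..1}. f x * (a * \<psi> x + b * \<psi>' x))
          = (LBINT x:{0..1}. a * (f x * \<psi> x) + b * (f x * \<psi>' x))"
        by (simp add: algebra_simps)
      also have "\<dots> = a * (LBINT x:{0..1}. f x * \<psi> x) + b * (LBINT x:{0..1}. f x * \<psi>' x)"
        using i by (subst set_integral_add) auto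
      finally show ?thesis using True t test_fun_lincomb[OF t] by (simp add: G_def)
    qed
    have bd: "\<bar>G \<psi>\<bar> \<le> (LBINT x:{0..1}. \<bar>f x\<bar>) * M"
      if "test_fun \<psi>" "\<forall>k\<le>(0::nat). \<forall>x. \<bar>(deriv ^^ k) \<psi> x\<bar> \<le> M" for \<psi> M
    proof -
      have "\<forall>x\<in>{0..1}. \<bar>\<psi> x\<bar> \<le> M" using that(2) by auto
      from bnd[OF that(1) this] show ?thesis using True that(1) by (simp add: G_def)
    qed
    have off: "\<forall>\<psi>. \<not> test_fun \<psi> \<longrightarrow> G \<psi> = 0" by (simp add: G_def)
    show ?thesis unfolding is_pdist_def
    proof (intro conjI off allI impI)
      show "\<exists>(N::nat) C. \<forall>\<psi> M. test_fun \<psi> \<longrightarrow>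
          (\<forall>k\<le>N. \<forall>x. \<bar>(deriv ^^ k) \<psi> x\<bar> \<le> M) \<longrightarrow> \<bar>G \<psi>\<bar> \<le> C * M"
        using bd by blast
    qed (rule lin)
  qed
  then show "is_pdist (\<lambda>\<psi>. if set_integrable lborel {0..1} f \<and> test_fun \<psi>
         then LBINT x:{0..1}. f x * \<psi> x else 0)" by (simp add: G_def)
qed

text \<open>
  Products are taken in L^2 x L^2 -> L^1, by choosing square integrable
  representatives (unique up to null sets, so the choice is immaterial).  The value is
  unspecified if a factor is not in L^2.  In the equation below all factors and partial
  products are in L^2, since the space with s = 1/2, p = 2, r = 1 embeds into L^2.
\<close>

definition L2_rep :: "pdist \<Rightarrow> real \<Rightarrow> real" where
  "L2_rep S = (SOME f. f \<in> borel_measurable lborel \<and>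
     set_integrable lborel {0..1} (\<lambda>x. (f x)\<^sup>2) \<and> pd_of_fun f = S)"

definition pd_mult :: "pdist \<Rightarrow> pdist \<Rightarrow> pdist" where
  "pd_mult S S' = pd_of_fun (\<lambda>x. L2_rep S x * L2_rep S' x)"

definition helmholtz_inv :: "pdist \<Rightarrow> pdist" where
  "helmholtz_inv = inv (\<lambda>U. U - pd_deriv (pd_deriv U))"


section \<open>Littlewood--Paley blocks and Besov spaces\<close>

definition dyadic_partition :: "(real \<Rightarrow> real) \<Rightarrow> (real \<Rightarrow> real) \<Rightarrow> bool" where
  "dyadic_partition chi phi \<longleftrightarrow>
     smooth chi \<and> smooth phi \<and>
     (\<forall>x. 0 \<le> chi x \<and> chi x \<le> 1 \<and> chi (- x) = chi x) \<and>
     (\<forall>x. 0 \<le> phi x \<and> phi x \<le> 1 \<and> phi (- x) = phi x) \<and>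
     (\<forall>x. chi x \<noteq> 0 \<longrightarrow> \<bar>x\<bar> \<le> 4/3) \<and>
     (\<forall>x. phi x \<noteq> 0 \<longrightarrow> 3/4 \<le> \<bar>x\<bar> \<and> \<bar>x\<bar> \<le> 8/3) \<and>
     (\<forall>x. (\<lambda>q. phi (x / 2 ^ q)) sums (1 - chi x))"

definition lp_symbol :: "(real \<Rightarrow> real) \<Rightarrow> (real \<Rightarrow> real) \<Rightarrow> int \<Rightarrow> real \<Rightarrow> real" where
  "lp_symbol chi phi q x = (if q = -1 then chi x else phi (x / 2 powi q))"

definition fourier_coeff :: "pdist \<Rightarrow> int \<Rightarrow> complex" where
  "fourier_coeff S k = Complex (pairing S (\<lambda>x. cos (2 * pi * k * x)))
                               (- pairing S (\<lambda>x. sin (2 * pi * k * x)))"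

text \<open>
  On R/Z the k-th mode has frequency 2 pi k.  The symbol has bounded support, so each block is
  a trigonometric polynomial and the sum is finite.
\<close>

definition lp_block ::
    "(real \<Rightarrow> real) \<Rightarrow> (real \<Rightarrow> real) \<Rightarrow> int \<Rightarrow> pdist \<Rightarrow> real \<Rightarrow> complex" where
  "lp_block chi phi q S x =
     (\<Sum>k | lp_symbol chi phi q (2 * pi * of_int k) \<noteq> 0.
        of_real (lp_symbol chi phi q (2 * pi * of_int k)) * fourier_coeff S k
          * cis (2 * pi * of_int k * x))"

definition L2_norm :: "(real \<Rightarrow> complex) \<Rightarrow> real" where
  "L2_norm g = sqrt (LBINT x:{0..1}. (cmod (g x))\<^sup>2)"

text \<open>The case p = 2, r = 1.\<close>

definition besov :: "(real \<Rightarrow> real) \<Rightarrow> (real \<Rightarrow> real) \<Rightarrow> real \<Rightarrow> pdist set" where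
  "besov chi phi s =
     {S. (\<lambda>q::int. 2 powr (of_int q * s) * L2_norm (lp_block chi phi q S)) summable_on {-1..}}"

definition besov_norm :: "(real \<Rightarrow> real) \<Rightarrow> (real \<Rightarrow> real) \<Rightarrow> real \<Rightarrow> pdist \<Rightarrow> real" where
  "besov_norm chi phi s S =
     (\<Sum>\<^sub>\<infinity>q::int\<in>{-1..}. 2 powr (of_int q * s) * L2_norm (lp_block chi phi q S))"

abbreviation besov2 :: "(real \<Rightarrow> real) \<Rightarrow> (real \<Rightarrow> real) \<Rightarrow> real \<Rightarrow> (pdist \<times> pdist) set" where
  "besov2 chi phi s \<equiv> besov chi phi s \<times> besov chi phi s"

definition besov2_norm ::
    "(real \<Rightarrow> real) \<Rightarrow> (real \<Rightarrow> real) \<Rightarrow> real \<Rightarrow> pdist \<times> pdist \<Rightarrow> real" where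
  "besov2_norm chi phi s w = besov_norm chi phi s (fst w) + besov_norm chi phi s (snd w)"


section \<open>Curves in a normed space given by a carrier and a norm\<close>

definition curve_has_deriv ::
    "('a::real_vector \<Rightarrow> real) \<Rightarrow> (real \<Rightarrow> 'a) \<Rightarrow> 'a \<Rightarrow> real \<Rightarrow> real set \<Rightarrow> bool" where
  "curve_has_deriv nrm w d t I \<longleftrightarrow>
     ((\<lambda>h. nrm ((w h - w t) /\<^sub>R (h - t) - d)) \<longlongrightarrow> 0) (at t within I)"

definition curves_C :: "real \<Rightarrow> 'a::real_vector set \<Rightarrow> ('a \<Rightarrow> real) \<Rightarrow> (real \<Rightarrow> 'a) set" where
  "curves_C T X nrm =
     {w. (\<forall>t\<in>{0..T}. w t \<in> X) \<and>
         (\<forall>t\<in>{0..T}. ((\<lambda>h. nrm (w h - w t)) \<longlongrightarrow> 0) (at t within {0..T}))}"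

definition curves_C1 :: "real \<Rightarrow> 'a::real_vector set \<Rightarrow> ('a \<Rightarrow> real) \<Rightarrow> (real \<Rightarrow> 'a) set" where
  "curves_C1 T X nrm =
     {w \<in> curves_C T X nrm. \<exists>w' \<in> curves_C T X nrm.
        \<forall>t\<in>{0..T}. curve_has_deriv nrm w (w' t) t {0..T}}"

definition E_space ::
    "(real \<Rightarrow> real) \<Rightarrow> (real \<Rightarrow> real) \<Rightarrow> real \<Rightarrow> real \<Rightarrow> (real \<Rightarrow> pdist \<times> pdist) set" where
  "E_space chi phi s T =
     curves_C T (besov2 chi phi s) (besov2_norm chi phi s) \<inter>
     curves_C1 T (besov2 chi phi (s - 1)) (besov2_norm chi phi (s - 1))"

definition E_space_infty ::
    "(real \<Rightarrow> real) \<Rightarrow> (real \<Rightarrow> real) \<Rightarrow> real \<Rightarrow> (real \<Rightarrow> pdist \<times> pdist) set" where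
  "E_space_infty chi phi s = (\<Inter>T\<in>{0<..}. E_space chi phi s T)"


section \<open>The weakly dissipative SQQ system\<close>

definition sqq_velocity :: "pdist \<Rightarrow> pdist \<Rightarrow> pdist" where
  "sqq_velocity m n =
     (let u = helmholtz_inv m; v = helmholtz_inv n
      in pd_mult (u - pd_deriv u) (v + pd_deriv v))"

text \<open>
  Curves are total functions of time, but only times t >= 0 matter.  The equation is an
  identity in the Besov space of index s - 1, in whose norm the time derivative is taken.
\<close>

definition sqq_global_strong_solution ::
    "(real \<Rightarrow> real) \<Rightarrow> (real \<Rightarrow> real) \<Rightarrow> real \<Rightarrow> real \<Rightarrow> pdist \<Rightarrow> pdist
      \<Rightarrow> (real \<Rightarrow> pdist \<times> pdist) \<Rightarrow> bool" where
  "sqq_global_strong_solution chi phi s lam m0 n0 w \<longleftrightarrow>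
     w \<in> E_space_infty chi phi s \<and>
     w 0 = (m0, n0) \<and>
     (\<forall>t>0. \<exists>mt nt. 
        curve_has_deriv (besov2_norm chi phi (s - 1)) w (mt, nt) t {0..} \<and>
        mt \<in> besov chi phi (s - 1) \<and> nt \<in> besov chi phi (s - 1) \<and>
        (let m = fst (w t); n = snd (w t) in
           mt + pd_deriv (pd_mult (sqq_velocity m n) m) + lam *\<^sub>R m = 0 \<and>
           nt + pd_deriv (pd_mult (sqq_velocity m n) n) + lam *\<^sub>R n = 0))"

end

theory Submission
  imports Defs
begin

text \<open>The factors of the velocity are first order resolvents, \<open>u - u\<^sub>x = (1 + \<partial>\<^sub>x)\<^sup>-\<^sup>1 m\<close> and
  \<open>v + v\<^sub>x = (1 - \<partial>\<^sub>x)\<^sup>-\<^sup>1 n\<close>. Since the flux is cubic, the substitution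
  \<open>(m, n)(t) = exp (- \<lambda> t) (M, N)(\<tau> t)\<close> with \<open>\<tau> t = (1 - exp (- 2 \<lambda> t)) / (2 \<lambda>)\<close> removes the damping and
  compresses the half line of times to an interval of length \<open>1 / (2 \<lambda>)\<close>, on which the undamped system
  need only be solved for data of size \<open>N\<^sub>0\<close> with \<open>N\<^sub>0\<^sup>2 / \<lambda>\<close> small.

  There the unknown is the displacement \<open>d\<close> of the characteristics. In Lagrangian coordinates \<open>M\<close> and \<open>N\<close> are
  transported densities, the resolvents are integrals of the initial data against kernels that depend only on \<open>d\<close>,
  and \<open>d\<close> is the fixed point of a contraction in the sup norm. The Jacobian of the flow is \<open>1 + a\<close>, where \<open>a\<close> is built
  from products of the initial data with continuously differentiable functions; as the Besov space of index \<open>1/2\<close> is an algebra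
  that is stable under composition with such diffeomorphisms, \<open>M\<close> and \<open>N\<close> stay in it.

  Two solutions are compared in the energy \<open>\<parallel>(1 + \<partial>\<^sub>x)\<^sup>-\<^sup>1 (m\<^sub>1 - m\<^sub>2)\<parallel>\<^sup>2 + \<parallel>(1 - \<partial>\<^sub>x)\<^sup>-\<^sup>1 (n\<^sub>1 - n\<^sub>2)\<parallel>\<^sup>2\<close> in \<open>L\<^sup>2\<close>:
  one derivative is gained by the resolvents, the transport term is integrated by parts, and Gronwall's inequality applies.\<close>

section \<open>Fourier coefficients of continuous periodic functions\<close>

text \<open>A fixed point for the densities themselves would lose a derivative: in the Besov space
  of index 1/2, composition with a moving diffeomorphism is continuous in time, but a Lipschitz
  bound would cost a derivative of the composed function. The resolvent kernels, by contrast, are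
  Lipschitz in the displacement for the sup norm. The displacement found in this way is a priori
  only continuous; it becomes differentiable because the exponential weights cancel in the product
  of the two resolvents. One estimate carries most Besov bounds: a series whose terms have the L2
  and H1 sizes of dyadic pieces lies in the space. Products, weighted compositions and tails of
  block series are instances. Time derivatives are computed for single Fourier coefficients, where
  the continuity equation is a derivative under an integral, and are lifted to the norm of index
  -1/2 only at the end. No constant is optimised: \<open>C = 1000\<close> makes lambda at least 2 *
  10^8 times the square of \<open>N0\<close>, enough for the inverse Jacobian to be a Neumann series
  with ratio at most 1/2.\<close>

definition pcont :: "(real \<Rightarrow> 'a::real_normed_vector) \<Rightarrow> bool" where
  "pcont f \<longleftrightarrow> continuous_on UNIV f \<and> (\<forall>x. f (x + 1) = f x)"

definition pC1 :: "(real \<Rightarrow> 'a::real_normed_vector) \<Rightarrow> (real \<Rightarrow> 'a) \<Rightarrow> bool" where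
  "pC1 f f' \<longleftrightarrow> pcont f \<and> pcont f' \<and> (\<forall>x. (f has_vector_derivative f' x) (at x))"

definition wave :: "int \<Rightarrow> real \<Rightarrow> complex" where
  "wave k x = cis (2 * pi * of_int k * x)"

definition fc :: "(real \<Rightarrow> complex) \<Rightarrow> int \<Rightarrow> complex" where
  "fc f k = integral {0..1} (\<lambda>x. f x * wave (- k) x)"

definition l2 :: "(real \<Rightarrow> complex) \<Rightarrow> real" where
  "l2 f = sqrt (integral {0..1} (\<lambda>x. (cmod (f x))\<^sup>2))"

lemma pcont_continuous: "pcont f \<Longrightarrow> continuous_on A f"
  unfolding pcont_def using continuous_on_subset by blast

lemma pcont_per: "pcont f \<Longrightarrow> f (x + 1) = f x"
  by (simp add: pcont_def)

lemma periodic_int: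
  assumes "\<And>x::real. f (x + 1) = f x" shows "f (x + of_int k) = f x"
proof -
  have n: "f (y + of_nat n) = f y" for n y
    by (induction n) (use assms in \<open>auto simp: add.assoc[symmetric] add.commute[of 1]\<close>)
  show ?thesis
  proof (cases k)
    case (nonneg n) then show ?thesis using n by simp
  next
    case (neg n)
    then have "x + of_int k + of_nat (Suc n) = x" by simp
    then show ?thesis using n[of "x + of_int k" "Suc n"] by metis
  qed
qed

lemma pcont_integrable:
  fixes f :: "real \<Rightarrow> 'a::banach"
  shows "pcont f \<Longrightarrow> f integrable_on {a..b}"
  by (intro integrable_continuous_real pcont_continuous)

lemma pcont_const [simp, intro!]: "pcont (\<lambda>x. c)"
  by (auto simp: pcont_def)

lemma pcont_add [intro!]: "pcont f \<Longrightarrow> pcont g \<Longrightarrow> pcont (\<lambda>x. f x + g x)"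
  by (auto simp: pcont_def intro!: continuous_intros)

lemma pcont_diff [intro!]: "pcont f \<Longrightarrow> pcont g \<Longrightarrow> pcont (\<lambda>x. f x - g x)"
  by (auto simp: pcont_def intro!: continuous_intros)

lemma pcont_minus [intro!]: "pcont f \<Longrightarrow> pcont (\<lambda>x. - f x)"
  by (auto simp: pcont_def intro!: continuous_intros)

lemma pcont_mult [intro!]:
  fixes f :: "real \<Rightarrow> 'a::real_normed_algebra"
  shows "pcont f \<Longrightarrow> pcont g \<Longrightarrow> pcont (\<lambda>x. f x * g x)"
  by (auto simp: pcont_def intro!: continuous_intros)

lemma pcont_power [intro!]:
  fixes f :: "real \<Rightarrow> 'a::{real_normed_algebra_1}"
  shows "pcont f \<Longrightarrow> pcont (\<lambda>x. f x ^ n)"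
  by (auto simp: pcont_def intro!: continuous_intros)

lemma pcont_of_real [intro!]: "pcont f \<Longrightarrow> pcont (\<lambda>x. complex_of_real (f x))"
  by (auto simp: pcont_def intro!: continuous_intros)

lemma pcont_Re [intro!]: "pcont f \<Longrightarrow> pcont (\<lambda>x. Re (f x))"
  by (auto simp: pcont_def intro!: continuous_intros)

lemma pcont_norm [intro!]: "pcont f \<Longrightarrow> pcont (\<lambda>x. norm (f x))"
  by (auto simp: pcont_def intro!: continuous_intros)

lemma pcont_cnj [intro!]: "pcont f \<Longrightarrow> pcont (\<lambda>x. cnj (f x))"
  by (auto simp: pcont_def intro!: continuous_intros)

lemma pcont_sum [intro!]: "(\<And>i. i \<in> A \<Longrightarrow> pcont (f i)) \<Longrightarrow> pcont (\<lambda>x. \<Sum>i\<in>A. f i x)"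
  by (auto simp: pcont_def intro!: continuous_intros)

lemma pcont_compose:
  assumes "pcont f" "continuous_on UNIV q" "\<And>x. q (x + 1) = q x + 1"
  shows "pcont (\<lambda>x. f (q x))"
  using assms by (auto simp: pcont_def intro!: continuous_on_compose2[of UNIV f])

lemma pC1_pcont: "pC1 f f' \<Longrightarrow> pcont f" "pC1 f f' \<Longrightarrow> pcont f'"
  by (auto simp: pC1_def)

lemma pC1_deriv: "pC1 f f' \<Longrightarrow> (f has_vector_derivative f' x) (at x within A)"
  unfolding pC1_def by (blast intro: has_vector_derivative_at_within)

lemma has_vector_derivative_shift:
  assumes "\<And>x::real. (f has_vector_derivative f' x) (at x)"
  shows "((\<lambda>y. f (y + a)) has_vector_derivative f' (x + a)) (at x)"
proof -
  have "((\<lambda>y. y + a) has_vector_derivative 1) (at x)"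
    by (auto intro!: derivative_eq_intros)
  from vector_diff_chain_at[OF this, of f "f' (x + a)"] assms[of "x + a"] show ?thesis
    by (simp add: o_def)
qed

text \<open>Periodicity of the derivative comes from uniqueness of derivatives, and continuity of
  \<open>f\<close> from differentiability.\<close>

lemma pC1_intro:
  assumes "\<And>x. f (x + 1) = f x" "\<And>x. (f has_vector_derivative f' x) (at x)"
    "continuous_on UNIV f'"
  shows "pC1 f f'"
proof -
  have "f' (x + 1) = f' x" for x
  proof -
    have "((\<lambda>y. f (y + 1)) has_vector_derivative f' (x + 1)) (at x)"
      using assms(2) by (rule has_vector_derivative_shift)
    moreover have "(\<lambda>y. f (y + 1)) = f" using assms(1) by auto
    ultimately show ?thesis using assms(2) vector_derivative_unique_at by metis
  qed
  moreover have "continuous_on UNIV f"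
    using assms(2) by (auto simp: continuous_on_eq_continuous_within
        intro: has_vector_derivative_continuous)
  ultimately show ?thesis using assms by (auto simp: pC1_def pcont_def)
qed

lemma pC1_mult:
  fixes f :: "real \<Rightarrow> 'a::real_normed_algebra"
  assumes "pC1 f f'" "pC1 g g'"
  shows "pC1 (\<lambda>x. f x * g x) (\<lambda>x. f x * g' x + f' x * g x)"
  using assms by (auto simp: pC1_def intro: has_vector_derivative_mult)

lemma pC1_add:
  assumes "pC1 f f'" "pC1 g g'"
  shows "pC1 (\<lambda>x. f x + g x) (\<lambda>x. f' x + g' x)"
  using assms by (auto simp: pC1_def intro: has_vector_derivative_add)

lemma pC1_diff:
  assumes "pC1 f f'" "pC1 g g'"
  shows "pC1 (\<lambda>x. f x - g x) (\<lambda>x. f' x - g' x)"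
  using assms by (auto simp: pC1_def intro: has_vector_derivative_diff)

lemma pC1_cmult:
  fixes f :: "real \<Rightarrow> 'a::real_normed_algebra"
  assumes "pC1 f f'"
  shows "pC1 (\<lambda>x. c * f x) (\<lambda>x. c * f' x)"
  using assms by (auto simp: pC1_def intro: has_vector_derivative_mult_right)

lemma pC1_sum:
  assumes "\<And>i. i \<in> A \<Longrightarrow> pC1 (f i) (f' i)"
  shows "pC1 (\<lambda>x. \<Sum>i\<in>A. f i x) (\<lambda>x. \<Sum>i\<in>A. f' i x)"
  unfolding pC1_def
proof (intro conjI allI)
  show "((\<lambda>x. \<Sum>i\<in>A. f i x) has_vector_derivative (\<Sum>i\<in>A. f' i x)) (at x)" for x
    using assms by (intro has_vector_derivative_sum) (auto simp: pC1_def)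
qed (use assms in \<open>auto simp: pC1_def\<close>)

lemma pC1_of_real:
  assumes "pC1 f f'" shows "pC1 (\<lambda>x. complex_of_real (f x)) (\<lambda>x. of_real (f' x))"
  using assms unfolding pC1_def
  by (auto simp: has_real_derivative_iff_has_vector_derivative[symmetric]
      intro: has_vector_derivative_of_real)

lemma pC1_compose:
  fixes f :: "real \<Rightarrow> 'a::real_normed_vector"
  assumes "pC1 f f'" "\<And>x. q (x + 1) = q x + 1" "\<And>x. (q has_real_derivative q' x) (at x)"
    "continuous_on UNIV q'"
  shows "pC1 (\<lambda>x. f (q x)) (\<lambda>x. q' x *\<^sub>R f' (q x))"
proof (rule pC1_intro)
  have cq: "continuous_on UNIV q"
    using assms(3) by (auto simp: continuous_on_eq_continuous_within intro: DERIV_isCont)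
  show "((\<lambda>x. f (q x)) has_vector_derivative q' x *\<^sub>R f' (q x)) (at x)" for x
    using vector_diff_chain_at[of q "q' x" x f "f' (q x)"] assms(3)[of x] pC1_deriv[OF assms(1)]
    by (simp add: has_real_derivative_iff_has_vector_derivative o_def)
  show "continuous_on UNIV (\<lambda>x. q' x *\<^sub>R f' (q x))"
    using assms(4) cq pcont_continuous[OF pC1_pcont(2)[OF assms(1)]]
    by (intro continuous_intros continuous_on_compose2[of UNIV f' UNIV q]) auto
qed (use assms pcont_per[OF pC1_pcont(1)[OF assms(1)]] in auto)

section \<open>Integration over a period and change of variables on the circle\<close>

lemma has_antiderivative:
  fixes f :: "real \<Rightarrow> 'a::euclidean_space"
  assumes "continuous_on UNIV f"
  obtains F where "\<And>x. (F has_vector_derivative f x) (at x)"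
  using einterval_antiderivative[of "-\<infinity>" "\<infinity>" f] assms
  by (auto simp: continuous_on_eq_continuous_at)

lemma integral_deriv:
  assumes "\<And>x. (F has_vector_derivative f x) (at x)" "a \<le> b"
  shows "integral {a..b} f = F b - (F a :: 'a::banach)"
  by (rule integral_unique, rule fundamental_theorem_of_calculus[OF assms(2)])
    (use assms(1) has_vector_derivative_at_within in blast)

lemma antiderivative_shift:
  fixes f :: "real \<Rightarrow> 'a::euclidean_space"
  assumes F: "\<And>x. (F has_vector_derivative f x) (at x)" and per: "\<And>x. f (x + 1) = f x"
  shows "F (x + 1) = F x + integral {0..1} f"
proof -
  have "((\<lambda>y. F (y + 1) - F y) has_vector_derivative 0) (at y within UNIV)" for y
    using has_vector_derivative_diff[OF has_vector_derivative_shift[of F f 1 y] F[of y]] F per[of y]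
    by simp
  then obtain c where "\<And>y. F (y + 1) - F y = c"
    using has_vector_derivative_zero_constant[of UNIV] by auto
  from this[of 0] this[of x] show ?thesis using integral_deriv[OF F, of 0 1]
    by (simp add: algebra_simps)
qed

text \<open>Both sides are the increment of one antiderivative over an interval of length 1. Only
  the degree of \<open>q\<close> enters, so no sign of \<open>q'\<close> is involved.\<close>

lemma integral_periodic_substitution:
  fixes f :: "real \<Rightarrow> 'a::euclidean_space"
  assumes f: "pcont f" and q: "\<And>x. q (x + 1) = q x + 1"
    "\<And>x. (q has_real_derivative q' x) (at x)"
  shows "integral {0..1} (\<lambda>x. q' x *\<^sub>R f (q x)) = integral {0..1} f"
proof -
  obtain F where F: "\<And>x. (F has_vector_derivative f x) (at x)"
    using has_antiderivative pcont_continuous[OF f] by blast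
  have "((\<lambda>x. F (q x)) has_vector_derivative q' x *\<^sub>R f (q x)) (at x)" for x
    using vector_diff_chain_at[of q "q' x" x F "f (q x)"] q(2)[of x] F
    by (simp add: has_real_derivative_iff_has_vector_derivative o_def)
  from integral_deriv[OF this, of 0 1] show ?thesis
    using antiderivative_shift[OF F pcont_per[OF f], of "q 0"] q(1)[of 0] by simp
qed

lemma integral_periodic_shift:
  fixes f :: "real \<Rightarrow> 'a::euclidean_space"
  assumes "pcont f"
  shows "integral {0..1} (\<lambda>x. f (x + a)) = integral {0..1} f"
proof -
  have "((\<lambda>x. x + a) has_real_derivative 1) (at x)" for x
    by (auto intro!: derivative_eq_intros)
  from integral_periodic_substitution[OF assms _ this] show ?thesis by simp
qed

lemma integral_pC1_deriv:
  fixes f :: "real \<Rightarrow> 'a::banach"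
  assumes "pC1 f f'" shows "integral {0..1} f' = 0"
  using integral_deriv[of f f' 0 1] assms pcont_per[of f 0] by (auto simp: pC1_def)

section \<open>Characters of the circle and Fourier coefficients\<close>

lemma wave_mult: "wave j x * wave k x = wave (j + k) x"
  by (simp add: wave_def cis_mult algebra_simps)

lemma norm_wave [simp]: "cmod (wave k x) = 1"
  by (simp add: wave_def)

lemma wave_0 [simp]: "wave 0 x = 1" "wave k 0 = 1"
  by (auto simp: wave_def)

lemma cnj_wave: "cnj (wave k x) = wave (- k) x"
  by (simp add: wave_def cis_cnj)

lemma wave_plus: "wave k (x + y) = wave k x * wave k y"
  by (simp add: wave_def cis_mult algebra_simps)

lemma wave_1 [simp]: "wave k 1 = 1"
  by (simp add: wave_def cis.code complex_eq_iff)

lemma continuous_wave [continuous_intros]: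
  "continuous_on A f \<Longrightarrow> continuous_on A (\<lambda>x. wave k (f x))"
  unfolding wave_def cis_conv_exp
  by (intro continuous_on_exp continuous_on_mult continuous_on_const continuous_on_of_real)

lemma wave_deriv:
  "(wave k has_vector_derivative (2 * pi * \<i> * of_int k) * wave k x) (at x within A)"
proof -
  define c where "c = 2 * pi * \<i> * of_int k"
  have "((\<lambda>x. exp (x *\<^sub>R c)) has_vector_derivative exp (x *\<^sub>R c) * c) (at x within A)"
    by (rule exp_scaleR_has_vector_derivative_right)
  moreover have "wave k y = exp (y *\<^sub>R c)" for y
    by (simp add: wave_def cis_conv_exp c_def scaleR_conv_of_real mult_ac)
  ultimately have "(wave k has_vector_derivative wave k x * c) (at x within A)"
    by presburger
  then show ?thesis by (simp add: c_def mult_ac)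
qed

lemma pcont_wave [simp, intro!]: "pcont (wave k)"
  by (auto simp: pcont_def wave_plus intro!: continuous_intros)

lemma pC1_wave: "pC1 (wave k) (\<lambda>x. (2 * pi * \<i> * of_int k) * wave k x)"
  using wave_deriv by (auto simp: pC1_def)

lemma integral_wave: "integral {0..1} (wave k) = (if k = 0 then 1 else 0)"
proof (cases "k = 0")
  case False
  have "integral {0..1} (\<lambda>x. (2 * pi * \<i> * of_int k) * wave k x) = 0"
    using integral_pC1_deriv[OF pC1_wave[of k]] by simp
  then show ?thesis using False by simp
next
  case True
  have "wave 0 = (\<lambda>x. 1)" by (rule ext) simp
  then show ?thesis using True by simp
qed

lemma fc_integrable: "pcont f \<Longrightarrow> (\<lambda>x. f x * wave k x) integrable_on {0..1}"
  by (rule pcont_integrable[OF pcont_mult[OF _ pcont_wave]])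

lemma fc_add: "pcont f \<Longrightarrow> pcont g \<Longrightarrow> fc (\<lambda>x. f x + g x) k = fc f k + fc g k"
  unfolding fc_def by (simp add: ring_distribs integral_add fc_integrable)

lemma fc_diff: "pcont f \<Longrightarrow> pcont g \<Longrightarrow> fc (\<lambda>x. f x - g x) k = fc f k - fc g k"
  unfolding fc_def by (simp add: ring_distribs integral_diff fc_integrable)

lemma fc_cmult: "fc (\<lambda>x. c * f x) k = c * fc f k"
  unfolding fc_def by (simp add: mult.assoc)

lemma fc_minus: "fc (\<lambda>x. - f x) k = - fc f k"
  unfolding fc_def by simp

lemma fc_sum: "finite A \<Longrightarrow> (\<And>i. i \<in> A \<Longrightarrow> pcont (f i)) \<Longrightarrow>
    fc (\<lambda>x. \<Sum>i\<in>A. f i x) k = (\<Sum>i\<in>A. fc (f i) k)"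
  unfolding fc_def by (simp add: sum_distrib_right integral_sum fc_integrable)

lemma fc_wave: "fc (wave j) k = (if j = k then 1 else 0)"
  unfolding fc_def by (simp add: wave_mult integral_wave)

lemma fc_wave_mult: "fc (\<lambda>x. wave j x * f x) k = fc f (k - j)"
  unfolding fc_def using wave_mult[of j _ "- k"]
  by (simp add: mult.assoc mult.left_commute[of "wave j _"] algebra_simps)

lemma fc_const: "fc (\<lambda>x. c) k = (if k = 0 then c else 0)"
  using fc_cmult[of c "wave 0" k] fc_wave[of 0 k] by simp

lemma fc_deriv:
  assumes "pC1 f f'" shows "fc f' k = 2 * pi * \<i> * of_int k * fc f k"
proof -
  have "pC1 (\<lambda>x. f x * wave (- k) x)
      (\<lambda>x. f x * ((2 * pi * \<i> * of_int (- k)) * wave (- k) x) + f' x * wave (- k) x)"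
    using pC1_mult[OF assms pC1_wave] .
  from integral_pC1_deriv[OF this]
  have "integral {0..1} (\<lambda>x. (2 * pi * \<i> * of_int (- k)) * (f x * wave (- k) x) + f' x * wave (- k) x) = 0"
    by (simp add: mult_ac)
  moreover have "(\<lambda>x. (2 * pi * \<i> * of_int (- k)) * (f x * wave (- k) x)) integrable_on {0..1}"
    "(\<lambda>x. f' x * wave (- k) x) integrable_on {0..1}"
    using pC1_pcont[OF assms] by (auto intro!: pcont_integrable)
  ultimately have "(2 * pi * \<i> * of_int (- k)) * fc f k + fc f' k = 0"
    unfolding fc_def by (subst (asm) integral_add) auto
  then show ?thesis by (simp add: algebra_simps)
qed

lemma norm_fc_le:
  assumes "pcont f" "\<And>x. cmod (f x) \<le> M"
  shows "cmod (fc f k) \<le> M"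
proof -
  have "cmod (fc f k) \<le> integral {0..1} (\<lambda>x::real. M)"
    unfolding fc_def using assms
    by (intro integral_norm_bound_integral fc_integrable) (auto simp: norm_mult)
  then show ?thesis by simp
qed

section \<open>The L2 norm, Bessel's inequality and Parseval for trigonometric polynomials\<close>

lemma l2_nonneg [simp]: "0 \<le> l2 f"
  unfolding l2_def by (cases "(\<lambda>x. (cmod (f x))\<^sup>2) integrable_on {0..1}")
    (auto intro!: integral_nonneg simp: not_integrable_integral)

lemma l2_square: "pcont f \<Longrightarrow> (l2 f)\<^sup>2 = integral {0..1} (\<lambda>x. (cmod (f x))\<^sup>2)"
  unfolding l2_def
  by (intro real_sqrt_pow2 integral_nonneg pcont_integrable pcont_power pcont_norm) simp_all

lemma l2_mono:
  assumes "pcont f" "pcont g" "\<And>x. cmod (f x) \<le> C * cmod (g x)" "0 \<le> C"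
  shows "l2 f \<le> C * l2 g"
proof -
  have "integral {0..1} (\<lambda>x. (cmod (f x))\<^sup>2) \<le> integral {0..1} (\<lambda>x. C\<^sup>2 * (cmod (g x))\<^sup>2)"
    using assms power_mono[OF assms(3), of _ 2]
    by (intro integral_le pcont_integrable) (auto simp: power_mult_distrib)
  also have "\<dots> = C\<^sup>2 * integral {0..1} (\<lambda>x. (cmod (g x))\<^sup>2)" by simp
  finally have "l2 f \<le> sqrt (C\<^sup>2 * integral {0..1} (\<lambda>x. (cmod (g x))\<^sup>2))"
    unfolding l2_def by simp
  then show ?thesis using assms(4) by (simp add: l2_def real_sqrt_mult)
qed

lemma l2_le_sup:
  assumes "pcont f" "\<And>x. cmod (f x) \<le> M"
  shows "l2 f \<le> M"
proof -
  have "0 \<le> M" using assms(2) norm_ge_zero order_trans by blast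
  then have "l2 f \<le> M * l2 (\<lambda>x. 1)" using assms by (intro l2_mono) auto
  then show ?thesis by (simp add: l2_def)
qed

text \<open>Expand the nonnegative integral of the square of \<open>f - P\<close>, where
  \<open>P\<close> is the orthogonal projection of \<open>f\<close> to the modes in
  \<open>A\<close>.\<close>

lemma bessel:
  assumes f: "pcont f" and A: "finite A"
  shows "(\<Sum>k\<in>A. (cmod (fc f k))\<^sup>2) \<le> (l2 f)\<^sup>2"
proof -
  define P where "P x = (\<Sum>k\<in>A. fc f k * wave k x)" for x
  have P: "pcont P" unfolding P_def by auto
  have fP: "fc P k = (if k \<in> A then fc f k else 0)" for k
  proof -
    have "fc P k = (\<Sum>j\<in>A. fc f j * (if j = k then 1 else 0))"
      unfolding P_def using A by (subst fc_sum) (auto simp: fc_cmult fc_wave)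
    also have "\<dots> = (\<Sum>j\<in>A. if j = k then fc f j else 0)" by (rule sum.cong) auto
    finally show ?thesis using A by (simp add: sum.delta')
  qed
  have ip: "integral {0..1} (\<lambda>x. g x * cnj (P x)) = (\<Sum>k\<in>A. cnj (fc f k) * fc g k)" if "pcont g" for g
  proof -
    have "(\<lambda>x. g x * cnj (P x)) = (\<lambda>x. \<Sum>k\<in>A. cnj (fc f k) * (g x * wave (- k) x))"
      by (simp add: P_def fun_eq_iff sum_distrib_left cnj_wave mult_ac)
    then show ?thesis using A that unfolding fc_def[of g]
      by (simp only:) (subst integral_sum, auto intro!: pcont_integrable)
  qed
  have Re_int: "integral {0..1} (\<lambda>x. Re (g x)) = Re (integral {0..1} g)" if "pcont g" for g
    using integral_linear[OF pcont_integrable[OF that, of 0 1] bounded_linear_Re] by (simp add: o_def)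
  have s: "Re (\<Sum>k\<in>A. cnj (fc f k) * fc f k) = (\<Sum>k\<in>A. (cmod (fc f k))\<^sup>2)"
    unfolding Re_sum by (intro sum.cong refl) (simp add: cmod_power2 power2_eq_square[symmetric])
  have fP': "pcont (\<lambda>x. f x * cnj (P x))" "pcont (\<lambda>x. P x * cnj (P x))" "pcont (\<lambda>x. (cmod (f x))\<^sup>2)"
    using f P by auto
  have "0 \<le> integral {0..1} (\<lambda>x. (cmod (f x - P x))\<^sup>2)"
    using f P by (intro integral_nonneg pcont_integrable) auto
  also have "(\<lambda>x. (cmod (f x - P x))\<^sup>2) =
      (\<lambda>x. (cmod (f x))\<^sup>2 - 2 * Re (f x * cnj (P x)) + Re (P x * cnj (P x)))"
    unfolding cmod_power2 by (simp add: fun_eq_iff algebra_simps power2_eq_square)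
  also have "integral {0..1} \<dots> = (l2 f)\<^sup>2 - 2 * Re (integral {0..1} (\<lambda>x. f x * cnj (P x)))
      + Re (integral {0..1} (\<lambda>x. P x * cnj (P x)))"
  proof -
    have i: "(\<lambda>x. (cmod (f x))\<^sup>2) integrable_on {0..1}"
      "(\<lambda>x. 2 * Re (f x * cnj (P x))) integrable_on {0..1}"
      "(\<lambda>x. Re (P x * cnj (P x))) integrable_on {0..1}"
      by (rule pcont_integrable, intro fP' pcont_Re pcont_mult[OF pcont_const])+
    show ?thesis
      unfolding integral_add[OF integrable_diff[OF i(1,2)] i(3)] integral_diff[OF i(1,2)]
        integral_mult_right Re_int[OF fP'(1)] Re_int[OF fP'(2)] l2_square[OF f] ..
  qed
  also have "\<dots> = (l2 f)\<^sup>2 - (\<Sum>k\<in>A. (cmod (fc f k))\<^sup>2)"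
    using ip[OF f] ip[OF P] s fP by simp
  finally show ?thesis by simp
qed

lemma l2_trig:
  assumes A: "finite A"
  shows "l2 (\<lambda>x. \<Sum>k\<in>A. c k * wave k x) = L2_set (\<lambda>k. cmod (c k)) A"
proof -
  define P where "P x = (\<Sum>k\<in>A. c k * wave k x)" for x
  have P: "pcont P" unfolding P_def by auto
  have fP: "fc P k = (if k \<in> A then c k else 0)" for k
  proof -
    have "fc P k = (\<Sum>j\<in>A. c j * (if j = k then 1 else 0))"
      unfolding P_def using A by (subst fc_sum) (auto simp: fc_cmult fc_wave)
    also have "\<dots> = (\<Sum>j\<in>A. if j = k then c j else 0)" by (rule sum.cong) auto
    finally show ?thesis using A by (simp add: sum.delta')
  qed
  have "complex_of_real (integral {0..1} (\<lambda>x. (cmod (P x))\<^sup>2)) = integral {0..1} (\<lambda>x. P x * cnj (P x))"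
    unfolding complex_norm_square[symmetric]
    using integral_linear[OF pcont_integrable[OF pcont_power[OF pcont_norm[OF P]]] bounded_linear_of_real[where ?'a = complex], of 0 1 2]
    by (simp add: o_def)
  also have "\<dots> = integral {0..1} (\<lambda>x. \<Sum>k\<in>A. cnj (c k) * (P x * wave (- k) x))"
    by (subst (2) P_def) (simp add: sum_distrib_left cnj_wave mult_ac)
  also have "\<dots> = (\<Sum>k\<in>A. cnj (c k) * fc P k)"
    using A P unfolding fc_def by (subst integral_sum) (auto intro!: pcont_integrable)
  also have "\<dots> = of_real (\<Sum>k\<in>A. (cmod (c k))\<^sup>2)"
    unfolding of_real_sum complex_norm_square by (simp add: fP mult.commute)
  finally have "integral {0..1} (\<lambda>x. (cmod (P x))\<^sup>2) = (\<Sum>k\<in>A. (cmod (c k))\<^sup>2)"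
    using of_real_eq_iff by blast
  then show ?thesis by (simp add: l2_def L2_set_def P_def)
qed

text \<open>A weak form of the Riemann-Lebesgue lemma: by Bessel, a nonzero value can be taken by
  only finitely many coefficients.\<close>

lemma const_coeffs_zero:
  assumes "pcont g" "inj h" "\<And>n::nat. fc g (h n) = c"
  shows "c = 0"
proof (rule ccontr)
  assume "c \<noteq> 0"
  then have c: "(cmod c)\<^sup>2 > 0" by simp
  obtain n :: nat where n: "(l2 g)\<^sup>2 / (cmod c)\<^sup>2 < n" using reals_Archimedean2 by blast
  have "real n * (cmod c)\<^sup>2 = (\<Sum>k\<in>h ` {..<n}. (cmod (fc g k))\<^sup>2)"
    using assms by (subst sum.reindex) (auto simp: inj_on_def)
  also have "\<dots> \<le> (l2 g)\<^sup>2" by (rule bessel) (use assms in auto)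
  finally show False using n c by (simp add: field_simps)
qed

section \<open>Uniqueness of Fourier coefficients\<close>

lemma vector_derivative_quotient:
  assumes "(f has_vector_derivative f') (at x within S)"
  shows "((\<lambda>y. (f y - f x) /\<^sub>R (y - x)) \<longlongrightarrow> f') (at x within S)"
proof (rule LIM_zero_cancel, rule tendsto_norm_zero_cancel)
  have "((\<lambda>y. norm ((1 / norm (y - x)) *\<^sub>R (f y - (f x + (y - x) *\<^sub>R f')))) \<longlongrightarrow> 0) (at x within S)"
    using assms unfolding has_vector_derivative_def has_derivative_within
    by (intro tendsto_norm_zero) auto
  moreover have "\<forall>\<^sub>F y in at x within S. norm ((1 / norm (y - x)) *\<^sub>R (f y - (f x + (y - x) *\<^sub>R f')))
      = norm ((f y - f x) /\<^sub>R (y - x) - f')"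
    using eventually_neq_at_within[of x]
  proof eventually_elim
    case (elim y)
    have "(f y - f x) /\<^sub>R (y - x) - f' = (1 / (y - x)) *\<^sub>R (f y - (f x + (y - x) *\<^sub>R f'))"
      using elim by (simp add: scaleR_right_diff_distrib scaleR_add_right divide_inverse)
    then show ?case by (simp only: norm_scaleR) simp
  qed
  ultimately show "((\<lambda>y. norm ((f y - f x) /\<^sub>R (y - x) - f')) \<longlongrightarrow> 0) (at x within S)"
    by (rule Lim_transform_eventually)
qed

text \<open>Chernoff's argument: the function \<open>(F - F 0) / (wave 1 - 1)\<close> is continuous, so its
  coefficients are square summable, while the coefficients of \<open>F\<close> are their differences.\<close>

lemma pC1_zero_coeffs_at_0:
  assumes F: "pC1 F F'" and z: "\<And>k. fc F k = 0"
  shows "F 0 = 0"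
proof -
  \<comment> \<open>At the integers, the zeros of the denominator, the quotient is given its limit,
    the ratio of the derivatives of \<open>F\<close> and \<open>wave 1\<close>.\<close>
  define g where "g x = (if wave 1 x = 1 then F' x / (2 * pi * \<i>) else (F x - F 0) / (wave 1 x - 1))" for x
  have w1: "wave 1 x = 1 \<longleftrightarrow> x \<in> \<int>" for x
  proof
    assume "wave 1 x = 1"
    then have "cos (2 * pi * x) = 1" by (simp add: wave_def cis.code complex_eq_iff)
    then obtain n :: int where "2 * pi * x = n * 2 * pi" using cos_one_2pi_int by auto
    then show "x \<in> \<int>" by simp
  next
    assume "x \<in> \<int>"
    then show "wave 1 x = 1" unfolding wave_def by (simp add: cis_multiple_2pi)
  qed
  have per: "F (x + of_int k) = F x" "F' (x + of_int k) = F' x" for x k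
    using periodic_int[of F] periodic_int[of F'] pC1_pcont[OF F] by (auto simp: pcont_def)
  have FI: "F x = F 0" if x: "x \<in> \<int>" for x
  proof -
    obtain k where "x = of_int k" using x by (auto elim: Ints_cases)
    then show ?thesis using per(1)[of 0 k] by simp
  qed
  have w: "(wave 1 has_vector_derivative (2 * pi * \<i>) * wave 1 x) (at x)" for x
    using wave_deriv[of 1 x UNIV] by simp
  have "isCont g x" for x
  proof (cases "x \<in> \<int>")
    case False
    have "open (- \<int> :: real set)" using closed_Ints by blast
    then have ev: "\<forall>\<^sub>F y in at x. y \<in> - \<int>"
      using False eventually_at_topological by (metis ComplI)
    have "((\<lambda>y. (F y - F 0) / (wave 1 y - 1)) \<longlongrightarrow> (F x - F 0) / (wave 1 x - 1)) (at x)"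
      using False w1[of x] has_vector_derivative_continuous[OF w[of x]]
        has_vector_derivative_continuous[OF pC1_deriv[OF F], of x UNIV]
      by (intro tendsto_divide tendsto_diff tendsto_const) (auto simp: continuous_within)
    moreover have "\<forall>\<^sub>F y in at x. (F y - F 0) / (wave 1 y - 1) = g y"
      using ev by eventually_elim (simp add: g_def w1)
    ultimately have "(g \<longlongrightarrow> (F x - F 0) / (wave 1 x - 1)) (at x)"
      by (rule Lim_transform_eventually)
    then show ?thesis using False w1 by (simp add: isCont_def g_def)
  next
    case True
    have "open (- (\<int> - {x}) :: real set)"
      using closed_subset_Ints[of "\<int> - {x}"] by blast
    then have "\<forall>\<^sub>F y in at x. y \<in> - (\<int> - {x})"
      unfolding eventually_at_topological by auto
    then have ev: "\<forall>\<^sub>F y in at x. y \<notin> \<int>"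
      using eventually_neq_at_within[of x x UNIV] by eventually_elim auto
    have "((\<lambda>y. ((F y - F x) /\<^sub>R (y - x)) / ((wave 1 y - wave 1 x) /\<^sub>R (y - x)))
        \<longlongrightarrow> F' x / (2 * pi * \<i> * wave 1 x)) (at x)"
      using True w1[of x] by (intro tendsto_divide vector_derivative_quotient w pC1_deriv[OF F]) auto
    moreover have "\<forall>\<^sub>F y in at x. ((F y - F x) /\<^sub>R (y - x)) / ((wave 1 y - wave 1 x) /\<^sub>R (y - x)) = g y"
      using ev eventually_neq_at_within[of x x UNIV]
    proof eventually_elim
      case (elim y)
      then show ?case using w1[of x] w1[of y] True FI[OF True]
        by (auto simp: g_def scaleR_conv_of_real divide_simps)
    qed
    ultimately have "(g \<longlongrightarrow> F' x / (2 * pi * \<i> * wave 1 x)) (at x)"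
      by (rule Lim_transform_eventually)
    moreover have "wave 1 x = 1" using True w1 by simp
    ultimately show ?thesis by (simp add: isCont_def g_def)
  qed
  then have "continuous_on UNIV g" by (simp add: continuous_at_imp_continuous_on)
  moreover have "g (x + 1) = g x" for x
    using per[of x 1] by (simp add: g_def wave_plus)
  ultimately have g: "pcont g" by (simp add: pcont_def)
  have Fg: "F x - F 0 = wave 1 x * g x - g x" for x
    using w1[of x] FI[of x] by (auto simp: g_def field_simps)
  \<comment> \<open>As the coefficients of \<open>F\<close> vanish, those of \<open>g\<close> are
    constant on the nonnegative and on the negative integers, with a jump by \<open>F 0\<close>
    between -1 and 0. Both constants are 0 by \<open>const_coeffs_zero\<close>, hence so is the
    jump.\<close>
  have rec: "fc g (k - 1) - fc g k = (if k = 0 then - F 0 else 0)" for k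
  proof -
    have "fc (\<lambda>x. wave 1 x * g x - g x) k = fc g (k - 1) - fc g k"
      using g by (subst fc_diff) (auto simp: fc_wave_mult)
    moreover have "fc (\<lambda>x. F x - F 0) k = fc F k - (if k = 0 then F 0 else 0)"
      using pC1_pcont[OF F] by (subst fc_diff) (auto simp: fc_const)
    ultimately show ?thesis using z Fg by simp
  qed
  have "fc g (int n) = fc g 0" for n
  proof (induction n)
    case (Suc n)
    have "fc g (int (Suc n) - 1) - fc g (int (Suc n)) = 0"
      using rec[of "int (Suc n)"] by (simp del: of_nat_Suc)
    then show ?case using Suc by simp
  qed simp
  then have 0: "fc g 0 = 0" using const_coeffs_zero[OF g, of int] by (auto simp: inj_def)
  have "fc g (- 1 - int n) = fc g (- 1)" for n
  proof (induction n)
    case (Suc n)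
    have "fc g (- 1 - int (Suc n)) - fc g (- 1 - int n) = 0"
      using rec[of "- 1 - int n"] by (simp add: algebra_simps)
    then show ?case using Suc by simp
  qed simp
  then have "fc g (- 1) = 0" using const_coeffs_zero[OF g, of "\<lambda>n. - 1 - int n"] by (auto simp: inj_def)
  then show ?thesis using rec[of 0] 0 by simp
qed

lemma fc_shift:
  assumes "pcont f" shows "fc (\<lambda>y. f (y + x)) k = wave k x * fc f k"
proof -
  have "wave k x * integral {0..1} (\<lambda>y. f (y + x) * wave (- k) (y + x)) = fc (\<lambda>y. f (y + x)) k"
    unfolding fc_def integral_mult_right[symmetric]
    by (rule arg_cong[of _ _ "integral {0..1}"]) (simp add: wave_plus fun_eq_iff wave_mult)
  moreover have "pcont (\<lambda>y. f y * wave (- k) y)" using assms by (intro pcont_mult pcont_wave)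
  ultimately show ?thesis
    using integral_periodic_shift[of "\<lambda>y. f y * wave (- k) y" x] by (simp add: fc_def)
qed

lemma pC1_shift: "pC1 f f' \<Longrightarrow> pC1 (\<lambda>y. f (y + x)) (\<lambda>y. f' (y + x))"
proof (rule pC1_intro)
  assume f: "pC1 f f'"
  show "f (y + 1 + x) = f (y + x)" for y
    using pcont_per[OF pC1_pcont(1)[OF f], of "y + x"] by (simp add: add_ac)
  show "((\<lambda>y. f (y + x)) has_vector_derivative f' (y + x)) (at y)" for y
    using f by (intro has_vector_derivative_shift) (simp add: pC1_def)
  show "continuous_on UNIV (\<lambda>y. f' (y + x))"
    using pcont_continuous[OF pC1_pcont(2)[OF f]]
    by (intro continuous_on_compose2[of UNIV f' UNIV "\<lambda>y. y + x"] continuous_intros) auto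
qed

lemma pC1_zero_coeffs:
  assumes F: "pC1 F F'" and z: "\<And>k. fc F k = 0"
  shows "F x = 0"
  using pC1_zero_coeffs_at_0[OF pC1_shift[OF F, of x]] fc_shift[OF pC1_pcont(1)[OF F]] z by simp

text \<open>Integrating once leads to the C1 case: the antiderivative is periodic because the
  coefficient of \<open>f\<close> at 0 vanishes, and subtracting its mean removes the one
  coefficient that differentiation does not see.\<close>

lemma pcont_zero_coeffs:
  assumes f: "pcont f" and z: "\<And>k. fc f k = 0"
  shows "f x = 0"
proof -
  obtain F where F: "\<And>x. (F has_vector_derivative f x) (at x)"
    using has_antiderivative pcont_continuous[OF f] by blast
  have "integral {0..1} f = fc f 0" by (simp add: fc_def)
  then have "F (x + 1) = F x" for x
    using antiderivative_shift[OF F pcont_per[OF f]] z[of 0] by simp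
  then have F1: "pC1 F f" using F pcont_continuous[OF f] by (auto intro!: pC1_intro)
  define G where "G x = F x - fc F 0" for x
  have "((\<lambda>x. F x - fc F 0) has_vector_derivative f x) (at x)" for x
    using has_vector_derivative_diff[OF F has_vector_derivative_const] by simp
  then have G: "pC1 G f" using F1 f unfolding G_def pC1_def by auto
  have "fc G k = 0" for k
  proof (cases "k = 0")
    case True
    then show ?thesis using pC1_pcont(1)[OF F1] unfolding G_def by (subst fc_diff) (auto simp: fc_const)
  next
    case False
    then show ?thesis using fc_deriv[OF G, of k] z by simp
  qed
  then have "G = (\<lambda>x. 0)" using pC1_zero_coeffs[OF G] by auto
  then show ?thesis
    using pC1_deriv[OF G, of x UNIV] vector_derivative_unique_at has_vector_derivative_const by blast
qed

lemma fc_inj: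
  assumes "pcont f" "pcont g" "\<And>k. fc f k = fc g k"
  shows "f = g"
  using pcont_zero_coeffs[of "\<lambda>x. f x - g x"] assms by (auto simp: fc_diff fun_eq_iff)

section \<open>Littlewood--Paley blocks of coefficient sequences\<close>

locale littlewood_paley =
  fixes chi phi :: "real \<Rightarrow> real"
  assumes dyadic: "dyadic_partition chi phi"
begin

text \<open>Blocks are numbered from 0 here, so block \<open>n\<close> has the index \<open>q = n - 1\<close>.\<close>

definition sg :: "nat \<Rightarrow> int \<Rightarrow> real" where
  "sg n k = lp_symbol chi phi (int n - 1) (2 * pi * of_int k)"

definition supp :: "nat \<Rightarrow> int set" where
  "supp n = {k. sg n k \<noteq> 0}"

text \<open>By Parseval (\<open>l2_blk\<close>) this is the L2 norm of block \<open>n\<close>.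
  Stated on coefficients, it serves functions and distributions alike.\<close>

definition bt :: "nat \<Rightarrow> (int \<Rightarrow> complex) \<Rightarrow> real" where
  "bt n c = L2_set (\<lambda>k. sg n k * cmod (c k)) (supp n)"

definition blk :: "nat \<Rightarrow> (int \<Rightarrow> complex) \<Rightarrow> real \<Rightarrow> complex" where
  "blk n c x = (\<Sum>k\<in>supp n. of_real (sg n k) * c k * wave k x)"

text \<open>The weight \<open>r\<close> stands for 2 to the power s. As the blocks are numbered from
  0, the Besov norm of index s is \<open>bn r\<close> times 2 to the power -s, see
  \<open>besov_norm_eq\<close>.\<close>

definition bfin :: "real \<Rightarrow> (int \<Rightarrow> complex) \<Rightarrow> bool" where
  "bfin r c \<longleftrightarrow> summable (\<lambda>n. r ^ n * bt n c)"

definition bn :: "real \<Rightarrow> (int \<Rightarrow> complex) \<Rightarrow> real" where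
  "bn r c = (\<Sum>n. r ^ n * bt n c)"

lemma sg_0: "sg 0 k = chi (2 * pi * of_int k)"
  by (simp add: sg_def lp_symbol_def)

lemma sg_Suc: "sg (Suc n) k = phi (2 * pi * of_int k / 2 ^ n)"
  by (simp add: sg_def lp_symbol_def)

lemma sg_range: "0 \<le> sg n k" "sg n k \<le> 1"
  using dyadic by (cases n; auto simp: dyadic_partition_def sg_0 sg_Suc)+

lemma sg_minus: "sg n (- k) = sg n k"
  using dyadic by (cases n; auto simp: dyadic_partition_def sg_0 sg_Suc)

text \<open>For \<open>n = Suc m\<close> the outer radius 8/3 * 2^m of the annulus equals 4/3 * 2^n,
  which is also the radius of the ball for \<open>n = 0\<close>. In the same way the inner radius
  3/4 * 2^m becomes 3/8 * 2^n in the next lemma.\<close>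

lemma supp_upper: "k \<in> supp n \<Longrightarrow> \<bar>2 * pi * of_int k\<bar> \<le> 4/3 * 2 ^ n"
proof (cases n)
  case (Suc m)
  assume "k \<in> supp n"
  then have "phi (2 * pi * of_int k / 2 ^ m) \<noteq> 0" by (simp add: supp_def sg_Suc Suc)
  then have "\<bar>2 * pi * of_int k / 2 ^ m\<bar> \<le> 8/3"
    using dyadic unfolding dyadic_partition_def by blast
  then show ?thesis by (simp add: Suc abs_mult field_simps)
qed (use dyadic in \<open>auto simp: supp_def sg_0 dyadic_partition_def\<close>)

lemma supp_lower: "k \<in> supp n \<Longrightarrow> n \<noteq> 0 \<Longrightarrow> 3/8 * 2 ^ n \<le> \<bar>2 * pi * of_int k\<bar>"
proof (cases n)
  case (Suc m)
  assume "k \<in> supp n"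
  then have "phi (2 * pi * of_int k / 2 ^ m) \<noteq> 0" by (simp add: supp_def sg_Suc Suc)
  then have "3/4 \<le> \<bar>2 * pi * of_int k / 2 ^ m\<bar>"
    using dyadic unfolding dyadic_partition_def by blast
  then show ?thesis by (simp add: Suc abs_mult field_simps)
qed simp

lemma supp_subset: "supp n \<subseteq> {- (2 ^ n) <..< 2 ^ n}"
proof
  fix k assume "k \<in> supp n"
  then have "2 * pi * \<bar>real_of_int k\<bar> \<le> 4/3 * 2 ^ n" using supp_upper by (simp add: abs_mult)
  moreover have "2 * 3 * \<bar>real_of_int k\<bar> \<le> 2 * pi * \<bar>real_of_int k\<bar>"
    using pi_gt3 by (intro mult_right_mono) auto
  moreover have "(0::real) < 2 ^ n" by simp
  ultimately have "\<bar>real_of_int k\<bar> < 2 ^ n" by linarith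
  then have "real_of_int \<bar>k\<bar> < real_of_int (2 ^ n)" by simp
  then have "\<bar>k\<bar> < 2 ^ n" by (simp only: of_int_less_iff)
  then show "k \<in> {- (2 ^ n) <..< 2 ^ n}" by auto
qed

lemma finite_supp [simp]: "finite (supp n)"
  using supp_subset finite_subset by blast

lemma card_supp: "real (card (supp n)) \<le> 2 * 2 ^ n"
proof -
  have "card (supp n) \<le> card {- (2 ^ n :: int) <..< 2 ^ n}"
    using supp_subset by (intro card_mono) auto
  also have "\<dots> \<le> nat (2 * 2 ^ n)" by simp
  also have "\<dots> = 2 * 2 ^ n" by (simp add: nat_mult_distrib nat_power_eq)
  finally have "real (card (supp n)) \<le> real (2 * 2 ^ n)" by (simp only: of_nat_le_iff)
  then show ?thesis by simp
qed

lemma sg_sums: "(\<lambda>n. sg n k) sums 1"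
proof -
  have "(\<lambda>n. sg (Suc n) k) sums (1 - sg 0 k)"
    using dyadic unfolding sg_Suc sg_0 dyadic_partition_def by blast
  then show ?thesis using sums_Suc_iff[of "\<lambda>n. sg n k"] by simp
qed

lemma bt_nonneg [simp]: "0 \<le> bt n c"
  by (simp add: bt_def)

lemma bt_mono: "(\<And>k. k \<in> supp n \<Longrightarrow> cmod (c k) \<le> C * cmod (d k)) \<Longrightarrow> 0 \<le> C \<Longrightarrow> bt n c \<le> C * bt n d"
  unfolding bt_def L2_set_right_distrib using sg_range
  by (intro L2_set_mono) (auto intro!: mult_nonneg_nonneg simp: mult.left_commute[of C] mult_left_mono)

lemma bt_add: "bt n (\<lambda>k. c k + d k) \<le> bt n c + bt n d"
proof -
  have "bt n (\<lambda>k. c k + d k) \<le> L2_set (\<lambda>k. sg n k * cmod (c k) + sg n k * cmod (d k)) (supp n)"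
    unfolding bt_def using sg_range
    by (intro L2_set_mono) (auto simp: distrib_left[symmetric] intro!: mult_left_mono norm_triangle_ineq)
  also have "\<dots> \<le> bt n c + bt n d" unfolding bt_def by (rule L2_set_triangle_ineq)
  finally show ?thesis .
qed

lemma bt_cmult: "bt n (\<lambda>k. a * c k) = cmod a * bt n c"
  unfolding bt_def L2_set_right_distrib[OF norm_ge_zero] by (simp add: norm_mult mult_ac)

lemma bt_zero [simp]: "bt n (\<lambda>k. 0) = 0"
  using bt_cmult[of n 0] by simp

lemma bt_sum: "finite A \<Longrightarrow> bt n (\<lambda>k. \<Sum>i\<in>A. c i k) \<le> (\<Sum>i\<in>A. bt n (c i))"
  by (induction A rule: finite_induct) (auto intro: order_trans[OF bt_add])

lemma bt_le: "bt n c \<le> L2_set (\<lambda>k. cmod (c k)) (supp n)"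
  unfolding bt_def using sg_range
  by (intro L2_set_mono) (auto intro!: mult_nonneg_nonneg mult_left_le_one_le)

lemma bt_le_l2: "pcont f \<Longrightarrow> bt n (fc f) \<le> l2 f"
  by (rule order_trans[OF bt_le])
    (auto simp: L2_set_def intro!: real_le_lsqrt bessel sum_nonneg)

lemma l2_blk: "l2 (blk n c) = bt n c"
proof -
  have "blk n c = (\<lambda>x. \<Sum>k\<in>supp n. (of_real (sg n k) * c k) * wave k x)"
    by (simp add: blk_def fun_eq_iff)
  then show ?thesis using l2_trig[OF finite_supp, of "\<lambda>k. of_real (sg n k) * c k" n] sg_range
    by (simp add: bt_def norm_mult)
qed

text \<open>Bernstein's inequality from L2 to the sup norm: Cauchy-Schwarz over the at most 2 * 2^n
  modes of the block.\<close>

lemma sum_supp_le: "(\<Sum>k\<in>supp n. sg n k * cmod (c k)) \<le> 2 * sqrt 2 ^ n * bt n c"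
proof -
  have "(\<Sum>k\<in>supp n. \<bar>1\<bar> * \<bar>sg n k * cmod (c k)\<bar>) \<le> L2_set (\<lambda>_. 1) (supp n) * bt n c"
    unfolding bt_def by (rule L2_set_mult_ineq)
  also have "L2_set (\<lambda>_. 1) (supp n) \<le> sqrt (2 * 2 ^ n)"
    using card_supp by (simp add: L2_set_constant)
  also have "sqrt (2 * 2 ^ n) \<le> 2 * sqrt 2 ^ n"
    by (simp add: real_sqrt_mult real_sqrt_power real_le_lsqrt)
  finally show ?thesis using sg_range by (simp add: mult_right_mono abs_mult)
qed

lemma norm_blk_le: "cmod (blk n c x) \<le> 2 * sqrt 2 ^ n * bt n c"
proof -
  have "cmod (blk n c x) \<le> (\<Sum>k\<in>supp n. sg n k * cmod (c k))"
    unfolding blk_def using sg_range by (intro sum_norm_le) (simp add: norm_mult)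
  then show ?thesis using sum_supp_le order_trans by blast
qed

lemma pC1_blk: "pC1 (blk n c) (blk n (\<lambda>k. 2 * pi * \<i> * of_int k * c k))"
proof -
  have "pC1 (\<lambda>x. \<Sum>k\<in>supp n. (of_real (sg n k) * c k) * wave k x)
      (\<lambda>x. \<Sum>k\<in>supp n. (of_real (sg n k) * c k) * ((2 * pi * \<i> * of_int k) * wave k x))"
    by (intro pC1_sum pC1_cmult pC1_wave)
  then show ?thesis unfolding blk_def[abs_def] by (simp add: mult_ac)
qed

lemma pcont_blk [simp, intro!]: "pcont (blk n c)"
  using pC1_pcont(1)[OF pC1_blk] .

lemma bt_deriv_le: "bt n (\<lambda>k. 2 * pi * \<i> * of_int k * c k) \<le> 4/3 * 2 ^ n * bt n c"
proof (rule bt_mono)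
  fix k assume "k \<in> supp n"
  then show "cmod (2 * pi * \<i> * of_int k * c k) \<le> 4/3 * 2 ^ n * cmod (c k)"
    using mult_right_mono[OF supp_upper, of k n "cmod (c k)"] by (simp add: norm_mult abs_mult)
qed auto

lemma fc_blk: "fc (blk n c) k = of_real (sg n k) * c k"
proof -
  have "blk n c = (\<lambda>x. \<Sum>j\<in>supp n. (of_real (sg n j) * c j) * wave j x)"
    by (simp add: blk_def fun_eq_iff)
  then have "fc (blk n c) k = (\<Sum>j\<in>supp n. (of_real (sg n j) * c j) * (if j = k then 1 else 0))"
    by (simp add: fc_sum pcont_mult fc_cmult fc_wave)
  also have "\<dots> = (\<Sum>j\<in>supp n. if j = k then of_real (sg n j) * c j else 0)" by (rule sum.cong) auto
  also have "\<dots> = of_real (sg n k) * c k"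
    by (subst sum.delta[OF finite_supp]) (simp add: supp_def)
  finally show ?thesis .
qed

end

text \<open>Pointwise, the square of a sum is at most twice the sum of the squares. The factor 2 is
  lost against Minkowski and absorbed in later constants.\<close>

lemma l2_add_le:
  assumes "pcont f" "pcont g"
  shows "l2 (\<lambda>x. f x + g x) \<le> 2 * (l2 f + l2 g)"
proof -
  have le: "(cmod (f x + g x))\<^sup>2 \<le> 2 * (cmod (f x))\<^sup>2 + 2 * (cmod (g x))\<^sup>2" for x
  proof -
    have "(cmod (f x + g x))\<^sup>2 \<le> (cmod (f x) + cmod (g x))\<^sup>2"
      by (intro power_mono norm_triangle_ineq) simp
    also have "\<dots> \<le> 2 * (cmod (f x))\<^sup>2 + 2 * (cmod (g x))\<^sup>2"
      using sum_squares_bound[of "cmod (f x)" "cmod (g x)"] by (simp add: power2_sum)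
    finally show ?thesis .
  qed
  have i: "(\<lambda>x. 2 * (cmod (f x))\<^sup>2) integrable_on {0..1}" "(\<lambda>x. 2 * (cmod (g x))\<^sup>2) integrable_on {0..1}"
    using assms by (auto intro!: pcont_integrable)
  have "(l2 (\<lambda>x. f x + g x))\<^sup>2 = integral {0..1} (\<lambda>x. (cmod (f x + g x))\<^sup>2)"
    using assms by (intro l2_square) auto
  also have "\<dots> \<le> integral {0..1} (\<lambda>x. 2 * (cmod (f x))\<^sup>2 + 2 * (cmod (g x))\<^sup>2)"
    using assms le by (intro integral_le integrable_add i) (auto intro!: pcont_integrable)
  also have "\<dots> = 2 * (l2 f)\<^sup>2 + 2 * (l2 g)\<^sup>2"
    by (simp only: integral_add[OF i] integral_mult_right l2_square[OF assms(1)] l2_square[OF assms(2)])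
  also have "\<dots> \<le> (2 * (l2 f + l2 g))\<^sup>2"
    by (simp add: power2_eq_square algebra_simps)
  finally show ?thesis by (rule power2_le_imp_le) simp
qed

lemma pcont_uniform_series:
  assumes f: "\<And>i. pcont (f i)" and M: "\<And>i x. cmod (f i x) \<le> M i" "summable M"
  defines "g \<equiv> (\<lambda>x. \<Sum>i. f i x)"
  shows "pcont g" "(\<lambda>i. f i x) sums g x" "(\<lambda>i. fc (f i) k) sums fc g k"
    "uniform_limit UNIV (\<lambda>n x. \<Sum>i<n. f i x) g sequentially"
proof -
  show ul: "uniform_limit UNIV (\<lambda>n x. \<Sum>i<n. f i x) g sequentially"
    unfolding g_def by (rule Weierstrass_m_test) (use M in auto)
  have s: "(\<lambda>i. f i x) sums g x" for x
    unfolding g_def by (intro summable_sums summable_comparison_test'[OF M(2), of 0] M(1))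
  then show "(\<lambda>i. f i x) sums g x" .
  have "continuous_on UNIV g"
    by (rule uniform_limit_theorem[OF _ ul])
      (use f in \<open>auto intro!: always_eventually continuous_on_sum pcont_continuous\<close>)
  moreover have "g (x + 1) = g x" for x
    using f by (simp add: g_def pcont_per)
  ultimately show g: "pcont g" by (simp add: pcont_def)
  show "(\<lambda>i. fc (f i) k) sums fc g k"
    unfolding sums_def tendsto_iff
  proof (intro allI impI)
    fix e :: real assume "e > 0"
    then have "\<forall>\<^sub>F n in sequentially. \<forall>x\<in>UNIV. dist (\<Sum>i<n. f i x) (g x) < e / 2"
      by (intro uniform_limitD[OF ul]) simp
    then show "\<forall>\<^sub>F n in sequentially. dist (\<Sum>i<n. fc (f i) k) (fc g k) < e"
    proof eventually_elim
      case (elim n)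
      have "cmod (fc (\<lambda>x. (\<Sum>i<n. f i x) - g x) k) \<le> e / 2"
      proof (rule norm_fc_le)
        show "pcont (\<lambda>x. (\<Sum>i<n. f i x) - g x)" by (intro pcont_diff pcont_sum f g)
        show "cmod ((\<Sum>i<n. f i x) - g x) \<le> e / 2" for x
          using elim unfolding dist_norm by (meson UNIV_I less_imp_le)
      qed
      moreover have "fc (\<lambda>x. (\<Sum>i<n. f i x) - g x) k = (\<Sum>i<n. fc (f i) k) - fc g k"
        by (subst fc_diff, rule pcont_sum, rule f, rule g, subst fc_sum) (simp_all add: f)
      ultimately show ?case using \<open>e > 0\<close> by (simp add: dist_norm)
    qed
  qed
qed

section \<open>The Besov space of index 1/2: embeddings, interpolation, composition,
  products\<close>

context littlewood_paley
begin

lemma sqrt2_facts: "7/5 \<le> sqrt 2" "sqrt 2 ^ n * sqrt 2 ^ n = (2::real) ^ n"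
  "(1 / sqrt 2) ^ n * 2 ^ n = sqrt 2 ^ n"  "(1 / sqrt 2) ^ n \<le> sqrt 2 ^ n" "1 \<le> sqrt 2 ^ n"
proof -
  show "7/5 \<le> sqrt 2" by (rule real_le_rsqrt) (simp add: power2_eq_square)
  show s: "sqrt 2 ^ n * sqrt 2 ^ n = (2::real) ^ n" by (simp flip: power_mult_distrib)
  show "(1 / sqrt 2) ^ n * 2 ^ n = sqrt 2 ^ n" using s by (simp add: power_divide divide_simps)
  show 1: "1 \<le> sqrt 2 ^ n" by (rule one_le_power) simp
  have "(1 / sqrt 2) ^ n \<le> 1" by (rule power_le_one) auto
  then show "(1 / sqrt 2) ^ n \<le> sqrt 2 ^ n" using 1 by linarith
qed

lemma bfin_iff_bounded: "0 \<le> r \<Longrightarrow> (\<And>N. (\<Sum>n<N. r ^ n * bt n c) \<le> M) \<Longrightarrow> bfin r c \<and> bn r c \<le> M"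
  unfolding bfin_def bn_def
  using summableI_nonneg_bounded[of "\<lambda>n. r ^ n * bt n c" M] suminf_le_const[of "\<lambda>n. r ^ n * bt n c" M]
  by simp

lemma bn_partial: "0 \<le> r \<Longrightarrow> bfin r c \<Longrightarrow> finite A \<Longrightarrow> (\<Sum>n\<in>A. r ^ n * bt n c) \<le> bn r c"
  unfolding bfin_def bn_def by (intro sum_le_suminf) auto

lemma bn_nonneg: "0 \<le> r \<Longrightarrow> bfin r c \<Longrightarrow> 0 \<le> bn r c"
  unfolding bfin_def bn_def by (intro suminf_nonneg) auto

lemma bfin_mono:
  assumes "\<And>n. r ^ n * bt n c \<le> K * (r' ^ n * bt n d)" "0 \<le> r" "bfin r' d"
  shows "bfin r c" "bn r c \<le> K * bn r' d"
proof -
  have s: "summable (\<lambda>n. K * (r' ^ n * bt n d))"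
    using assms(3) unfolding bfin_def by (rule summable_mult)
  show 1: "bfin r c"
    unfolding bfin_def using assms by (intro summable_comparison_test'[OF s, of 0]) auto
  show "bn r c \<le> K * bn r' d"
    using suminf_le[OF assms(1) _ s] 1 suminf_mult[of "\<lambda>n. r' ^ n * bt n d" K] assms(3)
    unfolding bn_def bfin_def by simp
qed

lemma bfin_add:
  assumes "0 \<le> r" "bfin r c" "bfin r d"
  shows "bfin r (\<lambda>k. c k + d k)" "bn r (\<lambda>k. c k + d k) \<le> bn r c + bn r d"
proof -
  have le: "r ^ n * bt n (\<lambda>k. c k + d k) \<le> r ^ n * bt n c + r ^ n * bt n d" for n
    using mult_left_mono[OF bt_add, of "r ^ n"] assms(1) by (simp add: distrib_left)
  have s: "summable (\<lambda>n. r ^ n * bt n c + r ^ n * bt n d)"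
    using assms unfolding bfin_def by (intro summable_add)
  show 1: "bfin r (\<lambda>k. c k + d k)"
    unfolding bfin_def using assms le by (intro summable_comparison_test'[OF s, of 0]) auto
  show "bn r (\<lambda>k. c k + d k) \<le> bn r c + bn r d"
    using suminf_le[OF le _ s] 1 assms suminf_add[of "\<lambda>n. r ^ n * bt n c" "\<lambda>n. r ^ n * bt n d"]
    unfolding bn_def bfin_def by simp
qed

lemma bfin_cmult:
  assumes "0 \<le> r" "bfin r c"
  shows "bfin r (\<lambda>k. a * c k)" "bn r (\<lambda>k. a * c k) = cmod a * bn r c"
  using assms summable_mult[of "\<lambda>n. r ^ n * bt n c" "cmod a"] suminf_mult[of "\<lambda>n. r ^ n * bt n c" "cmod a"]
  unfolding bfin_def bn_def by (auto simp: bt_cmult mult.left_commute)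

text \<open>Blocks below \<open>N\<close> are bounded by the L2 norm, those from \<open>N\<close> on
  by the H1 norm, which decays like 2^(-n). The free splitting index is the point: it is matched to
  the scale of an atom in \<open>bn_atoms\<close>, and sent to infinity in
  \<open>bn_small_of_uniform\<close>.\<close>

lemma bfin_pC1:
  assumes f: "pC1 f f'"
  shows "bfin (sqrt 2) (fc f)"
    "bn (sqrt 2) (fc f) \<le> 3 * sqrt 2 ^ N * l2 f + 11 * (1 / sqrt 2) ^ N * (l2 f + l2 f')"
proof -
  define A B where "A = l2 f" and "B = l2 f + l2 f'"
  have AB: "0 \<le> A" "0 \<le> B" "A \<le> B" "l2 f' \<le> B" by (auto simp: A_def B_def)
  have pc: "pcont f" "pcont f'" using pC1_pcont[OF f] by auto
  have b1: "bt n (fc f) \<le> A" for n using bt_le_l2[OF pc(1)] by (simp add: A_def)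
  have b2: "2 ^ n * bt n (fc f) \<le> 3 * B" for n
  proof (cases "n = 0")
    case True then show ?thesis using b1[of 0] AB by simp
  next
    case False
    have "bt n (fc f) \<le> (8/3 / 2 ^ n) * bt n (fc f')"
    proof (rule bt_mono)
      fix k assume "k \<in> supp n"
      then have "3/8 * 2 ^ n * cmod (fc f k) \<le> \<bar>2 * pi * of_int k\<bar> * cmod (fc f k)"
        using supp_lower[OF _ False] by (intro mult_right_mono) auto
      also have "\<dots> = cmod (fc f' k)" by (simp add: fc_deriv[OF f] norm_mult abs_mult)
      finally show "cmod (fc f k) \<le> (8/3 / 2 ^ n) * cmod (fc f' k)" by (simp add: field_simps)
    qed simp
    also have "\<dots> \<le> (8/3 / 2 ^ n) * B" using bt_le_l2[OF pc(2), of n] AB by (intro mult_left_mono) auto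
    finally show ?thesis using AB by (simp add: field_simps)
  qed
  have tm: "sqrt 2 ^ n * bt n (fc f) \<le> (1 / sqrt 2) ^ n * (3 * B)" for n
    using mult_left_mono[OF b2, of "(1 / sqrt 2) ^ n" n] sqrt2_facts(3)[of n]
    by (simp only: mult.assoc[symmetric]) simp
  have q: "norm (1 / sqrt 2) < 1" "0 < 1 - 1 / sqrt 2" by auto
  have s: "summable (\<lambda>n. (1 / sqrt 2) ^ n * (3 * B))" "summable (\<lambda>n. (1 / sqrt 2) ^ n)"
    using q by (auto intro!: summable_mult2 summable_geometric)
  show fin: "bfin (sqrt 2) (fc f)"
    unfolding bfin_def using tm by (intro summable_comparison_test'[OF s(1), of 0]) auto
  \<comment> \<open>The constant 3 exceeds 1 / (sqrt 2 - 1); the induction step uses sqrt 2 >= 7/5,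
    hence 3 * sqrt 2 >= 4.\<close>
  have geo: "(\<Sum>n<N. sqrt 2 ^ n) \<le> 3 * sqrt 2 ^ N" for N
  proof (induction N)
    case (Suc N)
    have "4 * sqrt 2 ^ N \<le> 3 * sqrt 2 * sqrt 2 ^ N"
      using sqrt2_facts(1) by (intro mult_right_mono) auto
    then have "3 * sqrt 2 ^ N + sqrt 2 ^ N \<le> 3 * sqrt 2 ^ Suc N" by simp
    then show ?case using Suc unfolding sum.lessThan_Suc by linarith
  qed simp
  have low: "(\<Sum>n<N. sqrt 2 ^ n * bt n (fc f)) \<le> 3 * sqrt 2 ^ N * A"
  proof -
    have "(\<Sum>n<N. sqrt 2 ^ n * bt n (fc f)) \<le> (\<Sum>n<N. sqrt 2 ^ n * A)"
      using b1 by (intro sum_mono mult_left_mono) auto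
    also have "\<dots> \<le> 3 * sqrt 2 ^ N * A"
      unfolding sum_distrib_right[symmetric] using geo AB by (intro mult_right_mono) auto
    finally show ?thesis .
  qed
  have "(\<Sum>n. sqrt 2 ^ (n + N) * bt (n + N) (fc f)) \<le> (\<Sum>n. (1 / sqrt 2) ^ (n + N) * (3 * B))"
    using fin unfolding bfin_def
    by (intro suminf_le tm) (auto intro: summable_ignore_initial_segment[OF s(1)] summable_ignore_initial_segment)
  also have "\<dots> = (\<Sum>n. (1 / sqrt 2) ^ n * ((1 / sqrt 2) ^ N * (3 * B)))"
    by (simp add: power_add mult.assoc)
  also have "\<dots> = (\<Sum>n. (1 / sqrt 2) ^ n) * ((1 / sqrt 2) ^ N * (3 * B))"
    by (rule suminf_mult2[symmetric, OF s(2)])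
  \<comment> \<open>From 1 / sqrt 2 <= 8/11 the geometric series is at most 11/3; with the factor 3
    of \<open>b2\<close> this gives 11.\<close>
  also have "\<dots> \<le> 11/3 * ((1 / sqrt 2) ^ N * (3 * B))"
  proof (rule mult_right_mono)
    have "(8::real) / 11 \<ge> 1 / sqrt 2" using sqrt2_facts(1) by (simp add: field_simps)
    then show "(\<Sum>n. (1 / sqrt 2) ^ n) \<le> 11/3"
      unfolding suminf_geometric[OF q(1)] using q(2) by (simp add: field_simps)
  qed (use AB in auto)
  finally have high: "(\<Sum>n. sqrt 2 ^ (n + N) * bt (n + N) (fc f)) \<le> 11 * (1 / sqrt 2) ^ N * B"
    by (simp add: mult_ac)
  show "bn (sqrt 2) (fc f) \<le> 3 * sqrt 2 ^ N * l2 f + 11 * (1 / sqrt 2) ^ N * (l2 f + l2 f')"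
    using suminf_split_initial_segment[of "\<lambda>n. sqrt 2 ^ n * bt n (fc f)" N] fin low high
    unfolding bn_def bfin_def A_def B_def by linarith
qed

text \<open>This is the use of the summation exponent 1: by Bernstein the sup norms of the blocks
  are summable, so the block series converges uniformly to a continuous function. Its coefficients
  are \<open>c\<close> because the symbols sum to 1.\<close>

lemma blk_series:
  assumes "bfin (sqrt 2) c"
  defines "g \<equiv> (\<lambda>x. \<Sum>n. blk n c x)"
  shows "pcont g" "fc g = c" "(\<lambda>n. blk n c x) sums g x" "cmod (g x) \<le> 2 * bn (sqrt 2) c"
    "uniform_limit UNIV (\<lambda>N x. \<Sum>n<N. blk n c x) g sequentially"
proof -
  have s: "summable (\<lambda>n. 2 * (sqrt 2 ^ n * bt n c))"
    using assms(1) unfolding bfin_def by (rule summable_mult)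
  have le: "cmod (blk n c x) \<le> 2 * (sqrt 2 ^ n * bt n c)" for n x
    using norm_blk_le by (simp add: mult.assoc)
  note u = pcont_uniform_series[OF pcont_blk le s, folded g_def]
  show "pcont g" "uniform_limit UNIV (\<lambda>N x. \<Sum>n<N. blk n c x) g sequentially"
    using u(1,4) by blast+
  show "(\<lambda>n. blk n c x) sums g x" using u(2) unfolding g_def .
  show "fc g = c"
  proof
    fix k
    have "(\<lambda>n. of_real (sg n k) * c k) sums (of_real 1 * c k)"
      by (intro sums_mult2 sums_of_real sg_sums)
    then show "fc g k = c k" using u(3)[of k] sums_unique2 by (fastforce simp: fc_blk)
  qed
  have sn: "summable (\<lambda>n. cmod (blk n c x))"
    by (rule summable_comparison_test'[OF s, of 0]) (use le in auto)
  have "cmod (g x) \<le> (\<Sum>n. cmod (blk n c x))" unfolding g_def by (rule summable_norm[OF sn])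
  also have "\<dots> \<le> (\<Sum>n. 2 * (sqrt 2 ^ n * bt n c))" by (rule suminf_le[OF le sn s])
  also have "\<dots> = 2 * bn (sqrt 2) c"
    unfolding bn_def using assms(1) unfolding bfin_def by (rule suminf_mult)
  finally show "cmod (g x) \<le> 2 * bn (sqrt 2) c" .
qed

text \<open>The block series has the coefficients of \<open>f\<close>, and continuous functions with
  equal coefficients are equal.\<close>

lemma blk_sums:
  assumes "pcont f" "bfin (sqrt 2) (fc f)"
  shows "(\<lambda>n. blk n (fc f) x) sums f x" "cmod (f x) \<le> 2 * bn (sqrt 2) (fc f)"
    "uniform_limit UNIV (\<lambda>N x. \<Sum>n<N. blk n (fc f) x) f sequentially"
proof -
  have "f = (\<lambda>x. \<Sum>n. blk n (fc f) x)"
    using assms blk_series(1,2)[OF assms(2)] by (intro fc_inj) auto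
  then show "(\<lambda>n. blk n (fc f) x) sums f x" "cmod (f x) \<le> 2 * bn (sqrt 2) (fc f)"
    "uniform_limit UNIV (\<lambda>N x. \<Sum>n<N. blk n (fc f) x) f sequentially"
    using blk_series(3,4,5)[OF assms(2)] by metis+
qed

text \<open>Countable subadditivity of the norm. A partial sum over blocks involves finitely many
  coefficients only, so the bound for finite sums passes to the limit, and then the number of blocks
  may grow.\<close>

lemma bn_series:
  assumes f: "\<And>i. pcont (f i)" "\<And>i. bfin (sqrt 2) (fc (f i))"
    and S: "summable (\<lambda>i. bn (sqrt 2) (fc (f i)))" and g: "\<And>x. (\<lambda>i. f i x) sums g x"
  shows "pcont g" "bfin (sqrt 2) (fc g)" "bn (sqrt 2) (fc g) \<le> (\<Sum>i. bn (sqrt 2) (fc (f i)))"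
proof -
  have s: "summable (\<lambda>i. 2 * bn (sqrt 2) (fc (f i)))" using S by (rule summable_mult)
  have ge: "g = (\<lambda>x. \<Sum>i. f i x)" using g sums_unique by blast
  note u = pcont_uniform_series[OF f(1) blk_sums(2)[OF f] s, folded ge]
  show "pcont g" using u by blast
  have bnd: "(\<Sum>n<N. sqrt 2 ^ n * bt n (fc g)) \<le> (\<Sum>i. bn (sqrt 2) (fc (f i)))" for N
  proof (rule LIMSEQ_le_const2)
    show "(\<lambda>m. \<Sum>n<N. sqrt 2 ^ n * bt n (\<lambda>k. \<Sum>i<m. fc (f i) k)) \<longlonglongrightarrow> (\<Sum>n<N. sqrt 2 ^ n * bt n (fc g))"
      unfolding bt_def L2_set_def using u(3)[unfolded sums_def]
      by (intro tendsto_sum tendsto_mult tendsto_const tendsto_real_sqrt tendsto_power tendsto_norm) auto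
    show "\<exists>M. \<forall>m\<ge>M. (\<Sum>n<N. sqrt 2 ^ n * bt n (\<lambda>k. \<Sum>i<m. fc (f i) k)) \<le> (\<Sum>i. bn (sqrt 2) (fc (f i)))"
    proof (intro exI allI impI)
      fix m
      have "(\<Sum>n<N. sqrt 2 ^ n * bt n (\<lambda>k. \<Sum>i<m. fc (f i) k))
          \<le> (\<Sum>n<N. sqrt 2 ^ n * (\<Sum>i<m. bt n (fc (f i))))"
        by (intro sum_mono mult_left_mono bt_sum) auto
      also have "\<dots> = (\<Sum>i<m. \<Sum>n<N. sqrt 2 ^ n * bt n (fc (f i)))"
        unfolding sum_distrib_left by (rule sum.swap)
      also have "\<dots> \<le> (\<Sum>i<m. bn (sqrt 2) (fc (f i)))"
        by (intro sum_mono bn_partial f) auto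
      also have "\<dots> \<le> (\<Sum>i. bn (sqrt 2) (fc (f i)))"
        using S f by (intro sum_le_suminf) (auto intro: bn_nonneg)
      finally show "(\<Sum>n<N. sqrt 2 ^ n * bt n (\<lambda>k. \<Sum>i<m. fc (f i) k)) \<le> \<dots>" .
    qed
  qed
  show "bfin (sqrt 2) (fc g)" "bn (sqrt 2) (fc g) \<le> (\<Sum>i. bn (sqrt 2) (fc (f i)))"
    using bfin_iff_bounded[OF _ bnd] by auto
qed

text \<open>This is real interpolation of the Besov space between \<open>L\<^sup>2\<close> and \<open>H\<^sup>1\<close>.\<close>

lemma bn_atoms:
  assumes f: "\<And>i. pC1 (f i) (f' i)" and a: "\<And>i. l2 (f i) \<le> a i" "\<And>i. l2 (f' i) \<le> K * 2 ^ i * a i"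
    and K: "0 \<le> K" and s: "summable (\<lambda>i. sqrt 2 ^ i * a i)" and g: "\<And>x. (\<lambda>i. f i x) sums g x"
  shows "pcont g" "bfin (sqrt 2) (fc g)" "bn (sqrt 2) (fc g) \<le> (14 + 11 * K) * (\<Sum>i. sqrt 2 ^ i * a i)"
proof -
  have a0: "0 \<le> a i" for i using a(1) l2_nonneg order_trans by blast
  have b: "bn (sqrt 2) (fc (f i)) \<le> (14 + 11 * K) * (sqrt 2 ^ i * a i)" for i
  proof -
    \<comment> \<open>The splitting index is the scale \<open>i\<close> of the atom: its L2 and its
      H1 contribution are then both of order sqrt 2 ^ i * a i.\<close>
    have "bn (sqrt 2) (fc (f i)) \<le> 3 * sqrt 2 ^ i * l2 (f i) + 11 * (1 / sqrt 2) ^ i * (l2 (f i) + l2 (f' i))"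
      by (rule bfin_pC1[OF f])
    also have "\<dots> \<le> 3 * sqrt 2 ^ i * a i + 11 * (1 / sqrt 2) ^ i * (a i + K * 2 ^ i * a i)"
      using a by (intro add_mono mult_left_mono) auto
    also have "\<dots> = 3 * (sqrt 2 ^ i * a i) + 11 * ((1 / sqrt 2) ^ i * a i) + 11 * K * (((1 / sqrt 2) ^ i * 2 ^ i) * a i)"
      by (simp add: algebra_simps)
    also have "\<dots> \<le> 3 * (sqrt 2 ^ i * a i) + 11 * (sqrt 2 ^ i * a i) + 11 * K * (sqrt 2 ^ i * a i)"
      unfolding sqrt2_facts(3) using sqrt2_facts(4)[of i] a0[of i]
      by (intro add_mono mult_left_mono mult_right_mono) auto
    finally show ?thesis by (simp add: algebra_simps)
  qed
  have sb: "summable (\<lambda>i. (14 + 11 * K) * (sqrt 2 ^ i * a i))" using s by (rule summable_mult)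
  have fin: "bfin (sqrt 2) (fc (f i))" for i by (rule bfin_pC1[OF f])
  have S: "summable (\<lambda>i. bn (sqrt 2) (fc (f i)))"
    by (rule summable_comparison_test'[OF sb, of 0]) (use b bn_nonneg[OF _ fin] in auto)
  note r = bn_series[OF pC1_pcont(1)[OF f] fin S g]
  show "pcont g" "bfin (sqrt 2) (fc g)" using r by auto
  show "bn (sqrt 2) (fc g) \<le> (14 + 11 * K) * (\<Sum>i. sqrt 2 ^ i * a i)"
    using r(3) suminf_le[OF b S sb] suminf_mult[OF s, of "14 + 11 * K"] by linarith
qed

text \<open>The functions obtained from the blocks of \<open>f\<close> by the same weight and the
  same composition are atoms in the sense of \<open>bn_atoms\<close>: composition changes L2 norms
  by at most \<open>M\<close>, and a derivative costs a factor of order 2^n times the sup bounds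
  \<open>G\<close>, \<open>G'\<close> and \<open>P\<close>.\<close>

lemma bn_weighted_composition:
  assumes f: "pcont f" "bfin (sqrt 2) (fc f)" and g: "pC1 g g'" "\<And>x. cmod (g x) \<le> G" "\<And>x. cmod (g' x) \<le> G'"
    and \<phi>: "\<And>x. \<phi> (x + 1) = \<phi> x + 1" "\<And>x. (\<phi> has_real_derivative \<phi>' x) (at x)"
      "continuous_on UNIV \<phi>'" "\<And>x. \<bar>\<phi>' x\<bar> \<le> P"
    and M: "\<And>h. pcont h \<Longrightarrow> l2 (\<lambda>x. h (\<phi> x)) \<le> M * l2 h" "0 < M"
  shows "pcont (\<lambda>x. g x * f (\<phi> x))" "bfin (sqrt 2) (fc (\<lambda>x. g x * f (\<phi> x)))"
    "bn (sqrt 2) (fc (\<lambda>x. g x * f (\<phi> x))) \<le> (44 * M * (G * (1 + P) + G')) * bn (sqrt 2) (fc f)"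
proof -
  define D where "D n = blk n (\<lambda>k. 2 * pi * \<i> * of_int k * fc f k)" for n
  define b where "b n = blk n (fc f)" for n
  have G0: "0 \<le> G" "0 \<le> G'" "0 \<le> P" using g(2,3) \<phi>(4) norm_ge_zero abs_ge_zero order_trans by blast+
  define K where "K = G * (1 + P) + G'"
  have K0: "0 \<le> K" using G0 by (simp add: K_def)
  have cphi: "continuous_on UNIV \<phi>"
    using \<phi>(2) by (auto simp: continuous_on_eq_continuous_within intro: DERIV_isCont)
  have 1: "pC1 (\<lambda>x. g x * b n (\<phi> x)) (\<lambda>x. g x * (\<phi>' x *\<^sub>R D n (\<phi> x)) + g' x * b n (\<phi> x))" for n
    unfolding b_def D_def by (intro pC1_mult g pC1_compose pC1_blk \<phi>)
  have pb: "pcont (\<lambda>x. b n (\<phi> x))" "pcont (\<lambda>x. D n (\<phi> x))" for n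
    unfolding b_def D_def using pcont_compose[OF _ cphi \<phi>(1)] by auto
  have pp: "pcont (\<lambda>x. \<phi>' x *\<^sub>R D n (\<phi> x))" for n
    using pC1_pcont(2)[OF pC1_compose[OF pC1_blk \<phi>(1-3)]] unfolding D_def by blast
  have lb: "l2 (\<lambda>x. b n (\<phi> x)) \<le> M * bt n (fc f)" for n
    using M(1)[OF pcont_blk, of n "fc f"] by (simp add: b_def l2_blk)
  have lD: "l2 (\<lambda>x. D n (\<phi> x)) \<le> M * (4/3 * 2 ^ n * bt n (fc f))" for n
    using order_trans[OF M(1)[OF pcont_blk, unfolded l2_blk] mult_left_mono[OF bt_deriv_le less_imp_le[OF M(2)]]]
    unfolding D_def .
  define a where "a n = M * K * bt n (fc f)" for n
  have a1: "l2 (\<lambda>x. g x * b n (\<phi> x)) \<le> a n" for n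
  proof -
    have "l2 (\<lambda>x. g x * b n (\<phi> x)) \<le> G * l2 (\<lambda>x. b n (\<phi> x))"
      using pb pC1_pcont(1)[OF g(1)] g(2) G0 by (intro l2_mono) (auto simp: norm_mult mult_right_mono)
    also have "\<dots> \<le> G * (M * bt n (fc f))" using lb G0 by (intro mult_left_mono)
    also have "\<dots> \<le> K * (M * bt n (fc f))"
      using G0 M(2) by (intro mult_right_mono) (auto simp: K_def algebra_simps)
    finally show ?thesis by (simp add: a_def mult_ac)
  qed
  have a2: "l2 (\<lambda>x. g x * (\<phi>' x *\<^sub>R D n (\<phi> x)) + g' x * b n (\<phi> x)) \<le> (8/3) * 2 ^ n * a n" for n
  proof -
    have "l2 (\<lambda>x. g x * (\<phi>' x *\<^sub>R D n (\<phi> x)) + g' x * b n (\<phi> x))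
        \<le> 2 * (l2 (\<lambda>x. g x * (\<phi>' x *\<^sub>R D n (\<phi> x))) + l2 (\<lambda>x. g' x * b n (\<phi> x)))"
      by (intro l2_add_le pcont_mult pp pb pC1_pcont[OF g(1)])
    also have "l2 (\<lambda>x. g x * (\<phi>' x *\<^sub>R D n (\<phi> x))) \<le> (G * P) * l2 (\<lambda>x. D n (\<phi> x))"
    proof (rule l2_mono)
      show "pcont (\<lambda>x. g x * (\<phi>' x *\<^sub>R D n (\<phi> x)))"
        by (rule pcont_mult[OF pC1_pcont(1)[OF g(1)] pp])
      show "cmod (g x * (\<phi>' x *\<^sub>R D n (\<phi> x))) \<le> (G * P) * cmod (D n (\<phi> x))" for x
        using mult_mono[OF g(2) \<phi>(4), of x x] G0
        by (simp only: norm_mult norm_scaleR mult.assoc[symmetric]) (intro mult_right_mono, auto)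
    qed (use pb G0 in auto)
    also have "\<dots> \<le> (G * P) * (M * (4/3 * 2 ^ n * bt n (fc f)))" using lD G0 by (intro mult_left_mono) auto
    also have "l2 (\<lambda>x. g' x * b n (\<phi> x)) \<le> G' * l2 (\<lambda>x. b n (\<phi> x))"
      using pb pC1_pcont(2)[OF g(1)] g(3) G0 by (intro l2_mono) (auto simp: norm_mult mult_right_mono)
    also have "\<dots> \<le> G' * (M * bt n (fc f))" using lb G0 by (intro mult_left_mono)
    also have "\<dots> \<le> G' * (M * (4/3 * 2 ^ n * bt n (fc f)))"
    proof -
      have "(1::real) \<le> 2 ^ n" by simp
      then have "(1::real) \<le> 4/3 * 2 ^ n" by linarith
      then have "1 * bt n (fc f) \<le> 4/3 * 2 ^ n * bt n (fc f)" by (intro mult_right_mono) auto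
      then show ?thesis using G0 M(2) by (intro mult_left_mono) auto
    qed
    also have "2 * ((G * P) * (M * (4/3 * 2 ^ n * bt n (fc f))) + G' * (M * (4/3 * 2 ^ n * bt n (fc f))))
        = (8/3) * 2 ^ n * (M * (G * P + G') * bt n (fc f))" by (simp add: algebra_simps)
    also have "\<dots> \<le> (8/3) * 2 ^ n * a n"
      unfolding a_def K_def using G0 M(2) by (intro mult_left_mono mult_right_mono) (auto simp: algebra_simps)
    finally show ?thesis by simp
  qed
  have s: "summable (\<lambda>n. sqrt 2 ^ n * bt n (fc f))" using f(2) by (simp add: bfin_def)
  have ae: "(\<lambda>n. sqrt 2 ^ n * a n) = (\<lambda>n. M * K * (sqrt 2 ^ n * bt n (fc f)))"
    by (simp add: a_def fun_eq_iff)
  have sm: "(\<lambda>n. g x * b n (\<phi> x)) sums (g x * f (\<phi> x))" for x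
    unfolding b_def by (intro sums_mult blk_sums f)
  note r = bn_atoms[OF 1 a1 a2 _ _ sm, unfolded ae]
  show "pcont (\<lambda>x. g x * f (\<phi> x))" "bfin (sqrt 2) (fc (\<lambda>x. g x * f (\<phi> x)))"
    using r summable_mult[OF s, of "M * K"] by auto
  \<comment> \<open>The atoms satisfy the derivative bound with K = 8/3, and 14 + 11 * 8/3 is less
    than 44.\<close>
  have "bn (sqrt 2) (fc (\<lambda>x. g x * f (\<phi> x))) \<le> (14 + 11 * (8/3)) * (M * K * bn (sqrt 2) (fc f))"
    using r(3) summable_mult[OF s, of "M * K"] suminf_mult[OF s, of "M * K"] by (simp add: bn_def)
  also have "\<dots> \<le> 44 * (M * K * bn (sqrt 2) (fc f))"
    using K0 M(2) bn_nonneg[OF _ f(2)] by (intro mult_right_mono) auto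
  finally show "bn (sqrt 2) (fc (\<lambda>x. g x * f (\<phi> x))) \<le> (44 * M * (G * (1 + P) + G')) * bn (sqrt 2) (fc f)"
    by (simp only: K_def mult_ac)
qed

text \<open>A paraproduct with two terms. With partial sums \<open>S\<close>, the telescoping
  identity S_{n+1} f S_{n+1} h - S_n f S_n h = (b_n f) (S_{n+1} h) + (b_n h) (S_n f) writes the
  product as a series of atoms at scale 2^n: one factor is a block measured in L2, the other a
  partial sum measured in the sup norm. The constants give (14 + 11 * 16) * 8 = 1520, rounded up
  generously.\<close>

lemma bn_mult:
  assumes f: "pcont f" "bfin (sqrt 2) (fc f)" and h: "pcont h" "bfin (sqrt 2) (fc h)"
  shows "bfin (sqrt 2) (fc (\<lambda>x. f x * h x))"
    "bn (sqrt 2) (fc (\<lambda>x. f x * h x)) \<le> 10000 * bn (sqrt 2) (fc f) * bn (sqrt 2) (fc h)"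
proof -
  define N where "N u = bn (sqrt 2) (fc u)" for u
  define b where "b u n = blk n (fc u)" for u n
  define D where "D u n = blk n (\<lambda>k. 2 * pi * \<i> * of_int k * fc u k)" for u n
  define S where "S u n x = (\<Sum>q<n. b u q x)" for u n x
  define S' where "S' u n x = (\<Sum>q<n. D u q x)" for u n x
  have bD: "pC1 (b u n) (D u n)" for u n unfolding b_def D_def by (rule pC1_blk)
  have SS: "pC1 (S u n) (S' u n)" for u n
    unfolding S_def[abs_def] S'_def[abs_def] by (intro pC1_sum bD)
  have N0: "0 \<le> N u" if "bfin (sqrt 2) (fc u)" for u unfolding N_def using that by (intro bn_nonneg) auto
  have Sb: "cmod (S u n x) \<le> 2 * N u" if u: "bfin (sqrt 2) (fc u)" for u n x
  proof -
    have "cmod (S u n x) \<le> (\<Sum>q<n. 2 * (sqrt 2 ^ q * bt q (fc u)))"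
      unfolding S_def b_def using norm_blk_le by (intro sum_norm_le) (simp add: mult.assoc)
    also have "\<dots> \<le> 2 * N u" unfolding sum_distrib_left[symmetric] N_def
      by (intro mult_left_mono bn_partial u) auto
    finally show ?thesis .
  qed
  have Sb': "cmod (S' u n x) \<le> 8/3 * 2 ^ n * N u" if u: "bfin (sqrt 2) (fc u)" for u n x
  proof -
    have "cmod (S' u n x) \<le> (\<Sum>q<n. 8/3 * 2 ^ n * (sqrt 2 ^ q * bt q (fc u)))"
      unfolding S'_def
    proof (rule sum_norm_le)
      fix q assume "q \<in> {..<n}"
      then have q: "(2::real) ^ q \<le> 2 ^ n" by (intro power_increasing) auto
      have "cmod (D u q x) \<le> 2 * sqrt 2 ^ q * (4/3 * 2 ^ q * bt q (fc u))"
        unfolding D_def by (rule order_trans[OF norm_blk_le]) (intro mult_left_mono bt_deriv_le, auto)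
      also have "\<dots> = 8/3 * 2 ^ q * (sqrt 2 ^ q * bt q (fc u))" by simp
      also have "\<dots> \<le> 8/3 * 2 ^ n * (sqrt 2 ^ q * bt q (fc u))" using q by (intro mult_right_mono mult_left_mono) auto
      finally show "cmod (D u q x) \<le> \<dots>" .
    qed
    also have "\<dots> \<le> 8/3 * 2 ^ n * N u" unfolding sum_distrib_left[symmetric] N_def
      by (intro mult_left_mono bn_partial u) auto
    finally show ?thesis .
  qed
  have piece: "l2 (\<lambda>x. b u n x * S w m x) \<le> 2 * N w * bt n (fc u)"
    "l2 (\<lambda>x. b u n x * S' w m x + D u n x * S w m x) \<le> 16 * 2 ^ n * (2 * N w * bt n (fc u))"
    if w: "bfin (sqrt 2) (fc w)" and m: "m \<le> Suc n" for u w n m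
  proof -
    note pc = pC1_pcont(1)[OF bD[of u n]] pC1_pcont(2)[OF bD[of u n]] pC1_pcont(1)[OF SS[of w m]] pC1_pcont(2)[OF SS[of w m]]
    have lb: "l2 (b u n) = bt n (fc u)" "l2 (D u n) \<le> 4/3 * 2 ^ n * bt n (fc u)"
      unfolding b_def D_def l2_blk using bt_deriv_le by auto
    have "l2 (\<lambda>x. b u n x * S w m x) \<le> 2 * N w * l2 (b u n)"
      using pc Sb[OF w] N0[OF w] by (intro l2_mono) (auto simp: norm_mult mult.commute[of "cmod (b _ _ _)"] intro!: mult_right_mono)
    then show "l2 (\<lambda>x. b u n x * S w m x) \<le> 2 * N w * bt n (fc u)" by (simp add: lb)
    have "l2 (\<lambda>x. b u n x * S' w m x) \<le> 8/3 * 2 ^ m * N w * l2 (b u n)"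
      using pc Sb'[OF w] N0[OF w] by (intro l2_mono) (auto simp: norm_mult mult.commute[of "cmod (b _ _ _)"] simp del: times_divide_eq_left intro!: mult_right_mono)
    also have "\<dots> \<le> 8/3 * (2 * 2 ^ n) * N w * l2 (b u n)"
      using power_increasing[OF m, of "2::real"] N0[OF w] by (intro mult_right_mono mult_left_mono) auto
    finally have 1: "l2 (\<lambda>x. b u n x * S' w m x) \<le> 16/3 * 2 ^ n * N w * bt n (fc u)" by (simp add: lb)
    have "l2 (\<lambda>x. D u n x * S w m x) \<le> 2 * N w * l2 (D u n)"
      using pc Sb[OF w] N0[OF w] by (intro l2_mono) (auto simp: norm_mult mult.commute[of "cmod (D _ _ _)"] intro!: mult_right_mono)
    also have "\<dots> \<le> 2 * N w * (4/3 * 2 ^ n * bt n (fc u))" using lb N0[OF w] by (intro mult_left_mono) auto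
    finally have 2: "l2 (\<lambda>x. D u n x * S w m x) \<le> 8/3 * 2 ^ n * N w * bt n (fc u)" by (simp add: mult_ac)
    have "l2 (\<lambda>x. b u n x * S' w m x + D u n x * S w m x)
        \<le> 2 * (l2 (\<lambda>x. b u n x * S' w m x) + l2 (\<lambda>x. D u n x * S w m x))"
      using pc by (intro l2_add_le) auto
    also have "\<dots> \<le> 2 * (16/3 * 2 ^ n * N w * bt n (fc u) + 8/3 * 2 ^ n * N w * bt n (fc u))"
      using 1 2 by (intro mult_left_mono add_mono) auto
    also have "\<dots> = 8 * 2 ^ n * (2 * N w * bt n (fc u))" by simp
    also have "\<dots> \<le> 16 * 2 ^ n * (2 * N w * bt n (fc u))"
      using N0[OF w] by (intro mult_right_mono) auto
    finally show "l2 (\<lambda>x. b u n x * S' w m x + D u n x * S w m x) \<le> 16 * 2 ^ n * (2 * N w * bt n (fc u))" .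
  qed
  define F where "F n x = b f n x * S h (Suc n) x + b h n x * S f n x" for n x
  define F' where "F' n x = (b f n x * S' h (Suc n) x + D f n x * S h (Suc n) x)
      + (b h n x * S' f n x + D h n x * S f n x)" for n x
  define a where "a n = 4 * (N h * bt n (fc f) + N f * bt n (fc h))" for n
  have FF: "pC1 (F n) (F' n)" for n
    unfolding F_def[abs_def] F'_def[abs_def] by (intro pC1_add pC1_mult bD SS)
  have pc: "pcont (b u n)" "pcont (D u n)" "pcont (S u n)" "pcont (S' u n)" for u n
    using pC1_pcont bD SS by blast+
  have a1: "l2 (F n) \<le> a n" for n
  proof -
    have "l2 (F n) \<le> 2 * (l2 (\<lambda>x. b f n x * S h (Suc n) x) + l2 (\<lambda>x. b h n x * S f n x))"
      unfolding F_def[abs_def] using pc by (intro l2_add_le) auto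
    also have "\<dots> \<le> a n" using piece(1)[OF h(2), of "Suc n" n f] piece(1)[OF f(2), of n n h] by (simp add: a_def)
    finally show ?thesis .
  qed
  have a2: "l2 (F' n) \<le> 16 * 2 ^ n * a n" for n
  proof -
    have "l2 (F' n) \<le> 2 * (l2 (\<lambda>x. b f n x * S' h (Suc n) x + D f n x * S h (Suc n) x)
        + l2 (\<lambda>x. b h n x * S' f n x + D h n x * S f n x))"
      unfolding F'_def[abs_def] using pc by (intro l2_add_le) auto
    also have "\<dots> \<le> 2 * (16 * 2 ^ n * (2 * N h * bt n (fc f)) + 16 * 2 ^ n * (2 * N f * bt n (fc h)))"
      using piece(2)[OF h(2), of "Suc n" n f] piece(2)[OF f(2), of n n h] by simp
    also have "\<dots> = 16 * 2 ^ n * a n" by (simp add: a_def algebra_simps)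
    finally show ?thesis .
  qed
  have sF: "(\<lambda>n. F n x) sums (f x * h x)" for x
  proof -
    have "(\<Sum>n<k. F n x) = S f k x * S h k x" for k
      by (induction k) (auto simp: F_def S_def algebra_simps)
    moreover have "(\<lambda>k. S f k x * S h k x) \<longlonglongrightarrow> f x * h x"
      using blk_sums(1)[OF f, of x] blk_sums(1)[OF h, of x] unfolding S_def b_def sums_def by (intro tendsto_mult)
    ultimately show ?thesis by (simp add: sums_def)
  qed
  have ss: "summable (\<lambda>n. sqrt 2 ^ n * bt n (fc f))" "summable (\<lambda>n. sqrt 2 ^ n * bt n (fc h))"
    using f h by (auto simp: bfin_def)
  have ae: "(\<lambda>n. sqrt 2 ^ n * a n)
      = (\<lambda>n. 4 * N h * (sqrt 2 ^ n * bt n (fc f)) + 4 * N f * (sqrt 2 ^ n * bt n (fc h)))"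
    by (simp add: a_def fun_eq_iff algebra_simps)
  have su: "(\<lambda>n. sqrt 2 ^ n * a n) sums (4 * N h * N f + 4 * N f * N h)"
    unfolding ae using ss by (intro sums_add sums_mult) (auto simp: N_def bn_def)
  note r = bn_atoms[OF FF a1 a2 _ sums_summable[OF su] sF]
  show "bfin (sqrt 2) (fc (\<lambda>x. f x * h x))" using r by simp
  have "N (\<lambda>x. f x * h x) \<le> (14 + 11 * 16) * (8 * (N f * N h))"
    using r(3) sums_unique[OF su] by (simp add: N_def algebra_simps)
  also have "\<dots> \<le> 10000 * (N f * N h)"
    using N0[OF f(2)] N0[OF h(2)] by (simp add: mult_right_mono)
  finally show "bn (sqrt 2) (fc (\<lambda>x. f x * h x)) \<le> 10000 * bn (sqrt 2) (fc f) * bn (sqrt 2) (fc h)"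
    by (simp add: N_def)
qed

end

section \<open>Periodic distributions and their Fourier coefficients\<close>

text \<open>The span of the two functions is closed under differentiation, so smoothness follows
  without computing any higher derivative.\<close>

lemma trig_higher_deriv:
  "\<exists>a' b'. (deriv ^^ j) (\<lambda>x. a * cos (w * x) + b * sin (w * x)) = (\<lambda>x. a' * cos (w * x) + b' * sin (w * x))"
proof (induction j)
  case 0
  then show ?case by auto
next
  case (Suc j)
  then obtain a' b' where *: "(deriv ^^ j) (\<lambda>x. a * cos (w * x) + b * sin (w * x))
      = (\<lambda>x. a' * cos (w * x) + b' * sin (w * x))" by blast
  have "deriv (\<lambda>x. a' * cos (w * x) + b' * sin (w * x)) x = (b' * w) * cos (w * x) + (- a' * w) * sin (w * x)" for x
    by (rule DERIV_imp_deriv) (auto intro!: derivative_eq_intros)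
  then show ?case unfolding funpow.simps o_apply * by blast
qed

lemma smooth_trig: "smooth (\<lambda>x. a * cos (w * x) + b * sin (w * x))"
  unfolding smooth_def
proof (intro allI)
  fix k x
  obtain a' b' where *: "(deriv ^^ k) (\<lambda>x. a * cos (w * x) + b * sin (w * x))
      = (\<lambda>x. a' * cos (w * x) + b' * sin (w * x))" using trig_higher_deriv by blast
  have "((\<lambda>x. a' * cos (w * x) + b' * sin (w * x)) has_real_derivative
      (b' * w) * cos (w * x) + (- a' * w) * sin (w * x)) (at x)"
    by (auto intro!: derivative_eq_intros)
  then show "(deriv ^^ k) (\<lambda>x. a * cos (w * x) + b * sin (w * x)) differentiable at x"
    unfolding * by (auto simp: real_differentiable_def)
qed

lemma test_fun_trig:
  "test_fun (\<lambda>x. a * cos (2 * pi * of_int k * x) + b * sin (2 * pi * of_int k * x))"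
proof -
  have "cos (2 * pi * of_int k * (x + 1)) = cos (2 * pi * of_int k * x)"
    "sin (2 * pi * of_int k * (x + 1)) = sin (2 * pi * of_int k * x)" for x
    using sin_cos_eq_iff[of "2 * pi * of_int k * (x + 1)" "2 * pi * of_int k * x"]
    by (auto simp: algebra_simps intro!: exI[of _ k])
  then show ?thesis by (simp add: test_fun_def smooth_trig)
qed

lemma test_fun_cos: "test_fun (\<lambda>x. cos (2 * pi * of_int k * x))"
  and test_fun_sin: "test_fun (\<lambda>x. sin (2 * pi * of_int k * x))"
  using test_fun_trig[of 1 k 0] test_fun_trig[of 0 k 1] by simp_all

lemma test_fun_zero: "test_fun (\<lambda>x. 0)"
  using test_fun_trig[of 0 0 0] by simp

lemma is_pdist_pairing: "is_pdist (pairing S)"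
  using pairing by blast

lemma pairing_lincomb:
  "test_fun f \<Longrightarrow> test_fun g \<Longrightarrow> pairing S (\<lambda>x. a * f x + b * g x) = a * pairing S f + b * pairing S g"
  using is_pdist_pairing[of S] unfolding is_pdist_def by blast

lemma pairing_cmult: "test_fun f \<Longrightarrow> pairing S (\<lambda>x. a * f x) = a * pairing S f"
  using pairing_lincomb[of f "\<lambda>x. 0" S a 0] test_fun_zero by simp

lemma test_fun_sum:
  "(\<And>i. i \<in> A \<Longrightarrow> test_fun (f i)) \<Longrightarrow> test_fun (\<lambda>x. \<Sum>i\<in>A. f i x)"
proof (induction A rule: infinite_finite_induct)
  case (insert i A)
  then show ?case using test_fun_lincomb[of "f i" "\<lambda>x. \<Sum>i\<in>A. f i x" 1 1] by simp
qed (auto simp: test_fun_zero)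

lemma pairing_sum:
  assumes "\<And>i. i \<in> A \<Longrightarrow> test_fun (f i)"
  shows "pairing S (\<lambda>x. \<Sum>i\<in>A. f i x) = (\<Sum>i\<in>A. pairing S (f i))"
  using assms
proof (induction A rule: infinite_finite_induct)
  case (insert i A)
  then show ?case using pairing_lincomb[of "f i" "\<lambda>x. \<Sum>i\<in>A. f i x" S 1 1] test_fun_sum[of A f]
    by simp
qed (use pairing_cmult[OF test_fun_zero, of S 0] in simp_all)

lemma test_fun_funpow: "test_fun f \<Longrightarrow> test_fun ((deriv ^^ j) f)"
  by (induction j) (auto intro: test_fun_deriv)

lemma test_fun_pC1:
  assumes "test_fun f" shows "pC1 f (deriv f)"
proof -
  have d: "(f has_vector_derivative deriv f x) (at x)" if "test_fun f" for f x
  proof -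
    have "(deriv ^^ 0) f differentiable (at x)" using that unfolding test_fun_def smooth_def by blast
    then show ?thesis
      by (simp add: DERIV_deriv_iff_real_differentiable flip: has_real_derivative_iff_has_vector_derivative)
  qed
  have "continuous_on UNIV (deriv f)"
    using d[OF test_fun_deriv[OF assms]]
    by (auto simp: continuous_on_eq_continuous_within intro: has_vector_derivative_continuous)
  then show ?thesis using assms d by (intro pC1_intro) (auto simp: test_fun_def)
qed

lemma fourier_coeff_diff: "fourier_coeff (S - S') k = fourier_coeff S k - fourier_coeff S' k"
  by (simp add: fourier_coeff_def minus_pdist.rep_eq complex_eq_iff)

lemma fourier_coeff_scaleR: "fourier_coeff (a *\<^sub>R S) k = a * fourier_coeff S k"
  by (simp add: fourier_coeff_def scaleR_pdist.rep_eq complex_eq_iff)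

lemma fourier_coeff_uminus: "fourier_coeff (- S) k = - fourier_coeff S k"
  using fourier_coeff_scaleR[of "-1" S k] by simp

lemma fourier_coeff_cnj: "fourier_coeff S (- k) = cnj (fourier_coeff S k)"
  using pairing_cmult[OF test_fun_sin, of S "-1" k]
  by (simp add: fourier_coeff_def complex_eq_iff)

lemma fourier_coeff_deriv: "fourier_coeff (pd_deriv S) k = 2 * pi * \<i> * of_int k * fourier_coeff S k"
proof -
  have "deriv (\<lambda>x. cos (2 * pi * of_int k * x)) = (\<lambda>x. (- 2 * pi * of_int k) * sin (2 * pi * of_int k * x))"
    by (rule ext, rule DERIV_imp_deriv) (auto intro!: derivative_eq_intros)
  moreover have "deriv (\<lambda>x. sin (2 * pi * of_int k * x)) = (\<lambda>x. (2 * pi * of_int k) * cos (2 * pi * of_int k * x))"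
    by (rule ext, rule DERIV_imp_deriv) (auto intro!: derivative_eq_intros)
  ultimately show ?thesis
    by (simp only: fourier_coeff_def pd_deriv.rep_eq test_fun_cos test_fun_sin if_True
        pairing_cmult[OF test_fun_sin] pairing_cmult[OF test_fun_cos])
      (simp add: complex_eq_iff)
qed

lemma set_integrable_pcont:
  fixes f :: "real \<Rightarrow> 'a::{banach, second_countable_topology}"
  shows "pcont f \<Longrightarrow> set_integrable lborel {a..b} f"
  by (intro borel_integrable_atLeastAtMost' pcont_continuous)

lemma LBINT_pcont:
  fixes f :: "real \<Rightarrow> 'a::euclidean_space"
  shows "pcont f \<Longrightarrow> (LBINT x:{a..b}. f x) = integral {a..b} f"
  by (intro set_borel_integral_eq_integral set_integrable_pcont)

lemma pairing_pd_of_fun: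
  assumes "pcont f" "test_fun \<psi>"
  shows "pairing (pd_of_fun f) \<psi> = integral {0..1} (\<lambda>x. f x * \<psi> x)"
  using assms LBINT_pcont[OF pcont_mult[OF assms(1) pC1_pcont(1)[OF test_fun_pC1[OF assms(2)]]], of 0 1]
  by (simp add: pd_of_fun.rep_eq set_integrable_pcont)

definition rfc :: "(real \<Rightarrow> real) \<Rightarrow> int \<Rightarrow> complex" where
  "rfc f = fc (\<lambda>x. of_real (f x))"

lemma fourier_coeff_pd_of_fun:
  assumes f: "pcont f" shows "fourier_coeff (pd_of_fun f) k = rfc f k"
proof -
  define G where "G x = complex_of_real (f x) * wave (- k) x" for x
  have G: "pcont G" unfolding G_def using f by auto
  have "Re (integral {0..1} G) = integral {0..1} (\<lambda>x. Re (G x))"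
    "Im (integral {0..1} G) = integral {0..1} (\<lambda>x. Im (G x))"
    using integral_linear[OF pcont_integrable[OF G, of 0 1] bounded_linear_Re]
      integral_linear[OF pcont_integrable[OF G, of 0 1] bounded_linear_Im] by (simp_all add: o_def)
  moreover have "rfc f k = integral {0..1} G" by (simp add: rfc_def fc_def G_def[abs_def])
  moreover have "Re (G x) = f x * cos (2 * pi * of_int k * x)" "Im (G x) = - (f x * sin (2 * pi * of_int k * x))" for x
    by (simp_all add: G_def wave_def)
  ultimately show ?thesis
    unfolding fourier_coeff_def pairing_pd_of_fun[OF f test_fun_cos] pairing_pd_of_fun[OF f test_fun_sin]
    by (simp add: complex_eq_iff)
qed

section \<open>Distributions as coefficient sequences, and the Besov norms in these terms\<close>

context littlewood_paley
begin

text \<open>Distributions are paired with real test functions only, hence the real part.\<close>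

definition rblk :: "nat \<Rightarrow> (int \<Rightarrow> complex) \<Rightarrow> real \<Rightarrow> real" where
  "rblk n c x = Re (blk n c x)"

lemma rblk_trig: "rblk n c x = (\<Sum>k\<in>supp n. (sg n k * Re (c k)) * cos (2 * pi * of_int k * x)
    + (- sg n k * Im (c k)) * sin (2 * pi * of_int k * x))"
  unfolding rblk_def blk_def Re_sum by (intro sum.cong refl) (simp add: wave_def)

lemma test_fun_rblk: "test_fun (rblk n c)"
  unfolding rblk_trig[abs_def] by (intro test_fun_sum test_fun_trig)

lemma pairing_rblk:
  assumes "\<And>k. fourier_coeff S k = 0" shows "pairing S (rblk n c) = 0"
proof -
  have "pairing S (\<lambda>x. cos (2 * pi * of_int k * x)) = 0" "pairing S (\<lambda>x. sin (2 * pi * of_int k * x)) = 0" for k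
    using assms[of k] by (auto simp: fourier_coeff_def complex_eq_iff)
  then show ?thesis unfolding rblk_trig[abs_def]
    by (subst pairing_sum[OF test_fun_trig]) (simp only: pairing_lincomb[OF test_fun_cos test_fun_sin], simp)
qed

lemma rblk_deriv: "deriv (rblk n c) = rblk n (\<lambda>k. 2 * pi * \<i> * of_int k * c k)"
proof
  fix x
  have "(rblk n c has_vector_derivative rblk n (\<lambda>k. 2 * pi * \<i> * of_int k * c k) x) (at x)"
    unfolding rblk_def[abs_def]
    by (rule bounded_linear.has_vector_derivative[OF bounded_linear_Re pC1_deriv[OF pC1_blk]])
  then show "deriv (rblk n c) x = rblk n (\<lambda>k. 2 * pi * \<i> * of_int k * c k) x"
    by (intro DERIV_imp_deriv) (simp add: has_real_derivative_iff_has_vector_derivative)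
qed

lemma rfc_deriv: "pC1 f f' \<Longrightarrow> rfc f' k = 2 * pi * \<i> * of_int k * rfc f k"
  unfolding rfc_def by (rule fc_deriv[OF pC1_of_real])

lemma rblk_uniform:
  assumes "pcont f" "bfin (sqrt 2) (rfc f)"
  shows "uniform_limit UNIV (\<lambda>N x. \<Sum>n<N. rblk n (rfc f) x) f sequentially"
proof -
  have "uniform_limit UNIV (\<lambda>N x. Re (\<Sum>n<N. blk n (rfc f) x)) (\<lambda>x. Re (of_real (f x))) sequentially"
    by (rule bounded_linear.uniform_limit[OF bounded_linear_Re])
      (use assms blk_sums(3)[of "\<lambda>x. of_real (f x)"] in \<open>auto simp: rfc_def\<close>)
  then show ?thesis by (simp add: rblk_def)
qed

lemma bfin_rfc_pC1: "pC1 f f' \<Longrightarrow> bfin (sqrt 2) (rfc f)"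
  unfolding rfc_def by (rule bfin_pC1(1)[OF pC1_of_real])

text \<open>A distribution is bounded by some C^N norm, and partial sums of the block series of a
  test function converge uniformly together with their first \<open>N\<close> derivatives, since
  taking blocks commutes with differentiation. On these trigonometric polynomials the functional
  vanishes.\<close>

lemma fourier_coeff_zero:
  assumes z: "\<And>k. fourier_coeff S k = 0"
  shows "S = 0"
proof -
  obtain N C where NC: "\<And>\<psi> M. test_fun \<psi> \<Longrightarrow> (\<forall>k\<le>(N::nat). \<forall>x. \<bar>(deriv ^^ k) \<psi> x\<bar> \<le> M) \<Longrightarrow> \<bar>pairing S \<psi>\<bar> \<le> C * M"
    using is_pdist_pairing[of S] unfolding is_pdist_def by blast
  have "pairing S \<psi> = 0" if t: "test_fun \<psi>" for \<psi>
  proof -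
    define D where "D j = (deriv ^^ j) \<psi>" for j
    define T where "T m j x = (\<Sum>n<m. rblk n (rfc (D j)) x)" for m j x
    have tD: "test_fun (D j)" for j unfolding D_def by (rule test_fun_funpow[OF t])
    have pD: "pC1 (D j) (D (Suc j))" for j using test_fun_pC1[OF tD[of j]] by (simp add: D_def)
    have tT: "test_fun (T m j)" for m j unfolding T_def[abs_def] by (intro test_fun_sum test_fun_rblk)
    have "rblk n (rfc (D (Suc j))) = deriv (rblk n (rfc (D j)))" for n j
      unfolding rblk_deriv using rfc_deriv[OF pD] by presburger
    then have dT: "deriv (T m j) = T m (Suc j)" for m j
      unfolding T_def[abs_def]
      using test_fun_pC1[OF test_fun_rblk]
      by (intro ext DERIV_imp_deriv DERIV_sum)
        (auto simp: pC1_def has_real_derivative_iff_has_vector_derivative)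
    have higher: "(deriv ^^ j) (\<lambda>x. 1 * D 0 x + (-1) * T m 0 x) = (\<lambda>x. 1 * D j x + (-1) * T m j x)" for j m
    proof -
      have "(deriv ^^ j) (T m 0) = T m j" for j by (induction j) (auto simp: dT)
      moreover have "(deriv ^^ j) (D 0) = D j" by (simp add: D_def)
      moreover have "smooth (D 0)" "smooth (T m 0)" using tD tT by (auto simp: test_fun_def)
      ultimately show ?thesis by (subst higher_deriv_lincomb) simp_all
    qed
    have pT: "pairing S (T m j) = 0" for m j
      unfolding T_def[abs_def] by (subst pairing_sum) (auto simp: test_fun_rblk pairing_rblk[OF z])
    have "\<bar>pairing S \<psi>\<bar> \<le> C * e" if e: "e > 0" for e
    proof -
      have "\<forall>\<^sub>F m in sequentially. \<forall>x\<in>UNIV. dist (T m j x) (D j x) < e" for j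
        unfolding T_def using rblk_uniform[OF pC1_pcont(1)[OF pD] bfin_rfc_pC1[OF pD]] e
        by (rule uniform_limitD)
      then have "\<forall>\<^sub>F m in sequentially. \<forall>j\<in>{..N}. \<forall>x\<in>UNIV. dist (T m j x) (D j x) < e"
        by (intro eventually_ball_finite) auto
      then obtain m where m: "\<And>j x. j \<le> N \<Longrightarrow> dist (T m j x) (D j x) < e"
        unfolding eventually_sequentially by auto
      have "\<bar>pairing S (\<lambda>x. 1 * D 0 x + (-1) * T m 0 x)\<bar> \<le> C * e"
      proof (rule NC)
        show "test_fun (\<lambda>x. 1 * D 0 x + (-1) * T m 0 x)" by (intro test_fun_lincomb tD tT)
        show "\<forall>k\<le>N. \<forall>x. \<bar>(deriv ^^ k) (\<lambda>x. 1 * D 0 x + (-1) * T m 0 x) x\<bar> \<le> e"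
          unfolding higher using m by (auto simp: dist_real_def abs_minus_commute intro: less_imp_le)
      qed
      then show ?thesis using pairing_lincomb[OF tD tT, of S 1 0 "-1" m 0] pT by (simp add: D_def)
    qed
    then have "\<bar>pairing S \<psi>\<bar> \<le> 0"
    proof -
      assume *: "\<And>e. e > 0 \<Longrightarrow> \<bar>pairing S \<psi>\<bar> \<le> C * e"
      have C: "0 \<le> C" using *[of 1] by simp
      show ?thesis
      proof (rule field_le_epsilon)
        fix e :: real assume "e > 0"
        then have "\<bar>pairing S \<psi>\<bar> \<le> C * (e / (C + 1))" using C by (intro *) auto
        also have "\<dots> \<le> e" using C \<open>e > 0\<close> by (simp add: field_simps)
        finally show "\<bar>pairing S \<psi>\<bar> \<le> 0 + e" by simp
      qed
    qed
    then show ?thesis by simp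
  qed
  moreover have "pairing S \<psi> = 0" if "\<not> test_fun \<psi>" for \<psi>
    using is_pdist_pairing[of S] that unfolding is_pdist_def by blast
  ultimately have "pairing S = pairing 0" by (auto simp: zero_pdist.rep_eq)
  then show ?thesis by (simp add: pairing_inject)
qed

lemma pdist_eqI: "(\<And>k. fourier_coeff S k = fourier_coeff S' k) \<Longrightarrow> S = S'"
  using fourier_coeff_zero[of "S - S'"] by (simp add: fourier_coeff_diff)

lemma pd_deriv_pd_of_fun: "pC1 f f' \<Longrightarrow> pd_deriv (pd_of_fun f) = pd_of_fun f'"
  by (rule pdist_eqI) (use pC1_pcont[of f f'] in \<open>simp add: fourier_coeff_deriv fourier_coeff_pd_of_fun rfc_deriv\<close>)

lemma rfc_add: "pcont f \<Longrightarrow> pcont g \<Longrightarrow> rfc (\<lambda>x. f x + g x) k = rfc f k + rfc g k"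
  unfolding rfc_def by (simp add: fc_add pcont_of_real)

lemma rfc_diff: "pcont f \<Longrightarrow> pcont g \<Longrightarrow> rfc (\<lambda>x. f x - g x) k = rfc f k - rfc g k"
  unfolding rfc_def by (simp add: fc_diff pcont_of_real)

lemma rfc_cmult: "rfc (\<lambda>x. a * f x) k = a * rfc f k"
  unfolding rfc_def by (simp add: fc_cmult)

lemma pd_of_fun_diff: "pcont f \<Longrightarrow> pcont g \<Longrightarrow> pd_of_fun (\<lambda>x. f x - g x) = pd_of_fun f - pd_of_fun g"
  by (rule pdist_eqI) (simp add: fourier_coeff_diff fourier_coeff_pd_of_fun pcont_diff rfc_diff)

lemma pd_of_fun_cmult: "pcont f \<Longrightarrow> pd_of_fun (\<lambda>x. a * f x) = a *\<^sub>R pd_of_fun f"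
  by (rule pdist_eqI) (simp add: fourier_coeff_scaleR fourier_coeff_pd_of_fun pcont_mult rfc_cmult)

lemma L2_norm_lp_block: "L2_norm (lp_block chi phi (int n - 1) S) = bt n (fourier_coeff S)"
proof -
  have "lp_block chi phi (int n - 1) S = blk n (fourier_coeff S)"
    by (simp add: lp_block_def blk_def supp_def sg_def fun_eq_iff wave_def)
  moreover have "L2_norm g = l2 g" if "pcont g" for g
    unfolding L2_norm_def l2_def using that by (subst LBINT_pcont) auto
  ultimately show ?thesis using l2_blk by simp
qed

lemma besov_term:
  "2 powr (of_int (int n - 1) * s) * L2_norm (lp_block chi phi (int n - 1) S)
    = 2 powr (- s) * ((2 powr s) ^ n * bt n (fourier_coeff S))"
proof -
  have "2 powr (of_int (int n - 1) * s) = 2 powr (- s) * (2 powr s) ^ n"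
    by (simp add: powr_realpow[symmetric] powr_powr powr_add[symmetric] algebra_simps)
  then show ?thesis by (simp add: L2_norm_lp_block)
qed

lemma bij_shift: "bij_betw (\<lambda>n. int n - 1) UNIV {- 1..}"
  by (rule bij_betwI[of _ _ _ "\<lambda>k. nat (k + 1)"]) auto

lemma besov_iff: "S \<in> besov chi phi s \<longleftrightarrow> bfin (2 powr s) (fourier_coeff S)"
proof -
  have "S \<in> besov chi phi s \<longleftrightarrow> (\<lambda>n. 2 powr (of_int (int n - 1) * s) * L2_norm (lp_block chi phi (int n - 1) S)) summable_on UNIV"
    unfolding besov_def mem_Collect_eq
    by (rule summable_on_reindex_bij_betw[OF bij_shift, symmetric])
  also have "\<dots> \<longleftrightarrow> summable (\<lambda>n. 2 powr (- s) * ((2 powr s) ^ n * bt n (fourier_coeff S)))"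
    unfolding besov_term by (rule summable_on_UNIV_nonneg_real_iff) simp
  also have "\<dots> \<longleftrightarrow> bfin (2 powr s) (fourier_coeff S)"
    by (simp add: bfin_def summable_cmult_iff)
  finally show ?thesis .
qed

lemma besov_norm_eq:
  assumes "S \<in> besov chi phi s"
  shows "besov_norm chi phi s S = 2 powr (- s) * bn (2 powr s) (fourier_coeff S)"
proof -
  have s: "summable (\<lambda>n. (2 powr s) ^ n * bt n (fourier_coeff S))"
    using assms by (simp add: besov_iff bfin_def)
  have "besov_norm chi phi s S = (\<Sum>\<^sub>\<infinity>n. 2 powr (of_int (int n - 1) * s) * L2_norm (lp_block chi phi (int n - 1) S))"
    unfolding besov_norm_def by (rule infsum_reindex_bij_betw[OF bij_shift, symmetric])
  also have "\<dots> = (\<Sum>n. 2 powr (- s) * ((2 powr s) ^ n * bt n (fourier_coeff S)))"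
    unfolding besov_term
  proof (rule infsumI, rule sums_nonneg_imp_has_sum)
    show "(\<lambda>n. 2 powr (- s) * ((2 powr s) ^ n * bt n (fourier_coeff S))) sums
      (\<Sum>n. 2 powr (- s) * ((2 powr s) ^ n * bt n (fourier_coeff S)))"
      by (intro summable_sums summable_mult s)
  qed simp
  also have "\<dots> = 2 powr (- s) * bn (2 powr s) (fourier_coeff S)"
    unfolding bn_def by (rule suminf_mult[OF s])
  finally show ?thesis .
qed

end

section \<open>Square integrable representatives and products\<close>

text \<open>The squared positive part is the simplest C1 cut-off; it turns the positivity set of a
  cosine into the support of a C1 periodic bump.\<close>

lemma max_square_deriv: "((\<lambda>s::real. (max 0 s)\<^sup>2) has_real_derivative 2 * max 0 s) (at s)"
proof (cases "s = 0")
  case True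
  have "((\<lambda>h. ((max 0 (0 + h))\<^sup>2 - (max 0 0)\<^sup>2) / h) \<longlongrightarrow> (0::real)) (at 0)"
  proof (rule Lim_null_comparison)
    show "\<forall>\<^sub>F h::real in at 0. norm (((max 0 (0 + h))\<^sup>2 - (max 0 0)\<^sup>2) / h) \<le> \<bar>h\<bar>"
      by (intro always_eventually allI) (auto simp: max_def power2_eq_square)
    show "((\<lambda>h::real. \<bar>h\<bar>) \<longlongrightarrow> 0) (at 0)" by (rule tendsto_rabs_zero) simp
  qed
  then show ?thesis using True by (simp add: DERIV_def)
next
  case False
  define g where "g = (\<lambda>s::real. if 0 < s then s\<^sup>2 else 0)"
  have "((\<lambda>x. x\<^sup>2) has_real_derivative 2 * s) (at s)" by (auto intro!: derivative_eq_intros)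
  have "0 < s \<Longrightarrow> ?thesis"
    using has_field_derivative_transform_within_open[OF \<open>((\<lambda>x. x\<^sup>2) has_real_derivative 2 * s) (at s)\<close>, of "{0<..}"]
    by (auto simp: max_def)
  moreover have "s < 0 \<Longrightarrow> ?thesis"
    using has_field_derivative_transform_within_open[OF DERIV_const[of 0 "at s"], of "{..<0}" "\<lambda>s. (max 0 s)\<^sup>2"]
    by (auto simp: max_def)
  ultimately show ?thesis using False by linarith
qed

text \<open>A cosine centred at the midpoint of an interval exceeds its value at the endpoints
  exactly inside. This describes the interval by a single periodic function.\<close>

lemma cos_arc_iff:
  fixes a b x :: real
  assumes "0 \<le> a" "a < b" "b \<le> 1" "x \<in> {0..1}"
  shows "cos (2 * pi * ((b - a) / 2)) < cos (2 * pi * (x - (a + b) / 2)) \<longleftrightarrow> x \<in> {a<..<b}"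
proof -
  define r t where "r = (b - a) / 2" and "t = \<bar>x - (a + b) / 2\<bar>"
  have r: "0 < r" "r \<le> 1/2" "t \<le> 1 - r" "0 \<le> t" using assms by (auto simp: r_def t_def abs_if field_simps)
  have t: "cos (2 * pi * (x - (a + b) / 2)) = cos (2 * pi * t)"
    using cos_minus[of "2 * pi * (x - (a + b) / 2)"] unfolding t_def abs_if by (auto simp: algebra_simps)
  have 1: "cos (2 * pi * r) < cos (2 * pi * t)" if "t < r"
    using r that by (intro cos_monotone_0_pi) (auto simp: field_simps)
  have 2: "cos (2 * pi * t) \<le> cos (2 * pi * r)" if "r \<le> t"
  proof (cases "t \<le> 1/2")
    case True
    then show ?thesis using r that by (intro cos_monotone_0_pi_le) (auto simp: field_simps)
  next
    \<comment> \<open>Beyond half a period the cosine grows again; reflection replaces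
      \<open>t\<close> by \<open>1 - t\<close>, and \<open>t \<le> 1 - r\<close> keeps this at
      distance at least \<open>r\<close>.\<close>
    case False
    have "cos (2 * pi * t) = cos (2 * pi - 2 * pi * t)" by (simp add: cos_diff)
    also have "\<dots> = cos (2 * pi * (1 - t))" by (simp add: algebra_simps)
    also have "\<dots> \<le> cos (2 * pi * r)"
    proof (rule cos_monotone_0_pi_le)
      show "2 * pi * r \<le> 2 * pi * (1 - t)" using r by (intro mult_left_mono) auto
      have "2 * pi * (1 - t) \<le> 2 * pi * (1/2)" using False by (intro mult_left_mono) auto
      then show "2 * pi * (1 - t) \<le> pi" by simp
    qed (use r in auto)
    finally show ?thesis .
  qed
  have "x \<in> {a<..<b} \<longleftrightarrow> t < r" unfolding r_def t_def abs_less_iff by (auto simp: field_simps)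
  then show ?thesis using 1 2 t r_def by (metis linorder_not_less)
qed

text \<open>The function 1 - exp (- n s^2) tends to 1 for s > 0 and is 0 at s = 0; it is applied to
  the positive part of the shifted cosine. C1 bumps are enough because
  \<open>test_orthogonal_pC1\<close> passes from smooth to C1 functions.\<close>

lemma interval_bump:
  fixes a b :: real
  assumes "0 \<le> a" "a < b" "b \<le> 1"
  shows "\<exists>\<theta> \<theta>' :: nat \<Rightarrow> real \<Rightarrow> real. (\<forall>n. pC1 (\<theta> n) (\<theta>' n)) \<and> (\<forall>n x. 0 \<le> \<theta> n x \<and> \<theta> n x \<le> 1)
    \<and> (\<forall>x\<in>{0..1}. (\<lambda>n. \<theta> n x) \<longlonglongrightarrow> indicator {a<..<b} x)"
proof -
  define T where "T x = cos (2 * pi * (x - (a + b) / 2)) - cos (2 * pi * ((b - a) / 2))" for x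
  define T' where "T' x = - (2 * pi * sin (2 * pi * (x - (a + b) / 2)))" for x
  define \<theta> where "\<theta> n x = 1 - exp (- (real n * (max 0 (T x))\<^sup>2))" for n x
  define \<theta>' where "\<theta>' n x = exp (- (real n * (max 0 (T x))\<^sup>2)) * (real n * (2 * max 0 (T x) * T' x))" for n x
  have dT: "(T has_real_derivative T' x) (at x)" for x
    unfolding T_def[abs_def] T'_def by (auto intro!: derivative_eq_intros)
  have d2: "((\<lambda>x. (max 0 (T x))\<^sup>2) has_real_derivative 2 * max 0 (T x) * T' x) (at x)" for x
    using DERIV_chain2[OF max_square_deriv dT] .
  have cT: "continuous_on UNIV T" "continuous_on UNIV T'"
    unfolding T_def[abs_def] T'_def[abs_def] by (intro continuous_intros)+
  have "pC1 (\<theta> n) (\<theta>' n)" for n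
  proof (rule pC1_intro)
    have "T (x + 1) = T x" for x
      unfolding T_def using cos_periodic[of "2 * pi * (x - (a + b) / 2)"] by (simp add: algebra_simps)
    then show "\<theta> n (x + 1) = \<theta> n x" for x by (simp add: \<theta>_def)
    show "(\<theta> n has_vector_derivative \<theta>' n x) (at x)" for x
      unfolding has_real_derivative_iff_has_vector_derivative[symmetric] \<theta>_def[abs_def] \<theta>'_def
      by (rule derivative_eq_intros d2 refl)+ simp
    show "continuous_on UNIV (\<theta>' n)"
      unfolding \<theta>'_def[abs_def] by (intro continuous_intros cT)
  qed
  moreover have "0 \<le> \<theta> n x \<and> \<theta> n x \<le> 1" for n x by (simp add: \<theta>_def)
  moreover have "(\<lambda>n. \<theta> n x) \<longlonglongrightarrow> indicator {a<..<b} x" if x: "x \<in> {0..1}" for x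
  proof (cases "x \<in> {a<..<b}")
    case True
    then have "T x > 0" using cos_arc_iff[OF assms x] by (simp add: T_def)
    define q where "q = exp (- (T x)\<^sup>2)"
    have "\<theta> n x = 1 - q ^ n" for n
      using \<open>T x > 0\<close> by (simp add: \<theta>_def q_def exp_of_nat_mult[symmetric] max_def)
    moreover have "(\<lambda>n. 1 - q ^ n) \<longlonglongrightarrow> 1 - 0"
      using \<open>T x > 0\<close> by (intro tendsto_intros LIMSEQ_power_zero) (simp add: q_def)
    ultimately show ?thesis using True by simp
  next
    case False
    then have "T x \<le> 0" using cos_arc_iff[OF assms x] unfolding T_def by linarith
    then have "\<theta> n x = 0" for n by (simp add: \<theta>_def max_def)
    then show ?thesis using False by simp
  qed
  ultimately show ?thesis by blast
qed

lemma pcont_bounded: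
  fixes f :: "real \<Rightarrow> 'a::real_normed_vector"
  assumes "pcont f" obtains M where "\<And>x. norm (f x) \<le> M" "0 \<le> M"
proof -
  have "compact (f ` {0..1})" using assms by (intro compact_continuous_image pcont_continuous) auto
  then obtain M where M: "\<And>x. x \<in> {0..1} \<Longrightarrow> norm (f x) \<le> M"
    using compact_imp_bounded[of "f ` {0..1}"] unfolding bounded_iff by blast
  have "norm (f x) \<le> M" for x
  proof -
    have "f (x + of_int (- \<lfloor>x\<rfloor>)) = f x" using periodic_int[of f] assms by (simp only: pcont_def)
    moreover have "x + of_int (- \<lfloor>x\<rfloor>) \<in> {0..1}" by (simp, linarith)
    ultimately show ?thesis using M by metis
  qed
  moreover from this[of 0] have "0 \<le> M" using norm_ge_zero order_trans by blast
  ultimately show ?thesis by (rule that)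
qed

lemma pcont_measurable: "pcont (f :: real \<Rightarrow> real) \<Longrightarrow> f \<in> borel_measurable lborel"
  using borel_measurable_continuous_onI[OF pcont_continuous] by simp

lemma integrable_mult_bounded:
  fixes W h :: "real \<Rightarrow> real"
  assumes W: "integrable lborel W" and h: "h \<in> borel_measurable lborel" "\<And>x. \<bar>h x\<bar> \<le> M"
  shows "integrable lborel (\<lambda>x. W x * h x)"
proof (rule Bochner_Integration.integrable_bound)
  show "integrable lborel (\<lambda>x. M * W x)" using W by simp
  show "(\<lambda>x. W x * h x) \<in> borel_measurable lborel" using W h(1) by simp
  have "0 \<le> M" using h(2)[of 0] abs_ge_zero order_trans by blast
  then have "norm (W x * h x) \<le> norm (M * W x)" for x
    using mult_right_mono[OF h(2)[of x], of "\<bar>W x\<bar>"] by (simp add: abs_mult mult.commute)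
  then show "AE x in lborel. norm (W x * h x) \<le> norm (M * W x)" by simp
qed

section \<open>Independence of products from the chosen square integrable representatives\<close>

context littlewood_paley
begin

text \<open>The partial sums of the block series of a C1 function are test functions and converge to
  it uniformly, while \<open>W\<close> is integrable.\<close>

lemma test_orthogonal_pC1:
  assumes W: "integrable lborel W" and z: "\<And>\<psi>. test_fun \<psi> \<Longrightarrow> (LINT x|lborel. W x * \<psi> x) = 0"
    and \<theta>: "pC1 \<theta> \<theta>'"
  shows "(LINT x|lborel. W x * \<theta> x) = 0"
proof -
  define T where "T m x = (\<Sum>n<m. rblk n (rfc \<theta>) x)" for m x
  have tT: "test_fun (T m)" for m unfolding T_def[abs_def] by (intro test_fun_sum test_fun_rblk)
  note ul = rblk_uniform[OF pC1_pcont(1)[OF \<theta>] bfin_rfc_pC1[OF \<theta>], folded T_def]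
  have i: "integrable lborel (\<lambda>x. W x * h x)" if h: "pcont h" for h
  proof -
    obtain M where "\<And>x. norm (h x) \<le> M" using pcont_bounded[OF h] by blast
    then show ?thesis using integrable_mult_bounded[OF W pcont_measurable[OF h], of M] by simp
  qed
  define I where "I = (LINT x|lborel. \<bar>W x\<bar>)"
  have I: "0 \<le> I" by (simp add: I_def)
  have "\<bar>LINT x|lborel. W x * \<theta> x\<bar> \<le> e * I" if e: "e > 0" for e
  proof -
    obtain m where m: "\<And>x. dist (T m x) (\<theta> x) < e"
      using uniform_limitD[OF ul e] unfolding eventually_sequentially by auto
    have pT: "pcont (T m)" using pC1_pcont(1)[OF test_fun_pC1[OF tT]] .
    have "(LINT x|lborel. W x * \<theta> x) = (LINT x|lborel. W x * \<theta> x - W x * T m x)"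
      using i pT pC1_pcont(1)[OF \<theta>] z[OF tT] by (subst Bochner_Integration.integral_diff) auto
    also have "\<bar>\<dots>\<bar> \<le> (LINT x|lborel. e * \<bar>W x\<bar>)"
    proof -
      have "\<bar>W x * \<theta> x - W x * T m x\<bar> \<le> e * \<bar>W x\<bar>" for x
      proof -
        have "\<bar>W x * \<theta> x - W x * T m x\<bar> = \<bar>W x\<bar> * dist (T m x) (\<theta> x)"
          by (simp add: dist_real_def abs_mult[symmetric] algebra_simps abs_minus_commute)
        also have "\<dots> \<le> \<bar>W x\<bar> * e" using m[of x] by (intro mult_left_mono) auto
        finally show ?thesis by (simp add: mult.commute)
      qed
      then show ?thesis
        using Bochner_Integration.integral_norm_bound_integral[of lborel "\<lambda>x. W x * \<theta> x - W x * T m x" "\<lambda>x. e * \<bar>W x\<bar>"]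
          i pT pC1_pcont(1)[OF \<theta>] W by simp
    qed
    finally show ?thesis by (simp add: I_def)
  qed
  note b = this
  have "\<bar>LINT x|lborel. W x * \<theta> x\<bar> \<le> 0"
  proof (rule field_le_epsilon)
    fix e :: real assume e: "e > 0"
    have "\<bar>LINT x|lborel. W x * \<theta> x\<bar> \<le> e / (I + 1) * I" using I e by (intro b) auto
    also have "\<dots> \<le> e" using I e by (simp add: field_simps)
    finally show "\<bar>LINT x|lborel. W x * \<theta> x\<bar> \<le> 0 + e" by simp
  qed
  then show ?thesis by simp
qed

text \<open>The fundamental lemma of the calculus of variations. Bumps and dominated convergence
  give integral 0 over intervals, induction over Borel sets gives all Borel sets, and uniqueness of
  densities concludes.\<close>

lemma AE_zero_test_orthogonal:
  assumes W: "integrable lborel W" and out: "\<And>x. x \<notin> {0..1} \<Longrightarrow> W x = 0"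
    and z: "\<And>\<psi>. test_fun \<psi> \<Longrightarrow> (LINT x|lborel. W x * \<psi> x) = 0"
  shows "AE x in lborel. W x = 0"
proof -
  have sub: "(LINT x|lborel. W x * indicator {a<..<b} x) = 0" if ab: "0 \<le> a" "a < b" "b \<le> 1" for a b
  proof -
    from interval_bump[OF ab] obtain \<theta> \<theta>' :: "nat \<Rightarrow> real \<Rightarrow> real"
      where *: "(\<forall>n. pC1 (\<theta> n) (\<theta>' n)) \<and> (\<forall>n x. 0 \<le> \<theta> n x \<and> \<theta> n x \<le> 1)
        \<and> (\<forall>x\<in>{0..1}. (\<lambda>n. \<theta> n x) \<longlonglongrightarrow> indicator {a<..<b} x)"
      by (elim exE)
    then have t: "\<And>n. pC1 (\<theta> n) (\<theta>' n)" "\<And>n x. 0 \<le> \<theta> n x \<and> \<theta> n x \<le> 1"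
      "\<And>x. x \<in> {0..1} \<Longrightarrow> (\<lambda>n. \<theta> n x) \<longlonglongrightarrow> indicator {a<..<b} x" by blast+
    have "(\<lambda>n. LINT x|lborel. W x * \<theta> n x) \<longlonglongrightarrow> (LINT x|lborel. W x * indicator {a<..<b} x)"
    proof (rule integral_dominated_convergence[where w = "\<lambda>x. \<bar>W x\<bar>"])
      show "(\<lambda>x. W x * indicator {a<..<b} x) \<in> borel_measurable lborel" using W by simp
      show "(\<lambda>x. W x * \<theta> n x) \<in> borel_measurable lborel" for n
        using W pcont_measurable[OF pC1_pcont(1)[OF t(1)]] by simp
      show "AE x in lborel. (\<lambda>n. W x * \<theta> n x) \<longlonglongrightarrow> W x * indicator {a<..<b} x"
      proof (rule AE_I2)
        show "(\<lambda>n. W x * \<theta> n x) \<longlonglongrightarrow> W x * indicator {a<..<b} x" for x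
          using tendsto_mult_left[OF t(3)[of x], of "W x"] out[of x] by (cases "x \<in> {0..1}") simp_all
      qed
      show "AE x in lborel. norm (W x * \<theta> n x) \<le> \<bar>W x\<bar>" for n
      proof (rule AE_I2)
        show "norm (W x * \<theta> n x) \<le> \<bar>W x\<bar>" for x
          using t(2)[of n x] by (simp add: abs_mult mult_left_le)
      qed
    qed (use W in auto)
    moreover have "(LINT x|lborel. W x * \<theta> n x) = 0" for n by (rule test_orthogonal_pC1[OF W z t(1)])
    ultimately show ?thesis by (simp add: LIMSEQ_const_iff)
  qed
  have iv: "(LINT x:{a..b}|lborel. W x) = 0" for a b :: real
  proof -
    \<comment> \<open>Since \<open>W\<close> vanishes outside the unit interval, any interval may be
      clipped to it; the endpoints form a null set.\<close>
    define a' b' where "a' = max a 0" and "b' = min b 1"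
    have ae: "AE x in lborel. x \<noteq> a \<and> x \<noteq> b \<and> x \<noteq> 0 \<and> x \<noteq> 1"
      using AE_lborel_singleton[of a] AE_lborel_singleton[of b] AE_lborel_singleton[of 0] AE_lborel_singleton[of 1]
      by eventually_elim auto
    have "(LINT x:{a..b}|lborel. W x) = (LINT x|lborel. W x * indicator {a'<..<b'} x)"
      unfolding set_lebesgue_integral_def
    proof (rule integral_cong_AE)
      show "AE x in lborel. indicat_real {a..b} x *\<^sub>R W x = W x * indicator {a'<..<b'} x"
        using ae
      proof eventually_elim
        case (elim x)
        then show ?case using out[of x] by (cases "x \<in> {0..1}") (auto simp: a'_def b'_def indicator_def)
      qed
    qed (use W in auto)
    also have "\<dots> = 0"
    proof (cases "a' < b'")
      case True then show ?thesis by (intro sub) (auto simp: a'_def b'_def)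
    next
      case False then show ?thesis by simp
    qed
    finally show ?thesis .
  qed
  have all: "(LINT x|lborel. W x) = 0" using z[of "\<lambda>x. 1"] test_fun_trig[of 1 0 0] by simp
  have si: "set_integrable lborel A W" if "A \<in> sets borel" for A
    using W that unfolding set_integrable_def by (intro integrable_mult_indicator) auto
  have borel: "(LINT x:A|lborel. W x) = 0" if "A \<in> sets borel" for A
    using that
  proof (induction rule: borel_set_induct)
    case empty then show ?case by (simp add: set_lebesgue_integral_def)
  next
    case (interval a b) show ?case by (rule iv)
  next
    case (compl A)
    have "(LINT x:(A \<union> - A)|lborel. W x) = (LINT x:A|lborel. W x) + (LINT x:- A|lborel. W x)"
      using compl by (intro set_integral_Un si) auto
    then show ?case using compl all by (simp add: set_lebesgue_integral_def Compl_eq_Diff_UNIV)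
  next
    case (union A)
    then show ?case
      by (subst lebesgue_integral_countable_add) (auto simp: disjoint_family_on_def intro!: si)
  qed
  show ?thesis
    by (rule density_unique_real[OF W, of "\<lambda>x. 0"]) (use borel in \<open>auto simp: set_lebesgue_integral_def\<close>)
qed

text \<open>The difference of \<open>f\<close> and any other square integrable representative is
  orthogonal to all test functions. So the choice in \<open>L2_rep\<close> can only change
  \<open>f\<close> on a null set, and \<open>pd_mult\<close> becomes the pointwise product.\<close>

lemma L2_rep_pd_of_fun:
  assumes f: "pcont f"
  shows "L2_rep (pd_of_fun f) \<in> borel_measurable lborel"
    "AE x in lborel. x \<in> {0..1} \<longrightarrow> L2_rep (pd_of_fun f) x = f x"
proof -
  define g where "g = L2_rep (pd_of_fun f)"
  have "\<exists>g. g \<in> borel_measurable lborel \<and> set_integrable lborel {0..1} (\<lambda>x. (g x)\<^sup>2) \<and> pd_of_fun g = pd_of_fun f"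
    using pcont_measurable[OF f] set_integrable_pcont[OF pcont_power[OF f]] by blast
  from someI_ex[OF this] have g: "g \<in> borel_measurable lborel"
    "set_integrable lborel {0..1} (\<lambda>x. (g x)\<^sup>2)" "pd_of_fun g = pd_of_fun f"
    by (auto simp: g_def L2_rep_def)
  show "L2_rep (pd_of_fun f) \<in> borel_measurable lborel" using g(1) by (simp add: g_def)
  have gi: "set_integrable lborel {0..1} g"
    unfolding set_integrable_def
  proof (rule Bochner_Integration.integrable_bound)
    show "integrable lborel (\<lambda>x. indicat_real {0..1} x *\<^sub>R (1::real) + indicat_real {0..1} x *\<^sub>R (g x)\<^sup>2)"
      using g(2) set_integrable_pcont[OF pcont_const, of 0 1 "1::real"] unfolding set_integrable_def
      by (intro Bochner_Integration.integrable_add)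
    have "norm (indicat_real {0..1} x *\<^sub>R g x) \<le> norm (indicat_real {0..1} x *\<^sub>R (1::real) + indicat_real {0..1} x *\<^sub>R (g x)\<^sup>2)" for x
    proof -
      have "\<bar>g x\<bar> \<le> 1 + (g x)\<^sup>2"
        using sum_power2_ge_zero[of "\<bar>g x\<bar> - 1/2" 0] by (simp add: power2_eq_square algebra_simps)
      then show ?thesis by (auto simp: indicator_def)
    qed
    then show "AE x in lborel. norm (indicat_real {0..1} x *\<^sub>R g x)
        \<le> norm (indicat_real {0..1} x *\<^sub>R (1::real) + indicat_real {0..1} x *\<^sub>R (g x)\<^sup>2)" by simp
  qed (use g(1) in auto)
  define W where "W x = indicator {0..1} x * (g x - f x)" for x
  have Wi: "integrable lborel W"
    using set_integral_diff(1)[OF gi set_integrable_pcont[OF f]] by (simp add: set_integrable_def W_def[abs_def])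
  have "AE x in lborel. W x = 0"
  proof (rule AE_zero_test_orthogonal[OF Wi])
    fix \<psi> assume t: "test_fun \<psi>"
    obtain M where M: "\<And>x. norm (\<psi> x) \<le> M" using pcont_bounded[OF pC1_pcont(1)[OF test_fun_pC1[OF t]]] by blast
    have m: "\<psi> \<in> borel_measurable lborel" by (rule pcont_measurable[OF pC1_pcont(1)[OF test_fun_pC1[OF t]]])
    have sp: "set_integrable lborel {0..1} (\<lambda>x. h x * \<psi> x)" if "set_integrable lborel {0..1} h" for h
      using integrable_mult_bounded[OF that[unfolded set_integrable_def] m, of M] M
      by (simp add: set_integrable_def mult.assoc)
    have "pairing (pd_of_fun g) \<psi> = pairing (pd_of_fun f) \<psi>" using g(3) by simp
    then have "(LBINT x:{0..1}. g x * \<psi> x) = (LBINT x:{0..1}. f x * \<psi> x)"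
      using gi t set_integrable_pcont[OF f] by (simp add: pd_of_fun.rep_eq)
    then have "(LBINT x:{0..1}. g x * \<psi> x - f x * \<psi> x) = 0"
      using set_integral_diff(2)[OF sp[OF gi] sp[OF set_integrable_pcont[OF f]]] by simp
    then show "(LINT x|lborel. W x * \<psi> x) = 0"
      by (simp add: set_lebesgue_integral_def W_def algebra_simps)
  qed (simp add: W_def)
  then show "AE x in lborel. x \<in> {0..1} \<longrightarrow> L2_rep (pd_of_fun f) x = f x"
    by eventually_elim (auto simp: W_def g_def)
qed

lemma pd_of_fun_cong_AE:
  assumes m: "f \<in> borel_measurable lborel" "g \<in> borel_measurable lborel"
    and ae: "AE x in lborel. x \<in> {0..1} \<longrightarrow> f x = g x"
  shows "pd_of_fun f = pd_of_fun g"
proof -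
  have i: "set_integrable lborel {0..1} f \<longleftrightarrow> set_integrable lborel {0..1} g"
    unfolding set_integrable_def using m ae by (intro integrable_cong_AE) (auto simp: indicator_def)
  have "(LBINT x:{0..1}. f x * \<psi> x) = (LBINT x:{0..1}. g x * \<psi> x)" if t: "test_fun \<psi>" for \<psi>
    unfolding set_lebesgue_integral_def
    using m ae pcont_measurable[OF pC1_pcont(1)[OF test_fun_pC1[OF t]]]
    by (intro integral_cong_AE) (auto simp: indicator_def)
  then have "pairing (pd_of_fun f) = pairing (pd_of_fun g)"
    using i by (auto simp: pd_of_fun.rep_eq fun_eq_iff)
  then show ?thesis by (simp add: pairing_inject)
qed

lemma pd_mult_pd_of_fun:
  assumes "pcont f" "pcont g"
  shows "pd_mult (pd_of_fun f) (pd_of_fun g) = pd_of_fun (\<lambda>x. f x * g x)"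
  unfolding pd_mult_def
proof (rule pd_of_fun_cong_AE)
  show "AE x in lborel. x \<in> {0..1} \<longrightarrow> L2_rep (pd_of_fun f) x * L2_rep (pd_of_fun g) x = f x * g x"
    using L2_rep_pd_of_fun(2)[OF assms(1)] L2_rep_pd_of_fun(2)[OF assms(2)] by eventually_elim auto
qed (use L2_rep_pd_of_fun(1) pcont_measurable assms in \<open>auto intro!: borel_measurable_times\<close>)

text \<open>The coefficients of a real distribution are conjugate symmetric and the symbols are
  even, so every block is real and so is the continuous sum of the blocks.\<close>

lemma besov_half_continuous:
  assumes "S \<in> besov chi phi (1/2)"
  obtains f where "pcont f" "S = pd_of_fun f" "bfin (sqrt 2) (rfc f)"
proof -
  define c where "c = fourier_coeff S"
  have c: "bfin (sqrt 2) c" using assms by (simp add: besov_iff c_def powr_half_sqrt)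
  define g where "g = (\<lambda>x. \<Sum>n. blk n c x)"
  note g = blk_series[OF c, folded g_def]
  have "cnj (blk n c x) = blk n c x" for n x
  proof -
    have "cnj (blk n c x) = (\<Sum>k\<in>supp n. of_real (sg n (- k)) * c (- k) * wave (- k) x)"
      unfolding blk_def cnj_sum by (simp add: sg_minus cnj_wave c_def fourier_coeff_cnj)
    also have "\<dots> = (\<Sum>k\<in>uminus ` supp n. of_real (sg n k) * c k * wave k x)"
      by (subst sum.reindex) auto
    also have "uminus ` supp n = supp n"
      by (auto simp: supp_def sg_minus image_iff) (metis minus_minus sg_minus)
    finally show ?thesis by (simp add: blk_def)
  qed
  then have "cnj (g x) = g x" for x
    using sums_cnj[of "\<lambda>n. blk n c x" "g x"] blk_series(3)[OF c, of x] sums_unique2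
    by (simp add: g_def)
  then have ge: "g = (\<lambda>x. of_real (Re (g x)))"
    by (metis Reals_cnj_iff of_real_Re)
  define f where "f x = Re (g x)" for x
  have f: "pcont f" unfolding f_def[abs_def] using g(1) by auto
  have fg: "rfc f = c" using g(2) ge unfolding rfc_def f_def by simp
  have "S = pd_of_fun f"
    by (rule pdist_eqI) (simp add: fourier_coeff_pd_of_fun[OF f] fg c_def)
  then show ?thesis using that f c fg by simp
qed

end

section \<open>The first order resolvents and the velocity\<close>

text \<open>With \<open>q x = x + d x\<close> this is \<open>(1 + \<sigma> \<partial>)\<^sup>-\<^sup>1\<close> applied to the density carried by \<open>g\<close>,
  in Lagrangian coordinates: the periodised kernel is \<open>exp (- \<sigma> (q x - q y))\<close> for \<open>\<sigma> y < \<sigma> x\<close>,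
  reduced to one period.\<close>

definition lag :: "real \<Rightarrow> (real \<Rightarrow> real) \<Rightarrow> (real \<Rightarrow> real) \<Rightarrow> real \<Rightarrow> real" where
  "lag \<sigma> d g x = (1 / (1 - exp (- 1))) *
     integral {0..1} (\<lambda>z. exp (- z + \<sigma> * (d (x - \<sigma> * z) - d x)) * g (x - \<sigma> * z))"

definition res :: "real \<Rightarrow> (real \<Rightarrow> real) \<Rightarrow> real \<Rightarrow> real" where
  "res \<sigma> g = lag \<sigma> (\<lambda>_. 0) g"

lemma exp_m1_less: "exp (- 1) < (1::real)"
  using exp_less_mono[of "-1" "0::real"] by simp

lemma abs_sign_mult: "\<sigma> = 1 \<or> \<sigma> = - 1 \<Longrightarrow> \<bar>\<sigma> * w\<bar> = \<bar>w :: real\<bar>"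
  by auto

lemma pcont_sub: "pcont f \<Longrightarrow> \<sigma> = 1 \<or> \<sigma> = - 1 \<Longrightarrow> f (x - \<sigma>) = f x"
  using pcont_per[of f "x - 1"] pcont_per[of f x] by auto

text \<open>Multiplied by the weight exp (sigma q), the integral becomes an increment of an
  antiderivative of the weighted density. Hence the weighted resolvent is differentiable although
  \<open>d\<close> is merely continuous; \<open>FH_deriv\<close> depends on this.\<close>

lemma lag_exp_deriv:
  assumes d: "pcont d" and g: "pcont g" and \<sigma>: "\<sigma> = 1 \<or> \<sigma> = - 1"
  shows "((\<lambda>x. exp (\<sigma> * (x + d x)) * lag \<sigma> d g x) has_real_derivative
    \<sigma> * (exp (\<sigma> * (x + d x)) * g x)) (at x)"
proof -
  define G where "G y = exp (\<sigma> * (y + d y)) * g y" for y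
  have \<sigma>2: "\<sigma> * \<sigma> = 1" using \<sigma> by auto
  have cG: "continuous_on UNIV G"
    unfolding G_def[abs_def] by (intro continuous_intros pcont_continuous d g)
  obtain \<Gamma> where \<Gamma>: "\<And>x. (\<Gamma> has_vector_derivative G x) (at x)"
    using has_antiderivative[OF cG] by blast
  then have \<Gamma>': "(\<Gamma> has_real_derivative G x) (at x)" for x
    by (simp add: has_real_derivative_iff_has_vector_derivative)
  have GG: "exp (\<sigma> * (x + d x)) * lag \<sigma> d g x = (\<sigma> / (1 - exp (- 1))) * (\<Gamma> x - \<Gamma> (x - \<sigma>))" for x
  proof -
    have "((\<lambda>z. - \<sigma> * \<Gamma> (x - \<sigma> * z)) has_vector_derivative G (x - \<sigma> * z)) (at z)" for z
    proof -
      have "((\<lambda>z. - \<sigma> * \<Gamma> (x - \<sigma> * z)) has_real_derivative - \<sigma> * (G (x - \<sigma> * z) * (- \<sigma>))) (at z)"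
        by (rule DERIV_cmult, rule DERIV_chain2[OF \<Gamma>']) (auto intro!: derivative_eq_intros)
      moreover have "- \<sigma> * (G (x - \<sigma> * z) * (- \<sigma>)) = G (x - \<sigma> * z)" using \<sigma> by auto
      ultimately show ?thesis
        by (simp only: has_real_derivative_iff_has_vector_derivative[symmetric])
    qed
    from integral_deriv[OF this, of 0 1]
    have "integral {0..1} (\<lambda>z. G (x - \<sigma> * z)) = \<sigma> * (\<Gamma> x - \<Gamma> (x - \<sigma>))" by (simp add: algebra_simps)
    moreover have "exp (\<sigma> * (x + d x)) * (exp (- z + \<sigma> * (d (x - \<sigma> * z) - d x)) * g (x - \<sigma> * z)) = G (x - \<sigma> * z)" for z
    proof -
      have "\<sigma> * (x + d x) + (- z + \<sigma> * (d (x - \<sigma> * z) - d x)) = \<sigma> * (x - \<sigma> * z + d (x - \<sigma> * z))"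
        using \<sigma> by (auto simp: algebra_simps)
      then show ?thesis by (simp add: G_def mult.assoc[symmetric] exp_add[symmetric])
    qed
    ultimately show ?thesis unfolding lag_def
      by (subst mult.left_commute, subst integral_mult_right[symmetric]) simp
  qed
  \<comment> \<open>Shifting by a period multiplies the weighted density by 1/e, which cancels the
    normalisation 1 / (1 - exp (- 1)).\<close>
  have "G (x - \<sigma>) = exp (- 1) * G x"
  proof -
    have "exp (\<sigma> * (x - \<sigma> + d x)) = exp (- 1) * exp (\<sigma> * (x + d x))"
      using \<sigma> by (auto simp: exp_add[symmetric] algebra_simps)
    then show ?thesis using pcont_sub[OF d \<sigma>] pcont_sub[OF g \<sigma>] by (simp add: G_def)
  qed
  then have "\<sigma> / (1 - exp (- 1)) * (G x - G (x - \<sigma>) * (1 - 0)) = \<sigma> * G x"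
    using exp_m1_less by (simp add: field_simps)
  moreover have "((\<lambda>x. (\<sigma> / (1 - exp (- 1))) * (\<Gamma> x - \<Gamma> (x - \<sigma>))) has_real_derivative
      \<sigma> / (1 - exp (- 1)) * (G x - G (x - \<sigma>) * (1 - 0))) (at x)"
    by (intro DERIV_cmult DERIV_diff \<Gamma>' DERIV_chain2[OF \<Gamma>'] DERIV_ident DERIV_const)
  ultimately show ?thesis unfolding GG by (simp add: G_def)
qed

lemma lag_per:
  assumes "pcont d" "pcont g" shows "lag \<sigma> d g (x + 1) = lag \<sigma> d g x"
proof -
  have "f (x + 1 - \<sigma> * z) = f (x - \<sigma> * z)" if "pcont f" for f :: "real \<Rightarrow> real" and z
    using pcont_per[OF that, of "x - \<sigma> * z"] by (simp add: algebra_simps)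
  from this[OF assms(1)] this[OF assms(2)] show ?thesis
    unfolding lag_def pcont_per[OF assms(1)] by presburger
qed

lemma pcont_lag:
  assumes d: "pcont d" and g: "pcont g" and \<sigma>: "\<sigma> = 1 \<or> \<sigma> = - 1"
  shows "pcont (lag \<sigma> d g)"
proof -
  have "exp (- y) * (exp y * l) = l" for y l :: real by (simp add: exp_minus)
  then have e: "lag \<sigma> d g = (\<lambda>x. exp (- (\<sigma> * (x + d x))) * (exp (\<sigma> * (x + d x)) * lag \<sigma> d g x))" by presburger
  have "continuous_on UNIV (\<lambda>x. exp (- (\<sigma> * (x + d x))) * (exp (\<sigma> * (x + d x)) * lag \<sigma> d g x))"
  proof (rule continuous_on_mult)
    show "continuous_on UNIV (\<lambda>x. exp (\<sigma> * (x + d x)) * lag \<sigma> d g x)"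
      by (intro continuous_at_imp_continuous_on ballI DERIV_isCont[OF lag_exp_deriv[OF assms]])
  qed (intro continuous_intros pcont_continuous d)
  then have "continuous_on UNIV (lag \<sigma> d g)" unfolding e[symmetric] .
  then show ?thesis using lag_per[OF d g] by (simp add: pcont_def)
qed

text \<open>For differentiable \<open>d\<close> the weight can be divided out. The formula says that
  y = \<open>lag\<close> solves (1 + d') y + sigma y' = g, the equation (1 + sigma d/dx) y = density
  in the coordinate q = x + d.\<close>

lemma lag_pC1:
  assumes d: "pC1 d d'" and g: "pcont g" and \<sigma>: "\<sigma> = 1 \<or> \<sigma> = - 1"
  shows "pC1 (lag \<sigma> d g) (\<lambda>x. \<sigma> * (g x - (1 + d' x) * lag \<sigma> d g x))"
proof (rule pC1_intro)
  note pd = pC1_pcont[OF d]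
  show "lag \<sigma> d g (x + 1) = lag \<sigma> d g x" for x by (rule lag_per[OF pd(1) g])
  show "continuous_on UNIV (\<lambda>x. \<sigma> * (g x - (1 + d' x) * lag \<sigma> d g x))"
    by (intro continuous_intros pcont_continuous g pd pcont_lag \<sigma>)
  fix x
  define E where "E x = exp (\<sigma> * (x + d x))" for x
  have dd: "(d has_real_derivative d' x) (at x)"
    using pC1_deriv[OF d] by (simp add: has_real_derivative_iff_has_vector_derivative)
  have E1: "exp (- (\<sigma> * (x + d x))) * E x = 1" for x by (simp add: E_def exp_minus)
  have e: "lag \<sigma> d g = (\<lambda>x. exp (- (\<sigma> * (x + d x))) * (E x * lag \<sigma> d g x))"
    using E1 by (simp only: mult.assoc[symmetric] mult_1_left)
  have "((\<lambda>x. exp (- (\<sigma> * (x + d x)))) has_real_derivative exp (- (\<sigma> * (x + d x))) * (- (\<sigma> * (1 + d' x)))) (at x)"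
    by (auto intro!: derivative_eq_intros dd)
  from DERIV_mult[OF this lag_exp_deriv[OF pd(1) g \<sigma>, folded E_def]]
  have "((\<lambda>x. exp (- (\<sigma> * (x + d x))) * (E x * lag \<sigma> d g x)) has_real_derivative
      (exp (- (\<sigma> * (x + d x))) * E x) * (- (\<sigma> * (1 + d' x)) * lag \<sigma> d g x)
        + (exp (- (\<sigma> * (x + d x))) * E x) * (\<sigma> * g x)) (at x)"
    by (simp add: algebra_simps)
  then have "(lag \<sigma> d g has_real_derivative - (\<sigma> * (1 + d' x)) * lag \<sigma> d g x + \<sigma> * g x) (at x)"
    unfolding e[symmetric] E1 by simp
  then show "(lag \<sigma> d g has_vector_derivative \<sigma> * (g x - (1 + d' x) * lag \<sigma> d g x)) (at x)"
    by (simp add: has_real_derivative_iff_has_vector_derivative algebra_simps)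
qed

lemma res_pC1:
  assumes "pcont g" "\<sigma> = 1 \<or> \<sigma> = - 1"
  shows "pC1 (res \<sigma> g) (\<lambda>x. \<sigma> * (g x - res \<sigma> g x))"
proof -
  have "pC1 (\<lambda>_. 0) (\<lambda>_. 0 :: real)" by (auto simp: pC1_def)
  from lag_pC1[OF this assms] show ?thesis by (simp add: res_def)
qed

lemma integral_exp_kernel: "integral {0..1} (\<lambda>z. exp (- z)) = 1 - exp (- 1 :: real)"
proof -
  have "((\<lambda>z. - exp (- z)) has_vector_derivative exp (- z)) (at z)" for z :: real
    unfolding has_real_derivative_iff_has_vector_derivative[symmetric] by (auto intro!: derivative_eq_intros)
  from integral_deriv[OF this, of 0 1] show ?thesis by simp
qed

text \<open>After normalisation the kernel exp (- z) has mass 1 on the unit interval.\<close>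

lemma kernel_integral_le:
  assumes f: "continuous_on {0..1} f" "\<And>z. z \<in> {0..1} \<Longrightarrow> \<bar>f z\<bar> \<le> exp (- z) * M"
  shows "\<bar>(1 / (1 - exp (- 1))) * integral {0..1} f\<bar> \<le> (M :: real)"
proof -
  have "norm (integral {0..1} f) \<le> integral {0..1} (\<lambda>z. exp (- z) * M)"
    using f by (intro integral_norm_bound_integral integrable_continuous_real continuous_intros) auto
  also have "\<dots> = (1 - exp (- 1)) * M" by (simp add: integral_exp_kernel)
  finally show ?thesis using exp_m1_less by (simp add: abs_mult field_simps)
qed

lemma exp_half_le: "exp (1/2) \<le> (2::real)"
proof -
  have "exp (1/2) * exp (1/2) = exp (1::real)" by (simp flip: exp_add)
  also have "\<dots> \<le> 2 * 2" using exp_le by linarith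
  finally show ?thesis
    by (metis abs_exp_cancel abs_le_square_iff abs_numeral power2_eq_square)
qed

lemma lag_kernel_continuous:
  assumes d: "pcont d" and g: "pcont g"
  shows "continuous_on A (\<lambda>z. exp (- z + \<sigma> * (d (x - \<sigma> * z) - d x)) * g (x - \<sigma> * z))"
proof -
  have "continuous_on A (\<lambda>z. f (x - \<sigma> * z))" if "pcont f" for f :: "real \<Rightarrow> real"
    by (rule continuous_on_compose2[OF pcont_continuous[OF that, of UNIV]]) (auto intro!: continuous_intros)
  then show ?thesis using assms by (intro continuous_intros) auto
qed

text \<open>The bound 1/4 on \<open>d\<close> keeps the exponent of the distortion below 1/2, and
  exp (1/2) is at most 2.\<close>

lemma lag_bound:
  assumes d: "pcont d" "\<And>x. \<bar>d x\<bar> \<le> 1/4" and g: "pcont g" "\<And>x. \<bar>g x\<bar> \<le> \<mu>" and \<sigma>: "\<sigma> = 1 \<or> \<sigma> = - 1"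
  shows "\<bar>lag \<sigma> d g x\<bar> \<le> 2 * \<mu>"
  unfolding lag_def
proof (rule kernel_integral_le[OF lag_kernel_continuous[OF d(1) g(1)]])
  fix z :: real
  have "\<bar>\<sigma> * (d (x - \<sigma> * z) - d x)\<bar> \<le> 1/2"
    unfolding abs_sign_mult[OF \<sigma>] using d(2)[of "x - \<sigma> * z"] d(2)[of x] by linarith
  then have "exp (\<sigma> * (d (x - \<sigma> * z) - d x)) \<le> exp (1/2)" by (subst exp_le_cancel_iff) simp
  also have "\<dots> \<le> 2" by (rule exp_half_le)
  finally have e: "exp (\<sigma> * (d (x - \<sigma> * z) - d x)) \<le> 2" .
  have "0 \<le> \<mu>" using g(2)[of 0] by linarith
  then have "exp (\<sigma> * (d (x - \<sigma> * z) - d x)) * \<bar>g (x - \<sigma> * z)\<bar> \<le> 2 * \<mu>"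
    using e g(2) by (intro mult_mono) auto
  then have "exp (- z) * (exp (\<sigma> * (d (x - \<sigma> * z) - d x)) * \<bar>g (x - \<sigma> * z)\<bar>) \<le> exp (- z) * (2 * \<mu>)"
    by (intro mult_left_mono) auto
  then show "\<bar>exp (- z + \<sigma> * (d (x - \<sigma> * z) - d x)) * g (x - \<sigma> * z)\<bar> \<le> exp (- z) * (2 * \<mu>)"
    by (simp only: abs_mult exp_add mult.assoc abs_exp_cancel)
qed

lemma exp_diff_le:
  fixes a b :: real
  assumes "a \<le> 1/2" "b \<le> 1/2" shows "\<bar>exp a - exp b\<bar> \<le> 2 * \<bar>a - b\<bar>"
proof -
  have *: "exp a - exp b \<le> 2 * (a - b)" if "b \<le> a" "a \<le> 1/2" for a b :: real
  proof -
    have "1 + (b - a) \<le> exp (b - a)" by (rule exp_ge_add_one_self)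
    then have "exp a * (1 + (b - a)) \<le> exp a * exp (b - a)" by (rule mult_left_mono) simp
    then have "exp a - exp b \<le> exp a * (a - b)" by (simp add: exp_diff algebra_simps)
    also have "\<dots> \<le> 2 * (a - b)"
      using that exp_half_le exp_le_cancel_iff[of a "1/2"] by (intro mult_right_mono) linarith+
    finally show ?thesis .
  qed
  show ?thesis using *[of b a] *[of a b] assms exp_le_cancel_iff[of a b] exp_le_cancel_iff[of b a]
    by (cases "b \<le> a") auto
qed

text \<open>The factor 4 combines the slope bound 2 of exp below 1/2 with the two occurrences of the
  displacement in the exponent.\<close>

lemma lag_lipschitz:
  assumes d: "pcont d" "\<And>x. \<bar>d x\<bar> \<le> 1/4" and e: "pcont e" "\<And>x. \<bar>e x\<bar> \<le> 1/4"
    and g: "pcont g" "\<And>x. \<bar>g x\<bar> \<le> \<mu>" and \<sigma>: "\<sigma> = 1 \<or> \<sigma> = - 1"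
    and de: "\<And>x. \<bar>d x - e x\<bar> \<le> \<delta>"
  shows "\<bar>lag \<sigma> d g x - lag \<sigma> e g x\<bar> \<le> 4 * \<mu> * \<delta>"
proof -
  let ?k = "\<lambda>d z. exp (- z + \<sigma> * (d (x - \<sigma> * z) - d x)) * g (x - \<sigma> * z)"
  have i: "?k d integrable_on {0..1}" "?k e integrable_on {0..1}"
    by (intro integrable_continuous_real lag_kernel_continuous d e g)+
  have "lag \<sigma> d g x - lag \<sigma> e g x = (1 / (1 - exp (- 1))) * integral {0..1} (\<lambda>z. ?k d z - ?k e z)"
    unfolding lag_def using Henstock_Kurzweil_Integration.integral_diff[OF i] by (simp add: right_diff_distrib)
  also have "\<bar>\<dots>\<bar> \<le> 4 * \<mu> * \<delta>"
  proof (rule kernel_integral_le)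
    show "continuous_on {0..1} (\<lambda>z. ?k d z - ?k e z)"
      by (intro continuous_on_diff lag_kernel_continuous d e g)
    fix z :: real
    let ?a = "\<sigma> * (d (x - \<sigma> * z) - d x)" and ?b = "\<sigma> * (e (x - \<sigma> * z) - e x)"
    have "\<bar>?a\<bar> \<le> 1/2" "\<bar>?b\<bar> \<le> 1/2"
      unfolding abs_sign_mult[OF \<sigma>]
      using d(2)[of "x - \<sigma> * z"] d(2)[of x] e(2)[of "x - \<sigma> * z"] e(2)[of x] by linarith+
    then have "\<bar>exp ?a - exp ?b\<bar> \<le> 2 * \<bar>?a - ?b\<bar>" by (intro exp_diff_le) auto
    also have "?a - ?b = \<sigma> * ((d (x - \<sigma> * z) - e (x - \<sigma> * z)) - (d x - e x))" by (simp add: algebra_simps)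
    also have "\<bar>\<dots>\<bar> \<le> 2 * \<delta>"
      unfolding abs_sign_mult[OF \<sigma>] using de[of "x - \<sigma> * z"] de[of x] by linarith
    finally have "\<bar>exp ?a - exp ?b\<bar> \<le> 4 * \<delta>" by simp
    moreover have "0 \<le> \<mu>" "0 \<le> \<delta>" using g(2)[of 0] de[of 0] by linarith+
    ultimately have "\<bar>exp ?a - exp ?b\<bar> * \<bar>g (x - \<sigma> * z)\<bar> \<le> (4 * \<delta>) * \<mu>"
      using g(2) by (intro mult_mono) auto
    then have "exp (- z) * (\<bar>exp ?a - exp ?b\<bar> * \<bar>g (x - \<sigma> * z)\<bar>) \<le> exp (- z) * (4 * \<mu> * \<delta>)"
      by (intro mult_left_mono) (auto simp: mult_ac)
    moreover have "?k d z - ?k e z = exp (- z) * ((exp ?a - exp ?b) * g (x - \<sigma> * z))"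
      by (simp only: exp_add) (simp add: algebra_simps)
    ultimately show "\<bar>?k d z - ?k e z\<bar> \<le> exp (- z) * (4 * \<mu> * \<delta>)" by (simp add: abs_mult)
  qed
  finally show ?thesis .
qed

lemma res_bound:
  assumes "pcont g" "\<And>x. \<bar>g x\<bar> \<le> \<mu>" "\<sigma> = 1 \<or> \<sigma> = - 1"
  shows "\<bar>res \<sigma> g x\<bar> \<le> 2 * \<mu>"
  unfolding res_def by (rule lag_bound) (use assms in auto)

lemma res_linear:
  assumes "pcont f" "pcont g"
  shows "res \<sigma> (\<lambda>x. a * f x + b * g x) x = a * res \<sigma> f x + b * res \<sigma> g x"
proof -
  have i: "(\<lambda>z. exp (- z) * f (x - \<sigma> * z)) integrable_on {0..1}" if "pcont f" for f
    using lag_kernel_continuous[OF pcont_const[of 0] that, of "{0..1}" \<sigma> x] by (intro integrable_continuous_real) simp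
  have "((\<lambda>z. a * (exp (- z) * f (x - \<sigma> * z)) + b * (exp (- z) * g (x - \<sigma> * z))) has_integral
      a * integral {0..1} (\<lambda>z. exp (- z) * f (x - \<sigma> * z)) + b * integral {0..1} (\<lambda>z. exp (- z) * g (x - \<sigma> * z))) {0..1}"
    by (intro has_integral_add has_integral_mult_right integrable_integral i assms)
  from integral_unique[OF this]
  have "integral {0..1} (\<lambda>z. exp (- z) * (a * f (x - \<sigma> * z) + b * g (x - \<sigma> * z)))
      = a * integral {0..1} (\<lambda>z. exp (- z) * f (x - \<sigma> * z)) + b * integral {0..1} (\<lambda>z. exp (- z) * g (x - \<sigma> * z))"
    by (simp only: distrib_left mult.left_commute[of "exp _"])
  then show ?thesis unfolding res_def lag_def by (simp add: add_divide_distrib)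
qed

section \<open>The velocity as a product of two resolvents\<close>

context littlewood_paley
begin

text \<open>\<open>helmholtz_inv\<close> is an inverse by choice, so its value is known once a
  preimage is exhibited and the operator is injective. Injectivity holds because the symbol 1 + (2
  pi k)^2 never vanishes.\<close>

lemma helmholtz_inv_eq:
  assumes "U - pd_deriv (pd_deriv U) = S" shows "helmholtz_inv S = U"
proof -
  have "inj (\<lambda>U. U - pd_deriv (pd_deriv U))"
  proof (rule injI, rule pdist_eqI)
    fix U V k
    assume e: "U - pd_deriv (pd_deriv U) = V - pd_deriv (pd_deriv V)"
    have c: "fourier_coeff (U - pd_deriv (pd_deriv U)) k = of_real (1 + (2 * pi * of_int k)\<^sup>2) * fourier_coeff U k" for U
      by (simp add: fourier_coeff_diff fourier_coeff_deriv algebra_simps power2_eq_square)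
    have "(1 + (2 * pi * of_int k)\<^sup>2) \<noteq> (0::real)" by (simp add: add_nonneg_eq_0_iff)
    then show "fourier_coeff U k = fourier_coeff V k" using e c[of U] c[of V]
      by (metis mult_left_cancel of_real_eq_0_iff)
  qed
  then show ?thesis unfolding helmholtz_inv_def using assms inv_f_f by fastforce
qed

text \<open>The second order operator factors as (1 + sigma d/dx) (1 - sigma d/dx). So its inverse
  is a composition of two resolvents, and applying 1 - sigma d/dx again leaves
  \<open>res \<sigma> m\<close>.\<close>

lemma helmholtz_resolvent:
  assumes m: "pcont m" and \<sigma>: "\<sigma> = 1 \<or> \<sigma> = - 1"
  shows "helmholtz_inv (pd_of_fun m) - \<sigma> *\<^sub>R pd_deriv (helmholtz_inv (pd_of_fun m)) = pd_of_fun (res \<sigma> m)"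
proof -
  define a where "a = res \<sigma> m"
  define u where "u = res (- \<sigma>) a"
  have a: "pC1 a (\<lambda>x. \<sigma> * (m x - a x))" unfolding a_def by (rule res_pC1[OF m \<sigma>])
  note pa = pC1_pcont(1)[OF a]
  have u: "pC1 u (\<lambda>x. - \<sigma> * (a x - u x))" unfolding u_def by (rule res_pC1[OF pa]) (use \<sigma> in auto)
  have u': "pC1 (\<lambda>x. - \<sigma> * (a x - u x)) (\<lambda>x. - \<sigma> * (\<sigma> * (m x - a x) - (- \<sigma> * (a x - u x))))"
    by (intro pC1_cmult pC1_diff a u)
  have e: "(\<lambda>x. - \<sigma> * (\<sigma> * (m x - a x) - (- \<sigma> * (a x - u x)))) = (\<lambda>x. u x - m x)"
    using \<sigma> by (auto simp: algebra_simps)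
  note pu = pC1_pcont(1)[OF u]
  have "pd_of_fun u - pd_deriv (pd_deriv (pd_of_fun u)) = pd_of_fun m"
    unfolding pd_deriv_pd_of_fun[OF u] pd_deriv_pd_of_fun[OF u'] e pd_of_fun_diff[OF pu m] by simp
  then have h: "helmholtz_inv (pd_of_fun m) = pd_of_fun u" by (rule helmholtz_inv_eq)
  have "pd_of_fun u - \<sigma> *\<^sub>R pd_of_fun (\<lambda>x. - \<sigma> * (a x - u x)) = pd_of_fun (\<lambda>x. u x - \<sigma> * (- \<sigma> * (a x - u x)))"
    by (subst pd_of_fun_diff[OF pu pcont_mult[OF pcont_const pC1_pcont(2)[OF u]]],
        subst pd_of_fun_cmult[OF pC1_pcont(2)[OF u]]) simp
  also have "(\<lambda>x. u x - \<sigma> * (- \<sigma> * (a x - u x))) = a" using \<sigma> by auto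
  finally show ?thesis unfolding h pd_deriv_pd_of_fun[OF u] a_def .
qed

lemma sqq_velocity_eq:
  assumes m: "pcont m" and n: "pcont n"
  shows "sqq_velocity (pd_of_fun m) (pd_of_fun n) = pd_of_fun (\<lambda>x. res 1 m x * res (- 1) n x)"
proof -
  have "helmholtz_inv (pd_of_fun m) - pd_deriv (helmholtz_inv (pd_of_fun m)) = pd_of_fun (res 1 m)"
    "helmholtz_inv (pd_of_fun n) + pd_deriv (helmholtz_inv (pd_of_fun n)) = pd_of_fun (res (- 1) n)"
    using helmholtz_resolvent[OF m, of 1] helmholtz_resolvent[OF n, of "- 1"] by simp_all
  then show ?thesis
    unfolding sqq_velocity_def Let_def
    using pC1_pcont(1)[OF res_pC1[OF m, of 1]] pC1_pcont(1)[OF res_pC1[OF n, of "- 1"]]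
    by (simp add: pd_mult_pd_of_fun)
qed

lemma rfc_res:
  assumes "pcont g" "\<sigma> = 1 \<or> \<sigma> = - 1"
  shows "(1 + 2 * pi * \<i> * of_int k * \<sigma>) * rfc (res \<sigma> g) k = rfc g k"
proof -
  have p: "pC1 (res \<sigma> g) (\<lambda>x. \<sigma> * (g x - res \<sigma> g x))" by (rule res_pC1[OF assms])
  have "2 * pi * \<i> * of_int k * rfc (res \<sigma> g) k = \<sigma> * (rfc g k - rfc (res \<sigma> g) k)"
    using rfc_deriv[OF p, of k] pC1_pcont(1)[OF p] assms(1) by (simp add: rfc_cmult rfc_diff)
  then show ?thesis using assms(2) by (auto simp: algebra_simps)
qed

lemma norm_resolvent_symbol:
  fixes k :: int and \<sigma> :: real
  assumes "\<sigma> = 1 \<or> \<sigma> = - 1"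
  shows "1 \<le> cmod (1 + 2 * pi * \<i> * of_int k * \<sigma>)" "\<bar>2 * pi * of_int k\<bar> \<le> cmod (1 + 2 * pi * \<i> * of_int k * \<sigma>)"
proof -
  have "1 + 2 * pi * \<i> * of_int k * \<sigma> = Complex 1 (2 * pi * of_int k * \<sigma>)" by (simp add: complex_eq_iff)
  then show "1 \<le> cmod (1 + 2 * pi * \<i> * of_int k * \<sigma>)" "\<bar>2 * pi * of_int k\<bar> \<le> cmod (1 + 2 * pi * \<i> * of_int k * \<sigma>)"
    using abs_Re_le_cmod[of "1 + 2 * pi * \<i> * of_int k * \<sigma>"] abs_Im_le_cmod[of "1 + 2 * pi * \<i> * of_int k * \<sigma>"] assms
    by (auto simp: abs_mult)
qed

text \<open>On block \<open>n > 0\<close> the symbol is at least 3/8 * 2^n in modulus, so the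
  resolvent gains one derivative; 8/3 is rounded to 3. Block 0 is covered by the bound 1 on the
  inverse symbol.\<close>

lemma bt_resolvent:
  fixes \<sigma> :: real
  assumes c: "\<And>k. (1 + 2 * pi * \<i> * of_int k * \<sigma>) * c' k = c k" and \<sigma>: "\<sigma> = 1 \<or> \<sigma> = - 1"
  shows "bt n c' \<le> bt n c" "bt n c' \<le> 3 / 2 ^ n * bt n c"
proof -
  have k: "cmod (c k) = cmod (1 + 2 * pi * \<i> * of_int k * \<sigma>) * cmod (c' k)" for k
    using c[of k] by (metis norm_mult)
  have 1: "cmod (c' k) \<le> 1 * cmod (c k)" for k
    unfolding k using mult_right_mono[OF norm_resolvent_symbol(1)[OF \<sigma>], of "cmod (c' k)" k] by simp
  then show b: "bt n c' \<le> bt n c" using bt_mono[of n c' 1 c] by simp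
  show "bt n c' \<le> 3 / 2 ^ n * bt n c"
  proof (cases "n = 0")
    case True 
    moreover have "bt n c' \<le> 3 * bt n c" using b bt_nonneg[of n c] by linarith
    ultimately show ?thesis by simp
  next
    case False
    show ?thesis
    proof (rule bt_mono)
      fix k assume "k \<in> supp n"
      then have "3/8 * 2 ^ n * cmod (c' k) \<le> cmod (c k)"
        unfolding k using order_trans[OF supp_lower[OF _ False] norm_resolvent_symbol(2)[OF \<sigma>]]
        by (intro mult_right_mono) auto
      then have "2 ^ n * cmod (c' k) \<le> 3 * cmod (c k)" using norm_ge_zero[of "c k"] by linarith
      then show "cmod (c' k) \<le> 3 / 2 ^ n * cmod (c k)" by (simp add: field_simps)
    qed simp
  qed
qed

end

section \<open>Real functions of finite Besov norm\<close>

text \<open>A slope of at least 1/2 makes \<open>q\<close> expand distances by at least 1/2; this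
  gives injectivity, the intermediate value theorem on a large interval, and the Lipschitz constant
  2 of the inverse.\<close>

lemma circle_diffeo_inverse:
  fixes q q' :: "real \<Rightarrow> real"
  assumes per: "\<And>x. q (x + 1) = q x + 1" and d: "\<And>x. (q has_real_derivative q' x) (at x)"
    and lb: "\<And>x. 1/2 \<le> q' x"
  defines "p \<equiv> inv q"
  shows "q (p x) = x" "p (q x) = x" "p (x + 1) = p x + 1"
    "(p has_real_derivative 1 / q' (p x)) (at x)" "\<bar>p x - p y\<bar> \<le> 2 * \<bar>x - y\<bar>"
proof -
  have cont: "isCont q x" for x using d DERIV_isCont by blast
  have grow: "(y - x) / 2 \<le> q y - q x" if xy: "x \<le> y" for x y
  proof (cases "x = y")
    case False
    then have "x < y" using xy by simp
    then obtain z where "q y - q x = (y - x) * q' z" using MVT2[of x y q q'] d by auto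
    then show ?thesis using lb[of z] xy mult_left_mono[of "1/2" "q' z" "y - x"] by simp
  qed simp
  have inj: "inj q"
  proof (rule injI)
    fix x y assume e: "q x = q y"
    show "x = y"
    proof (rule antisym; rule ccontr)
      assume *: "\<not> x \<le> y"
      then have "y \<le> x" by simp
      from grow[OF this] * show False unfolding e by simp
    next
      assume *: "\<not> y \<le> x"
      then have "x \<le> y" by simp
      from grow[OF this] * show False unfolding e by simp
    qed
  qed
  have surj: "\<exists>x. q x = y" for y
  proof -
    define R where "R = 2 * \<bar>y - q 0\<bar>"
    have R: "0 \<le> R" by (simp add: R_def)
    have "q (- R) \<le> y" "y \<le> q R"
      using grow[of "- R" 0] grow[of 0 R] R unfolding R_def by (auto simp: field_simps)
    moreover have "- R \<le> R" using R by simp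
    ultimately have "\<exists>x. - R \<le> x \<and> x \<le> R \<and> q x = y"
      using cont by (intro IVT) auto
    then show ?thesis by blast
  qed
  have qp: "q (p x) = x" for x unfolding p_def using surj by (intro f_inv_into_f) (auto simp: image_iff, metis)
  have pq: "p (q x) = x" for x unfolding p_def using inj by simp
  show "q (p x) = x" "p (q x) = x" using qp pq by auto
  show "p (x + 1) = p x + 1" using pq[of "p x + 1"] per[of "p x"] qp[of x] by simp
  have lip: "\<bar>p x - p y\<bar> \<le> 2 * \<bar>x - y\<bar>" for x y
    using grow[of "p x" "p y"] grow[of "p y" "p x"] qp[of x] qp[of y] by (cases "p x \<le> p y") auto
  then show "\<bar>p x - p y\<bar> \<le> 2 * \<bar>x - y\<bar>" .
  have "isCont p x"
    unfolding continuous_at_eps_delta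
  proof (intro allI impI)
    fix e :: real assume e: "e > 0"
    show "\<exists>d>0. \<forall>x'. dist x' x < d \<longrightarrow> dist (p x') (p x) < e"
    proof (intro exI[of _ "e / 2"] conjI allI impI)
      fix x' assume "dist x' x < e / 2"
      then have "2 * \<bar>x' - x\<bar> < e" by (simp add: dist_real_def)
      with lip[of x' x] show "dist (p x') (p x) < e" unfolding dist_real_def by (rule le_less_trans)
    qed (use e in simp)
  qed
  moreover have "q' (p x) \<noteq> 0" using lb[of "p x"] by linarith
  ultimately have "(p has_real_derivative inverse (q' (p x))) (at x)"
    using d qp by (intro DERIV_inverse_function[of q "q' (p x)" p x "x - 1" "x + 1"]) auto
  then show "(p has_real_derivative 1 / q' (p x)) (at x)" by (simp add: inverse_eq_divide)
qed

text \<open>The substitution x = q y produces the Jacobian, at most 2, in the squared norm.\<close>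

lemma l2_compose_inverse:
  fixes q q' :: "real \<Rightarrow> real"
  assumes per: "\<And>x. q (x + 1) = q x + 1" and d: "\<And>x. (q has_real_derivative q' x) (at x)"
    and lb: "\<And>x. 1/2 \<le> q' x" and ub: "\<And>x. q' x \<le> 2" and c: "continuous_on UNIV q'" and h: "pcont h"
  shows "l2 (\<lambda>x. h (inv q x)) \<le> 2 * l2 h"
proof -
  note inv = circle_diffeo_inverse[OF per d lb]
  have cp: "continuous_on UNIV (inv q)"
    by (intro continuous_at_imp_continuous_on ballI DERIV_isCont[OF inv(4)])
  have hp: "pcont (\<lambda>x. h (inv q x))" by (rule pcont_compose[OF h cp inv(3)])
  have q'p: "pcont q'" using pC1_pcont(2)[OF pC1_intro[of "\<lambda>x. q x - x" "\<lambda>x. q' x - 1"]] 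
  proof -
    have "pC1 (\<lambda>x. q x - x) (\<lambda>x. q' x - 1)"
    proof (rule pC1_intro)
      show "((\<lambda>x. q x - x) has_vector_derivative q' x - 1) (at x)" for x
        unfolding has_real_derivative_iff_has_vector_derivative[symmetric] by (intro DERIV_diff d DERIV_ident)
    qed (use per c in \<open>auto intro!: continuous_intros\<close>)
    from pC1_pcont(2)[OF this] have "pcont (\<lambda>x. (q' x - 1) + 1)" by (intro pcont_add) auto
    then show ?thesis by simp
  qed
  have "(l2 (\<lambda>x. h (inv q x)))\<^sup>2 = integral {0..1} (\<lambda>x. (cmod (h (inv q x)))\<^sup>2)"
    using hp by (rule l2_square)
  also have "\<dots> = integral {0..1} (\<lambda>x. q' x *\<^sub>R (cmod (h (inv q (q x))))\<^sup>2)"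
    by (rule integral_periodic_substitution[symmetric, OF _ per d]) (use hp in auto)
  also have "\<dots> \<le> integral {0..1} (\<lambda>x. 2 * (cmod (h x))\<^sup>2)"
    unfolding inv(2)
    by (intro integral_le pcont_integrable) (use h q'p ub in \<open>auto intro!: mult_right_mono\<close>)
  also have "\<dots> \<le> (2 * l2 h)\<^sup>2"
    using l2_square[OF h] zero_le_power2[of "l2 h"] by (simp add: power_mult_distrib)
  finally show ?thesis by (rule power2_le_imp_le) simp
qed

section \<open>Continuity of composition in the Besov norm\<close>

context littlewood_paley
begin

text \<open>Neighbouring blocks overlap, so the norm of the remainder is not literally a tail of the
  series for the norm. The remaining blocks are treated as atoms, and 14 + 11 * 4/3 is rounded to
  30.\<close>

lemma bn_tail_small:
  assumes f: "pcont f" "bfin (sqrt 2) (fc f)" and e: "0 < e"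
  obtains N where "bfin (sqrt 2) (fc (\<lambda>x. f x - (\<Sum>n<N. blk n (fc f) x)))"
    "bn (sqrt 2) (fc (\<lambda>x. f x - (\<Sum>n<N. blk n (fc f) x))) < e"
proof -
  define s where "s n = sqrt 2 ^ n * bt n (fc f)" for n
  have s: "summable s" using f(2) by (simp add: bfin_def s_def[abs_def])
  have s0: "0 \<le> s n" for n by (simp add: s_def)
  have "(\<lambda>N. \<Sum>n. s (n + N)) \<longlonglongrightarrow> 0" by (rule suminf_exist_split2[OF s])
  then have "\<forall>\<^sub>F N in sequentially. (\<Sum>n. s (n + N)) < e / 30"
    using e by (intro order_tendstoD(2)[of _ 0]) auto
  then obtain N where N: "(\<Sum>n. s (n + N)) < e / 30" unfolding eventually_sequentially by auto
  define a where "a n = (if n < N then 0 else bt n (fc f))" for n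
  define F where "F n x = (if n < N then 0 else blk n (fc f) x)" for n x
  define F' where "F' n x = (if n < N then 0 else blk n (\<lambda>k. 2 * pi * \<i> * of_int k * fc f k) x)" for n x
  have FF: "pC1 (F n) (F' n)" for n
    unfolding F_def[abs_def] F'_def[abs_def] using pC1_blk by (cases "n < N") (auto simp: pC1_def)
  have l0: "l2 (\<lambda>x. 0) = 0" by (simp add: l2_def)
  have a1: "l2 (F n) \<le> a n" for n unfolding F_def[abs_def] a_def by (cases "n < N") (auto simp: l0 l2_blk)
  have a2: "l2 (F' n) \<le> 4/3 * 2 ^ n * a n" for n
    unfolding F'_def[abs_def] a_def using bt_deriv_le by (cases "n < N") (auto simp: l0 l2_blk)
  have ae: "(\<lambda>n. sqrt 2 ^ n * a n) = (\<lambda>n. if n < N then 0 else s n)"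
    by (auto simp: a_def s_def fun_eq_iff)
  have sm: "(\<lambda>n. if n < N then 0 else s n) sums (\<Sum>n. s (n + N))"
  proof -
    have "(\<lambda>n. s (n + N)) sums (\<Sum>n. s (n + N))" using s by (intro summable_sums summable_ignore_initial_segment)
    then show ?thesis using sums_iff_shift[of "\<lambda>n. if n < N then 0 else s n" N "\<Sum>n. s (n + N)"] by simp
  qed
  have sF: "(\<lambda>n. F n x) sums (f x - (\<Sum>n<N. blk n (fc f) x))" for x
  proof -
    have "(\<lambda>n. F n x) = (\<lambda>n. blk n (fc f) x - (if n \<in> {..<N} then blk n (fc f) x else 0))"
      by (auto simp: F_def)
    then show ?thesis using sums_diff[OF blk_sums(1)[OF f, of x] sums_If_finite_set[of "{..<N}" "\<lambda>n. blk n (fc f) x"]] by simp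
  qed
  note r = bn_atoms[OF FF a1 a2 _ _ sF, unfolded ae]
  have "bn (sqrt 2) (fc (\<lambda>x. f x - (\<Sum>n<N. blk n (fc f) x))) \<le> (14 + 11 * (4/3)) * (\<Sum>n. s (n + N))"
    using r(3) sums_summable[OF sm] sums_unique[OF sm] by simp
  also have "\<dots> \<le> 30 * (\<Sum>n. s (n + N))"
    using s s0 by (intro mult_right_mono suminf_nonneg summable_ignore_initial_segment) auto
  also have "\<dots> < e" using N by simp
  finally show ?thesis using that r(2) sums_summable[OF sm] by simp
qed

text \<open>Interpolation again: a large splitting index makes the H1 part small for all functions
  with the given derivative bound, and then a small sup norm controls the finitely many low
  blocks.\<close>

lemma bn_small_of_uniform:
  assumes e: "0 < e" and B: "0 \<le> B"
  obtains \<delta> where "0 < \<delta>" "\<And>f f'. pC1 f f' \<Longrightarrow> (\<And>x. cmod (f x) \<le> \<delta>) \<Longrightarrow> (\<And>x. cmod (f' x) \<le> B) \<Longrightarrow> bn (sqrt 2) (fc f) < e"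
proof -
  have "(\<lambda>N. (1 / sqrt 2) ^ N) \<longlonglongrightarrow> 0" by (rule LIMSEQ_power_zero) simp
  then have "(\<lambda>N. 11 * (1 / sqrt 2) ^ N * (1 + B)) \<longlonglongrightarrow> 11 * 0 * (1 + B)"
    by (intro tendsto_mult tendsto_const)
  then have "\<forall>\<^sub>F N in sequentially. 11 * (1 / sqrt 2) ^ N * (1 + B) < e / 2"
    using e by (intro order_tendstoD(2)[of _ 0]) auto
  then obtain N where N: "11 * (1 / sqrt 2) ^ N * (1 + B) < e / 2" unfolding eventually_sequentially by auto
  define \<delta> where "\<delta> = min 1 (e / (6 * sqrt 2 ^ N))"
  have d: "0 < \<delta>" "\<delta> \<le> 1" "3 * sqrt 2 ^ N * \<delta> \<le> e / 2"
    using e by (auto simp: \<delta>_def field_simps min_def)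
  show ?thesis
  proof (rule that[OF d(1)])
    fix f f' assume f: "pC1 f f'" "\<And>x. cmod (f x) \<le> \<delta>" "\<And>x. cmod (f' x) \<le> B"
    have l: "l2 f \<le> \<delta>" "l2 f' \<le> B" using pC1_pcont[OF f(1)] f(2,3) by (auto intro!: l2_le_sup)
    have "bn (sqrt 2) (fc f) \<le> 3 * sqrt 2 ^ N * l2 f + 11 * (1 / sqrt 2) ^ N * (l2 f + l2 f')"
      by (rule bfin_pC1(2)[OF f(1)])
    also have "\<dots> \<le> 3 * sqrt 2 ^ N * \<delta> + 11 * (1 / sqrt 2) ^ N * (1 + B)"
      using l d(2) by (intro add_mono mult_left_mono) auto
    also have "\<dots> < e" using N d(3) by linarith
    finally show "bn (sqrt 2) (fc f) < e" .
  qed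
qed

text \<open>A density argument, as no modulus of continuity uniform in \<open>f\<close> is
  available. Write \<open>f\<close> as a finite block sum \<open>g\<close> plus a remainder of small
  norm: the remainder stays small under every composition, and for the C1 function \<open>g\<close>
  uniform closeness suffices by \<open>bn_small_of_uniform\<close>.\<close>

lemma bn_compose_continuous:
  assumes f: "pcont f" "bfin (sqrt 2) (fc f)"
    and p: "\<And>s x. s \<in> I \<Longrightarrow> p s (x + 1) = p s x + 1" "\<And>s x. s \<in> I \<Longrightarrow> (p s has_real_derivative p' s x) (at x)"
      "\<And>s. s \<in> I \<Longrightarrow> continuous_on UNIV (p' s)" "\<And>s x. s \<in> I \<Longrightarrow> \<bar>p' s x\<bar> \<le> 2"
    and M: "\<And>s h. s \<in> I \<Longrightarrow> pcont h \<Longrightarrow> l2 (\<lambda>x. h (p s x)) \<le> 2 * l2 h"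
    and t: "t \<in> I" and u: "\<And>e. e > 0 \<Longrightarrow> \<forall>\<^sub>F s in at t within I. \<forall>x. \<bar>p s x - p t x\<bar> < e"
  shows "((\<lambda>s. bn (sqrt 2) (fc (\<lambda>x. f (p s x) - f (p t x)))) \<longlongrightarrow> 0) (at t within I)"
proof (rule tendstoI)
  fix e :: real assume e: "e > 0"
  have one: "pC1 (\<lambda>x. 1) (\<lambda>x. 0 :: complex)" by (auto simp: pC1_def)
  have comp: "pcont (\<lambda>x. h (p s x))" "bfin (sqrt 2) (fc (\<lambda>x. h (p s x)))"
    "bn (sqrt 2) (fc (\<lambda>x. h (p s x))) \<le> 264 * bn (sqrt 2) (fc h)"
    if "pcont h" "bfin (sqrt 2) (fc h)" "s \<in> I" for h s
    using bn_weighted_composition[OF that(1,2) one, of 1 0 "p s" "p' s" 2 2] p[OF that(3)] M[OF that(3)] by auto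
  \<comment> \<open>Composition costs a factor 44 * 2 * 3 = 264, and 1584 = 6 * 264. The two
    composed remainders thus contribute e/3 together, the smooth part another e/3.\<close>
  obtain N where N: "bfin (sqrt 2) (fc (\<lambda>x. f x - (\<Sum>n<N. blk n (fc f) x)))"
    "bn (sqrt 2) (fc (\<lambda>x. f x - (\<Sum>n<N. blk n (fc f) x))) < e / 1584"
    using bn_tail_small[OF f, of "e / 1584"] e by auto
  define g where "g x = (\<Sum>n<N. blk n (fc f) x)" for x
  define g' where "g' x = (\<Sum>n<N. blk n (\<lambda>k. 2 * pi * \<i> * of_int k * fc f k) x)" for x
  have gg: "pC1 g g'" unfolding g_def[abs_def] g'_def[abs_def] by (intro pC1_sum pC1_blk)
  define r where "r x = f x - g x" for x
  have r: "pcont r" "bfin (sqrt 2) (fc r)" "bn (sqrt 2) (fc r) < e / 1584"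
    using f(1) pC1_pcont(1)[OF gg] N unfolding r_def[abs_def] by (auto simp: g_def)
  obtain B where B: "\<And>x. cmod (g' x) \<le> B" "0 \<le> B" using pcont_bounded[OF pC1_pcont(2)[OF gg]] by blast
  \<comment> \<open>The derivative of each composed \<open>g\<close> is at most 2 * B, which gives 4
    * B for their difference.\<close>
  obtain \<delta> where \<delta>: "0 < \<delta>" "\<And>f f'. pC1 f f' \<Longrightarrow> (\<And>x. cmod (f x) \<le> \<delta>) \<Longrightarrow> (\<And>x. cmod (f' x) \<le> 4 * B) \<Longrightarrow> bn (sqrt 2) (fc f) < e / 3"
    using bn_small_of_uniform[of "e / 3" "4 * B"] e B(2) by auto
  have "\<forall>\<^sub>F s in at t within I. \<forall>x. \<bar>p s x - p t x\<bar> < \<delta> / (B + 1)" using \<delta>(1) B(2) by (intro u) auto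
  moreover have "\<forall>\<^sub>F s in at t within I. s \<in> I" by (simp add: eventually_at_filter)
  ultimately show "\<forall>\<^sub>F s in at t within I. dist (bn (sqrt 2) (fc (\<lambda>x. f (p s x) - f (p t x)))) 0 < e"
  proof eventually_elim
    case (elim s)
    have G: "pC1 (\<lambda>x. g (p s x) - g (p t x)) (\<lambda>x. p' s x *\<^sub>R g' (p s x) - p' t x *\<^sub>R g' (p t x))"
      using p elim(2) t by (intro pC1_diff pC1_compose gg) auto
    have b1: "bn (sqrt 2) (fc (\<lambda>x. g (p s x) - g (p t x))) < e / 3"
    proof (rule \<delta>(2)[OF G])
      fix x
      have "norm (g (p s x) - g (p t x)) \<le> B * norm (p s x - p t x)"
        by (rule differentiable_bound[where S = UNIV and f' = "\<lambda>y h. h *\<^sub>R g' y"])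
          (use pC1_deriv[OF gg] B in \<open>auto simp: has_vector_derivative_def mult.commute[of B] intro!: onorm_le mult_left_mono\<close>)
      also have "\<dots> \<le> B * (\<delta> / (B + 1))" using elim(1) B(2) by (intro mult_left_mono) (auto intro: less_imp_le)
      also have "\<dots> \<le> \<delta>" using \<delta>(1) B(2) by (simp add: field_simps)
      finally show "cmod (g (p s x) - g (p t x)) \<le> \<delta>" .
      have "norm (p' u x *\<^sub>R g' (p u x)) \<le> 2 * B" if "u \<in> I" for u
        unfolding norm_scaleR using p(4)[OF that] B by (intro mult_mono) auto
      from this[OF elim(2)] this[OF t] show "cmod (p' s x *\<^sub>R g' (p s x) - p' t x *\<^sub>R g' (p t x)) \<le> 4 * B"
        using norm_triangle_ineq4[of "p' s x *\<^sub>R g' (p s x)" "p' t x *\<^sub>R g' (p t x)"] by linarith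
    qed
    have f1: "bfin (sqrt 2) (fc (\<lambda>x. g (p s x) - g (p t x)))" by (rule bfin_pC1(1)[OF G])
    note cs = comp[OF r(1,2) elim(2)] and ct = comp[OF r(1,2) t]
    have m: "bfin (sqrt 2) (fc (\<lambda>x. - r (p t x)))" "bn (sqrt 2) (fc (\<lambda>x. - r (p t x))) = bn (sqrt 2) (fc (\<lambda>x. r (p t x)))"
      using bfin_cmult[OF _ ct(2), of "- 1"] by (simp_all add: fc_minus[abs_def])
    have e1: "fc (\<lambda>x. f (p s x) - f (p t x)) = (\<lambda>k. fc (\<lambda>x. g (p s x) - g (p t x)) k
        + (fc (\<lambda>x. r (p s x)) k + fc (\<lambda>x. - r (p t x)) k))"
    proof
      fix k
      have "(\<lambda>x. f (p s x) - f (p t x)) = (\<lambda>x. (g (p s x) - g (p t x)) + (r (p s x) + - r (p t x)))"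
        by (simp add: r_def)
      then show "fc (\<lambda>x. f (p s x) - f (p t x)) k = fc (\<lambda>x. g (p s x) - g (p t x)) k
        + (fc (\<lambda>x. r (p s x)) k + fc (\<lambda>x. - r (p t x)) k)"
        using cs(1) ct(1) pC1_pcont(1)[OF G] by (simp only:) (subst fc_add, auto simp only: fc_add pcont_add pcont_minus)
    qed
    have s0: "0 \<le> sqrt 2" by simp
    note a2 = bfin_add[OF s0 cs(2) m(1)] and a1 = bfin_add[OF s0 f1 bfin_add(1)[OF s0 cs(2) m(1)]]
    have "bn (sqrt 2) (fc (\<lambda>x. f (p s x) - f (p t x))) < e"
      unfolding e1 using a1(2) a2(2) b1 cs(3) ct(3) m(2) r(3) e by linarith
    moreover have "0 \<le> bn (sqrt 2) (fc (\<lambda>x. f (p s x) - f (p t x)))"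
      unfolding e1 using a1(1) by (intro bn_nonneg) auto
    ultimately show ?case by simp
  qed
qed

section \<open>Real functions of finite norm: algebra, multipliers, division\<close>

definition rfin :: "(real \<Rightarrow> real) \<Rightarrow> bool" where
  "rfin f \<longleftrightarrow> pcont f \<and> bfin (sqrt 2) (rfc f)"

text \<open>This is sqrt 2 times the Besov norm of index 1/2; \<open>rfin_besov\<close> restores the
  factor.\<close>

definition rbn :: "(real \<Rightarrow> real) \<Rightarrow> real" where
  "rbn f = bn (sqrt 2) (rfc f)"

lemma rfin_pcont: "rfin f \<Longrightarrow> pcont f"
  by (simp add: rfin_def)

lemma rbn_nonneg: "rfin f \<Longrightarrow> 0 \<le> rbn f"
  unfolding rfin_def rbn_def by (intro bn_nonneg) auto

lemma rbn_sup: "rfin f \<Longrightarrow> \<bar>f x\<bar> \<le> 2 * rbn f"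
  using blk_sums(2)[of "\<lambda>x. of_real (f x)" x] by (auto simp: rfin_def rbn_def rfc_def)

lemma rbn_lincomb:
  assumes "rfin f" "rfin g"
  shows "rfin (\<lambda>x. a * f x + b * g x)" "rbn (\<lambda>x. a * f x + b * g x) \<le> \<bar>a\<bar> * rbn f + \<bar>b\<bar> * rbn g"
proof -
  have e: "rfc (\<lambda>x. a * f x + b * g x) = (\<lambda>k. of_real a * rfc f k + of_real b * rfc g k)"
    using assms by (auto simp: rfin_def rfc_add rfc_cmult pcont_mult)
  have f: "bfin (sqrt 2) (rfc f)" "bfin (sqrt 2) (rfc g)" using assms by (auto simp: rfin_def)
  note ca = bfin_cmult[OF _ f(1), of "of_real a"] and cb = bfin_cmult[OF _ f(2), of "of_real b"]
  note ab = bfin_add[OF _ ca(1) cb(1)]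
  show "rfin (\<lambda>x. a * f x + b * g x)" using ab(1) assms by (auto simp: rfin_def e)
  show "rbn (\<lambda>x. a * f x + b * g x) \<le> \<bar>a\<bar> * rbn f + \<bar>b\<bar> * rbn g"
    using ab(2) ca(2) cb(2) by (simp add: rbn_def e)
qed

lemma rbn_add:
  assumes "rfin f" "rfin g"
  shows "rfin (\<lambda>x. f x + g x)" "rbn (\<lambda>x. f x + g x) \<le> rbn f + rbn g"
  using rbn_lincomb[OF assms, of 1 1] by simp_all

lemma rbn_diff:
  assumes "rfin f" "rfin g"
  shows "rfin (\<lambda>x. f x - g x)" "rbn (\<lambda>x. f x - g x) \<le> rbn f + rbn g"
  using rbn_lincomb[OF assms, of 1 "- 1"] by simp_all

lemma rbn_mult:
  assumes "rfin f" "rfin g"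
  shows "rfin (\<lambda>x. f x * g x)" "rbn (\<lambda>x. f x * g x) \<le> 10000 * rbn f * rbn g"
  using bn_mult[of "\<lambda>x. of_real (f x)" "\<lambda>x. of_real (g x)"] assms
  by (auto simp: rfin_def rbn_def rfc_def)

lemma rbn_weighted_composition:
  assumes f: "rfin f" and g: "pC1 g g'" "\<And>x. \<bar>g x\<bar> \<le> G" "\<And>x. \<bar>g' x\<bar> \<le> G'"
    and \<phi>: "\<And>x. \<phi> (x + 1) = \<phi> x + 1" "\<And>x. (\<phi> has_real_derivative \<phi>' x) (at x)"
      "continuous_on UNIV \<phi>'" "\<And>x. \<bar>\<phi>' x\<bar> \<le> P"
    and M: "\<And>h. pcont h \<Longrightarrow> l2 (\<lambda>x. h (\<phi> x)) \<le> M * l2 h" "0 < M"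
  shows "rfin (\<lambda>x. g x * f (\<phi> x))" "rbn (\<lambda>x. g x * f (\<phi> x)) \<le> (44 * M * (G * (1 + P) + G')) * rbn f"
proof -
  have f': "pcont (\<lambda>x. complex_of_real (f x))" "bfin (sqrt 2) (fc (\<lambda>x. of_real (f x)))"
    using f by (auto simp: rfin_def rfc_def)
  have pf: "pcont (\<lambda>x. f (\<phi> x))"
  proof (rule pcont_compose[where f = f and q = \<phi>])
    show "continuous_on UNIV \<phi>"
      by (intro continuous_at_imp_continuous_on ballI DERIV_isCont[OF \<phi>(2)])
  qed (use rfin_pcont[OF f] \<phi>(1) in auto)
  have "cmod (of_real (g x)) \<le> G" "cmod (of_real (g' x)) \<le> G'" for x using g(2,3) by auto
  note r = bn_weighted_composition[OF f' pC1_of_real[OF g(1)] this \<phi> M]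
  show "rfin (\<lambda>x. g x * f (\<phi> x))" using r(2) pf pC1_pcont(1)[OF g(1)] by (auto simp: rfin_def rfc_def)
  show "rbn (\<lambda>x. g x * f (\<phi> x)) \<le> (44 * M * (G * (1 + P) + G')) * rbn f"
    using r(3) by (simp add: rbn_def rfc_def)
qed

lemma rbn_mult_pC1:
  assumes f: "rfin f" and g: "pC1 g g'" "\<And>x. \<bar>g x\<bar> \<le> G" "\<And>x. \<bar>g' x\<bar> \<le> G'"
  shows "rfin (\<lambda>x. g x * f x)" "rbn (\<lambda>x. g x * f x) \<le> 44 * (2 * G + G') * rbn f"
  using rbn_weighted_composition[OF f g, of "\<lambda>x. x" "\<lambda>_. 1" 1 1] by (auto simp: mult_ac)

text \<open>A Neumann series. In view of the algebra constant 10000 in \<open>rbn_mult\<close>, the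
  hypothesis on \<open>rbn a\<close> makes it geometric with ratio 1/2; the sup bound on
  \<open>a\<close> makes it converge pointwise.\<close>

lemma rbn_divide:
  assumes g: "rfin g" and a: "rfin a" "10000 * rbn a \<le> 1/2" "\<And>x. \<bar>a x\<bar> \<le> 1/2"
  shows "rfin (\<lambda>x. g x / (1 + a x))" "rbn (\<lambda>x. g x / (1 + a x)) \<le> 2 * rbn g"
proof -
  define F where "F i x = g x * (- a x) ^ i" for i x
  have F: "rfin (F i) \<and> rbn (F i) \<le> (1/2) ^ i * rbn g" for i
  proof (induction i)
    case 0
    then show ?case using g by (simp add: F_def[abs_def])
  next
    case (Suc i)
    have e: "F (Suc i) = (\<lambda>x. (-1) * (F i x * a x) + 0 * g x)" by (simp add: F_def fun_eq_iff)
    have m: "rfin (\<lambda>x. F i x * a x)" "rbn (\<lambda>x. F i x * a x) \<le> 10000 * rbn (F i) * rbn a"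
      using rbn_mult[OF _ a(1)] Suc by auto
    note l = rbn_lincomb[OF m(1) g, of "-1" 0, folded e]
    have "rbn (F (Suc i)) \<le> rbn (F i) * (10000 * rbn a)" using l(2) m(2) by simp
    also have "\<dots> \<le> ((1/2) ^ i * rbn g) * (1/2)"
      using Suc a(2) rbn_nonneg[OF g] rbn_nonneg[OF a(1)] by (intro mult_mono) auto
    finally show ?case using l(1) by simp
  qed
  have S: "summable (\<lambda>i. (1/2::real) ^ i * rbn g)" "(\<Sum>i. (1/2::real) ^ i * rbn g) = 2 * rbn g"
    using suminf_mult2[OF summable_geometric, of "1/2::real" "rbn g"]
    by (auto intro!: summable_mult2 summable_geometric simp: suminf_geometric)
  have S': "summable (\<lambda>i. rbn (F i))"
    by (rule summable_comparison_test'[OF S(1), of 0]) (use F rbn_nonneg in auto)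
  have "(\<lambda>i. F i x) sums (g x / (1 + a x))" for x
  proof -
    have "(\<lambda>i. g x * (- a x) ^ i) sums (g x * (1 / (1 - (- a x))))"
      by (intro sums_mult geometric_sums) (use a(3)[of x] in auto)
    then show ?thesis by (simp add: F_def)
  qed
  then have c: "(\<lambda>i. complex_of_real (F i x)) sums of_real (g x / (1 + a x))" for x by (rule sums_of_real)
  have fi: "pcont (\<lambda>x. complex_of_real (F i x))" "bfin (sqrt 2) (fc (\<lambda>x. of_real (F i x)))" for i
    using F[of i] by (auto simp: rfin_def rfc_def)
  note r = bn_series[OF fi S'[unfolded rbn_def rfc_def] c]
  have "pcont (\<lambda>x. Re (of_real (g x / (1 + a x))))" using r(1) by (rule pcont_Re)
  then show "rfin (\<lambda>x. g x / (1 + a x))" using r(2) by (simp add: rfin_def rfc_def)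
  have "rbn (\<lambda>x. g x / (1 + a x)) \<le> (\<Sum>i. rbn (F i))" using r(3) by (simp add: rbn_def rfc_def)
  also have "\<dots> \<le> (\<Sum>i. (1/2) ^ i * rbn g)" using F by (intro suminf_le S S') auto
  finally show "rbn (\<lambda>x. g x / (1 + a x)) \<le> 2 * rbn g" using S(2) by simp
qed

end

section \<open>The Lagrangian flow\<close>

text \<open>All curves of functions are taken on the whole plane, although only times in a compact
  interval matter; this keeps time domains out of the continuity arguments.\<close>

definition jcont :: "(real \<Rightarrow> real \<Rightarrow> 'a::topological_space) \<Rightarrow> bool" where
  "jcont f \<longleftrightarrow> continuous_on UNIV (\<lambda>p. f (fst p) (snd p))"

lemma jcont_compose:
  assumes "jcont f" "continuous_on A a" "continuous_on A b"
  shows "continuous_on A (\<lambda>p. f (a p) (b p))"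
  using continuous_on_compose2[OF assms(1)[unfolded jcont_def] continuous_on_Pair[OF assms(2,3)]] by simp

lemma jcont_space: "jcont f \<Longrightarrow> continuous_on A (f t)"
  using jcont_compose[of f A "\<lambda>_. t" "\<lambda>x. x"] by simp

lemma jcont_time: "jcont f \<Longrightarrow> continuous_on A (\<lambda>t. f t x)"
  using jcont_compose[of f A "\<lambda>t. t" "\<lambda>_. x"] by simp

lemma jcont_integral_time:
  fixes f :: "real \<Rightarrow> real \<Rightarrow> real"
  assumes f: "jcont f"
  shows "jcont (\<lambda>t x. integral {0..t} (\<lambda>s. f s x))"
proof -
  \<comment> \<open>For negative \<open>t\<close> the interval is empty and the integral is 0, hence
    \<open>max 0 t\<close>. Rescaling to the unit interval makes the limits of integration
    constant.\<close>
  have e: "integral {0..t} (\<lambda>s. f s x) = max 0 t * integral (cbox 0 1) (\<lambda>z. f (max 0 t * z) x)" for t x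
  proof (cases "0 \<le> t")
    case True
    have "((\<lambda>z. t *\<^sub>R f (t * z) x) has_integral integral {t * 0..t * 1} (\<lambda>s. f s x)) {0..1}"
      by (rule has_integral_substitution[where c = 0 and d = t])
        (use True in \<open>auto intro!: derivative_eq_intros jcont_time f mult_left_le simp: mult_left_le\<close>)
    from integral_unique[OF this] show ?thesis using True by simp
  next
    case False
    then show ?thesis by simp
  qed
  show ?thesis
    unfolding jcont_def e
  proof (intro continuous_intros integral_continuous_on_param)
    show "continuous_on (UNIV \<times> cbox 0 1) (\<lambda>(p, z). f (max 0 (fst p) * z) (snd p))"
      unfolding split_beta by (intro jcont_compose[OF f] continuous_intros)
  qed
qed

lemma jcont_lag:
  assumes d: "jcont d" and g: "pcont g"
  shows "jcont (\<lambda>t. lag \<sigma> (d t) g)"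
proof -
  have "continuous_on (UNIV \<times> cbox 0 1) (\<lambda>(p, z). exp (- z + \<sigma> * (d (fst p) (snd p - \<sigma> * z) - d (fst p) (snd p))) * g (snd p - \<sigma> * z))"
    unfolding split_beta
    by (intro continuous_intros jcont_compose[OF d] continuous_on_compose2[OF pcont_continuous[OF g, of UNIV]]) auto
  then have "continuous_on UNIV (\<lambda>p. integral (cbox 0 1) (\<lambda>z. exp (- z + \<sigma> * (d (fst p) (snd p - \<sigma> * z) - d (fst p) (snd p))) * g (snd p - \<sigma> * z)))"
    by (rule integral_continuous_on_param)
  then show ?thesis unfolding jcont_def lag_def by (intro continuous_intros) (simp add: cbox_interval)
qed

text \<open>The Banach fixed point theorem in the bounded continuous functions on the plane. The
  velocity is at most 4 mu^2 and has Lipschitz constant 16 mu^2 in the displacement; with T mu^2 <=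
  1/64 the image is bounded by 1/16, inside the required 1/4, and the contraction factor is
  1/4.\<close>

lemma flow_exists:
  assumes m: "pcont m0" "\<And>x. \<bar>m0 x\<bar> \<le> \<mu>" and n: "pcont n0" "\<And>x. \<bar>n0 x\<bar> \<le> \<mu>"
    and T: "0 \<le> T" "T * \<mu>\<^sup>2 \<le> 1/64"
  shows "\<exists>d. jcont d \<and> (\<forall>t. pcont (d t)) \<and> (\<forall>t x. \<bar>d t x\<bar> \<le> 1/4) \<and>
    (\<forall>t\<in>{0..T}. \<forall>x. d t x = integral {0..t} (\<lambda>s. lag 1 (d s) m0 x * lag (- 1) (d s) n0 x))"
proof -
  define S where "S = {F :: (real \<times> real) \<Rightarrow>\<^sub>C real. (\<forall>p. \<bar>F p\<bar> \<le> 1/4) \<and> (\<forall>t x. F (t, x + 1) = F (t, x))}"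
  \<comment> \<open>Time is clamped to the interval, so that the integral operator returns bounded
    functions on the whole plane.\<close>
  define c where "c t = max 0 (min T t)" for t
  define V where "V F s x = lag 1 (\<lambda>y. apply_bcontfun F (s, y)) m0 x * lag (- 1) (\<lambda>y. apply_bcontfun F (s, y)) n0 x"
    for F :: "(real \<times> real) \<Rightarrow>\<^sub>C real" and s x :: real
  define I where "I F t x = integral {0..t} (\<lambda>s. V F s x)" for F t x
  define \<Phi> where "\<Phi> F = Bcontfun (\<lambda>p. I F (c (fst p)) (snd p))" for F
  have mu: "0 \<le> \<mu>" using m(2)[of 0] by linarith
  have jF: "jcont (\<lambda>s y. apply_bcontfun F (s, y))" for F by (simp add: jcont_def)
  have pF: "pcont (\<lambda>y. apply_bcontfun F (s, y))" "\<bar>apply_bcontfun F p\<bar> \<le> 1/4" if "F \<in> S" for F s p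
    using that jcont_space[OF jF, of UNIV F s] unfolding S_def pcont_def by blast+
  have jV: "jcont (V F)" for F
    using jcont_lag[OF jF m(1)] jcont_lag[OF jF n(1)] unfolding V_def[abs_def] jcont_def by (intro continuous_intros)
  have jI: "jcont (I F)" for F unfolding I_def[abs_def] by (rule jcont_integral_time[OF jV])
  have bl: "\<bar>lag 1 (\<lambda>y. apply_bcontfun F (s, y)) m0 x\<bar> \<le> 2 * \<mu>" "\<bar>lag (- 1) (\<lambda>y. apply_bcontfun F (s, y)) n0 x\<bar> \<le> 2 * \<mu>"
    if "F \<in> S" for F s x using lag_bound[OF pF[OF that] m] lag_bound[OF pF[OF that] n] by auto
  have bV: "\<bar>V F s x\<bar> \<le> 4 * \<mu>\<^sup>2" if "F \<in> S" for F s x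
    using mult_mono[OF bl[OF that]] mu by (simp add: V_def abs_mult power2_eq_square)
  have vi: "(\<lambda>s. V F s x) integrable_on {0..t}" for F x t
    by (intro integrable_continuous_real jcont_time jV)
  have ct: "0 \<le> c t" "c t \<le> T" for t using T by (auto simp: c_def)
  have ib: "\<bar>integral {0..c t} f\<bar> \<le> T * B" if "f integrable_on {0..c t}" "\<And>s. \<bar>f s\<bar> \<le> B" for t B and f :: "real \<Rightarrow> real"
  proof -
    have "norm (integral {0..c t} f) \<le> integral {0..c t} (\<lambda>_. B)"
      using that by (intro integral_norm_bound_integral) auto
    also have "\<dots> = c t * B" using ct by simp
    also have "\<dots> \<le> T * B"
    proof -
      have "0 \<le> B" using that(2)[of 0] by linarith
      then show ?thesis using ct(2) by (rule mult_right_mono[rotated])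
    qed
    finally show ?thesis by simp
  qed
  have bI: "\<bar>I F (c t) x\<bar> \<le> 1/4" if "F \<in> S" for F t x
    using ib[OF vi bV[OF that], of t x] T(2) unfolding I_def by simp
  have ap: "apply_bcontfun (\<Phi> F) p = I F (c (fst p)) (snd p)" if "F \<in> S" for F p
    unfolding \<Phi>_def
  proof (subst Bcontfun_inverse)
    show "(\<lambda>p. I F (c (fst p)) (snd p)) \<in> bcontfun"
      by (rule bcontfun_normI[where b = "1/4"])
        (use bI[OF that] in \<open>auto simp: c_def intro!: jcont_compose[OF jI] continuous_intros\<close>)
  qed simp
  have "\<exists>!F\<in>S. \<Phi> F = F"
  proof (rule Banach_fix[of S "1/4"])
    have "closed S"
      unfolding closed_sequential_limits
    proof (intro allI impI, elim conjE)
      fix X l assume X: "\<forall>n. X n \<in> S" "X \<longlonglongrightarrow> l"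
      have lim: "(\<lambda>n. apply_bcontfun (X n) p) \<longlonglongrightarrow> l p" for p
        using tendsto_uniform_limitI[OF tendsto_bcontfun_uniform_limit[OF X(2)]] by simp
      have "\<bar>l p\<bar> \<le> 1/4" for p
        by (rule LIMSEQ_le_const2[OF tendsto_rabs[OF lim]]) (use X(1) in \<open>unfold S_def, blast\<close>)
      moreover have "l (t, x + 1) = l (t, x)" for t x
      proof (rule LIMSEQ_unique[OF lim])
        show "(\<lambda>n. apply_bcontfun (X n) (t, x + 1)) \<longlonglongrightarrow> l (t, x)"
          using lim[of "(t, x)"] X(1) by (simp add: S_def)
      qed
      ultimately show "l \<in> S" by (simp add: S_def)
    qed
    then show "complete S" by (simp add: complete_eq_closed)
    have "0 \<in> S" by (simp add: S_def)
    then show "S \<noteq> {}" by blast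
    show "\<Phi> ` S \<subseteq> S"
    proof safe
      fix F assume F: "F \<in> S"
      have "V F s (x + 1) = V F s x" for s x
        unfolding V_def using lag_per[OF pF(1)[OF F] m(1)] lag_per[OF pF(1)[OF F] n(1)] by simp
      then show "\<Phi> F \<in> S" using bI[OF F] by (simp add: S_def ap[OF F] I_def)
    qed
    show "dist (\<Phi> F) (\<Phi> G) \<le> 1/4 * dist F G" if F: "F \<in> S" and G: "G \<in> S" for F G
    proof (rule dist_bound)
      fix p :: "real \<times> real"
      define t x where "t = fst p" and "x = snd p"
      define \<delta> where "\<delta> = dist F G"
      have fg: "\<bar>apply_bcontfun F p - apply_bcontfun G p\<bar> \<le> \<delta>" for p
        using dist_bounded[of F p G] by (simp add: dist_real_def \<delta>_def)
      have bd: "\<bar>V F s x - V G s x\<bar> \<le> 16 * \<mu>\<^sup>2 * \<delta>" for s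
      proof -
        let ?a = "\<lambda>F. lag 1 (\<lambda>y. apply_bcontfun F (s, y)) m0 x" and ?b = "\<lambda>F. lag (- 1) (\<lambda>y. apply_bcontfun F (s, y)) n0 x"
        have l: "\<bar>?a F - ?a G\<bar> \<le> 4 * \<mu> * \<delta>" "\<bar>?b F - ?b G\<bar> \<le> 4 * \<mu> * \<delta>"
          using lag_lipschitz[OF pF[OF F] pF[OF G] m] lag_lipschitz[OF pF[OF F] pF[OF G] n] fg by auto
        have "0 \<le> \<delta>" by (simp add: \<delta>_def)
        then have "0 \<le> 4 * \<mu> * \<delta>" "0 \<le> 2 * \<mu>" using mu by auto
        then have "\<bar>?a F - ?a G\<bar> * \<bar>?b F\<bar> \<le> (4 * \<mu> * \<delta>) * (2 * \<mu>)" "\<bar>?a G\<bar> * \<bar>?b F - ?b G\<bar> \<le> (2 * \<mu>) * (4 * \<mu> * \<delta>)"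
          using mult_mono[OF l(1) bl(2)[OF F, of s x]] mult_mono[OF bl(1)[OF G, of s x] l(2)] by simp_all
        moreover have "V F s x - V G s x = (?a F - ?a G) * ?b F + ?a G * (?b F - ?b G)"
          by (simp add: V_def algebra_simps)
        then have "\<bar>V F s x - V G s x\<bar> \<le> \<bar>?a F - ?a G\<bar> * \<bar>?b F\<bar> + \<bar>?a G\<bar> * \<bar>?b F - ?b G\<bar>"
          unfolding abs_mult[symmetric] by (simp add: abs_triangle_ineq)
        moreover have "(4 * \<mu> * \<delta>) * (2 * \<mu>) + (2 * \<mu>) * (4 * \<mu> * \<delta>) = 16 * \<mu>\<^sup>2 * \<delta>"
          by (simp add: power2_eq_square)
        ultimately show ?thesis by linarith
      qed
      have "I F (c t) x - I G (c t) x = integral {0..c t} (\<lambda>s. V F s x - V G s x)"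
        unfolding I_def by (rule integral_diff[symmetric, OF vi vi])
      also have "\<bar>\<dots>\<bar> \<le> T * (16 * \<mu>\<^sup>2 * \<delta>)" by (rule ib[OF integrable_diff[OF vi vi] bd])
      also have "\<dots> = 16 * (T * \<mu>\<^sup>2) * \<delta>" by simp
      also have "\<dots> \<le> 1/4 * \<delta>" using T(2) by (intro mult_right_mono) (auto simp: \<delta>_def)
      finally show "dist (apply_bcontfun (\<Phi> F) p) (apply_bcontfun (\<Phi> G) p) \<le> 1/4 * dist F G"
        by (simp add: ap[OF F] ap[OF G] dist_real_def t_def x_def \<delta>_def)
    qed
  qed auto
  then obtain F where F: "F \<in> S" "\<Phi> F = F" by blast
  have "apply_bcontfun F (t, x) = integral {0..t} (\<lambda>s. V F s x)" if "t \<in> {0..T}" for t x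
    using ap[OF F(1), of "(t, x)"] F(2) that by (simp add: c_def I_def)
  then show ?thesis
    using pF[OF F(1)] jF[of F] by (intro exI[of _ "\<lambda>t x. apply_bcontfun F (t, x)"]) (simp add: V_def)
qed

section \<open>Regularity of the flow in space and time\<close>

locale lagrangian_flow = littlewood_paley +
  fixes m0 n0 :: "real \<Rightarrow> real" and \<beta> T :: real and d :: "real \<Rightarrow> real \<Rightarrow> real"
  assumes m0: "rfin m0" "rbn m0 \<le> \<beta>" and n0: "rfin n0" "rbn n0 \<le> \<beta>"
    and T: "0 \<le> T" "10 ^ 8 * (T * \<beta>\<^sup>2) \<le> 1"
    and jd: "jcont d" and pd: "\<And>t. pcont (d t)" and bd: "\<And>t x. \<bar>d t x\<bar> \<le> 1/4"
    and eqd: "\<And>t x. t \<in> {0..T} \<Longrightarrow> d t x = integral {0..t} (\<lambda>s. lag 1 (d s) m0 x * lag (- 1) (d s) n0 x)"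
begin

definition F where "F t = lag 1 (d t) m0"
definition H where "H t = lag (- 1) (d t) n0"
definition IF where "IF t x = integral {0..t} (\<lambda>s. F s x)"
definition IH where "IH t x = integral {0..t} (\<lambda>s. H s x)"
text \<open>This is the space derivative of the displacement, see \<open>d_pC1\<close>. It contains
  the data but no derivative of them, which is why the Jacobian \<open>1 + a\<close> has the
  regularity of the data.\<close>

definition a where "a t x = m0 x * IH t x - n0 x * IF t x"
definition q where "q t x = x + d t x"

lemma beta_nonneg: "0 \<le> \<beta>"
  using rbn_nonneg[OF m0(1)] m0(2) by linarith

lemma data_bound: "\<bar>m0 x\<bar> \<le> 2 * \<beta>" "\<bar>n0 x\<bar> \<le> 2 * \<beta>"
  using rbn_sup[OF m0(1), of x] rbn_sup[OF n0(1), of x] m0(2) n0(2) by linarith+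

lemma small: "T * (2 * \<beta>)\<^sup>2 \<le> 1/64"
  using T beta_nonneg by (simp add: power_mult_distrib)

lemma pcont_data: "pcont m0" "pcont n0"
  using m0 n0 by (auto intro: rfin_pcont)

lemma F_bound: "\<bar>F t x\<bar> \<le> 4 * \<beta>" and H_bound: "\<bar>H t x\<bar> \<le> 4 * \<beta>"
  using lag_bound[OF pd bd pcont_data(1) data_bound(1), of 1 t x] lag_bound[OF pd bd pcont_data(2) data_bound(2), of "-1" t x]
  by (auto simp: F_def H_def)

lemma jcont_F: "jcont F" and jcont_H: "jcont H"
  unfolding F_def[abs_def] H_def[abs_def] using jcont_lag[OF jd] pcont_data by auto

lemma jcont_IF: "jcont IF" and jcont_IH: "jcont IH"
  unfolding IF_def[abs_def] IH_def[abs_def] using jcont_integral_time[OF jcont_F] jcont_integral_time[OF jcont_H] by auto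

lemma jcont_data: "jcont (\<lambda>t. m0)" "jcont (\<lambda>t. n0)"
  unfolding jcont_def using pcont_data
  by (auto intro!: continuous_on_compose2[OF pcont_continuous[of m0 UNIV]] continuous_on_compose2[OF pcont_continuous[of n0 UNIV]] continuous_intros)

lemma jcont_a: "jcont a"
  using jcont_IF jcont_IH jcont_data unfolding a_def[abs_def] jcont_def by (intro continuous_intros)

text \<open>The two resolvents have opposite signs, so their weights exp q and exp (- q) cancel in
  the product. Each weighted factor is differentiable by \<open>lag_exp_deriv\<close>, while
  \<open>F\<close> and \<open>H\<close> alone are not yet known to be, as \<open>d\<close> is only
  continuous at this stage.\<close>

lemma FH_deriv: "((\<lambda>x. F s x * H s x) has_real_derivative m0 x * H s x - n0 x * F s x) (at x)"
proof -
  have e: "exp (1 * (x + d s x)) * F s x * (exp (- 1 * (x + d s x)) * H s x) = F s x * H s x" for x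
    using exp_minus_inverse[of "x + d s x"] by (simp add: mult_ac)
  have "((\<lambda>x. (exp (1 * (x + d s x)) * F s x) * (exp (- 1 * (x + d s x)) * H s x)) has_real_derivative
      (1 * (exp (1 * (x + d s x)) * m0 x)) * (exp (- 1 * (x + d s x)) * H s x)
      + (- 1 * (exp (- 1 * (x + d s x)) * n0 x)) * (exp (1 * (x + d s x)) * F s x)) (at x)"
    unfolding F_def H_def by (intro DERIV_mult lag_exp_deriv pd pcont_data) auto
  moreover have "(1 * (exp (1 * (x + d s x)) * m0 x)) * (exp (- 1 * (x + d s x)) * H s x)
      + (- 1 * (exp (- 1 * (x + d s x)) * n0 x)) * (exp (1 * (x + d s x)) * F s x)
      = (exp (x + d s x) * exp (- (x + d s x))) * (m0 x * H s x - n0 x * F s x)"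
    by (simp add: algebra_simps)
  moreover have "exp (x + d s x) * exp (- (x + d s x)) = 1" by (rule exp_minus_inverse)
  ultimately show ?thesis unfolding e by simp
qed

lemma time_integrable: "jcont f \<Longrightarrow> (\<lambda>s. f s x) integrable_on {u..v}" for f :: "real \<Rightarrow> real \<Rightarrow> real"
  by (intro integrable_continuous_real jcont_time)

lemma space_deriv_integral:
  fixes f f' :: "real \<Rightarrow> real \<Rightarrow> real"
  assumes f: "jcont f" "jcont f'" and D: "\<And>s x. s \<in> {0..t} \<Longrightarrow> (f s has_real_derivative f' s x) (at x)"
  shows "((\<lambda>x. integral {0..t} (\<lambda>s. f s x)) has_vector_derivative integral {0..t} (\<lambda>s. f' s x)) (at x)"
proof -
  have "((\<lambda>x. integral (cbox 0 t) (\<lambda>s. f s x)) has_vector_derivative integral (cbox 0 t) (\<lambda>s. f' s x)) (at x within UNIV)"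
  proof (rule leibniz_rule_vector_derivative[where f = "\<lambda>x s. f s x" and fx = "\<lambda>x s. f' s x"])
    show "continuous_on (UNIV \<times> cbox 0 t) (\<lambda>(x, s). f' s x)"
      unfolding split_beta by (intro jcont_compose[OF f(2)] continuous_intros)
  qed (use D time_integrable[OF f(1)] in \<open>auto simp: has_real_derivative_iff_has_vector_derivative[symmetric]\<close>)
  then show ?thesis by simp
qed

text \<open>Differentiating the fixed point equation under the time integral upgrades the
  displacement from continuous to C1.\<close>

lemma d_pC1:
  assumes t: "t \<in> {0..T}" shows "pC1 (d t) (a t)"
proof (rule pC1_intro)
  show "d t (x + 1) = d t x" for x using pcont_per[OF pd] .
  show "continuous_on UNIV (a t)" by (rule jcont_space[OF jcont_a])
  fix x
  have j: "jcont (\<lambda>s x. F s x * H s x)" "jcont (\<lambda>s x. m0 x * H s x - n0 x * F s x)"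
    using jcont_F jcont_H jcont_data unfolding jcont_def by - (intro continuous_intros; assumption)+
  have e: "d t = (\<lambda>x. integral {0..t} (\<lambda>s. F s x * H s x))" using eqd[OF t] by (auto simp: F_def H_def)
  have "integral {0..t} (\<lambda>s. m0 x * H s x - n0 x * F s x) = a t x"
    unfolding a_def IF_def IH_def
    using integral_diff[OF integrable_on_mult_right[OF time_integrable[OF jcont_H]] integrable_on_mult_right[OF time_integrable[OF jcont_F]]]
    by simp
  then show "(d t has_vector_derivative a t x) (at x)"
    using space_deriv_integral[OF j FH_deriv, of t x] unfolding e by simp
qed

lemma time_integral_diff:
  fixes f :: "real \<Rightarrow> real \<Rightarrow> real"
  assumes f: "jcont f" "\<And>s. s \<in> {0..T} \<Longrightarrow> \<bar>f s x\<bar> \<le> B" and s: "s \<in> {0..T}" and t: "t \<in> {0..T}"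
  shows "\<bar>integral {0..t} (\<lambda>s. f s x) - integral {0..s} (\<lambda>s. f s x)\<bar> \<le> B * \<bar>t - s\<bar>"
proof -
  have *: "\<bar>integral {0..t} (\<lambda>s. f s x) - integral {0..s} (\<lambda>s. f s x)\<bar> \<le> B * \<bar>t - s\<bar>" if "s \<le> t" "s \<in> {0..T}" "t \<in> {0..T}" for s t
  proof -
    have "integral {0..s} (\<lambda>s. f s x) + integral {s..t} (\<lambda>s. f s x) = integral {0..t} (\<lambda>s. f s x)"
      using that by (intro Henstock_Kurzweil_Integration.integral_combine time_integrable[OF f(1)]) auto
    moreover have "norm (integral {s..t} (\<lambda>s. f s x)) \<le> integral {s..t} (\<lambda>_. B)"
      using that f(2) by (intro integral_norm_bound_integral time_integrable[OF f(1)]) auto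
    ultimately show ?thesis using that by (simp add: mult.commute)
  qed
  show ?thesis using *[of s t] *[of t s] s t by (cases "s \<le> t") (auto simp: abs_minus_commute)
qed

lemma IF_zero: "IF 0 x = 0" "IH 0 x = 0"
  by (simp_all add: IF_def IH_def)

lemma IF_lip: "s \<in> {0..T} \<Longrightarrow> t \<in> {0..T} \<Longrightarrow> \<bar>IF t x - IF s x\<bar> \<le> 4 * \<beta> * \<bar>t - s\<bar>"
  and IH_lip: "s \<in> {0..T} \<Longrightarrow> t \<in> {0..T} \<Longrightarrow> \<bar>IH t x - IH s x\<bar> \<le> 4 * \<beta> * \<bar>t - s\<bar>"
  unfolding IF_def IH_def by (intro time_integral_diff jcont_F jcont_H F_bound H_bound; assumption)+

lemma a_bound:
  assumes t: "t \<in> {0..T}" shows "\<bar>a t x\<bar> \<le> 1/4"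
proof -
  have i: "\<bar>IF t x\<bar> \<le> 4 * \<beta> * T" "\<bar>IH t x\<bar> \<le> 4 * \<beta> * T"
    using IF_lip[of 0 t x] IH_lip[of 0 t x] t T(1) mult_left_mono[of t T "4 * \<beta>"] beta_nonneg by (auto simp: IF_zero)
  have "\<bar>a t x\<bar> \<le> \<bar>m0 x\<bar> * \<bar>IH t x\<bar> + \<bar>n0 x\<bar> * \<bar>IF t x\<bar>"
    unfolding a_def abs_mult[symmetric] by (rule abs_triangle_ineq4)
  also have "\<dots> \<le> (2 * \<beta>) * (4 * \<beta> * T) + (2 * \<beta>) * (4 * \<beta> * T)"
    using i data_bound[of x] beta_nonneg by (intro add_mono mult_mono) auto
  also have "\<dots> \<le> 1/4" using small by (simp add: power2_eq_square mult_ac)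
  finally show ?thesis .
qed

lemma F_pC1: "t \<in> {0..T} \<Longrightarrow> pC1 (F t) (\<lambda>x. m0 x - (1 + a t x) * F t x)"
  and H_pC1: "t \<in> {0..T} \<Longrightarrow> pC1 (H t) (\<lambda>x. - (n0 x - (1 + a t x) * H t x))"
  using lag_pC1[OF d_pC1 pcont_data(1), of t 1] lag_pC1[OF d_pC1 pcont_data(2), of t "-1"]
  by (auto simp: F_def H_def)

lemma lag_deriv_bound:
  assumes t: "t \<in> {0..T}"
  shows "\<bar>m0 x - (1 + a t x) * F t x\<bar> \<le> 8 * \<beta>" "\<bar>- (n0 x - (1 + a t x) * H t x)\<bar> \<le> 8 * \<beta>"
proof -
  have "\<bar>1 + a t x\<bar> \<le> 5/4" using a_bound[OF t, of x] by linarith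
  then have "\<bar>1 + a t x\<bar> * \<bar>F t x\<bar> \<le> 5/4 * (4 * \<beta>)" "\<bar>1 + a t x\<bar> * \<bar>H t x\<bar> \<le> 5/4 * (4 * \<beta>)"
    by (rule mult_mono[OF _ F_bound] mult_mono[OF _ H_bound]; simp)+
  then show "\<bar>m0 x - (1 + a t x) * F t x\<bar> \<le> 8 * \<beta>" "\<bar>- (n0 x - (1 + a t x) * H t x)\<bar> \<le> 8 * \<beta>"
    using data_bound[of x] beta_nonneg unfolding abs_mult[symmetric] by linarith+
qed

text \<open>The time integrals of the resolvents are C1 in space, with derivatives Lipschitz in
  time. They act as multipliers on the data in \<open>a_rbn_diff\<close>.\<close>

lemma IFH_pC1_diff:
  assumes s: "s \<in> {0..T}" and t: "t \<in> {0..T}"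
  shows "\<exists>f'. pC1 (\<lambda>x. IF t x - IF s x) f' \<and> (\<forall>x. \<bar>f' x\<bar> \<le> 8 * \<beta> * \<bar>t - s\<bar>)"
    "\<exists>f'. pC1 (\<lambda>x. IH t x - IH s x) f' \<and> (\<forall>x. \<bar>f' x\<bar> \<le> 8 * \<beta> * \<bar>t - s\<bar>)"
proof -
  have main: "\<exists>f'. pC1 (\<lambda>x. integral {0..t} (\<lambda>s. f s x) - integral {0..s} (\<lambda>s. f s x)) f' \<and> (\<forall>x. \<bar>f' x\<bar> \<le> 8 * \<beta> * \<bar>t - s\<bar>)"
    if f: "jcont f" "jcont f'" "\<And>s. s \<in> {0..T} \<Longrightarrow> pC1 (f s) (f' s)" "\<And>s x. s \<in> {0..T} \<Longrightarrow> \<bar>f' s x\<bar> \<le> 8 * \<beta>"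
    for f f' :: "real \<Rightarrow> real \<Rightarrow> real"
  proof -
    have 1: "pC1 (\<lambda>x. integral {0..t} (\<lambda>s. f s x)) (\<lambda>x. integral {0..t} (\<lambda>s. f' s x))" if t: "t \<in> {0..T}" for t
    proof (rule pC1_intro)
      show "integral {0..t} (\<lambda>s. f s (x + 1)) = integral {0..t} (\<lambda>s. f s x)" for x
        using pcont_per[OF pC1_pcont(1)[OF f(3)]] t by (intro integral_cong) auto
      show "continuous_on UNIV (\<lambda>x. integral {0..t} (\<lambda>s. f' s x))"
        by (rule jcont_space[OF jcont_integral_time[OF f(2)]])
      show "((\<lambda>x. integral {0..t} (\<lambda>s. f s x)) has_vector_derivative integral {0..t} (\<lambda>s. f' s x)) (at x)" for x
        using t f(3) by (intro space_deriv_integral f)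
          (auto simp: pC1_def has_real_derivative_iff_has_vector_derivative)
    qed
    show ?thesis
      using pC1_diff[OF 1[OF t] 1[OF s]] time_integral_diff[OF f(2) f(4) s t] by blast
  qed
  have j: "jcont (\<lambda>t x. m0 x - (1 + a t x) * F t x)" "jcont (\<lambda>t x. - (n0 x - (1 + a t x) * H t x))"
    using jcont_F jcont_H jcont_a jcont_data unfolding jcont_def by - (intro continuous_intros; assumption)+
  show "\<exists>f'. pC1 (\<lambda>x. IF t x - IF s x) f' \<and> (\<forall>x. \<bar>f' x\<bar> \<le> 8 * \<beta> * \<bar>t - s\<bar>)"
    unfolding IF_def by (rule main[OF jcont_F j(1) F_pC1 lag_deriv_bound(1)])
  show "\<exists>f'. pC1 (\<lambda>x. IH t x - IH s x) f' \<and> (\<forall>x. \<bar>f' x\<bar> \<le> 8 * \<beta> * \<bar>t - s\<bar>)"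
    unfolding IH_def by (rule main[OF jcont_H j(2) H_pC1 lag_deriv_bound(2)])
qed

text \<open>Each product of a datum with a C1 multiplier costs 44 * (2 * 4 + 8) = 704 by
  \<open>rbn_mult_pC1\<close>; two of them give 1408.\<close>

lemma a_rbn_diff:
  assumes s: "s \<in> {0..T}" and t: "t \<in> {0..T}"
  shows "rfin (\<lambda>x. a t x - a s x)" "rbn (\<lambda>x. a t x - a s x) \<le> 1408 * \<beta>\<^sup>2 * \<bar>t - s\<bar>"
proof -
  obtain f' h' where f: "pC1 (\<lambda>x. IF t x - IF s x) f'" "\<And>x. \<bar>f' x\<bar> \<le> 8 * \<beta> * \<bar>t - s\<bar>"
    and h: "pC1 (\<lambda>x. IH t x - IH s x) h'" "\<And>x. \<bar>h' x\<bar> \<le> 8 * \<beta> * \<bar>t - s\<bar>"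
    using IFH_pC1_diff[OF s t] by blast
  note r1 = rbn_mult_pC1[OF m0(1) h(1) IH_lip[OF s t] h(2)]
  note r2 = rbn_mult_pC1[OF n0(1) f(1) IF_lip[OF s t] f(2)]
  have e: "(\<lambda>x. a t x - a s x) = (\<lambda>x. (IH t x - IH s x) * m0 x - (IF t x - IF s x) * n0 x)"
    by (simp add: a_def algebra_simps)
  show "rfin (\<lambda>x. a t x - a s x)" unfolding e by (rule rbn_diff(1)[OF r1(1) r2(1)])
  define K where "K = 44 * (2 * (4 * \<beta> * \<bar>t - s\<bar>) + 8 * \<beta> * \<bar>t - s\<bar>)"
  have K: "0 \<le> K" using beta_nonneg by (simp add: K_def)
  have "rbn (\<lambda>x. a t x - a s x) \<le> K * rbn m0 + K * rbn n0"
    unfolding e using rbn_diff(2)[OF r1(1) r2(1)] r1(2) r2(2) unfolding K_def by linarith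
  also have "\<dots> \<le> K * \<beta> + K * \<beta>" using K m0(2) n0(2) by (intro add_mono mult_left_mono)
  finally show "rbn (\<lambda>x. a t x - a s x) \<le> 1408 * \<beta>\<^sup>2 * \<bar>t - s\<bar>" by (simp add: K_def power2_eq_square algebra_simps)
qed

text \<open>At time 0 the function \<open>a\<close> vanishes, so its norm is at most 1408 T beta^2.
  The factor 10^8 in the locale leaves room for the algebra constant 10000 required by
  \<open>rbn_divide\<close>.\<close>

lemma a_rbn:
  assumes t: "t \<in> {0..T}" shows "rfin (a t)" "10000 * rbn (a t) \<le> 1/2"
proof -
  have "0 \<in> {0..T}" using T by simp
  note r = a_rbn_diff[OF this t]
  have z: "(\<lambda>x. a t x - a 0 x) = a t" by (simp add: a_def IF_zero fun_eq_iff)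
  show "rfin (a t)" using r(1) by (simp add: z)
  have "rbn (a t) \<le> 1408 * \<beta>\<^sup>2 * t" using r(2) t by (simp add: z)
  also have "\<dots> \<le> 1408 * \<beta>\<^sup>2 * T" using t by (intro mult_left_mono) auto
  finally show "10000 * rbn (a t) \<le> 1/2" using T(2) by (simp add: mult_ac)
qed

end

context littlewood_paley
begin

text \<open>The symbol 1 + 2 pi i k sigma never vanishes, so the first order equation has only one
  periodic solution.\<close>

lemma res_unique:
  assumes b: "pC1 b (\<lambda>x. \<sigma> * (m x - b x))" and m: "pcont m" and \<sigma>: "\<sigma> = 1 \<or> \<sigma> = - 1"
  shows "res \<sigma> m = b"
proof -
  note pr = pC1_pcont(1)[OF res_pC1[OF m \<sigma>]] and pb = pC1_pcont(1)[OF b]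
  have "rfc (res \<sigma> m) k = rfc b k" for k
  proof -
    have "2 * pi * \<i> * of_int k * rfc b k = \<sigma> * (rfc m k - rfc b k)"
      using rfc_deriv[OF b, of k] pb m by (simp add: rfc_cmult rfc_diff)
    then have "(1 + 2 * pi * \<i> * of_int k * \<sigma>) * rfc b k = rfc m k" using \<sigma> by (auto simp: algebra_simps)
    moreover have "1 + 2 * pi * \<i> * of_int k * \<sigma> \<noteq> 0"
      using norm_resolvent_symbol(1)[OF \<sigma>, of k] by auto
    ultimately show ?thesis using rfc_res[OF m \<sigma>, of k] by (metis mult_left_cancel)
  qed
  then have "(\<lambda>x. complex_of_real (res \<sigma> m x)) = (\<lambda>x. of_real (b x))"
    using pr pb by (intro fc_inj) (auto simp: rfc_def)
  then show ?thesis by (simp add: fun_eq_iff)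
qed

end

section \<open>Densities transported by the flow\<close>

context lagrangian_flow
begin

definition p where "p t = inv (q t)"

text \<open>The push-forward of the density \<open>g\<close> under the map \<open>q t\<close>:
  division by the Jacobian conserves the mass between characteristics.\<close>

definition dens where "dens g t x = g (p t x) / (1 + a t (p t x))"

lemma q_facts:
  assumes t: "t \<in> {0..T}"
  shows "q t (x + 1) = q t x + 1" "(q t has_real_derivative 1 + a t x) (at x)"
    "1/2 \<le> 1 + a t x" "1 + a t x \<le> 2" "continuous_on A (\<lambda>x. 1 + a t x)"
proof -
  show "q t (x + 1) = q t x + 1" using pcont_per[OF pd] by (simp add: q_def)
  have "(d t has_real_derivative a t x) (at x)"
    using pC1_deriv[OF d_pC1[OF t]] by (simp add: has_real_derivative_iff_has_vector_derivative)
  then show "(q t has_real_derivative 1 + a t x) (at x)"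
    unfolding q_def[abs_def] by (intro DERIV_add DERIV_ident)
  show "1/2 \<le> 1 + a t x" "1 + a t x \<le> 2" using a_bound[OF t, of x] by linarith+
  show "continuous_on A (\<lambda>x. 1 + a t x)" by (intro continuous_intros jcont_space[OF jcont_a])
qed

lemma p_facts:
  assumes t: "t \<in> {0..T}"
  shows "q t (p t x) = x" "p t (q t x) = x" "p t (x + 1) = p t x + 1"
    "(p t has_real_derivative 1 / (1 + a t (p t x))) (at x)" "\<bar>p t x - p t y\<bar> \<le> 2 * \<bar>x - y\<bar>"
    "continuous_on UNIV (p t)" "continuous_on UNIV (\<lambda>x. 1 / (1 + a t (p t x)))" "\<bar>1 / (1 + a t (p t x))\<bar> \<le> 2"
    "pcont h \<Longrightarrow> l2 (\<lambda>x. h (p t x)) \<le> 2 * l2 h"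
proof -
  note c = circle_diffeo_inverse[of "q t" "\<lambda>x. 1 + a t x", folded p_def, OF q_facts(1-3)[OF t]]
  show "q t (p t x) = x" "p t (q t x) = x" "p t (x + 1) = p t x + 1"
    "(p t has_real_derivative 1 / (1 + a t (p t x))) (at x)" "\<bar>p t x - p t y\<bar> \<le> 2 * \<bar>x - y\<bar>" using c by auto
  show cp: "continuous_on UNIV (p t)" by (intro continuous_at_imp_continuous_on ballI DERIV_isCont[OF c(4)])
  have lb: "1/2 \<le> 1 + a t x" for x by (rule q_facts(3)[OF t])
  then have nz: "1 + a t x \<noteq> 0" for x using lb[of x] by linarith
  show "continuous_on UNIV (\<lambda>x. 1 / (1 + a t (p t x)))"
    using nz by (intro continuous_intros continuous_on_compose2[OF jcont_space[OF jcont_a] cp]) auto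
  show "\<bar>1 / (1 + a t (p t x))\<bar> \<le> 2" using lb[of "p t x"] by (simp add: field_simps)
  show "l2 (\<lambda>x. h (p t x)) \<le> 2 * l2 h" if "pcont h"
    unfolding p_def using l2_compose_inverse[OF q_facts(1,2,3,4)[OF t] q_facts(5)[OF t] that] .
qed

lemma rbn_compose_p:
  assumes t: "t \<in> {0..T}" and f: "rfin f"
  shows "rfin (\<lambda>x. f (p t x))" "rbn (\<lambda>x. f (p t x)) \<le> 264 * rbn f"
proof -
  have one: "pC1 (\<lambda>x. 1) (\<lambda>x. 0 :: real)" by (auto simp: pC1_def)
  note r = rbn_weighted_composition[OF f one _ _ p_facts(3,4,7,8,9)[OF t], of 1 0]
  show "rfin (\<lambda>x. f (p t x))" "rbn (\<lambda>x. f (p t x)) \<le> 264 * rbn f" using r by auto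
qed

lemma rbn_quotient:
  assumes t: "t \<in> {0..T}" and g: "rfin g"
  shows "rfin (\<lambda>x. g x / (1 + a t x))" "rbn (\<lambda>x. g x / (1 + a t x)) \<le> 2 * rbn g"
proof -
  have "\<bar>a t x\<bar> \<le> 1/2" for x using a_bound[OF t, of x] by linarith
  then show "rfin (\<lambda>x. g x / (1 + a t x))" "rbn (\<lambda>x. g x / (1 + a t x)) \<le> 2 * rbn g"
    using rbn_divide[OF g a_rbn[OF t]] by auto
qed

lemma dens_rfin: "t \<in> {0..T} \<Longrightarrow> rfin g \<Longrightarrow> rfin (dens g t)"
  unfolding dens_def[abs_def] by (rule rbn_compose_p(1)[OF _ rbn_quotient(1)])

text \<open>Put y = p t x. Then p s x and y are the images under \<open>p s\<close> of x and
  \<open>q s y\<close>, which differ by the change of the displacement at y; the Lipschitz constant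
  2 of \<open>p s\<close> turns the bound 16 beta^2 into 32 beta^2.\<close>

lemma p_time:
  assumes s: "s \<in> {0..T}" and t: "t \<in> {0..T}"
  shows "\<bar>p s x - p t x\<bar> \<le> 32 * \<beta>\<^sup>2 * \<bar>s - t\<bar>"
proof -
  define y where "y = p t x"
  have x: "x = y + d t y" using p_facts(1)[OF t, of x] by (simp add: y_def q_def)
  have b: "\<bar>F s x * H s x\<bar> \<le> 16 * \<beta>\<^sup>2" for s x
    using mult_mono[OF F_bound[of s x] H_bound[of s x]] beta_nonneg by (simp add: abs_mult power2_eq_square)
  have j: "jcont (\<lambda>s x. F s x * H s x)"
    using jcont_F jcont_H unfolding jcont_def by (intro continuous_intros)
  have "\<bar>d t y - d s y\<bar> \<le> 16 * \<beta>\<^sup>2 * \<bar>t - s\<bar>"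
    using time_integral_diff[OF j b s t, of y] eqd[OF s] eqd[OF t] by (simp add: F_def H_def)
  moreover have "\<bar>p s x - p s (q s y)\<bar> \<le> 2 * \<bar>x - q s y\<bar>" by (rule p_facts(5)[OF s])
  moreover have "x - q s y = d t y - d s y" using x by (simp add: q_def)
  ultimately show ?thesis
    using p_facts(2)[OF s, of y] by (simp add: y_def abs_minus_commute[of t s])
qed

text \<open>With E s = g / (1 + a s), the change splits into (E s - E t) composed with
  \<open>p s\<close>, Lipschitz in time by \<open>a_rbn_diff\<close>, and the change of composition
  for the fixed function \<open>E t\<close>, which tends to 0 by
  \<open>bn_compose_continuous\<close>.\<close>

lemma dens_continuous:
  assumes t: "t \<in> {0..T}" and g: "rfin g"
  shows "((\<lambda>s. rbn (\<lambda>x. dens g s x - dens g t x)) \<longlongrightarrow> 0) (at t within {0..T})"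
proof -
  define E where "E s x = g x / (1 + a s x)" for s x
  have E: "rfin (E s)" "rbn (E s) \<le> 2 * rbn g" if "s \<in> {0..T}" for s
    unfolding E_def[abs_def] by (rule rbn_quotient[OF that g])+
  define K where "K = 2 * (10000 * (1408 * \<beta>\<^sup>2) * rbn (E t))"
  have diff: "rfin (\<lambda>x. E s x - E t x) \<and> rbn (\<lambda>x. E s x - E t x) \<le> K * \<bar>s - t\<bar>" if s: "s \<in> {0..T}" for s
  proof -
    have "E s x - E t x = ((a t x - a s x) * E t x) / (1 + a s x)" for x
      using q_facts(3)[OF s, of x] q_facts(3)[OF t, of x] by (simp add: E_def field_simps)
    then have e: "(\<lambda>x. E s x - E t x) = (\<lambda>x. ((a t x - a s x) * E t x) / (1 + a s x))" by simp
    note r = a_rbn_diff[OF s t]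
    note m = rbn_mult[OF r(1) E(1)[OF t]]
    have "rbn (\<lambda>x. E s x - E t x) \<le> 2 * (10000 * rbn (\<lambda>x. a t x - a s x) * rbn (E t))"
      unfolding e using rbn_quotient(2)[OF s m(1)] m(2) by linarith
    also have "\<dots> \<le> 2 * (10000 * (1408 * \<beta>\<^sup>2 * \<bar>t - s\<bar>) * rbn (E t))"
      using r(2) rbn_nonneg[OF E(1)[OF t]] by (intro mult_left_mono mult_right_mono) auto
    also have "\<dots> = K * \<bar>s - t\<bar>" by (simp add: K_def abs_minus_commute)
    finally show ?thesis using rbn_quotient(1)[OF s m(1)] unfolding e by simp
  qed
  have cf: "pcont (\<lambda>x. complex_of_real (E t x))" "bfin (sqrt 2) (fc (\<lambda>x. of_real (E t x)))"
    using E(1)[OF t] by (auto simp: rfin_def rfc_def)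
  have un: "\<forall>\<^sub>F s in at t within {0..T}. \<forall>x. \<bar>p s x - p t x\<bar> < e" if e: "e > 0" for e
  proof -
    define \<delta> where "\<delta> = e / (32 * \<beta>\<^sup>2 + 1)"
    have \<delta>: "\<delta> > 0" using e by (simp add: \<delta>_def add_nonneg_pos)
    have "\<forall>\<^sub>F s in at t within {0..T}. s \<in> {0..T}" by (simp add: eventually_at_filter)
    moreover have "\<forall>\<^sub>F s in at t within {0..T}. dist s t < \<delta>"
      using \<delta> eventually_at by blast
    ultimately show ?thesis
    proof eventually_elim
      case (elim s)
      show ?case
      proof
        fix x
        have "\<bar>p s x - p t x\<bar> \<le> 32 * \<beta>\<^sup>2 * \<bar>s - t\<bar>" by (rule p_time[OF elim(1) t])
        also have "\<dots> \<le> 32 * \<beta>\<^sup>2 * \<delta>" using elim(2) by (intro mult_left_mono) (auto simp: dist_real_def)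
        also have "\<dots> < (32 * \<beta>\<^sup>2 + 1) * \<delta>" using \<delta> by (intro mult_strict_right_mono) auto
        also have "\<dots> = e" using add_nonneg_pos[of "32 * \<beta>\<^sup>2" 1] by (simp add: \<delta>_def)
        finally show "\<bar>p s x - p t x\<bar> < e" .
      qed
    qed
  qed
  have c: "((\<lambda>s. rbn (\<lambda>x. E t (p s x) - E t (p t x))) \<longlongrightarrow> 0) (at t within {0..T})"
    using bn_compose_continuous[OF cf p_facts(3,4,7,8,9) t un] by (simp add: rbn_def rfc_def)
  have up: "((\<lambda>s. 264 * (K * \<bar>s - t\<bar>) + rbn (\<lambda>x. E t (p s x) - E t (p t x))) \<longlongrightarrow> 264 * (K * \<bar>t - t\<bar>) + 0) (at t within {0..T})"
    by (intro tendsto_intros c)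
  have inT: "\<forall>\<^sub>F s in at t within {0..T}. s \<in> {0..T}" by (simp add: eventually_at_filter)
  show ?thesis
  proof (rule tendsto_sandwich[OF _ _ tendsto_const up[simplified]])
    show "\<forall>\<^sub>F s in at t within {0..T}. 0 \<le> rbn (\<lambda>x. dens g s x - dens g t x)"
      using inT by eventually_elim (intro rbn_nonneg rbn_diff dens_rfin t g)
    show "\<forall>\<^sub>F s in at t within {0..T}. rbn (\<lambda>x. dens g s x - dens g t x) \<le> 264 * (K * \<bar>s - t\<bar>) + rbn (\<lambda>x. E t (p s x) - E t (p t x))"
      using inT
    proof eventually_elim
      case (elim s)
      have e: "(\<lambda>x. dens g s x - dens g t x) = (\<lambda>x. (E s (p s x) - E t (p s x)) + (E t (p s x) - E t (p t x)))"
        by (simp add: dens_def E_def)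
      note r1 = rbn_compose_p[OF elim conjunct1[OF diff[OF elim]]]
      have r2: "rfin (\<lambda>x. E t (p s x) - E t (p t x))"
        by (intro rbn_diff rbn_compose_p elim t E)
      show ?case unfolding e using rbn_add(2)[OF r1(1) r2] r1(2) diff[OF elim] by linarith
    qed
  qed
qed

text \<open>Changing variables to the initial positions removes the inverse flow, so time enters
  only through \<open>q t\<close> inside the character.\<close>

lemma fc_push_forward:
  assumes t: "t \<in> {0..T}" and h: "pcont h"
  shows "fc (\<lambda>x. h (p t x) / of_real (1 + a t (p t x))) k = integral {0..1} (\<lambda>y. h y * wave (- k) (q t y))"
proof -
  have nz: "1 + a t x \<noteq> 0" for x using q_facts(3)[OF t, of x] by linarith
  have hp: "pcont (\<lambda>x. h (p t x) / of_real (1 + a t (p t x)))"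
  proof -
    have "pcont (\<lambda>x. h x / of_real (1 + a t x))"
      unfolding pcont_def
    proof (intro conjI allI)
      show "continuous_on UNIV (\<lambda>x. h x / of_real (1 + a t x))"
        using nz by (intro continuous_intros q_facts(5)[OF t] pcont_continuous[OF h]) (auto simp: of_real_add[symmetric] simp del: of_real_add)
      show "h (x + 1) / of_real (1 + a t (x + 1)) = h x / of_real (1 + a t x)" for x
        using pcont_per[OF h] pcont_per[OF pC1_pcont(2)[OF d_pC1[OF t]]] by simp
    qed
    from pcont_compose[OF this p_facts(6)[OF t] p_facts(3)[OF t]] show ?thesis .
  qed
  define f where "f x = h (p t x) / of_real (1 + a t (p t x)) * wave (- k) x" for x
  have "integral {0..1} f = integral {0..1} (\<lambda>x. (1 + a t x) *\<^sub>R f (q t x))"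
  proof (rule integral_periodic_substitution[symmetric, OF _ q_facts(1,2)[OF t]])
    show "pcont f" unfolding f_def[abs_def] by (rule pcont_mult[OF hp pcont_wave])
  qed
  also have "(\<lambda>x. (1 + a t x) *\<^sub>R f (q t x)) = (\<lambda>x. h x * wave (- k) (q t x))"
  proof
    fix x
    have "complex_of_real (1 + a t x) \<noteq> 0" using nz[of x] unfolding of_real_eq_0_iff .
    then show "(1 + a t x) *\<^sub>R f (q t x) = h x * wave (- k) (q t x)"
      by (simp only: f_def p_facts(2)[OF t] scaleR_conv_of_real) (simp add: field_simps)
  qed
  finally show ?thesis by (simp add: fc_def f_def[abs_def])
qed

text \<open>The continuity equation tested against a character: by \<open>fc_push_forward\<close>
  the time derivative falls on the character along the flow, where it produces the factor - 2 pi i k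
  times the velocity \<open>F t y * H t y\<close>.\<close>

lemma dens_time_deriv:
  assumes t: "t \<in> {0..T}" and g: "pcont g"
  shows "((\<lambda>s. rfc (dens g s) k) has_vector_derivative
    - (2 * pi * \<i> * of_int k * rfc (\<lambda>x. F t (p t x) * H t (p t x) * dens g t x) k)) (at t within {0..T})"
proof -
  define c where "c = 2 * pi * \<i> * of_int (- k)"
  define f where "f s y = complex_of_real (g y) * wave (- k) (q s y)" for s y
  define f' where "f' s y = complex_of_real (g y) * ((F s y * H s y) *\<^sub>R (c * wave (- k) (q s y)))" for s y
  have 1: "rfc (dens g s) k = integral (cbox 0 1) (f s)" if "s \<in> {0..T}" for s
    using fc_push_forward[OF that pcont_of_real[OF g], of k] by (simp add: rfc_def dens_def f_def[abs_def] cbox_interval)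
  have jq: "continuous_on UNIV (\<lambda>z. q (fst z) (snd z))"
    using jd unfolding q_def jcont_def by (intro continuous_intros)
  have jq': "continuous_on A (\<lambda>z. q (u z) (v z))" if "continuous_on A u" "continuous_on A v" for A :: "(real \<times> real) set" and u v
    using continuous_on_compose2[OF jq continuous_on_Pair[OF that]] by simp
  have dq: "((\<lambda>s. q s y) has_vector_derivative F s y * H s y) (at s within {0..T})" if s: "s \<in> {0..T}" for s y
  proof -
    have j: "jcont (\<lambda>s x. F s x * H s x)" using jcont_F jcont_H unfolding jcont_def by (intro continuous_intros)
    have "((\<lambda>u. integral {0..u} (\<lambda>s. F s y * H s y)) has_vector_derivative F s y * H s y) (at s within {0..T})"
      using s by (intro integral_has_vector_derivative jcont_time[OF j])
    then have "((\<lambda>u. y + integral {0..u} (\<lambda>s. F s y * H s y)) has_vector_derivative 0 + F s y * H s y) (at s within {0..T})"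
      by (intro has_vector_derivative_add has_vector_derivative_const)
    then have D: "((\<lambda>u. y + integral {0..u} (\<lambda>s. F s y * H s y)) has_vector_derivative F s y * H s y) (at s within {0..T})"
      by simp
    show ?thesis
      by (rule has_vector_derivative_transform[OF s _ D]) (use eqd in \<open>auto simp: q_def F_def H_def\<close>)
  qed
  have "((\<lambda>s. integral (cbox 0 1) (f s)) has_vector_derivative integral (cbox 0 1) (f' t)) (at t within {0..T})"
  proof (rule leibniz_rule_vector_derivative)
    fix s y assume s: "s \<in> {0..T}"
    have "((wave (- k) \<circ> (\<lambda>s. q s y)) has_vector_derivative (F s y * H s y) *\<^sub>R (c * wave (- k) (q s y))) (at s within {0..T})"
      unfolding c_def by (rule vector_diff_chain_within[OF dq[OF s]]) (rule wave_deriv)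
    then show "((\<lambda>s. f s y) has_vector_derivative f' s y) (at s within {0..T})"
      unfolding f_def f'_def o_def by (rule has_vector_derivative_mult_right)
  next
    fix s
    show "f s integrable_on cbox 0 1"
      unfolding f_def[abs_def] q_def cbox_interval
      by (intro integrable_continuous_real continuous_intros pcont_continuous g pd)
  next
    have "continuous_on ({0..T} \<times> cbox 0 1) (\<lambda>z. f' (fst z) (snd z))"
      unfolding f'_def
      by (intro continuous_intros jcont_compose[OF jcont_F] jcont_compose[OF jcont_H] jq'
          continuous_on_compose2[OF pcont_continuous[OF g, of UNIV]]) auto
    then show "continuous_on ({0..T} \<times> cbox 0 1) (\<lambda>(s, y). f' s y)" by (simp add: split_beta)
  qed (use t in auto)
  moreover have "integral (cbox 0 1) (f' t) = - (2 * pi * \<i> * of_int k * rfc (\<lambda>x. F t (p t x) * H t (p t x) * dens g t x) k)"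
  proof -
    have "pcont (\<lambda>y. complex_of_real (F t y * H t y * g y))"
      using pC1_pcont(1)[OF F_pC1[OF t]] pC1_pcont(1)[OF H_pC1[OF t]] g by (intro pcont_of_real pcont_mult)
    from fc_push_forward[OF t this, of k]
    have "rfc (\<lambda>x. F t (p t x) * H t (p t x) * dens g t x) k = integral {0..1} (\<lambda>y. of_real (F t y * H t y * g y) * wave (- k) (q t y))"
      by (simp add: rfc_def dens_def)
    moreover have "f' t = (\<lambda>y. c * (of_real (F t y * H t y * g y) * wave (- k) (q t y)))"
      by (simp add: f'_def fun_eq_iff scaleR_conv_of_real mult_ac)
    ultimately show ?thesis by (simp add: c_def cbox_interval)
  qed
  ultimately show ?thesis
    using has_vector_derivative_transform[OF t, of "\<lambda>s. rfc (dens g s) k" "\<lambda>s. integral (cbox 0 1) (f s)"] 1 by metis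
qed

text \<open>This closes the loop: the Lagrangian equations of \<open>F\<close> and \<open>H\<close>,
  transported by \<open>p\<close>, are the resolvent equations for the pushed densities. So the
  velocity driving the flow is the one generated by the transported densities.\<close>

lemma res_dens:
  assumes t: "t \<in> {0..T}"
  shows "res 1 (dens m0 t) x = F t (p t x)" "res (- 1) (dens n0 t) x = H t (p t x)"
proof -
  have nz: "1 + a t x \<noteq> 0" for x using q_facts(3)[OF t, of x] by linarith
  have "pC1 (\<lambda>x. F t (p t x)) (\<lambda>x. (1 / (1 + a t (p t x))) *\<^sub>R (m0 (p t x) - (1 + a t (p t x)) * F t (p t x)))"
    "pC1 (\<lambda>x. H t (p t x)) (\<lambda>x. (1 / (1 + a t (p t x))) *\<^sub>R (- (n0 (p t x) - (1 + a t (p t x)) * H t (p t x))))"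
    by (rule pC1_compose[OF _ p_facts(3,4,7)[OF t]], rule F_pC1[OF t] H_pC1[OF t])+
  moreover have "(1 / (1 + a t (p t x))) *\<^sub>R (m0 (p t x) - (1 + a t (p t x)) * F t (p t x)) = 1 * (dens m0 t x - F t (p t x))"
    "(1 / (1 + a t (p t x))) *\<^sub>R (- (n0 (p t x) - (1 + a t (p t x)) * H t (p t x))) = - 1 * (dens n0 t x - H t (p t x))" for x
    using nz[of "p t x"] by (simp_all add: dens_def field_simps)
  ultimately show "res 1 (dens m0 t) x = F t (p t x)" "res (- 1) (dens n0 t) x = H t (p t x)"
    using res_unique[of "\<lambda>x. F t (p t x)" 1 "dens m0 t"] res_unique[of "\<lambda>x. H t (p t x)" "- 1" "dens n0 t"]
      rfin_pcont[OF dens_rfin[OF t m0(1)]] rfin_pcont[OF dens_rfin[OF t n0(1)]] by simp_all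
qed

lemma dens_0: "dens g 0 = g"
proof -
  have 0: "0 \<in> {0..T}" using T by simp
  have "q 0 x = x" for x using eqd[OF 0] by (simp add: q_def)
  then have "p 0 x = x" for x using p_facts(2)[OF 0, of x] by simp
  then show ?thesis by (simp add: dens_def a_def IF_zero fun_eq_iff)
qed

end

context littlewood_paley
begin

lemma undamped_solution_exists:
  assumes m0: "rfin m0" "rbn m0 \<le> \<beta>" and n0: "rfin n0" "rbn n0 \<le> \<beta>"
    and T: "0 \<le> T" "10 ^ 8 * (T * \<beta>\<^sup>2) \<le> 1"
  obtains M N where "M 0 = m0" "N 0 = n0"
    "\<And>t. t \<in> {0..T} \<Longrightarrow> rfin (M t)" "\<And>t. t \<in> {0..T} \<Longrightarrow> rfin (N t)"
    "\<And>t. t \<in> {0..T} \<Longrightarrow> ((\<lambda>s. rbn (\<lambda>x. M s x - M t x)) \<longlongrightarrow> 0) (at t within {0..T})"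
    "\<And>t. t \<in> {0..T} \<Longrightarrow> ((\<lambda>s. rbn (\<lambda>x. N s x - N t x)) \<longlongrightarrow> 0) (at t within {0..T})"
    "\<And>t k. t \<in> {0..T} \<Longrightarrow> ((\<lambda>s. rfc (M s) k) has_vector_derivative
      - (2 * pi * \<i> * of_int k * rfc (\<lambda>x. res 1 (M t) x * res (- 1) (N t) x * M t x) k)) (at t within {0..T})"
    "\<And>t k. t \<in> {0..T} \<Longrightarrow> ((\<lambda>s. rfc (N s) k) has_vector_derivative
      - (2 * pi * \<i> * of_int k * rfc (\<lambda>x. res 1 (M t) x * res (- 1) (N t) x * N t x) k)) (at t within {0..T})"
proof -
  have \<beta>: "0 \<le> \<beta>" using rbn_nonneg[OF m0(1)] m0(2) by linarith
  have b: "\<bar>m0 x\<bar> \<le> 2 * \<beta>" "\<bar>n0 x\<bar> \<le> 2 * \<beta>" for x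
    using rbn_sup[OF m0(1), of x] rbn_sup[OF n0(1), of x] m0(2) n0(2) by linarith+
  have "T * (2 * \<beta>)\<^sup>2 \<le> 1/64" using T by (simp add: power_mult_distrib)
  from flow_exists[OF rfin_pcont[OF m0(1)] b(1) rfin_pcont[OF n0(1)] b(2) T(1) this]
  obtain d where d: "jcont d" "\<And>t. pcont (d t)" "\<And>t x. \<bar>d t x\<bar> \<le> 1/4"
    "\<And>t x. t \<in> {0..T} \<Longrightarrow> d t x = integral {0..t} (\<lambda>s. lag 1 (d s) m0 x * lag (- 1) (d s) n0 x)"
    by blast
  interpret lagrangian_flow chi phi m0 n0 \<beta> T d
    by unfold_locales (use m0 n0 T d in auto)
  show ?thesis
    by (rule that[of "dens m0" "dens n0"])
      (use dens_0 dens_rfin m0(1) n0(1) dens_continuous dens_time_deriv pcont_data res_dens in simp_all)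
qed

section \<open>Curves with values in Besov spaces\<close>

abbreviation ir :: real where "ir \<equiv> 1 / sqrt 2"

text \<open>A partial sum of the norm of index -1/2. It depends on finitely many coefficients, hence
  is continuous under coefficientwise convergence, and bounds uniform in \<open>N\<close> carry over
  to \<open>bn ir\<close>.\<close>

definition pn :: "nat \<Rightarrow> (int \<Rightarrow> complex) \<Rightarrow> real" where
  "pn N c = (\<Sum>n<N. ir ^ n * bt n c)"

lemma pn_triangle: "pn N (\<lambda>k. c k + d k) \<le> pn N c + pn N d"
  unfolding pn_def sum.distrib[symmetric] distrib_left[symmetric]
  by (intro sum_mono mult_left_mono bt_add) auto

lemma pn_cmult: "pn N (\<lambda>k. a * c k) = cmod a * pn N c"
  unfolding pn_def sum_distrib_left by (intro sum.cong refl) (simp add: bt_cmult)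

lemma pn_nonneg: "0 \<le> pn N c"
  unfolding pn_def by (intro sum_nonneg) auto

lemma pn_tendsto:
  assumes "\<And>k. ((\<lambda>s. u s k) \<longlongrightarrow> 0) F"
  shows "((\<lambda>s. pn N (u s)) \<longlongrightarrow> 0) F"
proof -
  have "((\<lambda>s. pn N (u s)) \<longlongrightarrow> pn N (\<lambda>k. 0)) F"
    unfolding pn_def bt_def L2_set_def
    by (intro tendsto_sum tendsto_mult tendsto_const tendsto_real_sqrt tendsto_power tendsto_norm assms)
  then show ?thesis by (simp add: pn_def)
qed

text \<open>A mean value inequality for a seminorm, by bisection. Near each point the difference
  quotient is within e of a derivative of seminorm at most e, whence the factor 2.\<close>

lemma pn_mean_value:
  fixes y y' :: "real \<Rightarrow> int \<Rightarrow> complex"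
  assumes ab: "a \<le> b" and e: "0 < e" and D: "\<And>s k. s \<in> {a..b} \<Longrightarrow> ((\<lambda>s. y s k) has_vector_derivative y' s k) (at s within {a..b})"
    and bd: "\<And>s. s \<in> {a..b} \<Longrightarrow> pn N (y' s) \<le> e"
  shows "pn N (\<lambda>k. y b k - y a k) \<le> 2 * e * (b - a)"
proof -
  define P where "P u v \<longleftrightarrow> a \<le> u \<and> v \<le> b \<longrightarrow> pn N (\<lambda>k. y v k - y u k) \<le> 2 * e * (v - u)" for u v
  have "P a b"
    using ab
  proof (induction rule: Bolzano)
    case (trans u v w)
    show ?case
      unfolding P_def
    proof
      assume "a \<le> u \<and> w \<le> b"
      then have "pn N (\<lambda>k. y v k - y u k) \<le> 2 * e * (v - u)" "pn N (\<lambda>k. y w k - y v k) \<le> 2 * e * (w - v)"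
        using trans unfolding P_def by auto
      then show "pn N (\<lambda>k. y w k - y u k) \<le> 2 * e * (w - u)"
        using pn_triangle[of N "\<lambda>k. y w k - y v k" "\<lambda>k. y v k - y u k"] by (simp add: algebra_simps)
    qed
  next
    case (local x)
    then have x: "x \<in> {a..b}" by simp
    have "((\<lambda>s. (y s k - y x k) /\<^sub>R (s - x) - y' x k) \<longlongrightarrow> 0) (at x within {a..b})" for k
      using vector_derivative_quotient[OF D[OF x]] by (rule LIM_zero)
    then have "((\<lambda>s. pn N (\<lambda>k. (y s k - y x k) /\<^sub>R (s - x) - y' x k)) \<longlongrightarrow> 0) (at x within {a..b})"
      by (rule pn_tendsto)
    then have "\<forall>\<^sub>F s in at x within {a..b}. pn N (\<lambda>k. (y s k - y x k) /\<^sub>R (s - x) - y' x k) < e"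
      using e by (intro order_tendstoD(2)[of _ 0])
    then obtain \<delta> where \<delta>: "\<delta> > 0" "\<And>s. s \<in> {a..b} \<Longrightarrow> s \<noteq> x \<Longrightarrow> dist s x < \<delta> \<Longrightarrow>
        pn N (\<lambda>k. (y s k - y x k) /\<^sub>R (s - x) - y' x k) < e"
      unfolding eventually_at by blast
    have near: "pn N (\<lambda>k. y s k - y x k) \<le> 2 * e * \<bar>s - x\<bar>" if s: "s \<in> {a..b}" "dist s x < \<delta>" for s
    proof (cases "s = x")
      case True then show ?thesis by (simp add: pn_def)
    next
      case False
      let ?w = "\<lambda>k. (y s k - y x k) /\<^sub>R (s - x) - y' x k"
      have "(\<lambda>k. y s k - y x k) = (\<lambda>k. of_real (s - x) * (?w k + y' x k))"
      proof
        fix k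
        have "of_real (s - x) * (?w k + y' x k) = (s - x) *\<^sub>R ((y s k - y x k) /\<^sub>R (s - x))"
          by (simp add: scaleR_conv_of_real)
        also have "\<dots> = y s k - y x k" using False by simp
        finally show "y s k - y x k = of_real (s - x) * (?w k + y' x k)" by simp
      qed
      then have "pn N (\<lambda>k. y s k - y x k) = \<bar>s - x\<bar> * pn N (\<lambda>k. ?w k + y' x k)"
        using pn_cmult[of N "of_real (s - x)" "\<lambda>k. ?w k + y' x k"] by (simp only: norm_of_real)
      also have "\<dots> \<le> \<bar>s - x\<bar> * (e + e)"
        using pn_triangle[of N ?w "y' x"] \<delta>(2)[OF s(1) False s(2)] bd[OF x] by (intro mult_left_mono) auto
      finally show ?thesis by (simp add: mult_ac)
    qed
    have "P u v" if uv: "u \<le> x" "x \<le> v" "v - u < \<delta>" for u v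
      unfolding P_def
    proof
      assume "a \<le> u \<and> v \<le> b"
      then have n: "pn N (\<lambda>k. y u k - y x k) \<le> 2 * e * (x - u)" "pn N (\<lambda>k. y v k - y x k) \<le> 2 * e * (v - x)"
        using near[of u] near[of v] uv local by (auto simp: dist_real_def)
      have "pn N (\<lambda>k. - (y u k - y x k)) = pn N (\<lambda>k. y u k - y x k)"
        using pn_cmult[of N "-1" "\<lambda>k. y u k - y x k"] by simp
      then show "pn N (\<lambda>k. y v k - y u k) \<le> 2 * e * (v - u)"
        using pn_triangle[of N "\<lambda>k. y v k - y x k" "\<lambda>k. - (y u k - y x k)"] n by (simp add: algebra_simps)
    qed
    then show ?case using \<delta>(1) by blast
  qed
  then show ?thesis by (simp add: P_def)
qed

text \<open>Coefficientwise derivatives that are continuous in the norm are derivatives in the norm.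
  The mean value inequality is applied to each partial sum, with a bound that does not depend on the
  number of blocks.\<close>

lemma bn_quotient_tendsto:
  fixes c c' :: "real \<Rightarrow> int \<Rightarrow> complex"
  assumes D: "\<And>s k. 0 \<le> s \<Longrightarrow> ((\<lambda>s. c s k) has_vector_derivative c' s k) (at s within {0..})"
    and fin: "\<And>s. 0 \<le> s \<Longrightarrow> bfin ir (\<lambda>k. c' s k - c' t k)" and t: "0 \<le> t"
    and lim: "((\<lambda>s. bn ir (\<lambda>k. c' s k - c' t k)) \<longlongrightarrow> 0) (at t within {0..})"
  shows "((\<lambda>h. bn ir (\<lambda>k. (c h k - c t k) / of_real (h - t) - c' t k)) \<longlongrightarrow> 0) (at t within {0..})"
proof (rule tendstoI)
  fix e :: real assume e: "e > 0"
  have "\<forall>\<^sub>F s in at t within {0..}. bn ir (\<lambda>k. c' s k - c' t k) < e / 4"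
    using lim e by (intro order_tendstoD(2)[of _ 0]) auto
  then obtain \<delta> where \<delta>: "\<delta> > 0" "\<And>s. 0 \<le> s \<Longrightarrow> s \<noteq> t \<Longrightarrow> dist s t < \<delta> \<Longrightarrow> bn ir (\<lambda>k. c' s k - c' t k) < e / 4"
    unfolding eventually_at by auto
  have p: "pn N (\<lambda>k. c' s k - c' t k) \<le> e / 4" if s: "0 \<le> s" "dist s t < \<delta>" for s N
  proof (cases "s = t")
    case True then show ?thesis using e by (simp add: pn_def)
  next
    case False
    have "pn N (\<lambda>k. c' s k - c' t k) \<le> bn ir (\<lambda>k. c' s k - c' t k)"
      unfolding pn_def using fin[OF s(1)] by (intro bn_partial) auto
    then show ?thesis using \<delta>(2)[OF s(1) False s(2)] by simp
  qed
  have near: "bfin ir (\<lambda>k. (c h k - c t k) / of_real (h - t) - c' t k) \<and> bn ir (\<lambda>k. (c h k - c t k) / of_real (h - t) - c' t k) \<le> e / 2"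
    if h: "0 \<le> h" "h \<noteq> t" "dist h t < \<delta>" for h
  proof (rule bfin_iff_bounded)
    fix N
    \<comment> \<open>Subtracting the linear part leaves a curve whose derivative c' s - c' t is
      small near t.\<close>
    define y where "y s k = c s k - of_real s * c' t k" for s k
    define u v where "u = min h t" and "v = max h t"
    have uv: "u \<le> v" "0 \<le> u" "v - u = \<bar>h - t\<bar>" "\<And>s. s \<in> {u..v} \<Longrightarrow> dist s t < \<delta>" "0 < \<bar>h - t\<bar>"
      using h t by (auto simp: u_def v_def dist_real_def)
    have dy: "((\<lambda>s. y s k) has_vector_derivative c' s k - c' t k) (at s within {u..v})" if "s \<in> {u..v}" for s k
    proof -
      have "((\<lambda>s. of_real s * c' t k) has_vector_derivative of_real 1 * c' t k) (at s within {u..v})"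
        by (intro has_vector_derivative_mult_left has_vector_derivative_of_real DERIV_ident)
      moreover have "((\<lambda>s. c s k) has_vector_derivative c' s k) (at s within {u..v})"
        using D[of s k] that uv(2) by (intro has_vector_derivative_within_subset[OF D[of s k]]) auto
      ultimately show ?thesis unfolding y_def using has_vector_derivative_diff by fastforce
    qed
    have "pn N (\<lambda>k. y v k - y u k) \<le> 2 * (e / 4) * (v - u)"
      by (rule pn_mean_value[OF uv(1) _ dy]) (use e uv p in auto)
    moreover have "(\<lambda>k. (c h k - c t k) / of_real (h - t) - c' t k) = (\<lambda>k. (1 / of_real (v - u)) * (y v k - y u k))"
    proof
      fix k
      have "of_real h - of_real t \<noteq> (0::complex)" using h(2) by (simp flip: of_real_diff)
      then have "(c h k - c t k) / of_real (h - t) - c' t k = (y h k - y t k) / of_real (h - t)"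
        by (simp add: y_def field_simps)
      also have "\<dots> = (1 / of_real (v - u)) * (y v k - y u k)"
        using h(2) by (auto simp: u_def v_def min_def max_def) (metis minus_diff_eq minus_divide_divide)
      finally show "(c h k - c t k) / of_real (h - t) - c' t k = (1 / of_real (v - u)) * (y v k - y u k)" .
    qed
    ultimately have "pn N (\<lambda>k. (c h k - c t k) / of_real (h - t) - c' t k) \<le> (1 / (v - u)) * (2 * (e / 4) * (v - u))"
      using uv by (simp only: pn_cmult norm_divide norm_one norm_of_real) (intro mult_mono, auto simp: pn_nonneg)
    also have "\<dots> = e / 2" using uv by (simp add: field_simps)
    finally show "(\<Sum>n<N. ir ^ n * bt n (\<lambda>k. (c h k - c t k) / of_real (h - t) - c' t k)) \<le> e / 2"
      by (simp add: pn_def)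
  qed simp
  show "\<forall>\<^sub>F h in at t within {0..}. dist (bn ir (\<lambda>k. (c h k - c t k) / of_real (h - t) - c' t k)) 0 < e"
    unfolding eventually_at
  proof (intro exI[of _ \<delta>] conjI ballI impI)
    fix h assume "h \<in> {0..}" "h \<noteq> t \<and> dist h t < \<delta>"
    then show "dist (bn ir (\<lambda>k. (c h k - c t k) / of_real (h - t) - c' t k)) 0 < e"
      using near[of h] bn_nonneg[of ir "\<lambda>k. (c h k - c t k) / of_real (h - t) - c' t k"] e by auto
  qed (use \<delta> in auto)
qed

section \<open>Besov norms of index 1/2 and -1/2 in terms of coefficients\<close>

lemma powr_half: "2 powr (1/2) = sqrt (2::real)" "2 powr (1/2 - 1) = ir" "2 powr (- (1/2)) = ir"
proof -
  show "2 powr (1/2) = sqrt (2::real)" by (simp add: powr_half_sqrt)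
  show 1: "2 powr (- (1/2)) = ir" by (simp add: powr_minus_divide powr_half_sqrt)
  have "(1/2 - 1 :: real) = - (1/2)" by simp
  then show "2 powr (1/2 - 1) = ir" using 1 by (simp only:)
qed

lemma besov_half_iff: "S \<in> besov chi phi (1/2) \<longleftrightarrow> bfin (sqrt 2) (fourier_coeff S)"
  "S \<in> besov chi phi (1/2 - 1) \<longleftrightarrow> bfin ir (fourier_coeff S)"
  unfolding besov_iff powr_half by auto

lemma besov_half_norm:
  "S \<in> besov chi phi (1/2) \<Longrightarrow> besov_norm chi phi (1/2) S = ir * bn (sqrt 2) (fourier_coeff S)"
  "S \<in> besov chi phi (1/2 - 1) \<Longrightarrow> besov_norm chi phi (1/2 - 1) S = sqrt 2 * bn ir (fourier_coeff S)"
proof -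
  have "- (1/2 - 1) = (1/2 :: real)" by simp
  then show "S \<in> besov chi phi (1/2) \<Longrightarrow> besov_norm chi phi (1/2) S = ir * bn (sqrt 2) (fourier_coeff S)"
    "S \<in> besov chi phi (1/2 - 1) \<Longrightarrow> besov_norm chi phi (1/2 - 1) S = sqrt 2 * bn ir (fourier_coeff S)"
    using besov_norm_eq by (simp_all only: powr_half)
qed

lemma bfin_lower:
  assumes "bfin (sqrt 2) c" shows "bfin ir c" "bn ir c \<le> bn (sqrt 2) c"
proof -
  have "ir ^ n * bt n c \<le> 1 * (sqrt 2 ^ n * bt n c)" for n
    unfolding mult_1_left by (intro mult_right_mono sqrt2_facts(4)) auto
  from bfin_mono[OF this _ assms] show "bfin ir c" "bn ir c \<le> bn (sqrt 2) c" by auto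
qed

lemma bfin_deriv:
  assumes "bfin (sqrt 2) c"
  shows "bfin ir (\<lambda>k. 2 * pi * \<i> * of_int k * c k)" "bn ir (\<lambda>k. 2 * pi * \<i> * of_int k * c k) \<le> 4/3 * bn (sqrt 2) c"
proof -
  have "ir ^ n * bt n (\<lambda>k. 2 * pi * \<i> * of_int k * c k) \<le> 4/3 * (sqrt 2 ^ n * bt n c)" for n
  proof -
    have "ir ^ n * bt n (\<lambda>k. 2 * pi * \<i> * of_int k * c k) \<le> ir ^ n * (4/3 * 2 ^ n * bt n c)"
      by (intro mult_left_mono bt_deriv_le) simp
    also have "\<dots> = 4/3 * ((ir ^ n * 2 ^ n) * bt n c)" by simp
    finally show ?thesis unfolding sqrt2_facts(3) .
  qed
  then show "bfin ir (\<lambda>k. 2 * pi * \<i> * of_int k * c k)" "bn ir (\<lambda>k. 2 * pi * \<i> * of_int k * c k) \<le> 4/3 * bn (sqrt 2) c"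
    using bfin_mono[of ir _ "4/3" "sqrt 2" c] assms by auto
qed

lemma rfin_besov:
  assumes "rfin f"
  shows "pd_of_fun f \<in> besov chi phi (1/2)" "pd_of_fun f \<in> besov chi phi (1/2 - 1)"
    "besov_norm chi phi (1/2) (pd_of_fun f) = ir * rbn f"
    "besov_norm chi phi (1/2 - 1) (pd_of_fun f) \<le> sqrt 2 * rbn f"
proof -
  have e: "fourier_coeff (pd_of_fun f) = rfc f" using fourier_coeff_pd_of_fun[OF rfin_pcont[OF assms]] by auto
  have f: "bfin (sqrt 2) (rfc f)" using assms by (simp add: rfin_def)
  show 1: "pd_of_fun f \<in> besov chi phi (1/2)" "pd_of_fun f \<in> besov chi phi (1/2 - 1)"
    unfolding besov_half_iff e using f bfin_lower by auto
  show "besov_norm chi phi (1/2) (pd_of_fun f) = ir * rbn f"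
    "besov_norm chi phi (1/2 - 1) (pd_of_fun f) \<le> sqrt 2 * rbn f"
    unfolding besov_half_norm(1)[OF 1(1)] besov_half_norm(2)[OF 1(2)] e rbn_def using bfin_lower[OF f] by auto
qed

text \<open>A component of the system, with flux \<open>v\<close>: \<open>y\<^sub>t = - v\<^sub>x - \<lambda> y\<close>.\<close>

lemma component_curve:
  fixes y v :: "real \<Rightarrow> real \<Rightarrow> real" and lam :: real
  assumes y: "\<And>t. 0 \<le> t \<Longrightarrow> rfin (y t)" and v: "\<And>t. 0 \<le> t \<Longrightarrow> rfin (v t)"
    and cy: "\<And>t. 0 \<le> t \<Longrightarrow> ((\<lambda>s. rbn (\<lambda>x. y s x - y t x)) \<longlongrightarrow> 0) (at t within {0..})"
    and cv: "\<And>t. 0 \<le> t \<Longrightarrow> ((\<lambda>s. rbn (\<lambda>x. v s x - v t x)) \<longlongrightarrow> 0) (at t within {0..})"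
    and D: "\<And>t k. 0 \<le> t \<Longrightarrow> ((\<lambda>s. rfc (y s) k) has_vector_derivative
      - (2 * pi * \<i> * of_int k * rfc (v t) k) - lam * rfc (y t) k) (at t within {0..})"
  defines "Y \<equiv> \<lambda>t. pd_of_fun (y t)" and "Z \<equiv> \<lambda>t. - pd_deriv (pd_of_fun (v t)) - lam *\<^sub>R pd_of_fun (y t)"
  shows "\<And>t. 0 \<le> t \<Longrightarrow> ((\<lambda>s. besov_norm chi phi (1/2) (Y s - Y t)) \<longlongrightarrow> 0) (at t within {0..})"
    "\<And>t. 0 \<le> t \<Longrightarrow> ((\<lambda>s. besov_norm chi phi (1/2 - 1) (Y s - Y t)) \<longlongrightarrow> 0) (at t within {0..})"
    "\<And>t. 0 \<le> t \<Longrightarrow> Z t \<in> besov chi phi (1/2 - 1)"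
    "\<And>t. 0 \<le> t \<Longrightarrow> ((\<lambda>s. besov_norm chi phi (1/2 - 1) (Z s - Z t)) \<longlongrightarrow> 0) (at t within {0..})"
    "\<And>t. 0 \<le> t \<Longrightarrow> curve_has_deriv (besov_norm chi phi (1/2 - 1)) Y (Z t) t {0..}"
proof -
  have ev: "\<forall>\<^sub>F s in at t within {0..}. 0 \<le> s" for t :: real by (simp add: eventually_at_filter)
  have fy: "rfin (\<lambda>x. y s x - y t x)" and fv: "rfin (\<lambda>x. v s x - v t x)" if "0 \<le> s" "0 \<le> t" for s t
    using rbn_diff(1) y v that by auto
  have Yd: "Y s - Y t = pd_of_fun (\<lambda>x. y s x - y t x)" if "0 \<le> s" "0 \<le> t" for s t
    unfolding Y_def using pd_of_fun_diff rfin_pcont y that by simp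
  have fcy: "fourier_coeff (Y t) k = rfc (y t) k" if "0 \<le> t" for t k
    unfolding Y_def using fourier_coeff_pd_of_fun rfin_pcont y that by simp
  define z where "z t k = - (2 * pi * \<i> * of_int k * rfc (v t) k) - lam * rfc (y t) k" for t k
  have fcZ: "fourier_coeff (Z t) k = z t k" if "0 \<le> t" for t k
    unfolding Z_def z_def using that
    by (simp add: fourier_coeff_diff fourier_coeff_uminus fourier_coeff_deriv fourier_coeff_scaleR
        fourier_coeff_pd_of_fun[OF rfin_pcont[OF y]] fourier_coeff_pd_of_fun[OF rfin_pcont[OF v]])
  have ir0: "0 \<le> ir" by simp
  have zb: "bfin ir (\<lambda>k. - (2 * pi * \<i> * of_int k * rfc g k) - lam * rfc f k) \<and>
      bn ir (\<lambda>k. - (2 * pi * \<i> * of_int k * rfc g k) - lam * rfc f k) \<le> 4/3 * rbn g + \<bar>lam\<bar> * rbn f"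
    if "rfin f" "rfin g" for f g
  proof -
    have g: "bfin (sqrt 2) (rfc g)" and f: "bfin (sqrt 2) (rfc f)" using that by (auto simp: rfin_def)
    note g1 = bfin_deriv[OF g] and f1 = bfin_lower[OF f]
    note g2 = bfin_cmult[OF ir0 g1(1), of "- 1"] and f2 = bfin_cmult[OF ir0 f1(1), of "- of_real lam"]
    note s = bfin_add[OF ir0 g2(1) f2(1)]
    have e: "(\<lambda>k. - (2 * pi * \<i> * of_int k * rfc g k) - lam * rfc f k)
        = (\<lambda>k. - 1 * (2 * pi * \<i> * of_int k * rfc g k) + - of_real lam * rfc f k)" by simp
    have "bn ir (\<lambda>k. - (2 * pi * \<i> * of_int k * rfc g k) - lam * rfc f k)
        \<le> 4/3 * rbn g + \<bar>lam\<bar> * bn ir (rfc f)"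
      unfolding e rbn_def using s(2) g2(2) f2(2) g1(2) by simp
    also have "\<dots> \<le> 4/3 * rbn g + \<bar>lam\<bar> * rbn f"
      using f1(2) unfolding rbn_def by (intro add_left_mono mult_left_mono) auto
    finally show ?thesis using s(1) unfolding e by simp
  qed
  have zd: "(\<lambda>k. z s k - z t k) = (\<lambda>k. - (2 * pi * \<i> * of_int k * rfc (\<lambda>x. v s x - v t x) k) - lam * rfc (\<lambda>x. y s x - y t x) k)"
    if "0 \<le> s" "0 \<le> t" for s t
  proof
    fix k
    have d: "rfc (\<lambda>x. v s x - v t x) k = rfc (v s) k - rfc (v t) k" "rfc (\<lambda>x. y s x - y t x) k = rfc (y s) k - rfc (y t) k"
      using rfin_pcont y v that by (auto intro!: rfc_diff)
    show "z s k - z t k = - (2 * pi * \<i> * of_int k * rfc (\<lambda>x. v s x - v t x) k) - lam * rfc (\<lambda>x. y s x - y t x) k"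
      unfolding z_def d by (simp add: right_diff_distrib)
  qed
  have zc: "((\<lambda>s. bn ir (\<lambda>k. z s k - z t k)) \<longlongrightarrow> 0) (at t within {0..})" if t: "0 \<le> t" for t
  proof (rule tendsto_sandwich[OF _ _ tendsto_const])
    show "\<forall>\<^sub>F s in at t within {0..}. 0 \<le> bn ir (\<lambda>k. z s k - z t k)"
      using ev by eventually_elim (use zb fy fv t in \<open>auto simp: zd intro!: bn_nonneg\<close>)
    show "\<forall>\<^sub>F s in at t within {0..}. bn ir (\<lambda>k. z s k - z t k)
        \<le> 4/3 * rbn (\<lambda>x. v s x - v t x) + \<bar>lam\<bar> * rbn (\<lambda>x. y s x - y t x)"
      using ev by eventually_elim (use zb fy fv t in \<open>simp add: zd\<close>)
    have "((\<lambda>s. 4/3 * rbn (\<lambda>x. v s x - v t x) + \<bar>lam\<bar> * rbn (\<lambda>x. y s x - y t x)) \<longlongrightarrow> 4/3 * 0 + \<bar>lam\<bar> * 0) (at t within {0..})"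
      by (intro tendsto_intros cv cy t)
    then show "((\<lambda>s. 4/3 * rbn (\<lambda>x. v s x - v t x) + \<bar>lam\<bar> * rbn (\<lambda>x. y s x - y t x)) \<longlongrightarrow> 0) (at t within {0..})" by simp
  qed
  have zfin: "bfin ir (\<lambda>k. z s k - z t k)" if "0 \<le> s" "0 \<le> t" for s t
    using zb fy fv that by (simp add: zd)
  fix t :: real assume t: "0 \<le> t"
  have fZ: "fourier_coeff (Z t) = z t" by (rule ext) (rule fcZ[OF t])
  show Zb: "Z t \<in> besov chi phi (1/2 - 1)"
    unfolding besov_half_iff fZ using zb[OF y v, OF t t] by (simp add: z_def[abs_def])
  show "((\<lambda>s. besov_norm chi phi (1/2) (Y s - Y t)) \<longlongrightarrow> 0) (at t within {0..})"
  proof (rule Lim_transform_eventually)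
    show "((\<lambda>s. ir * rbn (\<lambda>x. y s x - y t x)) \<longlongrightarrow> 0) (at t within {0..})"
      using tendsto_mult_left[OF cy[OF t], of ir] by simp
    show "\<forall>\<^sub>F s in at t within {0..}. ir * rbn (\<lambda>x. y s x - y t x) = besov_norm chi phi (1/2) (Y s - Y t)"
      using ev by eventually_elim (simp add: Yd t rfin_besov(3)[OF fy])
  qed
  show "((\<lambda>s. besov_norm chi phi (1/2 - 1) (Y s - Y t)) \<longlongrightarrow> 0) (at t within {0..})"
  proof (rule tendsto_sandwich[OF _ _ tendsto_const])
    show "((\<lambda>s. sqrt 2 * rbn (\<lambda>x. y s x - y t x)) \<longlongrightarrow> 0) (at t within {0..})"
      using tendsto_mult_left[OF cy[OF t], of "sqrt 2"] by simp
    show "\<forall>\<^sub>F s in at t within {0..}. besov_norm chi phi (1/2 - 1) (Y s - Y t) \<le> sqrt 2 * rbn (\<lambda>x. y s x - y t x)"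
      using ev by eventually_elim (simp only: Yd t rfin_besov(4)[OF fy])
    show "\<forall>\<^sub>F s in at t within {0..}. 0 \<le> besov_norm chi phi (1/2 - 1) (Y s - Y t)"
      using ev
    proof eventually_elim
      case (elim s)
      note b = rfin_besov(2)[OF fy[OF elim t]]
      show ?case unfolding Yd[OF elim t] besov_half_norm(2)[OF b]
        using b unfolding besov_half_iff by (intro mult_nonneg_nonneg bn_nonneg) auto
    qed
  qed
  have fcd: "fourier_coeff (Z s - Z t) = (\<lambda>k. z s k - z t k)" if "0 \<le> s" for s
    using fcZ t that by (auto simp: fourier_coeff_diff)
  show "((\<lambda>s. besov_norm chi phi (1/2 - 1) (Z s - Z t)) \<longlongrightarrow> 0) (at t within {0..})"
  proof (rule Lim_transform_eventually)
    show "((\<lambda>s. sqrt 2 * bn ir (\<lambda>k. z s k - z t k)) \<longlongrightarrow> 0) (at t within {0..})"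
      using tendsto_mult_left[OF zc[OF t], of "sqrt 2"] by simp
    show "\<forall>\<^sub>F s in at t within {0..}. sqrt 2 * bn ir (\<lambda>k. z s k - z t k) = besov_norm chi phi (1/2 - 1) (Z s - Z t)"
      using ev
    proof eventually_elim
      case (elim s)
      have "Z s - Z t \<in> besov chi phi (1/2 - 1)"
        unfolding besov_half_iff fcd[OF elim] by (rule zfin[OF elim t])
      then show ?case by (simp only: besov_half_norm(2) fcd[OF elim])
    qed
  qed
  define Q where "Q h k = (rfc (y h) k - rfc (y t) k) / of_real (h - t) - z t k" for h k
  have fcQ: "fourier_coeff ((Y h - Y t) /\<^sub>R (h - t) - Z t) = Q h" if "0 \<le> h" for h
    using fcy fcZ t that by (auto simp: fourier_coeff_diff fourier_coeff_scaleR Q_def divide_inverse mult.commute)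
  have Qfin: "bfin ir (Q h)" if h: "0 \<le> h" for h
  proof -
    have f: "bfin ir (\<lambda>k. rfc (\<lambda>x. y h x - y t x) k)" using fy[OF h t] bfin_lower(1) by (simp add: rfin_def)
    have "bfin ir (\<lambda>k. z t k)" using Zb unfolding besov_half_iff fZ by simp
    note g = bfin_cmult(1)[OF ir0 this, of "- 1"]
    from bfin_add(1)[OF ir0 bfin_cmult(1)[OF ir0 f, of "1 / of_real (h - t)"] g]
    show ?thesis using h t rfc_diff rfin_pcont y by (simp add: Q_def[abs_def])
  qed
  show "curve_has_deriv (besov_norm chi phi (1/2 - 1)) Y (Z t) t {0..}"
    unfolding curve_has_deriv_def
  proof (rule Lim_transform_eventually)
    have "((\<lambda>h. bn ir (Q h)) \<longlongrightarrow> 0) (at t within {0..})"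
      unfolding Q_def by (rule bn_quotient_tendsto[OF _ zfin t zc[OF t]]) (use D t in \<open>auto simp: z_def\<close>)
    then show "((\<lambda>h. sqrt 2 * bn ir (Q h)) \<longlongrightarrow> 0) (at t within {0..})"
      using tendsto_mult_left[of "\<lambda>h. bn ir (Q h)" 0 _ "sqrt 2"] by simp
    show "\<forall>\<^sub>F h in at t within {0..}. sqrt 2 * bn ir (Q h) = besov_norm chi phi (1/2 - 1) ((Y h - Y t) /\<^sub>R (h - t) - Z t)"
      using ev
    proof eventually_elim
      case (elim h)
      have "(Y h - Y t) /\<^sub>R (h - t) - Z t \<in> besov chi phi (1/2 - 1)"
        unfolding besov_half_iff fcQ[OF elim] by (rule Qfin[OF elim])
      then show ?case by (simp only: besov_half_norm(2) fcQ[OF elim])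
    qed
  qed
qed

end

section \<open>The energy estimate\<close>

lemma abs_integral_le_square:
  fixes f g :: "real \<Rightarrow> real"
  assumes "pcont f" "pcont g"
  shows "2 * integral {0..1} (\<lambda>x. f x * g x) \<le> integral {0..1} (\<lambda>x. (f x)\<^sup>2) + integral {0..1} (\<lambda>x. (g x)\<^sup>2)"
    "- 2 * integral {0..1} (\<lambda>x. f x * g x) \<le> integral {0..1} (\<lambda>x. (f x)\<^sup>2) + integral {0..1} (\<lambda>x. (g x)\<^sup>2)"
proof -
  have i: "(\<lambda>x. (f x)\<^sup>2) integrable_on {0..1}" "(\<lambda>x. (g x)\<^sup>2) integrable_on {0..1}" "(\<lambda>x. f x * g x) integrable_on {0..1}"
    using assms by (auto intro!: pcont_integrable)
  have e: "integral {0..1} (\<lambda>x. (f x)\<^sup>2) + integral {0..1} (\<lambda>x. (g x)\<^sup>2) = integral {0..1} (\<lambda>x. (f x)\<^sup>2 + (g x)\<^sup>2)"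
    by (rule integral_add[symmetric, OF i(1,2)])
  have "2 * (f x * g x) \<le> (f x)\<^sup>2 + (g x)\<^sup>2" "- 2 * (f x * g x) \<le> (f x)\<^sup>2 + (g x)\<^sup>2" for x
    using zero_le_power2[of "f x - g x"] zero_le_power2[of "f x + g x"] by (simp_all add: power2_eq_square algebra_simps)
  moreover have "integral {0..1} (\<lambda>x. c * (f x * g x)) \<le> integral {0..1} (\<lambda>x. (f x)\<^sup>2 + (g x)\<^sup>2)"
    if "\<And>x. c * (f x * g x) \<le> (f x)\<^sup>2 + (g x)\<^sup>2" for c
    using that assms by (intro integral_le pcont_integrable pcont_mult pcont_const pcont_add pcont_power)
  ultimately have "integral {0..1} (\<lambda>x. 2 * (f x * g x)) \<le> integral {0..1} (\<lambda>x. (f x)\<^sup>2 + (g x)\<^sup>2)"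
    "integral {0..1} (\<lambda>x. - 2 * (f x * g x)) \<le> integral {0..1} (\<lambda>x. (f x)\<^sup>2 + (g x)\<^sup>2)" by blast+
  then show "2 * integral {0..1} (\<lambda>x. f x * g x) \<le> integral {0..1} (\<lambda>x. (f x)\<^sup>2) + integral {0..1} (\<lambda>x. (g x)\<^sup>2)"
    "- 2 * integral {0..1} (\<lambda>x. f x * g x) \<le> integral {0..1} (\<lambda>x. (f x)\<^sup>2) + integral {0..1} (\<lambda>x. (g x)\<^sup>2)"
    unfolding e by simp_all
qed

text \<open>With y the resolvent of f one has f = y + sigma y', and the cross term in the square is
  the derivative of a periodic function.\<close>

lemma res_contraction:
  assumes f: "pcont f" and \<sigma>: "\<sigma> = 1 \<or> \<sigma> = - 1"
  shows "integral {0..1} (\<lambda>x. (res \<sigma> f x)\<^sup>2) \<le> integral {0..1} (\<lambda>x. (f x)\<^sup>2)"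
proof -
  define y y' where "y = res \<sigma> f" and "y' x = \<sigma> * (f x - y x)" for x
  have y: "pC1 y y'" unfolding y_def y'_def by (rule res_pC1[OF f \<sigma>])
  note p = pC1_pcont[OF y]
  have yy: "integral {0..1} (\<lambda>x. y x * y' x + y' x * y x) = 0" by (rule integral_pC1_deriv[OF pC1_mult[OF y y]])
  have i: "(\<lambda>x. (y x)\<^sup>2) integrable_on {0..1}" "(\<lambda>x. (y' x)\<^sup>2) integrable_on {0..1}"
    "(\<lambda>x. \<sigma> * (y x * y' x + y' x * y x)) integrable_on {0..1}"
    using p by (auto intro!: pcont_integrable)
  have "f x = y x + \<sigma> * y' x" for x using \<sigma> by (auto simp: y'_def)
  then have "(f x)\<^sup>2 = ((y x)\<^sup>2 + (y' x)\<^sup>2) + \<sigma> * (y x * y' x + y' x * y x)" for x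
    using \<sigma> by (auto simp: power2_eq_square algebra_simps)
  then have e: "(\<lambda>x. (f x)\<^sup>2) = (\<lambda>x. ((y x)\<^sup>2 + (y' x)\<^sup>2) + \<sigma> * (y x * y' x + y' x * y x))" by blast
  have "integral {0..1} (\<lambda>x. (f x)\<^sup>2) = integral {0..1} (\<lambda>x. (y x)\<^sup>2) + integral {0..1} (\<lambda>x. (y' x)\<^sup>2)"
    unfolding e integral_add[OF integrable_add[OF i(1,2)] i(3)] integral_add[OF i(1,2)] integral_mult_right yy by simp
  moreover have "0 \<le> integral {0..1} (\<lambda>x. (y' x)\<^sup>2)" by (intro integral_nonneg i) auto
  ultimately show ?thesis by (simp add: y_def)
qed

text \<open>Here mu is the difference of two densities, \<open>G\<close> the difference of their
  fluxes, and \<open>E\<close> the smoothed difference of the other component. Since the resolvent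
  composed with d/dx is sigma (1 - res), the factor of \<open>D\<close> is the transport part of its
  time derivative. The flux contains mu = D + sigma D', which the energy does not control; the
  integration by parts moves that derivative to the velocity \<open>W\<close>.\<close>

lemma (in littlewood_paley) energy_bound:
  assumes \<mu>: "pcont \<mu>" and \<sigma>: "\<sigma> = 1 \<or> \<sigma> = - 1" and W: "pC1 W W'" "\<And>x. \<bar>W x\<bar> \<le> B" "\<And>x. \<bar>W' x\<bar> \<le> B"
    and E: "pcont E" and h: "pcont h" "\<And>x. \<bar>h x\<bar> \<le> B * (\<bar>res \<sigma> \<mu> x\<bar> + \<bar>E x\<bar>)"
  defines "D \<equiv> res \<sigma> \<mu>" and "G \<equiv> \<lambda>x. W x * \<mu> x + h x"
  shows "2 * integral {0..1} (\<lambda>x. D x * (- \<sigma> * (G x - res \<sigma> G x)))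
    \<le> (6 * B + 1 + 18 * B\<^sup>2) * (integral {0..1} (\<lambda>x. (D x)\<^sup>2) + integral {0..1} (\<lambda>x. (E x)\<^sup>2))"
proof -
  define I where "I f = integral {0..1} f" for f :: "real \<Rightarrow> real"
  define D' where "D' x = \<sigma> * (\<mu> x - D x)" for x
  have D: "pC1 D D'" unfolding D_def D'_def by (rule res_pC1[OF \<mu> \<sigma>])
  note pD = pC1_pcont[OF D] and pW = pC1_pcont[OF W(1)]
  have B: "0 \<le> B" using W(2)[of 0] by linarith
  have \<mu>e: "\<mu> x = D x + \<sigma> * D' x" for x using \<sigma> by (auto simp: D'_def)
  have pG: "pcont G" unfolding G_def using pW \<mu> h by auto
  define d e where "d = I (\<lambda>x. (D x)\<^sup>2)" and "e = I (\<lambda>x. (E x)\<^sup>2)"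
  have Iadd: "I (\<lambda>x. f x + g x) = I f + I g" if "pcont f" "pcont g" for f g
    unfolding I_def using that by (intro integral_add pcont_integrable)
  have Icm: "I (\<lambda>x. c * f x) = c * I f" for c f unfolding I_def by simp
  have Ile: "I f \<le> I g" if "pcont f" "pcont g" "\<And>x. f x \<le> g x" for f g
    unfolding I_def using that by (intro integral_le pcont_integrable) auto
  have Ide: "I (\<lambda>x. \<alpha> * (D x)\<^sup>2 + \<gamma> * (E x)\<^sup>2) = \<alpha> * d + \<gamma> * e" for \<alpha> \<gamma>
    unfolding d_def e_def using pD E by (subst Iadd) (auto simp: Icm)
  have d0: "0 \<le> d" "0 \<le> e" unfolding d_def e_def I_def using pD E by (auto intro!: integral_nonneg pcont_integrable)
  have WD: "pC1 (\<lambda>x. W x * D x) (\<lambda>x. W x * D' x + W' x * D x)" by (rule pC1_mult[OF W(1) D])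
  text \<open>The local part: the derivative of \<open>D\<close> is removed by an integration by parts.\<close>
  have "I (\<lambda>x. (W x * D x) * D' x + (W x * D' x + W' x * D x) * D x) = 0"
    unfolding I_def by (rule integral_pC1_deriv[OF pC1_mult[OF WD D]])
  moreover have "(\<lambda>x. (W x * D x) * D' x + (W x * D' x + W' x * D x) * D x) = (\<lambda>x. 2 * (W x * (D x * D' x)) + W' x * (D x)\<^sup>2)"
    by (simp add: algebra_simps power2_eq_square)
  ultimately have ibp: "2 * I (\<lambda>x. W x * (D x * D' x)) + I (\<lambda>x. W' x * (D x)\<^sup>2) = 0"
    using pW pD by (simp add: Iadd Icm pcont_mult pcont_power)
  have loc: "\<bar>2 * I (\<lambda>x. D x * G x)\<bar> \<le> 6 * B * (d + e)"
  proof -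
    have "(\<lambda>x. D x * G x) = (\<lambda>x. (W x * (D x)\<^sup>2 + D x * h x) + \<sigma> * (W x * (D x * D' x)))"
      unfolding G_def \<mu>e by (simp add: algebra_simps power2_eq_square)
    then have "2 * I (\<lambda>x. D x * G x) = I (\<lambda>x. 2 * (W x * (D x)\<^sup>2 + D x * h x)) + \<sigma> * (2 * I (\<lambda>x. W x * (D x * D' x)))"
      using pW pD h by (simp add: Iadd Icm pcont_add pcont_mult pcont_power)
    also have "\<dots> = I (\<lambda>x. 2 * (W x * (D x)\<^sup>2 + D x * h x)) + I (\<lambda>x. (- \<sigma>) * (W' x * (D x)\<^sup>2))"
    proof -
      have "2 * I (\<lambda>x. W x * (D x * D' x)) = - I (\<lambda>x. W' x * (D x)\<^sup>2)" using ibp by linarith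
      then show ?thesis unfolding Icm by simp
    qed
    also have "\<dots> = I (\<lambda>x. 2 * (W x * (D x)\<^sup>2 + D x * h x) + (- \<sigma>) * (W' x * (D x)\<^sup>2))"
      using pW pD h by (intro Iadd[symmetric]) auto
    finally have e1: "2 * I (\<lambda>x. D x * G x) = I (\<lambda>x. 2 * (W x * (D x)\<^sup>2 + D x * h x) + (- \<sigma>) * (W' x * (D x)\<^sup>2))" .
    have pt: "\<bar>2 * (W x * (D x)\<^sup>2 + D x * h x) + (- \<sigma>) * (W' x * (D x)\<^sup>2)\<bar> \<le> (6 * B) * (D x)\<^sup>2 + B * (E x)\<^sup>2" for x
    proof -
      have 1: "\<bar>W x * (D x)\<^sup>2\<bar> \<le> B * (D x)\<^sup>2" "\<bar>W' x * (D x)\<^sup>2\<bar> \<le> B * (D x)\<^sup>2"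
        using W(2,3)[of x] by (auto simp: abs_mult intro!: mult_right_mono)
      have "\<bar>D x * h x\<bar> \<le> \<bar>D x\<bar> * (B * (\<bar>D x\<bar> + \<bar>E x\<bar>))"
        unfolding abs_mult using h(2)[of x] by (intro mult_left_mono) (auto simp: D_def)
      also have "\<dots> = B * (\<bar>D x\<bar>\<^sup>2 + \<bar>D x\<bar> * \<bar>E x\<bar>)" by (simp add: algebra_simps power2_eq_square)
      also have "\<dots> \<le> B * ((D x)\<^sup>2 + ((D x)\<^sup>2 + (E x)\<^sup>2) / 2)"
        using sum_squares_bound[of "\<bar>D x\<bar>" "\<bar>E x\<bar>"] B by (intro mult_left_mono) auto
      also have "\<dots> = B * (D x)\<^sup>2 + B * (D x)\<^sup>2 / 2 + B * (E x)\<^sup>2 / 2" by (simp add: field_simps)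
      finally have 2: "2 * \<bar>D x * h x\<bar> \<le> 3 * (B * (D x)\<^sup>2) + B * (E x)\<^sup>2" by simp
      have 3: "\<bar>(- \<sigma>) * (W' x * (D x)\<^sup>2)\<bar> = \<bar>W' x * (D x)\<^sup>2\<bar>" using \<sigma> by auto
      have arith: "\<bar>2 * (p + r) + s\<bar> \<le> 6 * u + v"
        if "\<bar>p\<bar> \<le> u" "2 * \<bar>r\<bar> \<le> 3 * u + v" "\<bar>s\<bar> \<le> u" for p r s u v :: real
        using that by argo
      show ?thesis using arith[OF 1(1) 2 1(2)[folded 3]] by (simp only: mult.assoc)
    qed
    have pc: "pcont (\<lambda>x. 2 * (W x * (D x)\<^sup>2 + D x * h x) + (- \<sigma>) * (W' x * (D x)\<^sup>2))"
      "pcont (\<lambda>x. (6 * B) * (D x)\<^sup>2 + B * (E x)\<^sup>2)" "pcont (\<lambda>x. (- (6 * B)) * (D x)\<^sup>2 + (- B) * (E x)\<^sup>2)"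
      using pW pD E h by auto
    have "I (\<lambda>x. 2 * (W x * (D x)\<^sup>2 + D x * h x) + (- \<sigma>) * (W' x * (D x)\<^sup>2)) \<le> I (\<lambda>x. (6 * B) * (D x)\<^sup>2 + B * (E x)\<^sup>2)"
      by (rule Ile[OF pc(1,2)]) (use pt in \<open>auto simp: abs_le_iff\<close>)
    moreover have "I (\<lambda>x. (- (6 * B)) * (D x)\<^sup>2 + (- B) * (E x)\<^sup>2) \<le> I (\<lambda>x. 2 * (W x * (D x)\<^sup>2 + D x * h x) + (- \<sigma>) * (W' x * (D x)\<^sup>2))"
    proof (rule Ile[OF pc(3,1)])
      show "(- (6 * B)) * (D x)\<^sup>2 + (- B) * (E x)\<^sup>2 \<le> 2 * (W x * (D x)\<^sup>2 + D x * h x) + (- \<sigma>) * (W' x * (D x)\<^sup>2)" for x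
        using pt[of x] unfolding abs_le_iff by linarith
    qed
    moreover have "B * e \<le> 6 * B * e" using B d0 by (intro mult_right_mono) auto
    moreover have "6 * B * (d + e) = 6 * B * d + 6 * B * e" by (simp add: algebra_simps)
    ultimately show ?thesis unfolding e1 Ide abs_le_iff by (intro conjI) linarith+
  qed
  text \<open>The nonlocal part: \<open>res \<sigma> G = W D + res \<sigma> f\<close>, since \<open>\<sigma> (W D)' + W D\<close> is mapped to \<open>W D\<close>.\<close>
  define f where "f x = - \<sigma> * (W' x * D x) + h x" for x
  have pf: "pcont f" unfolding f_def[abs_def] using pW pD h by auto
  define g where "g x = W x * D x + \<sigma> * (W x * D' x + W' x * D x)" for x
  have pg: "pcont g" unfolding g_def[abs_def] using pW pD by auto
  have nonloc: "res \<sigma> G x = W x * D x + res \<sigma> f x" for x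
  proof -
    have "res \<sigma> g = (\<lambda>x. W x * D x)"
    proof (rule res_unique[OF _ pg \<sigma>])
      have "(\<lambda>x. \<sigma> * (g x - W x * D x)) = (\<lambda>x. W x * D' x + W' x * D x)"
        using \<sigma> by (auto simp: g_def)
      then show "pC1 (\<lambda>x. W x * D x) (\<lambda>x. \<sigma> * (g x - W x * D x))" using WD by simp
    qed
    moreover have "G = (\<lambda>x. 1 * g x + 1 * f x)"
      unfolding G_def \<mu>e g_def f_def by (auto simp: algebra_simps)
    ultimately show ?thesis using res_linear[OF pg pf, of \<sigma> 1 1 x] by simp
  qed
  have pR: "pcont (res \<sigma> G)" "pcont (res \<sigma> f)" using pC1_pcont(1)[OF res_pC1[OF pG \<sigma>]] pC1_pcont(1)[OF res_pC1[OF pf \<sigma>]] by auto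
  have f2: "I (\<lambda>x. (f x)\<^sup>2) \<le> 8 * B\<^sup>2 * (d + e)"
  proof -
    have "(f x)\<^sup>2 \<le> (8 * B\<^sup>2) * (D x)\<^sup>2 + (8 * B\<^sup>2) * (E x)\<^sup>2" for x
    proof -
      have "\<bar>- \<sigma> * (W' x * D x)\<bar> = \<bar>W' x\<bar> * \<bar>D x\<bar>" using \<sigma> by (auto simp: abs_mult)
      also have "\<dots> \<le> B * \<bar>D x\<bar>" using W(3) by (intro mult_right_mono) auto
      finally have "\<bar>f x\<bar> \<le> B * \<bar>D x\<bar> + B * (\<bar>D x\<bar> + \<bar>E x\<bar>)"
        unfolding f_def using h(2)[of x] unfolding D_def by linarith
      then have "\<bar>f x\<bar> \<le> B * (2 * \<bar>D x\<bar> + \<bar>E x\<bar>)" by (simp add: algebra_simps)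
      then have "\<bar>f x\<bar>\<^sup>2 \<le> (B * (2 * \<bar>D x\<bar> + \<bar>E x\<bar>))\<^sup>2" by (rule power_mono) simp
      also have "\<dots> = B\<^sup>2 * (2 * \<bar>D x\<bar> + \<bar>E x\<bar>)\<^sup>2" by (rule power_mult_distrib)
      also have "\<dots> \<le> B\<^sup>2 * (8 * (D x)\<^sup>2 + 8 * (E x)\<^sup>2)"
      proof (rule mult_left_mono)
        have "(2 * \<bar>D x\<bar> + \<bar>E x\<bar>)\<^sup>2 = (4 * (D x)\<^sup>2 + (E x)\<^sup>2) + 2 * (2 * \<bar>D x\<bar>) * \<bar>E x\<bar>"
          by (simp add: power2_sum power_mult_distrib)
        also have "\<dots> \<le> (4 * (D x)\<^sup>2 + (E x)\<^sup>2) + (4 * (D x)\<^sup>2 + (E x)\<^sup>2)"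
          using sum_squares_bound[of "2 * \<bar>D x\<bar>" "\<bar>E x\<bar>"] by (intro add_left_mono) (simp add: power_mult_distrib)
        also have "\<dots> \<le> 8 * (D x)\<^sup>2 + 8 * (E x)\<^sup>2" by simp
        finally show "(2 * \<bar>D x\<bar> + \<bar>E x\<bar>)\<^sup>2 \<le> 8 * (D x)\<^sup>2 + 8 * (E x)\<^sup>2" .
      qed simp
      finally show ?thesis by (simp add: algebra_simps)
    qed
    then have "I (\<lambda>x. (f x)\<^sup>2) \<le> I (\<lambda>x. (8 * B\<^sup>2) * (D x)\<^sup>2 + (8 * B\<^sup>2) * (E x)\<^sup>2)"
      using pf pD E by (intro Ile) auto
    then show ?thesis unfolding Ide by (simp add: algebra_simps)
  qed
  \<comment> \<open>The constant 18 is 2 from the term W D plus twice the 8 of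
    \<open>f2\<close>.\<close>
  have R2: "I (\<lambda>x. (res \<sigma> G x)\<^sup>2) \<le> 18 * B\<^sup>2 * (d + e)"
  proof -
    have "(res \<sigma> G x)\<^sup>2 \<le> (2 * B\<^sup>2) * (D x)\<^sup>2 + 2 * (res \<sigma> f x)\<^sup>2" for x
    proof -
      have "(res \<sigma> G x)\<^sup>2 \<le> 2 * (W x * D x)\<^sup>2 + 2 * (res \<sigma> f x)\<^sup>2"
        unfolding nonloc using sum_squares_bound[of "W x * D x" "res \<sigma> f x"] by (simp add: power2_sum)
      moreover have "(W x * D x)\<^sup>2 \<le> B\<^sup>2 * (D x)\<^sup>2"
        unfolding power_mult_distrib using W(2)[of x] B by (intro mult_right_mono) (auto simp: abs_le_square_iff[symmetric])
      ultimately show ?thesis by simp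
    qed
    then have "I (\<lambda>x. (res \<sigma> G x)\<^sup>2) \<le> I (\<lambda>x. (2 * B\<^sup>2) * (D x)\<^sup>2 + 2 * (res \<sigma> f x)\<^sup>2)"
      using pR pD by (intro Ile) auto
    also have "\<dots> = (2 * B\<^sup>2) * d + 2 * I (\<lambda>x. (res \<sigma> f x)\<^sup>2)"
      using pR pD by (subst Iadd) (auto simp: Icm d_def)
    also have "\<dots> \<le> (2 * B\<^sup>2) * d + 2 * (8 * B\<^sup>2 * (d + e))"
      using res_contraction[OF pf \<sigma>] f2 unfolding I_def by linarith
    also have "\<dots> \<le> 18 * B\<^sup>2 * (d + e)" using d0 by (simp add: algebra_simps)
    finally show ?thesis .
  qed
  have "I (\<lambda>x. D x * (- \<sigma> * (G x - res \<sigma> G x))) = I (\<lambda>x. (- \<sigma>) * (D x * G x) + \<sigma> * (D x * res \<sigma> G x))"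
    by (rule arg_cong[of _ _ I]) (simp add: fun_eq_iff algebra_simps)
  also have "\<dots> = - \<sigma> * I (\<lambda>x. D x * G x) + \<sigma> * I (\<lambda>x. D x * res \<sigma> G x)"
    by (simp only: Iadd[OF pcont_mult[OF pcont_const pcont_mult[OF pD(1) pG]] pcont_mult[OF pcont_const pcont_mult[OF pD(1) pR(1)]]] Icm)
  finally have "2 * I (\<lambda>x. D x * (- \<sigma> * (G x - res \<sigma> G x))) = - \<sigma> * (2 * I (\<lambda>x. D x * G x)) + \<sigma> * (2 * I (\<lambda>x. D x * res \<sigma> G x))"
    by simp
  moreover have "- \<sigma> * (2 * I (\<lambda>x. D x * G x)) \<le> 6 * B * (d + e)"
  proof -
    have "- \<sigma> * (2 * I (\<lambda>x. D x * G x)) \<le> \<bar>- \<sigma> * (2 * I (\<lambda>x. D x * G x))\<bar>" by (rule abs_ge_self)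
    also have "\<dots> = \<bar>2 * I (\<lambda>x. D x * G x)\<bar>" using \<sigma> by (intro abs_sign_mult) auto
    finally show ?thesis using loc by (rule order_trans)
  qed
  moreover have "\<sigma> * (2 * I (\<lambda>x. D x * res \<sigma> G x)) \<le> d + 18 * B\<^sup>2 * (d + e)"
  proof -
    have "\<sigma> * (2 * I (\<lambda>x. D x * res \<sigma> G x)) \<le> \<bar>\<sigma> * (2 * I (\<lambda>x. D x * res \<sigma> G x))\<bar>" by (rule abs_ge_self)
    also have "\<dots> = \<bar>2 * I (\<lambda>x. D x * res \<sigma> G x)\<bar>" using \<sigma> by (rule abs_sign_mult)
    also have "\<dots> \<le> d + I (\<lambda>x. (res \<sigma> G x)\<^sup>2)"
      unfolding abs_le_iff using abs_integral_le_square[OF pD(1) pR(1), folded I_def] by (simp add: d_def)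
    also have "\<dots> \<le> d + 18 * B\<^sup>2 * (d + e)" using R2 by (rule add_left_mono)
    finally show ?thesis .
  qed
  ultimately have "2 * I (\<lambda>x. D x * (- \<sigma> * (G x - res \<sigma> G x))) \<le> 6 * B * (d + e) + (d + 18 * B\<^sup>2 * (d + e))"
    by linarith
  also have "\<dots> \<le> (6 * B + 1 + 18 * B\<^sup>2) * (d + e)" using d0 by (simp add: algebra_simps)
  finally show ?thesis by (simp add: I_def d_def e_def)
qed

text \<open>The quotient of the squares equals 2 Q D + Q^2 (h - t), where Q is the difference
  quotient. Uniform convergence of Q to \<open>V\<close> handles the first term, and boundedness of
  Q makes the second vanish; \<open>\<eta>\<close> and \<open>\<delta>\<close> bound the two errors
  by e/2 and e/4.\<close>

lemma energy_deriv:
  fixes D :: "real \<Rightarrow> real \<Rightarrow> real"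
  assumes D: "\<And>h. h \<in> S \<Longrightarrow> pcont (D h)" and V: "pcont V" and t: "t \<in> S"
    and q: "\<And>e. e > 0 \<Longrightarrow> \<forall>\<^sub>F h in at t within S. \<forall>x. \<bar>(D h x - D t x) / (h - t) - V x\<bar> \<le> e"
  shows "((\<lambda>h. integral {0..1} (\<lambda>x. (D h x)\<^sup>2)) has_real_derivative 2 * integral {0..1} (\<lambda>x. D t x * V x)) (at t within S)"
  unfolding has_field_derivative_iff
proof (rule tendstoI)
  fix e :: real assume e: "e > 0"
  obtain B1 where B1: "\<And>x. norm (D t x) \<le> B1" "0 \<le> B1" using pcont_bounded[OF D[OF t]] by blast
  obtain B2 where B2: "\<And>x. norm (V x) \<le> B2" "0 \<le> B2" using pcont_bounded[OF V] by blast
  define \<eta> where "\<eta> = min 1 (e / (4 * (B1 + 1)))"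
  define \<delta> where "\<delta> = e / (4 * (B2 + 1)\<^sup>2)"
  have \<eta>: "0 < \<eta>" "\<eta> \<le> 1" "2 * \<eta> * B1 \<le> e / 2"
  proof -
    show "0 < \<eta>" "\<eta> \<le> 1" using e B1(2) by (auto simp: \<eta>_def)
    have "2 * \<eta> * B1 \<le> 2 * (e / (4 * (B1 + 1))) * B1"
      using B1(2) by (intro mult_right_mono mult_left_mono) (auto simp: \<eta>_def)
    also have "\<dots> \<le> e / 2" using B1(2) e by (simp add: field_simps)
    finally show "2 * \<eta> * B1 \<le> e / 2" .
  qed
  have \<delta>: "0 < \<delta>" "\<delta> * (B2 + 1)\<^sup>2 = e / 4"
  proof -
    have "B2 + 1 \<noteq> 0" using B2(2) by linarith
    then show "0 < \<delta>" "\<delta> * (B2 + 1)\<^sup>2 = e / 4" using e by (auto simp: \<delta>_def)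
  qed
  have "\<forall>\<^sub>F h in at t within S. h \<in> S \<and> h \<noteq> t" by (simp add: eventually_at_filter)
  moreover have "\<forall>\<^sub>F h in at t within S. dist h t < \<delta>" using \<delta>(1) eventually_at by blast
  ultimately show "\<forall>\<^sub>F h in at t within S. dist ((integral {0..1} (\<lambda>x. (D h x)\<^sup>2) - integral {0..1} (\<lambda>x. (D t x)\<^sup>2)) / (h - t))
      (2 * integral {0..1} (\<lambda>x. D t x * V x)) < e"
    using q[OF \<eta>(1)]
  proof eventually_elim
    case (elim h)
    define Q where "Q x = (D h x - D t x) / (h - t)" for x
    have Dh: "D h x = D t x + (h - t) * Q x" for x using elim(1) by (simp add: Q_def)
    have Qe: "Q = (\<lambda>x. (1 / (h - t)) * (D h x - D t x))" by (simp add: Q_def fun_eq_iff)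
    have pQ: "pcont Q"
      unfolding Qe using D elim(1) t by (intro pcont_mult pcont_const pcont_diff) auto
    note pD = D[OF t]
    have Qb: "\<bar>Q x - V x\<bar> \<le> \<eta>" "\<bar>Q x\<bar> \<le> B2 + 1" for x
      using elim(3) B2(1)[of x] \<eta>(2) by (auto simp: Q_def[symmetric] dest!: spec[of _ x])
    have i: "(\<lambda>x. (D h x)\<^sup>2) integrable_on {0..1}" "(\<lambda>x. (D t x)\<^sup>2) integrable_on {0..1}" "(\<lambda>x. D t x * V x) integrable_on {0..1}"
      using D elim(1) t V by (auto intro!: pcont_integrable)
    have i2: "(\<lambda>x. (1 / (h - t)) * ((D h x)\<^sup>2 - (D t x)\<^sup>2)) integrable_on {0..1}" "(\<lambda>x. 2 * (D t x * V x)) integrable_on {0..1}"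
      using D elim(1) t V by (auto intro!: pcont_integrable pcont_mult[OF pcont_const])
    have "(integral {0..1} (\<lambda>x. (D h x)\<^sup>2) - integral {0..1} (\<lambda>x. (D t x)\<^sup>2)) / (h - t) - 2 * integral {0..1} (\<lambda>x. D t x * V x)
        = integral {0..1} (\<lambda>x. (1 / (h - t)) * ((D h x)\<^sup>2 - (D t x)\<^sup>2) - 2 * (D t x * V x))"
      unfolding integral_diff[OF i2] integral_mult_right integral_diff[OF i(1,2)] by simp
    also have "\<bar>\<dots>\<bar> \<le> integral {0..1} (\<lambda>x::real. e / 2 + e / 4)"
    proof -
      have "norm ((1 / (h - t)) * ((D h x)\<^sup>2 - (D t x)\<^sup>2) - 2 * (D t x * V x)) \<le> e / 2 + e / 4" for x
      proof -
        have "(1 / (h - t)) * ((D h x)\<^sup>2 - (D t x)\<^sup>2) - 2 * (D t x * V x) = 2 * (Q x - V x) * D t x + (Q x)\<^sup>2 * (h - t)"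
          using elim(1) unfolding Dh by (simp add: field_simps power2_eq_square)
        also have "\<bar>\<dots>\<bar> \<le> \<bar>2 * (Q x - V x) * D t x\<bar> + \<bar>(Q x)\<^sup>2 * (h - t)\<bar>" by (rule abs_triangle_ineq)
        also have "\<bar>2 * (Q x - V x) * D t x\<bar> \<le> 2 * \<eta> * B1"
          unfolding abs_mult using Qb(1)[of x] B1(1)[of x] \<eta>(1) by (intro mult_mono) auto
        also have "\<bar>(Q x)\<^sup>2 * (h - t)\<bar> \<le> (B2 + 1)\<^sup>2 * \<delta>"
          unfolding abs_mult using power_mono[OF Qb(2)[of x], of 2] elim(2) B2(2)
          by (intro mult_mono) (auto simp: dist_real_def)
        finally show ?thesis using \<eta>(3) \<delta>(2) by (simp add: mult.commute)
      qed
      then show ?thesis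
        unfolding real_norm_def[symmetric]
        by (intro integral_norm_bound_integral integrable_diff i2 pcont_integrable pcont_const)
    qed
    also have "\<dots> < e" using e by simp
    finally show ?case by (simp add: dist_real_def)
  qed
qed

section \<open>Uniqueness\<close>

context littlewood_paley
begin

lemma rfin_of_besov: "S \<in> besov chi phi (1/2) \<Longrightarrow> \<exists>f. rfin f \<and> S = pd_of_fun f"
  using besov_half_continuous[of S] unfolding rfin_def by metis

text \<open>A continuous representative of finite norm; by uniqueness of Fourier coefficients the
  choice is immaterial.\<close>

definition crep :: "pdist \<Rightarrow> real \<Rightarrow> real" where
  "crep S = (SOME f. rfin f \<and> S = pd_of_fun f)"

lemma crep:
  assumes "S \<in> besov chi phi (1/2)" shows "rfin (crep S)" "pd_of_fun (crep S) = S"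
  using someI_ex[OF rfin_of_besov[OF assms]] unfolding crep_def by auto

lemma rbn_res:
  assumes f: "rfin f" and \<sigma>: "\<sigma> = 1 \<or> \<sigma> = - 1"
  shows "rfin (res \<sigma> f)" "rbn (res \<sigma> f) \<le> rbn f"
proof -
  have p: "pcont f" using f by (rule rfin_pcont)
  have "sqrt 2 ^ n * bt n (rfc (res \<sigma> f)) \<le> 1 * (sqrt 2 ^ n * bt n (rfc f))" for n
    using bt_resolvent(1)[OF rfc_res[OF p \<sigma>] \<sigma>, of n] by (simp add: mult_left_mono)
  from bfin_mono[OF this, of] f have "bfin (sqrt 2) (rfc (res \<sigma> f)) \<and> bn (sqrt 2) (rfc (res \<sigma> f)) \<le> 1 * bn (sqrt 2) (rfc f)"
    by (simp add: rfin_def)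
  then show "rfin (res \<sigma> f)" "rbn (res \<sigma> f) \<le> rbn f"
    using pC1_pcont(1)[OF res_pC1[OF p \<sigma>]] by (auto simp: rfin_def rbn_def)
qed

text \<open>The time derivative of a strong solution exists only in the norm of index -1/2. The
  resolvent gains one derivative and so leads to index 1/2, hence to uniform convergence. The
  constant is 2 * 3 = 6, at most 5 * sqrt 2.\<close>

lemma resolvent_quotient_sup:
  fixes y y0 w :: "real \<Rightarrow> real" and lam :: real and \<sigma> :: real
  assumes y: "rfin y" and y0: "rfin y0" and v: "rfin v" and \<sigma>: "\<sigma> = 1 \<or> \<sigma> = - 1" and h: "h \<noteq> (t :: real)"
  defines "Z \<equiv> - pd_deriv (pd_of_fun v) - lam *\<^sub>R pd_of_fun y0"
  shows "\<bar>(res \<sigma> y x - res \<sigma> y0 x) / (h - t) - (- \<sigma> * (v x - res \<sigma> v x) - lam * res \<sigma> y0 x)\<bar>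
    \<le> 5 * besov_norm chi phi (1/2 - 1) ((pd_of_fun y - pd_of_fun y0) /\<^sub>R (h - t) - Z)"
proof -
  define U where "U x = (1 / (h - t)) * (res \<sigma> y x - res \<sigma> y0 x) - (- \<sigma> * (v x - res \<sigma> v x) - lam * res \<sigma> y0 x)" for x
  define S where "S = (pd_of_fun y - pd_of_fun y0) /\<^sub>R (h - t) - Z"
  note py = rfin_pcont[OF y] and py0 = rfin_pcont[OF y0] and pv = rfin_pcont[OF v]
  note pr = pC1_pcont(1)[OF res_pC1[OF py \<sigma>]] pC1_pcont(1)[OF res_pC1[OF py0 \<sigma>]] pC1_pcont(1)[OF res_pC1[OF pv \<sigma>]]
  have pU: "pcont U" unfolding U_def[abs_def] by (intro pcont_diff pcont_mult pcont_const pr pv)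
  have fS: "fourier_coeff S k = (1 / (h - t)) * (rfc y k - rfc y0 k)
      - (- (2 * pi * \<i> * of_int k * rfc v k) - lam * rfc y0 k)" for k
    unfolding S_def Z_def using h
    by (simp add: fourier_coeff_diff fourier_coeff_uminus fourier_coeff_deriv fourier_coeff_scaleR
        fourier_coeff_pd_of_fun[OF py] fourier_coeff_pd_of_fun[OF py0] fourier_coeff_pd_of_fun[OF pv] divide_inverse)
  define \<rho> where "\<rho> k = 1 + 2 * pi * \<i> * of_int k * \<sigma>" for k :: int
  have sc: "\<rho> k * rfc U k = fourier_coeff S k" for k
  proof -
    have rU: "rfc U k = (1 / (h - t)) * (rfc (res \<sigma> y) k - rfc (res \<sigma> y0) k)
        - (- \<sigma> * (rfc v k - rfc (res \<sigma> v) k) - lam * rfc (res \<sigma> y0) k)"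
      unfolding U_def[abs_def] using pr pv
      by (simp only: rfc_diff rfc_cmult pcont_diff pcont_mult pcont_const)
    have "\<rho> k * rfc U k = (1 / (h - t)) * (\<rho> k * rfc (res \<sigma> y) k - \<rho> k * rfc (res \<sigma> y0) k)
        - (- \<sigma> * (\<rho> k * rfc v k - \<rho> k * rfc (res \<sigma> v) k) - lam * (\<rho> k * rfc (res \<sigma> y0) k))"
      unfolding rU by (simp add: algebra_simps)
    also have "\<dots> = (1 / (h - t)) * (rfc y k - rfc y0 k) - (- \<sigma> * (\<rho> k * rfc v k - rfc v k) - lam * rfc y0 k)"
      unfolding \<rho>_def rfc_res[OF py \<sigma>] rfc_res[OF py0 \<sigma>] rfc_res[OF pv \<sigma>] ..
    also have "complex_of_real (- \<sigma>) * (\<rho> k * rfc v k - rfc v k) = - 2 * pi * \<i> * of_int k * rfc v k"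
      using \<sigma> by (auto simp: \<rho>_def algebra_simps)
    finally have "\<rho> k * rfc U k = (1 / (h - t)) * (rfc y k - rfc y0 k)
        - (- 2 * pi * \<i> * of_int k * rfc v k - lam * rfc y0 k)" .
    then show ?thesis unfolding fS by simp
  qed
  have ir0: "0 \<le> ir" by simp
  have Sfin: "bfin ir (fourier_coeff S)"
  proof -
    have f: "bfin ir (rfc y)" "bfin ir (rfc y0)" "bfin ir (\<lambda>k. 2 * pi * \<i> * of_int k * rfc v k)"
      using y y0 v bfin_lower(1) bfin_deriv(1) unfolding rfin_def by blast+
    note g = bfin_cmult(1)[OF ir0 f(1), of "1 / of_real (h - t)"] bfin_cmult(1)[OF ir0 f(2), of "- 1 / of_real (h - t)"]
      bfin_cmult(1)[OF ir0 f(2), of "of_real lam"]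
    note s = bfin_add(1)[OF ir0 bfin_add(1)[OF ir0 g(1,2)] bfin_add(1)[OF ir0 g(3) f(3)]]
    have "fourier_coeff S k = (1 / of_real (h - t) * rfc y k + - 1 / of_real (h - t) * rfc y0 k)
        + (of_real lam * rfc y0 k + 2 * pi * \<i> * of_int k * rfc v k)" for k
    proof -
      show ?thesis unfolding fS by (simp add: algebra_simps diff_divide_distrib)
    qed
    then have "fourier_coeff S = (\<lambda>k. (1 / of_real (h - t) * rfc y k + - 1 / of_real (h - t) * rfc y0 k)
        + (of_real lam * rfc y0 k + 2 * pi * \<i> * of_int k * rfc v k))" by (rule ext)
    then show ?thesis using s by (simp only:)
  qed
  have "sqrt 2 ^ n * bt n (rfc U) \<le> 3 * (ir ^ n * bt n (fourier_coeff S))" for n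
  proof -
    have "bt n (rfc U) \<le> 3 / 2 ^ n * bt n (fourier_coeff S)"
      by (rule bt_resolvent(2)[OF _ \<sigma>]) (use sc in \<open>simp add: \<rho>_def\<close>)
    then have "sqrt 2 ^ n * bt n (rfc U) \<le> sqrt 2 ^ n * (3 / 2 ^ n * bt n (fourier_coeff S))"
      by (intro mult_left_mono) auto
    also have "\<dots> = 3 * ((sqrt 2 ^ n / 2 ^ n) * bt n (fourier_coeff S))" by simp
    also have "sqrt 2 ^ n / 2 ^ n = ir ^ n" using sqrt2_facts(3)[of n] by (simp add: field_simps)
    finally show ?thesis .
  qed
  note U = bfin_mono[OF this _ Sfin]
  have rU: "rfin U" "rbn U \<le> 3 * bn ir (fourier_coeff S)" using U pU by (auto simp: rfin_def rbn_def)
  have "\<bar>U x\<bar> \<le> 2 * (3 * bn ir (fourier_coeff S))" using rbn_sup[OF rU(1), of x] rU(2) by linarith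
  also have "\<dots> \<le> 5 * (sqrt 2 * bn ir (fourier_coeff S))"
  proof -
    have "6 * bn ir (fourier_coeff S) \<le> (5 * sqrt 2) * bn ir (fourier_coeff S)"
      using sqrt2_facts(1) by (intro mult_right_mono bn_nonneg Sfin) auto
    then show ?thesis by simp
  qed
  also have "sqrt 2 * bn ir (fourier_coeff S) = besov_norm chi phi (1/2 - 1) S"
    using Sfin by (intro besov_half_norm(2)[symmetric]) (simp only: besov_half_iff)
  finally show ?thesis by (simp add: U_def S_def)
qed

lemma besov_norm_nonneg: "0 \<le> besov_norm chi phi s S"
  unfolding besov_norm_def
  by (intro infsum_nonneg mult_nonneg_nonneg) (auto simp: L2_norm_def set_lebesgue_integral_def)

lemma at_within_atLeast:
  fixes t T :: real
  assumes "t < T" shows "at t within {0..T} = at t within {0..}"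
  by (rule at_within_nhd[of t "{..<T}"]) (use assms in auto)

text \<open>Passes from the distributional formulation to continuous representatives, for which
  products are pointwise and the velocity is a product of resolvents.\<close>

lemma strong_solution_facts:
  assumes sol: "sqq_global_strong_solution chi phi (1/2) lam m0 n0 w"
  defines "M \<equiv> \<lambda>t. crep (fst (w t))" and "N \<equiv> \<lambda>t. crep (snd (w t))"
  defines "W \<equiv> \<lambda>t x. res 1 (M t) x * res (- 1) (N t) x"
  shows "\<And>t. 0 \<le> t \<Longrightarrow> rfin (M t)" "\<And>t. 0 \<le> t \<Longrightarrow> rfin (N t)"
    "\<And>t. 0 \<le> t \<Longrightarrow> pd_of_fun (M t) = fst (w t)" "\<And>t. 0 \<le> t \<Longrightarrow> pd_of_fun (N t) = snd (w t)"
    "\<And>t. 0 \<le> t \<Longrightarrow> ((\<lambda>h. rbn (\<lambda>x. M h x - M t x)) \<longlongrightarrow> 0) (at t within {0..})"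
    "\<And>t. 0 \<le> t \<Longrightarrow> ((\<lambda>h. rbn (\<lambda>x. N h x - N t x)) \<longlongrightarrow> 0) (at t within {0..})"
    "\<And>t. 0 < t \<Longrightarrow> ((\<lambda>h. besov_norm chi phi (1/2 - 1) ((pd_of_fun (M h) - pd_of_fun (M t)) /\<^sub>R (h - t)
      - (- pd_deriv (pd_of_fun (\<lambda>x. W t x * M t x)) - lam *\<^sub>R pd_of_fun (M t)))) \<longlongrightarrow> 0) (at t within {0..})"
    "\<And>t. 0 < t \<Longrightarrow> ((\<lambda>h. besov_norm chi phi (1/2 - 1) ((pd_of_fun (N h) - pd_of_fun (N t)) /\<^sub>R (h - t)
      - (- pd_deriv (pd_of_fun (\<lambda>x. W t x * N t x)) - lam *\<^sub>R pd_of_fun (N t)))) \<longlongrightarrow> 0) (at t within {0..})"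
proof -
  \<comment> \<open>The horizon \<open>t + 1\<close> exceeds \<open>t\<close>, so limits within the
    compact interval agree with limits within the half line.\<close>
  have E: "w \<in> curves_C (t + 1) (besov2 chi phi (1/2)) (besov2_norm chi phi (1/2))" if "0 \<le> t" for t
    using sol that unfolding sqq_global_strong_solution_def E_space_infty_def E_space_def by auto
  have wb: "fst (w t) \<in> besov chi phi (1/2)" "snd (w t) \<in> besov chi phi (1/2)" if "0 \<le> t" for t
    using E[OF that] that unfolding curves_C_def by (auto dest!: bspec[of _ _ t] simp: mem_Times_iff)
  have wc: "((\<lambda>h. besov2_norm chi phi (1/2) (w h - w t)) \<longlongrightarrow> 0) (at t within {0..})" if "0 \<le> t" for t
  proof -
    have "((\<lambda>h. besov2_norm chi phi (1/2) (w h - w t)) \<longlongrightarrow> 0) (at t within {0..t + 1})"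
      using E[OF that] that unfolding curves_C_def by auto
    then show ?thesis by (simp only: at_within_atLeast[of t "t + 1"])
  qed
  have r: "rfin (M t)" "rfin (N t)" "pd_of_fun (M t) = fst (w t)" "pd_of_fun (N t) = snd (w t)" if "0 \<le> t" for t
    unfolding M_def N_def using crep wb[OF that] by auto
  have ev: "\<forall>\<^sub>F h in at t within {0..}. 0 \<le> h" for t :: real by (simp add: eventually_at_filter)
  have d: "rfin (\<lambda>x. M h x - M t x)" "rfin (\<lambda>x. N h x - N t x)"
    "rbn (\<lambda>x. M h x - M t x) = sqrt 2 * besov_norm chi phi (1/2) (fst (w h) - fst (w t))"
    "rbn (\<lambda>x. N h x - N t x) = sqrt 2 * besov_norm chi phi (1/2) (snd (w h) - snd (w t))" if "0 \<le> h" "0 \<le> t" for h t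
  proof -
    show f: "rfin (\<lambda>x. M h x - M t x)" "rfin (\<lambda>x. N h x - N t x)" using r that by (auto intro: rbn_diff)
    have "pd_of_fun (\<lambda>x. M h x - M t x) = fst (w h) - fst (w t)" "pd_of_fun (\<lambda>x. N h x - N t x) = snd (w h) - snd (w t)"
      using r that by (simp_all add: pd_of_fun_diff rfin_pcont)
    then show "rbn (\<lambda>x. M h x - M t x) = sqrt 2 * besov_norm chi phi (1/2) (fst (w h) - fst (w t))"
      "rbn (\<lambda>x. N h x - N t x) = sqrt 2 * besov_norm chi phi (1/2) (snd (w h) - snd (w t))"
      using rfin_besov(3)[OF f(1)] rfin_besov(3)[OF f(2)] by simp_all
  qed
  have lim: "((\<lambda>h. sqrt 2 * besov2_norm chi phi (1/2) (w h - w t)) \<longlongrightarrow> 0) (at t within {0..})" if "0 \<le> t" for t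
    using tendsto_mult_left[OF wc[OF that], of "sqrt 2"] by simp
  have c: "((\<lambda>h. rbn (\<lambda>x. M h x - M t x)) \<longlongrightarrow> 0) (at t within {0..})"
    "((\<lambda>h. rbn (\<lambda>x. N h x - N t x)) \<longlongrightarrow> 0) (at t within {0..})" if t: "0 \<le> t" for t
  proof -
    have 0: "\<forall>\<^sub>F h in at t within {0..}. 0 \<le> rbn (\<lambda>x. M h x - M t x)" "\<forall>\<^sub>F h in at t within {0..}. 0 \<le> rbn (\<lambda>x. N h x - N t x)"
      using ev by (eventually_elim, use d(1,2) t rbn_nonneg in auto)+
    have 1: "\<forall>\<^sub>F h in at t within {0..}. rbn (\<lambda>x. M h x - M t x) \<le> sqrt 2 * besov2_norm chi phi (1/2) (w h - w t)"
      "\<forall>\<^sub>F h in at t within {0..}. rbn (\<lambda>x. N h x - N t x) \<le> sqrt 2 * besov2_norm chi phi (1/2) (w h - w t)"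
      using ev by (eventually_elim, use d(3,4) t besov_norm_nonneg in \<open>simp add: besov2_norm_def\<close>)+
    show "((\<lambda>h. rbn (\<lambda>x. M h x - M t x)) \<longlongrightarrow> 0) (at t within {0..})"
      "((\<lambda>h. rbn (\<lambda>x. N h x - N t x)) \<longlongrightarrow> 0) (at t within {0..})"
      by (rule tendsto_sandwich[OF 0(1) 1(1) tendsto_const lim[OF t]], rule tendsto_sandwich[OF 0(2) 1(2) tendsto_const lim[OF t]])
  qed
  have D: "((\<lambda>h. besov_norm chi phi (1/2 - 1) ((pd_of_fun (M h) - pd_of_fun (M t)) /\<^sub>R (h - t)
      - (- pd_deriv (pd_of_fun (\<lambda>x. W t x * M t x)) - lam *\<^sub>R pd_of_fun (M t)))) \<longlongrightarrow> 0) (at t within {0..})"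
    "((\<lambda>h. besov_norm chi phi (1/2 - 1) ((pd_of_fun (N h) - pd_of_fun (N t)) /\<^sub>R (h - t)
      - (- pd_deriv (pd_of_fun (\<lambda>x. W t x * N t x)) - lam *\<^sub>R pd_of_fun (N t)))) \<longlongrightarrow> 0) (at t within {0..})" if t: "0 < t" for t
  proof -
    have t0: "0 \<le> t" using t by simp
    note pM = rfin_pcont[OF r(1)[OF t0]] and pN = rfin_pcont[OF r(2)[OF t0]]
    have pW: "pcont (W t)"
      unfolding W_def using pC1_pcont(1)[OF res_pC1[OF pM, of 1]] pC1_pcont(1)[OF res_pC1[OF pN, of "- 1"]] by auto
    have vel: "sqq_velocity (fst (w t)) (snd (w t)) = pd_of_fun (W t)"
      unfolding r(3,4)[OF t0, symmetric] W_def by (rule sqq_velocity_eq[OF pM pN])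
    obtain mt nt where mn: "curve_has_deriv (besov2_norm chi phi (1/2 - 1)) w (mt, nt) t {0..}"
      "mt + pd_deriv (pd_mult (pd_of_fun (W t)) (fst (w t))) + lam *\<^sub>R fst (w t) = 0"
      "nt + pd_deriv (pd_mult (pd_of_fun (W t)) (snd (w t))) + lam *\<^sub>R snd (w t) = 0"
      using sol t unfolding sqq_global_strong_solution_def Let_def vel[symmetric] by blast
    have m: "mt = - pd_deriv (pd_of_fun (\<lambda>x. W t x * M t x)) - lam *\<^sub>R pd_of_fun (M t)"
      "nt = - pd_deriv (pd_of_fun (\<lambda>x. W t x * N t x)) - lam *\<^sub>R pd_of_fun (N t)"
      using mn(2,3) unfolding r(3,4)[OF t0, symmetric] pd_mult_pd_of_fun[OF pW pM] pd_mult_pd_of_fun[OF pW pN]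
      by (simp_all add: add.assoc eq_neg_iff_add_eq_0[symmetric])
    have lim: "((\<lambda>h. besov2_norm chi phi (1/2 - 1) ((w h - w t) /\<^sub>R (h - t) - (mt, nt))) \<longlongrightarrow> 0) (at t within {0..})"
      using mn(1) unfolding curve_has_deriv_def .
    have 1: "\<forall>\<^sub>F h in at t within {0..}. besov_norm chi phi (1/2 - 1) ((pd_of_fun (M h) - pd_of_fun (M t)) /\<^sub>R (h - t) - mt)
        \<le> besov2_norm chi phi (1/2 - 1) ((w h - w t) /\<^sub>R (h - t) - (mt, nt))"
      "\<forall>\<^sub>F h in at t within {0..}. besov_norm chi phi (1/2 - 1) ((pd_of_fun (N h) - pd_of_fun (N t)) /\<^sub>R (h - t) - nt)
        \<le> besov2_norm chi phi (1/2 - 1) ((w h - w t) /\<^sub>R (h - t) - (mt, nt))"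
      using ev by (eventually_elim, use r t0 besov_norm_nonneg in \<open>simp add: besov2_norm_def\<close>)+
    show "((\<lambda>h. besov_norm chi phi (1/2 - 1) ((pd_of_fun (M h) - pd_of_fun (M t)) /\<^sub>R (h - t)
      - (- pd_deriv (pd_of_fun (\<lambda>x. W t x * M t x)) - lam *\<^sub>R pd_of_fun (M t)))) \<longlongrightarrow> 0) (at t within {0..})"
      unfolding m(1)[symmetric]
      by (rule tendsto_sandwich[OF always_eventually[OF allI[OF besov_norm_nonneg]] 1(1) tendsto_const lim])
    show "((\<lambda>h. besov_norm chi phi (1/2 - 1) ((pd_of_fun (N h) - pd_of_fun (N t)) /\<^sub>R (h - t)
      - (- pd_deriv (pd_of_fun (\<lambda>x. W t x * N t x)) - lam *\<^sub>R pd_of_fun (N t)))) \<longlongrightarrow> 0) (at t within {0..})"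
      unfolding m(2)[symmetric]
      by (rule tendsto_sandwich[OF always_eventually[OF allI[OF besov_norm_nonneg]] 1(2) tendsto_const lim])
  qed
  show "\<And>t. 0 \<le> t \<Longrightarrow> rfin (M t)" "\<And>t. 0 \<le> t \<Longrightarrow> rfin (N t)"
    "\<And>t. 0 \<le> t \<Longrightarrow> pd_of_fun (M t) = fst (w t)" "\<And>t. 0 \<le> t \<Longrightarrow> pd_of_fun (N t) = snd (w t)"
    "\<And>t. 0 \<le> t \<Longrightarrow> ((\<lambda>h. rbn (\<lambda>x. M h x - M t x)) \<longlongrightarrow> 0) (at t within {0..})"
    "\<And>t. 0 \<le> t \<Longrightarrow> ((\<lambda>h. rbn (\<lambda>x. N h x - N t x)) \<longlongrightarrow> 0) (at t within {0..})"
    "\<And>t. 0 < t \<Longrightarrow> ((\<lambda>h. besov_norm chi phi (1/2 - 1) ((pd_of_fun (M h) - pd_of_fun (M t)) /\<^sub>R (h - t)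
      - (- pd_deriv (pd_of_fun (\<lambda>x. W t x * M t x)) - lam *\<^sub>R pd_of_fun (M t)))) \<longlongrightarrow> 0) (at t within {0..})"
    "\<And>t. 0 < t \<Longrightarrow> ((\<lambda>h. besov_norm chi phi (1/2 - 1) ((pd_of_fun (N h) - pd_of_fun (N t)) /\<^sub>R (h - t)
      - (- pd_deriv (pd_of_fun (\<lambda>x. W t x * N t x)) - lam *\<^sub>R pd_of_fun (N t)))) \<longlongrightarrow> 0) (at t within {0..})"
    using r c D by auto
qed

lemma rbn_locally_bounded:
  fixes M :: "real \<Rightarrow> real \<Rightarrow> real"
  assumes M: "\<And>t. 0 \<le> t \<Longrightarrow> rfin (M t)" and c: "\<And>t. 0 \<le> t \<Longrightarrow> ((\<lambda>h. rbn (\<lambda>x. M h x - M t x)) \<longlongrightarrow> 0) (at t within {0..})"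
  shows "\<exists>B. \<forall>t\<in>{0..T}. rbn (M t) \<le> B"
proof -
  have tri: "rbn (M s) \<le> rbn (M t) + rbn (\<lambda>x. M s x - M t x)" if "0 \<le> s" "0 \<le> t" for s t
    using rbn_add(2)[OF M[OF that(2)] rbn_diff(1)[OF M[OF that(1)] M[OF that(2)]]] by simp
  have sym: "rbn (\<lambda>x. M t x - M s x) \<le> rbn (\<lambda>x. M s x - M t x)" if "0 \<le> s" "0 \<le> t" for s t
  proof -
    have f: "rfin (\<lambda>x. M s x - M t x)" by (rule rbn_diff(1)[OF M[OF that(1)] M[OF that(2)]])
    show ?thesis using rbn_lincomb(2)[OF f f, of "- 1" 0] by simp
  qed
  have "continuous_on {0..T} (\<lambda>t. rbn (M t))"
    unfolding continuous_on_def
  proof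
    fix t assume t: "t \<in> {0..T}"
    have "((\<lambda>h. rbn (M h)) \<longlongrightarrow> rbn (M t)) (at t within {0..})"
    proof (rule LIM_zero_cancel, rule Lim_null_comparison[OF _ c])
      have "\<forall>\<^sub>F h in at t within {0..}. 0 \<le> h" by (simp add: eventually_at_filter)
      then show "\<forall>\<^sub>F h in at t within {0..}. norm (rbn (M h) - rbn (M t)) \<le> rbn (\<lambda>x. M h x - M t x)"
      proof eventually_elim
        case (elim h)
        then show ?case using tri[of h t] tri[of t h] sym[of h t] t by (simp add: abs_le_iff)
      qed
    qed (use t in simp)
    then show "((\<lambda>h. rbn (M h)) \<longlongrightarrow> rbn (M t)) (at t within {0..T})"
      by (rule tendsto_within_subset) auto
  qed
  then have "compact ((\<lambda>t. rbn (M t)) ` {0..T})" by (rule compact_continuous_image) simp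
  then have "bounded ((\<lambda>t. rbn (M t)) ` {0..T})" by (rule compact_imp_bounded)
  then obtain B where B: "\<And>y. y \<in> (\<lambda>t. rbn (M t)) ` {0..T} \<Longrightarrow> norm y \<le> B" unfolding bounded_iff by blast
  have "rbn (M t) \<le> B" if "t \<in> {0..T}" for t
    using B[of "rbn (M t)"] that by (simp add: abs_le_iff)
  then show ?thesis by blast
qed

text \<open>Multiplication by exp (- L t) makes \<open>X\<close> nonincreasing. The differential
  inequality is asked for in the open interval only, matching an equation that is imposed for
  positive times.\<close>

lemma gronwall_zero:
  fixes X :: "real \<Rightarrow> real"
  assumes T: "0 < T" and c: "continuous_on {0..T} X" and 0: "X 0 = 0"
    and D: "\<And>t. 0 < t \<Longrightarrow> t < T \<Longrightarrow> \<exists>X'. (X has_real_derivative X') (at t) \<and> X' \<le> L * X t"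
  shows "X T \<le> 0"
proof -
  define Y where "Y t = exp (- L * t) * X t" for t
  have "Y T \<le> Y 0"
  proof (rule DERIV_nonpos_imp_decreasing_open[of 0 T Y])
    fix t assume t: "0 < t" "t < T"
    then obtain X' where X': "(X has_real_derivative X') (at t)" "X' \<le> L * X t" using D by blast
    have "(Y has_real_derivative (exp (- L * t) * (- L)) * X t + X' * exp (- L * t)) (at t)"
      unfolding Y_def[abs_def] by (rule DERIV_mult[OF _ X'(1)]) (auto intro!: derivative_eq_intros)
    moreover have "(exp (- L * t) * (- L)) * X t + X' * exp (- L * t) = exp (- L * t) * (X' - L * X t)" by (simp add: algebra_simps)
    moreover have "exp (- L * t) * (X' - L * X t) \<le> 0" using X'(2) by (intro mult_nonneg_nonpos) auto
    ultimately show "\<exists>y. (Y has_real_derivative y) (at t) \<and> y \<le> 0" by metis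
  next
    show "continuous_on {0..T} Y" unfolding Y_def by (intro continuous_intros c)
  qed (use T in auto)
  then show ?thesis by (simp add: Y_def 0 mult_le_0_iff)
qed

section \<open>The energy of the difference of two solutions\<close>

lemma res_diff:
  assumes "pcont f" "pcont g"
  shows "res \<sigma> (\<lambda>x. f x - g x) x = res \<sigma> f x - res \<sigma> g x"
  using res_linear[OF assms, of \<sigma> 1 "- 1"] by simp

lemma res_pcont: "pcont g \<Longrightarrow> \<sigma> = 1 \<or> \<sigma> = - 1 \<Longrightarrow> pcont (res \<sigma> g)"
  by (rule pC1_pcont(1)[OF res_pC1])

text \<open>\<open>resolvent_quotient_sup\<close> for both solutions gives the uniform convergence
  of difference quotients that \<open>energy_deriv\<close> asks for.\<close>

lemma difference_energy_deriv:
  fixes M1 M2 :: "real \<Rightarrow> real \<Rightarrow> real" and lam :: real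
  assumes M: "\<And>t. 0 \<le> t \<Longrightarrow> rfin (M1 t)" "\<And>t. 0 \<le> t \<Longrightarrow> rfin (M2 t)"
    and v: "rfin v1" "rfin v2" and \<sigma>: "\<sigma> = 1 \<or> \<sigma> = - 1" and t: "0 < t"
    and q: "((\<lambda>h. besov_norm chi phi (1/2 - 1) ((pd_of_fun (M1 h) - pd_of_fun (M1 t)) /\<^sub>R (h - t)
        - (- pd_deriv (pd_of_fun v1) - lam *\<^sub>R pd_of_fun (M1 t)))) \<longlongrightarrow> 0) (at t within {0..})"
      "((\<lambda>h. besov_norm chi phi (1/2 - 1) ((pd_of_fun (M2 h) - pd_of_fun (M2 t)) /\<^sub>R (h - t)
        - (- pd_deriv (pd_of_fun v2) - lam *\<^sub>R pd_of_fun (M2 t)))) \<longlongrightarrow> 0) (at t within {0..})"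
  defines "D \<equiv> \<lambda>h. res \<sigma> (\<lambda>x. M1 h x - M2 h x)" and "G \<equiv> \<lambda>x. v1 x - v2 x"
  shows "((\<lambda>h. integral {0..1} (\<lambda>x. (D h x)\<^sup>2)) has_real_derivative
    2 * integral {0..1} (\<lambda>x. D t x * (- \<sigma> * (G x - res \<sigma> G x) - lam * D t x))) (at t within {0..})"
proof (rule energy_deriv)
  note p = rfin_pcont[OF M(1)] rfin_pcont[OF M(2)] and pv = rfin_pcont[OF v(1)] rfin_pcont[OF v(2)]
  show pD: "pcont (D h)" if "h \<in> {0..}" for h
    unfolding D_def using that by (intro res_pcont \<sigma> pcont_diff p) auto
  have pG: "pcont G" unfolding G_def by (intro pcont_diff pv)
  show "pcont (\<lambda>x. - \<sigma> * (G x - res \<sigma> G x) - lam * D t x)"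
    using t by (intro pcont_diff pcont_mult pcont_const pG res_pcont \<sigma> pD) auto
  show "t \<in> {0..}" using t by simp
  define n1 where "n1 h = besov_norm chi phi (1/2 - 1) ((pd_of_fun (M1 h) - pd_of_fun (M1 t)) /\<^sub>R (h - t)
        - (- pd_deriv (pd_of_fun v1) - lam *\<^sub>R pd_of_fun (M1 t)))" for h
  define n2 where "n2 h = besov_norm chi phi (1/2 - 1) ((pd_of_fun (M2 h) - pd_of_fun (M2 t)) /\<^sub>R (h - t)
        - (- pd_deriv (pd_of_fun v2) - lam *\<^sub>R pd_of_fun (M2 t)))" for h
  have le: "\<bar>(D h x - D t x) / (h - t) - (- \<sigma> * (G x - res \<sigma> G x) - lam * D t x)\<bar> \<le> 5 * n1 h + 5 * n2 h"
    if h: "h \<noteq> t" "0 \<le> h" for h x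
  proof -
    have t0: "0 \<le> t" using t by simp
    have "(D h x - D t x) / (h - t) - (- \<sigma> * (G x - res \<sigma> G x) - lam * D t x)
      = ((res \<sigma> (M1 h) x - res \<sigma> (M1 t) x) / (h - t) - (- \<sigma> * (v1 x - res \<sigma> v1 x) - lam * res \<sigma> (M1 t) x))
      - ((res \<sigma> (M2 h) x - res \<sigma> (M2 t) x) / (h - t) - (- \<sigma> * (v2 x - res \<sigma> v2 x) - lam * res \<sigma> (M2 t) x))"
      unfolding D_def G_def res_diff[OF p(1)[OF h(2)] p(2)[OF h(2)]] res_diff[OF p(1)[OF t0] p(2)[OF t0]] res_diff[OF pv]
      by (simp add: diff_divide_distrib add_divide_distrib algebra_simps)
    then show ?thesis
      using resolvent_quotient_sup[OF M(1)[OF h(2)] M(1)[OF t0] v(1) \<sigma> h(1), of x lam, folded n1_def]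
        resolvent_quotient_sup[OF M(2)[OF h(2)] M(2)[OF t0] v(2) \<sigma> h(1), of x lam, folded n2_def] by linarith
  qed
  have lim: "((\<lambda>h. 5 * n1 h + 5 * n2 h) \<longlongrightarrow> 0) (at t within {0..})"
    using tendsto_add[OF tendsto_mult_left[OF q(1), of 5] tendsto_mult_left[OF q(2), of 5]] by (simp add: n1_def n2_def)
  fix e :: real assume "e > 0"
  then have "\<forall>\<^sub>F h in at t within {0..}. 5 * n1 h + 5 * n2 h < e" using order_tendstoD(2)[OF lim] by blast
  moreover have "\<forall>\<^sub>F h in at t within {0..}. h \<noteq> t \<and> 0 \<le> h" by (simp add: eventually_at_filter)
  ultimately show "\<forall>\<^sub>F h in at t within {0..}. \<forall>x. \<bar>(D h x - D t x) / (h - t) - (- \<sigma> * (G x - res \<sigma> G x) - lam * D t x)\<bar> \<le> e"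
  proof eventually_elim
    case (elim h)
    then show ?case using le[of h] by (meson less_imp_le order_trans)
  qed
qed

text \<open>One statement for both components: \<open>U\<close> is the smoothed difference of the
  component under study and \<open>Q\<close> that of the other. The flux difference splits into
  velocity times density difference plus the term \<open>h\<close>, which is linear in
  \<open>D\<close> and \<open>E\<close> with bounded factors, as \<open>energy_bound\<close>
  requires. The damping contributes - lam U^2 and has the favourable sign.\<close>

lemma difference_energy_bound:
  fixes lam :: real
  assumes m: "pcont m1" "pcont m2" "pcont n1" "pcont n2" and g: "pcont g1" "pcont g2"
    and bd: "\<And>x. \<bar>m1 x\<bar> \<le> b" "\<And>x. \<bar>m2 x\<bar> \<le> b" "\<And>x. \<bar>n1 x\<bar> \<le> b" "\<And>x. \<bar>n2 x\<bar> \<le> b" "\<And>x. \<bar>g2 x\<bar> \<le> b"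
    and \<sigma>: "\<sigma> = 1 \<or> \<sigma> = - 1" and lam: "0 \<le> lam"
  defines "D \<equiv> res 1 (\<lambda>x. m1 x - m2 x)" and "E \<equiv> res (- 1) (\<lambda>x. n1 x - n2 x)" and "U \<equiv> res \<sigma> (\<lambda>x. g1 x - g2 x)"
    and "G \<equiv> \<lambda>x. res 1 m1 x * res (- 1) n1 x * g1 x - res 1 m2 x * res (- 1) n2 x * g2 x"
  assumes U: "U = D \<and> Q = E \<or> U = E \<and> Q = D"
  shows "2 * integral {0..1} (\<lambda>x. U x * (- \<sigma> * (G x - res \<sigma> G x) - lam * U x))
    \<le> (6 * (12 * b^3 + 12 * b\<^sup>2) + 1 + 18 * (12 * b^3 + 12 * b\<^sup>2)\<^sup>2) * (integral {0..1} (\<lambda>x. (D x)\<^sup>2) + integral {0..1} (\<lambda>x. (E x)\<^sup>2))"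
proof -
  have b0: "0 \<le> b" using bd(1)[of 0] by linarith
  \<comment> \<open>One constant above 4 b^2 for the velocity, 12 b^2 for its derivative and 2 b^2
    for the coefficient of \<open>h\<close>; resolvents are bounded by 2 b.\<close>
  define B where "B = 12 * b^3 + 12 * b\<^sup>2"
  define A1 B1 A2 B2 where "A1 = res 1 m1" and "B1 = res (- 1) n1" and "A2 = res 1 m2" and "B2 = res (- 1) n2"
  have s: "(1::real) = 1 \<or> (1::real) = - 1" "(- 1::real) = 1 \<or> (- 1::real) = - 1" by auto
  have R: "\<bar>A1 x\<bar> \<le> 2 * b" "\<bar>A2 x\<bar> \<le> 2 * b" "\<bar>B1 x\<bar> \<le> 2 * b" "\<bar>B2 x\<bar> \<le> 2 * b" for x
    unfolding A1_def A2_def B1_def B2_def using m bd by (auto intro!: res_bound)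
  have pr: "pcont A1" "pcont A2" "pcont B1" "pcont B2" "pcont D" "pcont E"
    unfolding A1_def A2_def B1_def B2_def D_def E_def by (intro res_pcont s pcont_diff m)+
  define h where "h x = (D x * B1 x + A2 x * E x) * g2 x" for x
  define \<mu> where "\<mu> x = g1 x - g2 x" for x
  have G: "G = (\<lambda>x. (A1 x * B1 x) * \<mu> x + h x)"
    unfolding G_def h_def \<mu>_def D_def E_def res_diff[OF m(1,2)] res_diff[OF m(3,4)] A1_def B1_def A2_def B2_def
    by (simp add: fun_eq_iff algebra_simps)
  have p\<mu>: "pcont \<mu>" unfolding \<mu>_def[abs_def] by (intro pcont_diff g)
  have ph: "pcont h" unfolding h_def[abs_def] by (intro pcont_mult pcont_add pr g)
  have W: "pC1 (\<lambda>x. A1 x * B1 x) (\<lambda>x. A1 x * (- 1 * (n1 x - B1 x)) + 1 * (m1 x - A1 x) * B1 x)"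
    unfolding A1_def B1_def by (intro pC1_mult res_pC1 m s)
  have b2: "0 \<le> 12 * b^3" "0 \<le> 12 * b\<^sup>2" using b0 by simp_all
  have W0: "\<bar>A1 x * B1 x\<bar> \<le> B" for x
  proof -
    have "\<bar>A1 x * B1 x\<bar> \<le> (2 * b) * (2 * b)" unfolding abs_mult using R b0 by (intro mult_mono) auto
    also have "\<dots> \<le> B" using b2 by (simp add: B_def power2_eq_square)
    finally show ?thesis .
  qed
  have W1: "\<bar>A1 x * (- 1 * (n1 x - B1 x)) + 1 * (m1 x - A1 x) * B1 x\<bar> \<le> B" for x
  proof -
    have "\<bar>A1 x * (- 1 * (n1 x - B1 x))\<bar> \<le> (2 * b) * (3 * b)"
      unfolding abs_mult[of "A1 x"] using R(1)[of x] R(3)[of x] bd(3)[of x] b0 by (intro mult_mono[of "\<bar>A1 x\<bar>"]) auto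
    moreover have "\<bar>1 * (m1 x - A1 x) * B1 x\<bar> \<le> (3 * b) * (2 * b)"
      unfolding abs_mult mult_1_left abs_one using R(1)[of x] R(3)[of x] bd(1)[of x] b0 by (intro mult_mono) auto
    moreover have "(2 * b) * (3 * b) + (3 * b) * (2 * b) \<le> B" using b2 by (simp add: B_def power2_eq_square)
    ultimately show ?thesis by linarith
  qed
  have H: "\<bar>h x\<bar> \<le> B * (\<bar>U x\<bar> + \<bar>Q x\<bar>)" for x
  proof -
    have "\<bar>h x\<bar> \<le> (\<bar>D x\<bar> * (2 * b) + (2 * b) * \<bar>E x\<bar>) * b"
      unfolding h_def abs_mult
    proof (intro mult_mono)
      have "\<bar>D x * B1 x\<bar> \<le> \<bar>D x\<bar> * (2 * b)" "\<bar>A2 x * E x\<bar> \<le> (2 * b) * \<bar>E x\<bar>"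
        unfolding abs_mult using R b0 by (auto intro!: mult_left_mono mult_right_mono)
      then show "\<bar>D x * B1 x + A2 x * E x\<bar> \<le> \<bar>D x\<bar> * (2 * b) + (2 * b) * \<bar>E x\<bar>" by linarith
    qed (use bd b0 in auto)
    also have "\<dots> = (2 * b\<^sup>2) * (\<bar>D x\<bar> + \<bar>E x\<bar>)" by (simp add: power2_eq_square algebra_simps)
    also have "\<dots> \<le> B * (\<bar>D x\<bar> + \<bar>E x\<bar>)" using b2 by (intro mult_right_mono) (auto simp: B_def)
    also have "\<bar>D x\<bar> + \<bar>E x\<bar> = \<bar>U x\<bar> + \<bar>Q x\<bar>" using U by auto
    finally show ?thesis .
  qed
  have U': "U = res \<sigma> \<mu>" unfolding U_def \<mu>_def[abs_def] ..
  have pO: "pcont Q" and pU: "pcont U" using U pr by auto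
  have pG: "pcont G" unfolding G by (intro pcont_add pcont_mult pr p\<mu> ph)
  have "2 * integral {0..1} (\<lambda>x. U x * (- \<sigma> * (G x - res \<sigma> G x)))
    \<le> (6 * B + 1 + 18 * B\<^sup>2) * (integral {0..1} (\<lambda>x. (U x)\<^sup>2) + integral {0..1} (\<lambda>x. (Q x)\<^sup>2))"
    using energy_bound[OF p\<mu> \<sigma> W W0 W1 pO ph] H unfolding G U' by blast
  also have "integral {0..1} (\<lambda>x. (U x)\<^sup>2) + integral {0..1} (\<lambda>x. (Q x)\<^sup>2)
     = integral {0..1} (\<lambda>x. (D x)\<^sup>2) + integral {0..1} (\<lambda>x. (E x)\<^sup>2)" using U by auto
  finally have 1: "2 * integral {0..1} (\<lambda>x. U x * (- \<sigma> * (G x - res \<sigma> G x)))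
    \<le> (6 * B + 1 + 18 * B\<^sup>2) * (integral {0..1} (\<lambda>x. (D x)\<^sup>2) + integral {0..1} (\<lambda>x. (E x)\<^sup>2))" .
  have "integral {0..1} (\<lambda>x. U x * (- \<sigma> * (G x - res \<sigma> G x) - lam * U x))
      \<le> integral {0..1} (\<lambda>x. U x * (- \<sigma> * (G x - res \<sigma> G x)))"
  proof (intro integral_le pcont_integrable pcont_mult pcont_diff pcont_const pU pG res_pcont \<sigma>)
    show "U x * (- \<sigma> * (G x - res \<sigma> G x) - lam * U x) \<le> U x * (- \<sigma> * (G x - res \<sigma> G x))" for x
      using lam mult_nonneg_nonneg[OF lam zero_le_square[of "U x"]] by (simp add: algebra_simps)
  qed
  then show ?thesis using 1 unfolding B_def[symmetric] by linarith
qed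

lemma res_square_zero:
  assumes g: "pcont g" and \<sigma>: "\<sigma> = 1 \<or> \<sigma> = - 1" and z: "integral {0..1} (\<lambda>x. (res \<sigma> g x)\<^sup>2) \<le> 0"
  shows "rfc g k = 0"
proof -
  have p: "pcont (res \<sigma> g)" by (rule res_pcont[OF g \<sigma>])
  have "pcont (\<lambda>x. complex_of_real (res \<sigma> g x))" using p by auto
  from bessel[OF this, of "{k}"] l2_square[OF this] have "(cmod (rfc (res \<sigma> g) k))\<^sup>2 \<le> integral {0..1} (\<lambda>x. (res \<sigma> g x)\<^sup>2)"
    by (simp add: rfc_def)
  from order_trans[OF this z] have "rfc (res \<sigma> g) k = 0" by simp
  then show ?thesis using rfc_res[OF g \<sigma>, of k] by simp
qed

text \<open>Continuity of the energy at time 0 needs its own argument, because the equation, and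
  with it the derivative of the energy, is available for positive times only. Equal initial values
  and continuity in the norm of index 1/2 give it.\<close>

lemma res_energy_tendsto:
  fixes M1 M2 :: "real \<Rightarrow> real \<Rightarrow> real"
  assumes M: "\<And>t. 0 \<le> t \<Longrightarrow> rfin (M1 t)" "\<And>t. 0 \<le> t \<Longrightarrow> rfin (M2 t)" "M1 0 = M2 0" and \<sigma>: "\<sigma> = 1 \<or> \<sigma> = - 1"
    and c: "((\<lambda>h. rbn (\<lambda>x. M1 h x - M1 0 x)) \<longlongrightarrow> 0) (at 0 within {0..})"
      "((\<lambda>h. rbn (\<lambda>x. M2 h x - M2 0 x)) \<longlongrightarrow> 0) (at 0 within {0..})"
  shows "((\<lambda>h. integral {0..1} (\<lambda>x. (res \<sigma> (\<lambda>x. M1 h x - M2 h x) x)\<^sup>2)) \<longlongrightarrow> 0) (at 0 within {0..})"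
proof (rule tendsto_sandwich)
  have f: "rfin (\<lambda>x. M1 h x - M2 h x)" if "0 \<le> h" for h using that M by (intro rbn_diff(1)) auto
  have p: "pcont (\<lambda>x. (res \<sigma> (\<lambda>x. M1 h x - M2 h x) x)\<^sup>2)" if "0 \<le> h" for h
    by (intro pcont_power res_pcont \<sigma> rfin_pcont[OF f[OF that]])
  have ev: "\<forall>\<^sub>F h in at 0 within {0..}. 0 \<le> (h::real)" by (simp add: eventually_at_filter)
  then show "\<forall>\<^sub>F h in at 0 within {0..}. 0 \<le> integral {0..1} (\<lambda>x. (res \<sigma> (\<lambda>x. M1 h x - M2 h x) x)\<^sup>2)"
    by eventually_elim (intro integral_nonneg pcont_integrable p; simp)
  show "((\<lambda>h. (2 * (rbn (\<lambda>x. M1 h x - M1 0 x) + rbn (\<lambda>x. M2 h x - M2 0 x)))\<^sup>2) \<longlongrightarrow> 0) (at 0 within {0..})"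
    using tendsto_power[OF tendsto_mult_left[OF tendsto_add[OF c], of 2], of 2] by simp
  show "\<forall>\<^sub>F h in at 0 within {0..}. integral {0..1} (\<lambda>x. (res \<sigma> (\<lambda>x. M1 h x - M2 h x) x)\<^sup>2)
    \<le> (2 * (rbn (\<lambda>x. M1 h x - M1 0 x) + rbn (\<lambda>x. M2 h x - M2 0 x)))\<^sup>2"
    using ev
  proof eventually_elim
    case (elim h)
    define r where "r = rbn (\<lambda>x. M1 h x - M1 0 x) + rbn (\<lambda>x. M2 h x - M2 0 x)"
    have "rbn (\<lambda>x. (M1 h x - M1 0 x) - (M2 h x - M2 0 x)) \<le> r"
      unfolding r_def using elim M by (intro rbn_diff) auto
    then have "rbn (res \<sigma> (\<lambda>x. M1 h x - M2 h x)) \<le> r" using rbn_res(2)[OF f[OF elim] \<sigma>] M(3) by simp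
    then have "\<bar>res \<sigma> (\<lambda>x. M1 h x - M2 h x) x\<bar> \<le> 2 * r" for x
      using rbn_sup[OF rbn_res(1)[OF f[OF elim] \<sigma>], of x] by linarith
    then have "(res \<sigma> (\<lambda>x. M1 h x - M2 h x) x)\<^sup>2 \<le> (2 * r)\<^sup>2" for x
      using power_mono[of "\<bar>res \<sigma> (\<lambda>x. M1 h x - M2 h x) x\<bar>" "2 * r" 2] by simp
    then have "integral {0..1} (\<lambda>x. (res \<sigma> (\<lambda>x. M1 h x - M2 h x) x)\<^sup>2) \<le> integral {0..1} (\<lambda>x::real. (2 * r)\<^sup>2)"
      using p[OF elim] by (intro integral_le) (auto intro: pcont_integrable)
    then show ?case by (simp add: r_def)
  qed
qed simp

lemma strong_solution_unique:
  assumes sol1: "sqq_global_strong_solution chi phi (1/2) lam m0 n0 w1"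
    and sol2: "sqq_global_strong_solution chi phi (1/2) lam m0 n0 w2" and lam: "0 \<le> lam" and T: "0 \<le> T"
  shows "w1 T = w2 T"
proof (cases "T = 0")
  case True
  then show ?thesis using sol1 sol2 by (simp add: sqq_global_strong_solution_def)
next
  case False
  then have T: "0 < T" using T by simp
  define M1 N1 M2 N2 where "M1 t = crep (fst (w1 t))" and "N1 t = crep (snd (w1 t))"
    and "M2 t = crep (fst (w2 t))" and "N2 t = crep (snd (w2 t))" for t
  note S1 = strong_solution_facts[OF sol1, folded M1_def N1_def]
  note S2 = strong_solution_facts[OF sol2, folded M2_def N2_def]
  have i: "M1 0 = M2 0" "N1 0 = N2 0"
    using sol1 sol2 by (simp_all add: sqq_global_strong_solution_def M1_def M2_def N1_def N2_def)
  have s: "(1::real) = 1 \<or> (1::real) = - 1" "(- 1::real) = 1 \<or> (- 1::real) = - 1" by auto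
  have "\<exists>b. \<forall>t\<in>{0..T}. rbn (M1 t) \<le> b" by (rule rbn_locally_bounded[OF S1(1,5)])
  then obtain b1 where b1: "\<forall>t\<in>{0..T}. rbn (M1 t) \<le> b1" ..
  have "\<exists>b. \<forall>t\<in>{0..T}. rbn (N1 t) \<le> b" by (rule rbn_locally_bounded[OF S1(2,6)])
  then obtain b2 where b2: "\<forall>t\<in>{0..T}. rbn (N1 t) \<le> b2" ..
  have "\<exists>b. \<forall>t\<in>{0..T}. rbn (M2 t) \<le> b" by (rule rbn_locally_bounded[OF S2(1,5)])
  then obtain b3 where b3: "\<forall>t\<in>{0..T}. rbn (M2 t) \<le> b3" ..
  have "\<exists>b. \<forall>t\<in>{0..T}. rbn (N2 t) \<le> b" by (rule rbn_locally_bounded[OF S2(2,6)])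
  then obtain b4 where b4: "\<forall>t\<in>{0..T}. rbn (N2 t) \<le> b4" ..
  define b where "b = 2 * (\<bar>b1\<bar> + \<bar>b2\<bar> + \<bar>b3\<bar> + \<bar>b4\<bar>)"
  have bd: "\<bar>M1 t x\<bar> \<le> b" "\<bar>M2 t x\<bar> \<le> b" "\<bar>N1 t x\<bar> \<le> b" "\<bar>N2 t x\<bar> \<le> b" if "t \<in> {0..T}" for t x
  proof -
    have t: "0 \<le> t" using that by simp
    have "rbn (M1 t) \<le> b1" "rbn (N1 t) \<le> b2" "rbn (M2 t) \<le> b3" "rbn (N2 t) \<le> b4" using b1 b2 b3 b4 that by blast+
    then have "2 * rbn (M1 t) \<le> 2 * \<bar>b1\<bar>" "2 * rbn (N1 t) \<le> 2 * \<bar>b2\<bar>" "2 * rbn (M2 t) \<le> 2 * \<bar>b3\<bar>" "2 * rbn (N2 t) \<le> 2 * \<bar>b4\<bar>"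
      by simp_all
    then show "\<bar>M1 t x\<bar> \<le> b" "\<bar>M2 t x\<bar> \<le> b" "\<bar>N1 t x\<bar> \<le> b" "\<bar>N2 t x\<bar> \<le> b"
      using rbn_sup[OF S1(1)[OF t], of x] rbn_sup[OF S1(2)[OF t], of x] rbn_sup[OF S2(1)[OF t], of x] rbn_sup[OF S2(2)[OF t], of x]
      unfolding b_def distrib_left using abs_ge_zero[of b1] abs_ge_zero[of b2] abs_ge_zero[of b3] abs_ge_zero[of b4]
      by linarith+
  qed
  define D where "D t = res 1 (\<lambda>x. M1 t x - M2 t x)" for t
  define E where "E t = res (- 1) (\<lambda>x. N1 t x - N2 t x)" for t
  define X where "X t = integral {0..1} (\<lambda>x. (D t x)\<^sup>2) + integral {0..1} (\<lambda>x. (E t x)\<^sup>2)" for t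
  define K where "K = 6 * (12 * b^3 + 12 * b\<^sup>2) + 1 + 18 * (12 * b^3 + 12 * b\<^sup>2)\<^sup>2"
  define G where "G t x = res 1 (M1 t) x * res (- 1) (N1 t) x * M1 t x - res 1 (M2 t) x * res (- 1) (N2 t) x * M2 t x" for t x
  define H where "H t x = res 1 (M1 t) x * res (- 1) (N1 t) x * N1 t x - res 1 (M2 t) x * res (- 1) (N2 t) x * N2 t x" for t x
  define X1 where "X1 t = 2 * integral {0..1} (\<lambda>x. D t x * (- 1 * (G t x - res 1 (G t) x) - lam * D t x))" for t
  define X2 where "X2 t = 2 * integral {0..1} (\<lambda>x. E t x * (- (- 1) * (H t x - res (- 1) (H t) x) - lam * E t x))" for t
  have dX: "(X has_real_derivative X1 t + X2 t) (at t within {0..})" if t: "0 < t" for t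
  proof -
    have t0: "0 \<le> t" using t by simp
    have fv: "rfin (\<lambda>x. res 1 (M1 t) x * res (- 1) (N1 t) x * M1 t x)" "rfin (\<lambda>x. res 1 (M2 t) x * res (- 1) (N2 t) x * M2 t x)"
      "rfin (\<lambda>x. res 1 (M1 t) x * res (- 1) (N1 t) x * N1 t x)" "rfin (\<lambda>x. res 1 (M2 t) x * res (- 1) (N2 t) x * N2 t x)"
      using S1(1,2)[OF t0] S2(1,2)[OF t0] by - (intro rbn_mult(1) rbn_res(1) s; assumption)+
    show ?thesis
      unfolding X_def[abs_def] X1_def X2_def D_def E_def G_def H_def
      by (intro DERIV_add difference_energy_deriv S1(1,2) S2(1,2) fv s t S1(7,8) S2(7,8); assumption)
  qed
  have leX: "X1 t + X2 t \<le> (2 * K) * X t" if t: "t \<in> {0..T}" for t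
  proof -
    have t0: "0 \<le> t" using t by simp
    note p = rfin_pcont[OF S1(1)[OF t0]] rfin_pcont[OF S2(1)[OF t0]] rfin_pcont[OF S1(2)[OF t0]] rfin_pcont[OF S2(2)[OF t0]]
    have "X1 t \<le> K * X t"
      unfolding X1_def X_def K_def D_def E_def G_def
      by (rule difference_energy_bound[OF p p(1,2) bd[OF t] bd(2)[OF t] s(1) lam, of "E t"]) (simp add: E_def)
    moreover have "X2 t \<le> K * X t"
      unfolding X2_def X_def K_def D_def E_def H_def
      by (rule difference_energy_bound[OF p p(3,4) bd[OF t] bd(4)[OF t] s(2) lam, of "D t"]) (simp add: D_def)
    ultimately show ?thesis by (simp add: algebra_simps)
  qed
  have X0: "X 0 = 0"
  proof -
    have "D 0 = (\<lambda>x. 0)" "E 0 = (\<lambda>x. 0)" by (simp_all add: D_def E_def i res_def lag_def fun_eq_iff)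
    then show ?thesis by (simp add: X_def)
  qed
  \<comment> \<open>Each of the two halves of the energy derivative is at most K times the whole
    energy, hence the rate 2 * K.\<close>
  have "X T \<le> 0"
  proof (rule gronwall_zero[where X = X and T = T and L = "2 * K"])
    show "0 < T" "X 0 = 0" by (fact T, fact X0)
    show "continuous_on {0..T} X"
      unfolding continuous_on_eq_continuous_within
    proof
      fix t assume "t \<in> {0..T}"
      then consider "t = 0" | "0 < t" by force
      then have "continuous (at t within {0..}) X"
      proof cases
        case 1
        have "(X \<longlongrightarrow> 0 + 0) (at 0 within {0..})"
          unfolding X_def[abs_def] D_def E_def
          by (intro tendsto_add res_energy_tendsto S1(1,2) S2(1,2) i s S1(5,6) S2(5,6); simp)
        then show ?thesis using X0 1 by (simp add: continuous_within)
      next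
        case 2
        then show ?thesis using dX DERIV_continuous by blast
      qed
      then show "continuous (at t within {0..T}) X" by (rule continuous_within_subset) auto
    qed
    fix t assume t: "0 < t" "t < T"
    have "at t within {0..} = at t" using t by (intro at_within_interior) simp
    then show "\<exists>X'. (X has_real_derivative X') (at t) \<and> X' \<le> (2 * K) * X t"
      using dX[OF t(1)] leX[of t] t by auto
  qed
  have T0: "0 \<le> T" using T by simp
  note p = rfin_pcont[OF S1(1)[OF T0]] rfin_pcont[OF S2(1)[OF T0]] rfin_pcont[OF S1(2)[OF T0]] rfin_pcont[OF S2(2)[OF T0]]
  have "0 \<le> integral {0..1} (\<lambda>x. (D T x)\<^sup>2)" "0 \<le> integral {0..1} (\<lambda>x. (E T x)\<^sup>2)"
    unfolding D_def E_def by (intro integral_nonneg pcont_integrable pcont_power res_pcont pcont_diff p s; simp)+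
  with \<open>X T \<le> 0\<close> have z: "integral {0..1} (\<lambda>x. (D T x)\<^sup>2) \<le> 0" "integral {0..1} (\<lambda>x. (E T x)\<^sup>2) \<le> 0"
    unfolding X_def by linarith+
  \<comment> \<open>Vanishing energy kills the resolvents of both differences, and the nonzero
    symbol carries this over to the coefficients of the differences.\<close>
  have "rfc (\<lambda>x. M1 T x - M2 T x) k = 0" "rfc (\<lambda>x. N1 T x - N2 T x) k = 0" for k
    using res_square_zero[OF pcont_diff[OF p(1,2)] s(1) z(1)[unfolded D_def]]
      res_square_zero[OF pcont_diff[OF p(3,4)] s(2) z(2)[unfolded E_def]] by auto
  then have "fourier_coeff (fst (w1 T)) k = fourier_coeff (fst (w2 T)) k" "fourier_coeff (snd (w1 T)) k = fourier_coeff (snd (w2 T)) k" for k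
    unfolding S1(3,4)[OF T0, symmetric] S2(3,4)[OF T0, symmetric] using p by (simp_all add: fourier_coeff_pd_of_fun rfc_diff)
  then show ?thesis by (intro prod_eqI pdist_eqI)
qed

section \<open>Damping by a change of time\<close>

lemma rbn_diff_tendsto_mult:
  assumes f: "\<And>r. r \<in> S \<Longrightarrow> rfin (f r)" "((\<lambda>s. rbn (\<lambda>x. f s x - f t x)) \<longlongrightarrow> 0) (at t within S)"
    and g: "\<And>r. r \<in> S \<Longrightarrow> rfin (g r)" "((\<lambda>s. rbn (\<lambda>x. g s x - g t x)) \<longlongrightarrow> 0) (at t within S)"
    and t: "t \<in> S"
  shows "((\<lambda>s. rbn (\<lambda>x. f s x * g s x - f t x * g t x)) \<longlongrightarrow> 0) (at t within S)"
proof (rule tendsto_sandwich)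
  define a where "a s = rbn (\<lambda>x. f s x - f t x)" for s
  define b where "b s = rbn (\<lambda>x. g s x - g t x)" for s
  have ev: "\<forall>\<^sub>F s in at t within S. s \<in> S" by (simp add: eventually_at_filter)
  have df: "rfin (\<lambda>x. f s x - f t x)" "rfin (\<lambda>x. g s x - g t x)" if "s \<in> S" for s
    using f(1) g(1) t that by (auto intro: rbn_diff(1))
  have dp: "rfin (\<lambda>x. f s x * g s x - f t x * g t x)" if "s \<in> S" for s
    using f(1) g(1) t that by (intro rbn_diff(1) rbn_mult(1))
  show "\<forall>\<^sub>F s in at t within S. 0 \<le> rbn (\<lambda>x. f s x * g s x - f t x * g t x)"
    using ev by eventually_elim (rule rbn_nonneg[OF dp])
  show "((\<lambda>s. 10000 * a s * b s + (10000 * a s * rbn (g t) + 10000 * rbn (f t) * b s)) \<longlongrightarrow> 0) (at t within S)"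
    using f(2) g(2) unfolding a_def[symmetric] b_def[symmetric] by (auto intro!: tendsto_eq_intros)
  show "\<forall>\<^sub>F s in at t within S. rbn (\<lambda>x. f s x * g s x - f t x * g t x)
    \<le> 10000 * a s * b s + (10000 * a s * rbn (g t) + 10000 * rbn (f t) * b s)"
    using ev
  proof eventually_elim
    case (elim s)
    note F = rbn_mult[OF df[OF elim]] and G = rbn_mult[OF df(1)[OF elim] g(1)[OF t]] and H = rbn_mult[OF f(1)[OF t] df(2)[OF elim]]
    have e: "(\<lambda>x. f s x * g s x - f t x * g t x)
      = (\<lambda>x. (f s x - f t x) * (g s x - g t x) + ((f s x - f t x) * g t x + f t x * (g s x - g t x)))"
      by (simp add: fun_eq_iff algebra_simps)
    show ?case
      unfolding e a_def b_def using rbn_add(2)[OF F(1) rbn_add(1)[OF G(1) H(1)]] rbn_add(2)[OF G(1) H(1)] F(2) G(2) H(2)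
      by linarith
  qed
qed simp

lemma rbn_diff_tendsto_res:
  assumes f: "\<And>r. r \<in> S \<Longrightarrow> rfin (f r)" "((\<lambda>s. rbn (\<lambda>x. f s x - f t x)) \<longlongrightarrow> 0) (at t within S)"
    and t: "t \<in> S" and \<sigma>: "\<sigma> = 1 \<or> \<sigma> = - 1"
  shows "((\<lambda>s. rbn (\<lambda>x. res \<sigma> (f s) x - res \<sigma> (f t) x)) \<longlongrightarrow> 0) (at t within S)"
proof (rule tendsto_sandwich[OF _ _ tendsto_const f(2)])
  have ev: "\<forall>\<^sub>F s in at t within S. s \<in> S" by (simp add: eventually_at_filter)
  have e: "(\<lambda>x. res \<sigma> (f s) x - res \<sigma> (f t) x) = res \<sigma> (\<lambda>x. f s x - f t x)"
    and df: "rfin (\<lambda>x. f s x - f t x)" if "s \<in> S" for s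
    using f(1)[OF that] f(1)[OF t] by (auto simp: fun_eq_iff res_diff rfin_pcont intro: rbn_diff(1))
  show "\<forall>\<^sub>F s in at t within S. 0 \<le> rbn (\<lambda>x. res \<sigma> (f s) x - res \<sigma> (f t) x)"
    using ev by eventually_elim (simp add: e rbn_nonneg rbn_res(1)[OF df \<sigma>])
  show "\<forall>\<^sub>F s in at t within S. rbn (\<lambda>x. res \<sigma> (f s) x - res \<sigma> (f t) x) \<le> rbn (\<lambda>x. f s x - f t x)"
    using ev by eventually_elim (simp add: e rbn_res(2)[OF df \<sigma>])
qed

text \<open>The solution of tau' = exp (- 2 lam t), tau 0 = 0. A cubic flux scales by exp (- 3 lam
  t), of which exp (- lam t) belongs to the amplitude and the rest to the speed of the
  clock.\<close>

definition clock :: "real \<Rightarrow> real \<Rightarrow> real" where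
  "clock lam t = (1 - exp (- 2 * lam * t)) / (2 * lam)"

lemma clock_range: "lam > 0 \<Longrightarrow> 0 \<le> t \<Longrightarrow> clock lam t \<in> {0..1 / (2 * lam)}"
  unfolding clock_def by (auto simp: divide_simps)

lemma clock_deriv: "lam > 0 \<Longrightarrow> (clock lam has_vector_derivative (exp (- lam * t))\<^sup>2) (at t within S)"
  unfolding clock_def[abs_def] has_real_derivative_iff_has_vector_derivative[symmetric]
  by (auto intro!: derivative_eq_intros simp: power2_eq_square exp_add[symmetric])

text \<open>Limits \<open>at\<close> a point exclude that point, so strict monotonicity of the clock
  is used besides its continuity.\<close>

lemma clock_filterlim:
  assumes "lam > 0" "0 \<le> t"
  shows "filterlim (clock lam) (at (clock lam t) within {0..1 / (2 * lam)}) (at t within {0..})"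
  unfolding filterlim_at
proof
  show "(clock lam \<longlongrightarrow> clock lam t) (at t within {0..})"
    using has_vector_derivative_continuous[OF clock_deriv[OF assms(1)]] by (simp add: continuous_within)
  have "\<forall>\<^sub>F s in at t within {0..}. 0 \<le> s \<and> s \<noteq> t" by (simp add: eventually_at_filter)
  then show "\<forall>\<^sub>F s in at t within {0..}. clock lam s \<in> {0..1 / (2 * lam)} \<and> clock lam s \<noteq> clock lam t"
    by eventually_elim (use assms clock_range[OF assms(1)] in \<open>auto simp: clock_def\<close>)
qed

lemma damped_tendsto:
  fixes g :: "real \<Rightarrow> real \<Rightarrow> real"
  assumes lam: "lam > 0" and t: "0 \<le> t" and g: "\<And>r. r \<in> {0..1 / (2 * lam)} \<Longrightarrow> rfin (g r)"
    and gc: "\<And>r. r \<in> {0..1 / (2 * lam)} \<Longrightarrow> ((\<lambda>s. rbn (\<lambda>x. g s x - g r x)) \<longlongrightarrow> 0) (at r within {0..1 / (2 * lam)})"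
    and c: "isCont c t"
  shows "((\<lambda>s. rbn (\<lambda>x. c s * g (clock lam s) x - c t * g (clock lam t) x)) \<longlongrightarrow> 0) (at t within {0..})"
proof (rule tendsto_sandwich)
  note K = clock_range[OF lam]
  have ev: "\<forall>\<^sub>F s in at t within {0..}. 0 \<le> s" by (simp add: eventually_at_filter)
  have d: "rfin (\<lambda>x. g (clock lam s) x - g (clock lam t) x)" if "0 \<le> s" for s
    by (intro rbn_diff(1) g K t that)
  have e: "(\<lambda>x. c s * g (clock lam s) x - c t * g (clock lam t) x)
    = (\<lambda>x. c s * (g (clock lam s) x - g (clock lam t) x) + (c s - c t) * g (clock lam t) x)" for s
    by (simp add: fun_eq_iff algebra_simps)
  show "\<forall>\<^sub>F s in at t within {0..}. 0 \<le> rbn (\<lambda>x. c s * g (clock lam s) x - c t * g (clock lam t) x)"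
    using ev unfolding e by eventually_elim (intro rbn_nonneg rbn_lincomb(1) d g K t)
  show "\<forall>\<^sub>F s in at t within {0..}. rbn (\<lambda>x. c s * g (clock lam s) x - c t * g (clock lam t) x)
    \<le> \<bar>c s\<bar> * rbn (\<lambda>x. g (clock lam s) x - g (clock lam t) x) + \<bar>c s - c t\<bar> * rbn (g (clock lam t))"
    using ev unfolding e by eventually_elim (intro rbn_lincomb(2) d g K t)
  have 1: "((\<lambda>s. rbn (\<lambda>x. g (clock lam s) x - g (clock lam t) x)) \<longlongrightarrow> 0) (at t within {0..})"
    by (rule filterlim_compose[OF gc[OF K[OF t]] clock_filterlim[OF lam t]])
  have 2: "(c \<longlongrightarrow> c t) (at t within {0..})" using c unfolding isCont_def by (rule tendsto_within_subset) simp
  show "((\<lambda>s. \<bar>c s\<bar> * rbn (\<lambda>x. g (clock lam s) x - g (clock lam t) x) + \<bar>c s - c t\<bar> * rbn (g (clock lam t))) \<longlongrightarrow> 0) (at t within {0..})"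
    using tendsto_add[OF tendsto_mult[OF tendsto_rabs[OF 2] 1] tendsto_mult_right[OF tendsto_rabs[OF tendsto_diff[OF 2 tendsto_const[of "c t"]]], of "rbn (g (clock lam t))"]]
    by simp
qed simp

text \<open>The product rule: differentiating the amplitude gives the damping term, and the clock
  speed times the amplitude gives the cube in front of the flux.\<close>

lemma damped_component:
  fixes g \<Phi> :: "real \<Rightarrow> real \<Rightarrow> real"
  assumes lam: "lam > 0" and g: "\<And>r. r \<in> {0..1 / (2 * lam)} \<Longrightarrow> rfin (g r)"
    and \<Phi>: "\<And>r. r \<in> {0..1 / (2 * lam)} \<Longrightarrow> rfin (\<Phi> r)"
    and D: "\<And>r k. r \<in> {0..1 / (2 * lam)} \<Longrightarrow> ((\<lambda>s. rfc (g s) k) has_vector_derivative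
      - (2 * pi * \<i> * of_int k * rfc (\<Phi> r) k)) (at r within {0..1 / (2 * lam)})"
    and t: "0 \<le> t"
  shows "((\<lambda>s. rfc (\<lambda>x. exp (- lam * s) * g (clock lam s) x) k) has_vector_derivative
      - (2 * pi * \<i> * of_int k * rfc (\<lambda>x. exp (- lam * t) ^ 3 * \<Phi> (clock lam t) x) k)
      - lam * rfc (\<lambda>x. exp (- lam * t) * g (clock lam t) x) k) (at t within {0..})"
proof -
  note K = clock_range[OF lam]
  have "((\<lambda>s. rfc (g s) k) has_vector_derivative - (2 * pi * \<i> * of_int k * rfc (\<Phi> (clock lam t)) k))
      (at (clock lam t) within clock lam ` {0..})"
    by (rule has_vector_derivative_within_subset[OF D[OF K[OF t]]]) (intro image_subsetI K, simp)
  from vector_diff_chain_within[OF clock_deriv[OF lam] this]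
  have 1: "((\<lambda>s. rfc (g (clock lam s)) k) has_vector_derivative
      (exp (- lam * t))\<^sup>2 *\<^sub>R - (2 * pi * \<i> * of_int k * rfc (\<Phi> (clock lam t)) k)) (at t within {0..})"
    by (simp add: o_def)
  have 2: "((\<lambda>s. exp (- lam * s)) has_real_derivative - lam * exp (- lam * t)) (at t within {0..})"
    by (auto intro!: derivative_eq_intros)
  define e where "e = exp (- lam * t)"
  define u v where "u = rfc (g (clock lam t)) k" and "v = rfc (\<Phi> (clock lam t)) k"
  have "exp (- lam * t) *\<^sub>R ((exp (- lam * t))\<^sup>2 *\<^sub>R - (2 * pi * \<i> * of_int k * v)) + (- lam * exp (- lam * t)) *\<^sub>R u
      = - (2 * pi * \<i> * of_int k * (of_real (e ^ 3) * v)) - lam * (of_real e * u)"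
    unfolding e_def[symmetric] scaleR_conv_of_real by (simp add: power2_eq_square power3_eq_cube algebra_simps)
  also have "\<dots> = - (2 * pi * \<i> * of_int k * rfc (\<lambda>x. exp (- lam * t) ^ 3 * \<Phi> (clock lam t) x) k)
      - lam * rfc (\<lambda>x. exp (- lam * t) * g (clock lam t) x) k"
    unfolding u_def v_def e_def rfc_cmult ..
  finally have "((\<lambda>s. exp (- lam * s) *\<^sub>R rfc (g (clock lam s)) k) has_vector_derivative
      - (2 * pi * \<i> * of_int k * rfc (\<lambda>x. exp (- lam * t) ^ 3 * \<Phi> (clock lam t) x) k)
      - lam * rfc (\<lambda>x. exp (- lam * t) * g (clock lam t) x) k) (at t within {0..})"
    using has_vector_derivative_scaleR[OF 2 1] unfolding u_def v_def by (simp only:)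
  then show ?thesis
    by (rule has_vector_derivative_transform[rotated 2]) (use t g K in \<open>auto simp: rfc_cmult rfin_pcont scaleR_conv_of_real\<close>)
qed

lemma strong_solution_exists:
  assumes m0: "rfin m0" "rbn m0 \<le> \<beta>" and n0: "rfin n0" "rbn n0 \<le> \<beta>"
    and lam: "lam > 0" "10 ^ 8 * (1 / (2 * lam) * \<beta>\<^sup>2) \<le> 1"
  shows "\<exists>w. sqq_global_strong_solution chi phi (1/2) lam (pd_of_fun m0) (pd_of_fun n0) w"
proof -
  define I where "I = {0..1 / (2 * lam)}"
  have T: "0 \<le> 1 / (2 * lam)" using lam by simp
  obtain M N where MN: "M 0 = m0" "N 0 = n0"
    "\<And>t. t \<in> I \<Longrightarrow> rfin (M t)" "\<And>t. t \<in> I \<Longrightarrow> rfin (N t)"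
    "\<And>t. t \<in> I \<Longrightarrow> ((\<lambda>s. rbn (\<lambda>x. M s x - M t x)) \<longlongrightarrow> 0) (at t within I)"
    "\<And>t. t \<in> I \<Longrightarrow> ((\<lambda>s. rbn (\<lambda>x. N s x - N t x)) \<longlongrightarrow> 0) (at t within I)"
    "\<And>t k. t \<in> I \<Longrightarrow> ((\<lambda>s. rfc (M s) k) has_vector_derivative
      - (2 * pi * \<i> * of_int k * rfc (\<lambda>x. res 1 (M t) x * res (- 1) (N t) x * M t x) k)) (at t within I)"
    "\<And>t k. t \<in> I \<Longrightarrow> ((\<lambda>s. rfc (N s) k) has_vector_derivative
      - (2 * pi * \<i> * of_int k * rfc (\<lambda>x. res 1 (M t) x * res (- 1) (N t) x * N t x) k)) (at t within I)"
    using undamped_solution_exists[OF m0 n0 T lam(2)] unfolding I_def by blast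
  note K = clock_range[OF lam(1), folded I_def]
  have s: "(1::real) = 1 \<or> (1::real) = - 1" "(- 1::real) = 1 \<or> (- 1::real) = - 1" by auto
  define W where "W t x = res 1 (M t) x * res (- 1) (N t) x" for t x
  have W: "rfin (W t)" "((\<lambda>s. rbn (\<lambda>x. W s x - W t x)) \<longlongrightarrow> 0) (at t within I)" if "t \<in> I" for t
  proof -
    note R = rbn_res(1)[OF MN(3) s(1)] rbn_res(1)[OF MN(4) s(2)]
    show "rfin (W t)" unfolding W_def[abs_def] by (intro rbn_mult(1) R that)
    show "((\<lambda>s. rbn (\<lambda>x. W s x - W t x)) \<longlongrightarrow> 0) (at t within I)"
      unfolding W_def[abs_def]
      by (intro rbn_diff_tendsto_mult R rbn_diff_tendsto_res MN(3,4) MN(5,6)[OF that] s that)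
  qed
  define A where "A t x = W t x * M t x" for t x
  define B where "B t x = W t x * N t x" for t x
  have A: "rfin (A t)" "((\<lambda>s. rbn (\<lambda>x. A s x - A t x)) \<longlongrightarrow> 0) (at t within I)"
    and B: "rfin (B t)" "((\<lambda>s. rbn (\<lambda>x. B s x - B t x)) \<longlongrightarrow> 0) (at t within I)" if "t \<in> I" for t
    unfolding A_def[abs_def] B_def[abs_def] using that
    by - (intro rbn_mult(1) W(1) MN(3,4) rbn_diff_tendsto_mult MN(5,6) W(2); assumption)+
  define m where "m t x = exp (- lam * t) * M (clock lam t) x" for t x
  define n where "n t x = exp (- lam * t) * N (clock lam t) x" for t x
  define a where "a t x = exp (- lam * t) ^ 3 * A (clock lam t) x" for t x
  define b where "b t x = exp (- lam * t) ^ 3 * B (clock lam t) x" for t x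
  have c: "isCont (\<lambda>t. exp (- lam * t)) t" "isCont (\<lambda>t. exp (- lam * t) ^ 3) t" for t by (auto intro!: continuous_intros)
  have r: "rfin (m t)" "rfin (n t)" "rfin (a t)" "rfin (b t)" if "0 \<le> t" for t
  proof -
    have sc: "rfin (\<lambda>x. c * f x)" if "rfin f" for c f using rbn_lincomb(1)[OF that that, of c 0] by simp
    note k = K[OF that]
    show "rfin (m t)" "rfin (n t)" "rfin (a t)" "rfin (b t)"
      unfolding m_def[abs_def] n_def[abs_def] a_def[abs_def] b_def[abs_def]
      by (rule sc[OF MN(3)[OF k]], rule sc[OF MN(4)[OF k]], rule sc[OF A(1)[OF k]], rule sc[OF B(1)[OF k]])
  qed
  have r_c: "((\<lambda>s. rbn (\<lambda>x. m s x - m t x)) \<longlongrightarrow> 0) (at t within {0..})" "((\<lambda>s. rbn (\<lambda>x. n s x - n t x)) \<longlongrightarrow> 0) (at t within {0..})"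
    "((\<lambda>s. rbn (\<lambda>x. a s x - a t x)) \<longlongrightarrow> 0) (at t within {0..})" "((\<lambda>s. rbn (\<lambda>x. b s x - b t x)) \<longlongrightarrow> 0) (at t within {0..})"
    if "0 \<le> t" for t
  proof -
    note dt = damped_tendsto[OF lam(1) that, folded I_def]
    show "((\<lambda>s. rbn (\<lambda>x. m s x - m t x)) \<longlongrightarrow> 0) (at t within {0..})" "((\<lambda>s. rbn (\<lambda>x. n s x - n t x)) \<longlongrightarrow> 0) (at t within {0..})"
      "((\<lambda>s. rbn (\<lambda>x. a s x - a t x)) \<longlongrightarrow> 0) (at t within {0..})" "((\<lambda>s. rbn (\<lambda>x. b s x - b t x)) \<longlongrightarrow> 0) (at t within {0..})"
      unfolding m_def n_def a_def b_def
      by (rule dt[of M, OF MN(3) MN(5) c(1)], assumption+, rule dt[of N, OF MN(4) MN(6) c(1)], assumption+,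
        rule dt[of A, OF A c(2)], assumption+, rule dt[of B, OF B c(2)], assumption+)
  qed
  have D: "((\<lambda>s. rfc (m s) k) has_vector_derivative - (2 * pi * \<i> * of_int k * rfc (a t) k) - lam * rfc (m t) k) (at t within {0..})"
    "((\<lambda>s. rfc (n s) k) has_vector_derivative - (2 * pi * \<i> * of_int k * rfc (b t) k) - lam * rfc (n t) k) (at t within {0..})"
    if "0 \<le> t" for t k
    unfolding m_def[abs_def] n_def[abs_def] a_def b_def
    by (rule damped_component[OF lam(1) _ _ _ that], unfold I_def[symmetric], fact MN(3), fact A(1), unfold A_def[abs_def] W_def, fact MN(7),
      rule damped_component[OF lam(1) _ _ _ that], unfold I_def[symmetric], fact MN(4), fact B(1), unfold B_def[abs_def] W_def, fact MN(8))
  note CM = component_curve[OF r(1,3) r_c(1,3) D(1), simplified implies_True_equals True_implies_equals triv_forall_equality]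
  note CN = component_curve[OF r(2,4) r_c(2,4) D(2), simplified implies_True_equals True_implies_equals triv_forall_equality]
  define w where "w t = (pd_of_fun (m t), pd_of_fun (n t))" for t
  define zm where "zm t = - pd_deriv (pd_of_fun (a t)) - lam *\<^sub>R pd_of_fun (m t)" for t
  define zn where "zn t = - pd_deriv (pd_of_fun (b t)) - lam *\<^sub>R pd_of_fun (n t)" for t
  have wc: "((\<lambda>h. besov2_norm chi phi (1/2) (w h - w t)) \<longlongrightarrow> 0) (at t within {0..})"
    "((\<lambda>h. besov2_norm chi phi (1/2 - 1) (w h - w t)) \<longlongrightarrow> 0) (at t within {0..})"
    "((\<lambda>h. besov2_norm chi phi (1/2 - 1) ((zm h, zn h) - (zm t, zn t))) \<longlongrightarrow> 0) (at t within {0..})"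
    "((\<lambda>h. besov2_norm chi phi (1/2 - 1) ((w h - w t) /\<^sub>R (h - t) - (zm t, zn t))) \<longlongrightarrow> 0) (at t within {0..})" if "0 \<le> t" for t
    unfolding besov2_norm_def w_def zm_def zn_def
    using tendsto_add[OF CM(1)[OF that] CN(1)[OF that]] tendsto_add[OF CM(2)[OF that] CN(2)[OF that]]
      tendsto_add[OF CM(4)[OF that] CN(4)[OF that]]
      tendsto_add[OF CM(5)[OF that, unfolded curve_has_deriv_def] CN(5)[OF that, unfolded curve_has_deriv_def]]
    by simp_all
  have wb: "w t \<in> besov2 chi phi (1/2)" "w t \<in> besov2 chi phi (1/2 - 1)" "(zm t, zn t) \<in> besov2 chi phi (1/2 - 1)" if "0 \<le> t" for t
    using rfin_besov(1,2)[OF r(1)[OF that]] rfin_besov(1,2)[OF r(2)[OF that]] CM(3)[OF that] CN(3)[OF that]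
    by (simp_all add: w_def zm_def zn_def)
  have sub: "(f \<longlongrightarrow> (0::real)) (at t within {0..T'})" if "(f \<longlongrightarrow> 0) (at t within {0..})" for f t and T' :: real
    using that by (rule tendsto_within_subset) auto
  have "w \<in> curves_C T' (besov2 chi phi (1/2)) (besov2_norm chi phi (1/2))" for T'
    unfolding curves_C_def using wb(1) sub[OF wc(1)] by auto
  moreover have "w \<in> curves_C1 T' (besov2 chi phi (1/2 - 1)) (besov2_norm chi phi (1/2 - 1))" for T'
    unfolding curves_C1_def curve_has_deriv_def
  proof (intro CollectI conjI bexI[of _ "\<lambda>t. (zm t, zn t)"] ballI)
    show "w \<in> curves_C T' (besov2 chi phi (1/2 - 1)) (besov2_norm chi phi (1/2 - 1))"
      unfolding curves_C_def using wb(2) sub[OF wc(2)] by (intro CollectI conjI ballI; simp only: atLeastAtMost_iff)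
    show "(\<lambda>t. (zm t, zn t)) \<in> curves_C T' (besov2 chi phi (1/2 - 1)) (besov2_norm chi phi (1/2 - 1))"
      unfolding curves_C_def using wb(3) sub[OF wc(3)] by (intro CollectI conjI ballI; simp only: atLeastAtMost_iff)
  qed (rule sub[OF wc(4)], simp)
  ultimately have E: "w \<in> E_space_infty chi phi (1/2)" unfolding E_space_infty_def E_space_def by blast
  have w0: "w 0 = (pd_of_fun m0, pd_of_fun n0)"
    by (simp add: w_def m_def[abs_def] n_def[abs_def] clock_def MN(1,2))
  have eq: "zm t + pd_deriv (pd_mult (sqq_velocity (fst (w t)) (snd (w t))) (fst (w t))) + lam *\<^sub>R fst (w t) = 0"
    "zn t + pd_deriv (pd_mult (sqq_velocity (fst (w t)) (snd (w t))) (snd (w t))) + lam *\<^sub>R snd (w t) = 0" if t: "0 \<le> t" for t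
  proof -
    note p = rfin_pcont[OF r(1)[OF t]] rfin_pcont[OF r(2)[OF t]] and P = rfin_pcont[OF MN(3)[OF K[OF t]]] rfin_pcont[OF MN(4)[OF K[OF t]]]
    \<comment> \<open>The resolvents are linear in the density, so the exponential factor passes
      through them; the three factors of the flux then yield the cube in \<open>a\<close> and
      \<open>b\<close>.\<close>
    have R: "res \<sigma> (m t) x = exp (- lam * t) * res \<sigma> (M (clock lam t)) x" "res \<sigma> (n t) x = exp (- lam * t) * res \<sigma> (N (clock lam t)) x" for \<sigma> x
      using res_linear[OF P(1) P(1), of \<sigma> "exp (- lam * t)" 0 x] res_linear[OF P(2) P(2), of \<sigma> "exp (- lam * t)" 0 x]
      unfolding m_def[abs_def] n_def[abs_def] by simp_all
    have f: "(\<lambda>x. res 1 (m t) x * res (- 1) (n t) x * m t x) = a t" "(\<lambda>x. res 1 (m t) x * res (- 1) (n t) x * n t x) = b t"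
      unfolding R by (simp_all add: m_def n_def a_def b_def A_def B_def W_def power3_eq_cube fun_eq_iff)
    have pv: "pcont (\<lambda>x. res 1 (m t) x * res (- 1) (n t) x)" by (intro pcont_mult res_pcont p s)
    show "zm t + pd_deriv (pd_mult (sqq_velocity (fst (w t)) (snd (w t))) (fst (w t))) + lam *\<^sub>R fst (w t) = 0"
      "zn t + pd_deriv (pd_mult (sqq_velocity (fst (w t)) (snd (w t))) (snd (w t))) + lam *\<^sub>R snd (w t) = 0"
      unfolding w_def fst_conv snd_conv sqq_velocity_eq[OF p] pd_mult_pd_of_fun[OF pv p(1)] pd_mult_pd_of_fun[OF pv p(2)] f zm_def zn_def
      by simp_all
  qed
  have "sqq_global_strong_solution chi phi (1/2) lam (pd_of_fun m0) (pd_of_fun n0) w"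
    unfolding sqq_global_strong_solution_def Let_def
  proof (intro conjI E w0 allI impI)
    fix t :: real assume "0 < t"
    then have "0 \<le> t" by simp
    then show "\<exists>mt nt. curve_has_deriv (besov2_norm chi phi (1/2 - 1)) w (mt, nt) t {0..} \<and>
        mt \<in> besov chi phi (1/2 - 1) \<and> nt \<in> besov chi phi (1/2 - 1) \<and>
        mt + pd_deriv (pd_mult (sqq_velocity (fst (w t)) (snd (w t))) (fst (w t))) + lam *\<^sub>R fst (w t) = 0 \<and>
        nt + pd_deriv (pd_mult (sqq_velocity (fst (w t)) (snd (w t))) (snd (w t))) + lam *\<^sub>R snd (w t) = 0"
      using eq[of t] wb(3)[of t] wc(4)[of t] unfolding curve_has_deriv_def by (intro exI[of _ "zm t"] exI[of _ "zn t"]) simp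
  qed
  then show ?thesis by (rule exI[of _ w])
qed

end

theorem corollary1p6:
  fixes chi phi :: "real \<Rightarrow> real"
  assumes "dyadic_partition chi phi"
  shows "\<exists>C::real. C > 0 \<and>
    (\<forall>m0 \<in> besov chi phi (1/2). \<forall>n0 \<in> besov chi phi (1/2). \<forall>N0 lam :: real.
       N0 = besov_norm chi phi (1/2) m0 + besov_norm chi phi (1/2) n0 \<longrightarrow>
       lam > 0 \<longrightarrow>
       lam \<ge> 6 * C ^ 3 / ln 2 * (N0 + 4 * C ^ 3 / lam * N0 ^ 3)\<^sup>2
               * exp (4 * C ^ 3 * N0\<^sup>2 / lam) \<longrightarrow>
       (\<exists>w. sqq_global_strong_solution chi phi (1/2) lam m0 n0 w \<and>
          (\<forall>w'. sqq_global_strong_solution chi phi (1/2) lam m0 n0 w' \<longrightarrow>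
             (\<forall>t\<ge>0. w' t = w t))))"
proof (intro exI[of _ "1000::real"] conjI ballI allI impI)
  interpret littlewood_paley chi phi by unfold_locales (rule assms)
  fix m0 n0 and N0 lam :: real
  assume m0: "m0 \<in> besov chi phi (1/2)" and n0: "n0 \<in> besov chi phi (1/2)"
    and N0: "N0 = besov_norm chi phi (1/2) m0 + besov_norm chi phi (1/2) n0" and lam: "lam > 0"
    and le: "lam \<ge> 6 * 1000 ^ 3 / ln 2 * (N0 + 4 * 1000 ^ 3 / lam * N0 ^ 3)\<^sup>2 * exp (4 * 1000 ^ 3 * N0\<^sup>2 / lam)"
  obtain f g where f: "rfin f" "m0 = pd_of_fun f" and g: "rfin g" "n0 = pd_of_fun g"
    using rfin_of_besov[OF m0] rfin_of_besov[OF n0] by blast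
  have pos: "0 \<le> besov_norm chi phi (1/2) m0" "0 \<le> besov_norm chi phi (1/2) n0" by (rule besov_norm_nonneg)+
  then have N0': "0 \<le> N0" using N0 by simp
  have "sqrt 2 * besov_norm chi phi (1/2) m0 \<le> 2 * besov_norm chi phi (1/2) m0"
    "sqrt 2 * besov_norm chi phi (1/2) n0 \<le> 2 * besov_norm chi phi (1/2) n0"
    using pos sqrt2_less_2 by (auto intro!: mult_right_mono)
  moreover have "rbn f = sqrt 2 * besov_norm chi phi (1/2) m0" "rbn g = sqrt 2 * besov_norm chi phi (1/2) n0"
    using rfin_besov(3)[OF f(1)] rfin_besov(3)[OF g(1)] f(2) g(2) by simp_all
  ultimately have r: "rbn f \<le> 2 * N0" "rbn g \<le> 2 * N0" using pos unfolding N0 distrib_left by linarith+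
  \<comment> \<open>With beta = 2 \<open>N0\<close> and T = 1 / (2 lam), the smallness 10^8 T beta^2
    <= 1 is this inequality. It follows because 6 * 1000^3 / ln 2 exceeds 2 * 10^8, the squared
    bracket is at least the square of \<open>N0\<close>, and the exponential is at least 1.\<close>
  have "N0\<^sup>2 * 2 * 10 ^ 8 \<le> lam"
  proof -
    define Q where "Q = (N0 + 4 * 1000 ^ 3 / lam * N0 ^ 3)\<^sup>2"
    have Q: "N0\<^sup>2 \<le> Q" unfolding Q_def using N0' lam by (intro power_mono) auto
    have Q0: "0 \<le> Q" unfolding Q_def by simp
    have l: "0 < ln (2::real)" "ln (2::real) \<le> 1" using ln_le_minus_one[of "2::real"] by auto
    have "2 * 10 ^ 8 \<le> 6 * 1000 ^ 3 / ln (2::real)" using l by (simp add: divide_simps)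
    then have "(2 * 10 ^ 8) * N0\<^sup>2 * 1 \<le> 6 * 1000 ^ 3 / ln 2 * Q * exp (4 * 1000 ^ 3 * N0\<^sup>2 / lam)"
      using Q Q0 lam l by (intro mult_mono) auto
    then show ?thesis using le unfolding Q_def by simp
  qed
  then have "10 ^ 8 * (1 / (2 * lam) * (2 * N0)\<^sup>2) \<le> 1" using lam by (simp add: field_simps power2_eq_square)
  from strong_solution_exists[OF f(1) r(1) g(1) r(2) lam this]
  obtain w where w: "sqq_global_strong_solution chi phi (1/2) lam m0 n0 w" unfolding f(2) g(2) by blast
  show "\<exists>w. sqq_global_strong_solution chi phi (1/2) lam m0 n0 w \<and>
          (\<forall>w'. sqq_global_strong_solution chi phi (1/2) lam m0 n0 w' \<longrightarrow> (\<forall>t\<ge>0. w' t = w t))"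
    using w strong_solution_unique[OF _ w] lam by (intro exI[of _ w]) auto
qed simp

end
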